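(* Let $n$ be a positive integer and let $f,g\in M_{1}(\mathbb{C})$. Let $S_{1}=\{\alpha_1,\alpha_2,\ldots,\alpha_n\}$ and $S_{2}=\{\beta_{1},\beta_{2}\}$, where $\alpha_1,\ldots,\alpha_n,\beta_{1},\beta_{2}$ are $n+2$ distinct non-zero complex constants. Let $P$ be the polynomial associated with $S_1$, let $\Gamma_1$ be the number of distinct zeros of $P$, and let $k$ be the number of distinct zeros of $P'$ (all as defined in the context). Suppose that $n>\max\{2k+5,\,2\Gamma_{1}\}$, $k\geq 2$ and $\Gamma_{1}\geq 3$. Suppose moreover that $$(\beta_{1}-\alpha_{1})(\beta_{1}-\alpha_{2})\cdots(\beta_{1}-\alpha_{n})\neq(\beta_{2}-\alpha_{1})(\beta_{2}-\alpha_{2})\cdots(\beta_{2}-\alpha_{n})$$ and that $f$ is of non-integer finite order. If $f$ and $g$ share $S_{1}$ IM and share $S_{2}$ IM, then $f\equiv g$.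
   Context: $M_{1}(\mathbb{C})$ denotes the class of meromorphic functions in $\mathbb{C}$ which have finitely many poles in $\mathbb{C}$. The order of a meromorphic function $f$ is $\rho(f)=\limsup_{r\to\infty}\frac{\ln T(r,f)}{\ln r}$, where $T(r,f)$ is the Nevanlinna characteristic; "$f$ is of non-integer finite order" means that $\rho(f)$ is finite and is not an integer. Sharing of sets. For a meromorphic $f$ and a non-empty set $S\subset\mathbb{C}\cup\{\infty\}$, $\overline{E}_f(S)$ denotes the set of distinct points $z\in\mathbb{C}$ with $f(z)\in S$. Two meromorphic functions $f,g$ share $S$ IM if $\overline{E}_f(S)=\overline{E}_g(S)$. Polynomial attached to $S_1$. For distinct non-zero complex constants $\alpha_1,\ldots,\alpha_n$, set $$P(z)=\frac{z^{n}-\left(\sum\alpha_{i}\right)z^{n-1}+\cdots+(-1)^{n-1}\left(\sum \alpha_{i_{1}}\alpha_{i_{2}}\cdots\alpha_{i_{n-1}}\right)z}{(-1)^{n+1}\alpha_{1}\alpha_{2}\cdots\alpha_{n}},$$ i.e. $(z-\alpha_1)\cdots(z-\alpha_n)=(-1)^{n+1}\alpha_1\cdots\alpha_n\,(P(z)-1)$. Let $m_1$ be the number of simple zeros of $P$ and $m_2$ the number of (distinct) multiple zeros of $P$; then $\Gamma_1:=m_1+m_2$. The integer $k$ is the number of distinct zeros of $P'(z)$. *)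

theory Defs
  imports "HOL-Complex_Analysis.Complex_Analysis"
begin

text \<open>
  Meromorphic functions are represented by their library normal form
  \<^const>\<open>nicely_meromorphic_on\<close>: removable singularities are filled in and the value at a pole
  is the dummy \<open>0\<close>. Hence equality of two meromorphic functions is equality of functions.
\<close>

definition M1 :: "(complex \<Rightarrow> complex) set" where
  "M1 = {f. f nicely_meromorphic_on UNIV \<and> finite {z. is_pole f z}}"


section \<open>Nevanlinna characteristic and order of growth\<close>

definition proximity :: "(complex \<Rightarrow> complex) \<Rightarrow> real \<Rightarrow> real" where
  "proximity f r =
     1 / (2 * pi) * integral {0..2 * pi} (\<lambda>t. max 0 (ln (cmod (f (of_real r * cis t)))))"

text \<open>Poles in the closed disc of radius \<open>t\<close>, counted with multiplicity.\<close>

definition pole_count :: "(complex \<Rightarrow> complex) \<Rightarrow> real \<Rightarrow> nat" where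
  "pole_count f t = (\<Sum>z | z \<in> cball 0 t \<and> is_pole f z. nat (- zorder f z))"

definition pole_counting :: "(complex \<Rightarrow> complex) \<Rightarrow> real \<Rightarrow> real" where
  "pole_counting f r =
     integral {0..r} (\<lambda>t. (real (pole_count f t) - real (pole_count f 0)) / t)
       + real (pole_count f 0) * ln r"

definition nevanlinna_T :: "(complex \<Rightarrow> complex) \<Rightarrow> real \<Rightarrow> real" where
  "nevanlinna_T f r = proximity f r + pole_counting f r"

definition nevanlinna_order :: "(complex \<Rightarrow> complex) \<Rightarrow> ereal" where
  "nevanlinna_order f = Limsup at_top (\<lambda>r::real. ereal (ln (nevanlinna_T f r) / ln r))"

definition noninteger_finite_order :: "(complex \<Rightarrow> complex) \<Rightarrow> bool" where
  "noninteger_finite_order f \<longleftrightarrow> (\<exists>\<rho>::real. nevanlinna_order f = ereal \<rho> \<and> \<rho> \<notin> \<int>)"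


section \<open>Sharing of sets of finite values\<close>

text \<open>A pole has value \<open>\<infinity>\<close>, not the dummy value \<open>0\<close>, so it never lies over a set of finite values.\<close>

definition Ebar :: "(complex \<Rightarrow> complex) \<Rightarrow> complex set \<Rightarrow> complex set" where
  "Ebar f S = {z. \<not> is_pole f z \<and> f z \<in> S}"

definition share_IM :: "(complex \<Rightarrow> complex) \<Rightarrow> (complex \<Rightarrow> complex) \<Rightarrow> complex set \<Rightarrow> bool" where
  "share_IM f g S \<longleftrightarrow> Ebar f S = Ebar g S"


section \<open>The polynomial attached to the set of \<open>\<alpha>\<^sub>1, \<dots>, \<alpha>\<^sub>n\<close>\<close>

definition elem_sym :: "nat \<Rightarrow> (nat \<Rightarrow> complex) \<Rightarrow> nat \<Rightarrow> complex" where
  "elem_sym n \<alpha> j = (\<Sum>I | I \<subseteq> {1..n} \<and> card I = j. \<Prod>i\<in>I. \<alpha> i)"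

definition assoc_poly :: "nat \<Rightarrow> (nat \<Rightarrow> complex) \<Rightarrow> complex poly" where
  "assoc_poly n \<alpha> =
     smult (1 / ((-1) ^ (n + 1) * (\<Prod>i=1..n. \<alpha> i)))
       (\<Sum>j<n. monom ((-1) ^ j * elem_sym n \<alpha> j) (n - j))"

definition num_simple_zeros :: "complex poly \<Rightarrow> nat" where
  "num_simple_zeros p = card {z. order z p = 1}"

definition num_multiple_zeros :: "complex poly \<Rightarrow> nat" where
  "num_multiple_zeros p = card {z. order z p \<ge> 2}"

definition Gamma1 :: "complex poly \<Rightarrow> nat" where
  "Gamma1 p = num_simple_zeros p + num_multiple_zeros p"

definition num_critical_points :: "complex poly \<Rightarrow> nat" where
  "num_critical_points p = card {z. poly (pderiv p) z = 0}"

lemma assoc_poly_factorization: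
  assumes "\<And>i. i \<in> {1..n} \<Longrightarrow> \<alpha> i \<noteq> 0"
  shows "(\<Prod>i=1..n. [:- \<alpha> i, 1:])
       = smult ((-1) ^ (n + 1) * (\<Prod>i=1..n. \<alpha> i)) (assoc_poly n \<alpha> - 1)"
proof -
  define c where "c = (-1) ^ (n + 1) * (\<Prod>i=1..n. \<alpha> i)"
  define t where "t = (\<lambda>j. monom ((-1) ^ j * elem_sym n \<alpha> j) (n - j))"
  have c0: "c \<noteq> 0"
    using assms by (simp add: c_def)
  have "(\<Prod>i=1..n. [:- \<alpha> i, 1:]) = (\<Prod>i\<in>{1..n}. [:- \<alpha> i:] + monom 1 1)"
    by (intro prod.cong) (auto simp: monom_altdef)
  also have "\<dots> = (\<Sum>I\<in>Pow {1..n}. (\<Prod>i\<in>I. [:- \<alpha> i:]) * (\<Prod>i\<in>{1..n} - I. monom 1 1))"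
    by (rule prod_add) simp
  also have "\<dots> = (\<Sum>I\<in>Pow {1..n}. monom ((-1) ^ card I * (\<Prod>i\<in>I. \<alpha> i)) (n - card I))"
  proof (rule sum.cong)
    fix I assume I: "I \<in> Pow {1..n}"
    then have fin: "finite I"
      using finite_subset by auto
    have "(\<Prod>i\<in>I. [:- \<alpha> i:]) = [:(-1) ^ card I * (\<Prod>i\<in>I. \<alpha> i):]"
      using fin by (induction I rule: finite_induct) auto
    moreover have "card ({1..n} - I) = n - card I"
      using I fin by (simp add: card_Diff_subset)
    ultimately show "(\<Prod>i\<in>I. [:- \<alpha> i:]) * (\<Prod>i\<in>{1..n} - I. monom 1 1)
        = monom ((-1) ^ card I * (\<Prod>i\<in>I. \<alpha> i)) (n - card I)"
      by (simp add: monom_power smult_monom)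
  qed simp
  also have "\<dots> = (\<Sum>j\<in>{..n}. \<Sum>I\<in>{I \<in> Pow {1..n}. card I = j}.
                    monom ((-1) ^ card I * (\<Prod>i\<in>I. \<alpha> i)) (n - card I))"
    by (rule sum.group [symmetric]) (use card_mono[of "{1..n}"] in auto)
  also have "\<dots> = (\<Sum>j\<le>n. t j)"
    unfolding t_def elem_sym_def
    by (intro sum.cong refl) (simp add: sum_distrib_left monom_sum)
  also have "\<dots> = (\<Sum>j<n. t j) + t n"
    by (simp add: lessThan_Suc_atMost [symmetric])
  also have "t n = [:- c:]"
  proof -
    have "{I. I \<subseteq> {1..n} \<and> card I = n} = {{1..n}}"
      using card_subset_eq[of "{1..n}"] by auto
    then show ?thesis
      by (simp add: t_def elem_sym_def c_def monom_0)
  qed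
  also have "(\<Sum>j<n. t j) = smult c (assoc_poly n \<alpha>)"
    using c0 by (simp add: assoc_poly_def c_def t_def)
  finally show ?thesis
    unfolding c_def [symmetric] by (simp add: smult_diff_right one_pCons)
qed

lemma Gamma1_eq_card_zeros:
  assumes "p \<noteq> 0"
  shows "Gamma1 p = card {z. poly p z = 0}"
proof -
  have eq: "{z. poly p z = 0} = {z. order z p = 1} \<union> {z. order z p \<ge> 2}"
    using assms by (auto simp: order_root)
  have "finite ({z. order z p = 1} \<union> {z. order z p \<ge> 2})"
    unfolding eq [symmetric] by (rule poly_roots_finite [OF assms])
  then show ?thesis
    unfolding Gamma1_def num_simple_zeros_def num_multiple_zeros_def eq
    by (subst card_Un_disjoint) auto
qed

end

theory Submission
  imports Defs "HOL-Real_Asymp.Real_Asymp"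
    "HOL-Computational_Algebra.Fundamental_Theorem_Algebra"
begin

text \<open>Write \<open>W = P - 1\<close>, a polynomial of degree \<open>n\<close> whose roots are the points of \<open>S1\<close>, all simple. The
idea is to show first that \<open>W(g)\<close> is a constant multiple of \<open>W(f)\<close>, and then to play off the two
values of the second set against each other.

For \<open>A = W \<circ> f\<close> put \<open>H\<^sub>f = A''/A' - 2A'/A\<close>; this is the logarithmic derivative of \<open>(1/A)'\<close>, so
\<open>H\<^sub>f = H\<^sub>g\<close> means that \<open>1/W(f)\<close> and \<open>1/W(g)\<close> are affinely related. At a simple zero of \<open>A\<close> the principal part of \<open>H\<^sub>f\<close> is \<open>-2/(z - z0)\<close> and the constant term vanishes; hence at a
common simple zero \<open>H\<^sub>f - H\<^sub>g\<close> vanishes. Sharing \<open>S1\<close> therefore makes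
\<^item> \<open>\<Phi> = (f' g')\<^sup>5 (Q(f) Q(g))\<^sup>2 (H\<^sub>f - H\<^sub>g)\<^sup>2 / (W(f) W(g))\<close>, with \<open>Q\<close> the product over the \<open>k\<close> distinct
  roots of \<open>W'\<close>,

free of poles where \<open>f\<close> and \<open>g\<close> have none (lemma \<open>aux_fun_tendsto\<close>). On the other hand, \<open>n \<ge> 2k + 6\<close>
makes \<open>\<Phi>\<close> small: if all relevant logarithmic derivatives are at most \<open>L\<close> at a point, then
\<open>|\<Phi>| (1 + |f|) (1 + |g|)\<close> is bounded there by a constant times a power of \<open>L\<close> (lemmas
\<open>aux_pointwise\<close> and \<open>ln_aux_fun_bound\<close>). If \<open>\<Phi>\<close> is not identically zero, its minimum modulus is
bounded below on suitable circles in terms of its own growth, which is only logarithmic in the growth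
of \<open>f\<close> and \<open>g\<close>. A lemma of Borel type then forces \<open>ln |f|\<close> to grow no faster than a power of
\<open>ln |z|\<close> (lemma \<open>polylog_of_auxiliary\<close>), so that \<open>f\<close> has order \<open>0\<close>, an integer. Thus \<open>\<Phi> = 0\<close> and
\<open>W(g) = a W(f) + b W(f) W(g)\<close> for constants \<open>a \<noteq> 0\<close> and \<open>b\<close>.

Non-integer order enters a second time through the following principle
(lemma \<open>ln_norm_bound_zero_free\<close>): a function of finite order less than \<open>d + 1\<close> with finitely many
zeros and poles is a rational function times \<open>exp\<close> of a polynomial of degree at most \<open>d\<close>. If the order
\<open>\<rho>\<close> satisfies \<open>d < \<rho> < d + 1\<close>, then \<open>f\<close> grows faster than any such function. In particular \<open>f\<close> takes
every complex value, and \<open>b = 0\<close> since otherwise \<open>f\<close> would omit the roots of \<open>W = 1/b\<close>.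

Now \<open>W(g) = a W(f)\<close>. As \<open>W\<close> separates \<open>\<beta>1\<close> and \<open>\<beta>2\<close>, sharing \<open>S2\<close> gives a permutation \<open>\<delta>1, \<delta>2\<close> of
\<open>\<beta>1, \<beta>2\<close> such that \<open>f\<close> takes the value \<open>\<beta>\<^sub>i\<close> exactly where \<open>g\<close> takes the value \<open>\<delta>\<^sub>i\<close>. The same
principle shows that \<open>u\<^sub>i = (f - \<beta>\<^sub>i)/(g - \<delta>\<^sub>i)\<close> has growth at most \<open>exp (O(|z|\<^sup>d ln |z|))\<close>, because a
quotient of powers of its numerator and denominator has no zeros and poles, and because \<open>|f|\<close> and
\<open>|g|\<close> are comparable where they are large. If \<open>u1\<close> and \<open>u2\<close> were different, then \<open>g\<close> could be
recovered from them and would be of growth \<open>exp (O(|z|\<^sup>d ln\<^sup>2 |z|))\<close>, too slow for \<open>\<rho> > d\<close>. Hence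
\<open>u1 = u2\<close>, which is an affine relation between \<open>f\<close> and \<open>g\<close> (lemma \<open>linear_relation\<close>): either
\<open>f = g\<close>, or \<open>f + g = \<beta>1 + \<beta>2\<close> and \<open>a = -1\<close>. In the second case the reflection
\<open>x \<mapsto> \<beta>1 + \<beta>2 - x\<close> changes \<open>W\<close> into \<open>-W\<close>, so that \<open>W\<close> takes the values \<open>1\<close> and \<open>-1\<close> at the same
number \<open>\<Gamma>\<^sub>1\<close> of points. Since \<open>W'\<close> has only \<open>n - 1\<close> zeros, two values are taken at no fewer than
\<open>n + 1\<close> points together, and this contradicts \<open>n > 2 \<Gamma>\<^sub>1\<close>.\<close>

section \<open>Zeros, logarithmic derivatives and minimum modulus of entire functions\<close>

lemma entire_factor_out_zero:
  fixes E :: "complex \<Rightarrow> complex"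
  assumes E: "E holomorphic_on UNIV" and nz: "E z0 \<noteq> 0"
  obtains m g where "g holomorphic_on UNIV" "g a \<noteq> 0" "\<And>z. E z = (z - a) ^ m * g z"
proof (cases "E a = 0")
  case False
  then show ?thesis
    using that[of E 0] E by auto
next
  case True
  have nc: "\<not> E constant_on UNIV"
  proof
    assume "E constant_on UNIV"
    then obtain y where "\<And>x. E x = y"
      unfolding constant_on_def by blast
    then show False
      using True nz by simp
  qed
  obtain h r m where h: "0 < m" "0 < r" "h holomorphic_on ball a r"
      "\<And>w. w \<in> ball a r \<Longrightarrow> E w = (w - a) ^ m * h w" "\<And>w. w \<in> ball a r \<Longrightarrow> h w \<noteq> 0"
    by (rule holomorphic_factor_zero_nonconstant[OF E open_UNIV connected_UNIV UNIV_I True nc])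
       (metis mult.commute)
  define g where "g = (\<lambda>z. if z = a then h a else E z / (z - a) ^ m)"
  have g1: "g holomorphic_on ball a r"
    by (rule holomorphic_transform[OF h(3)]) (auto simp: g_def h(4))
  have "(\<lambda>z. E z / (z - a) ^ m) holomorphic_on - {a}"
    by (intro holomorphic_intros holomorphic_on_subset[OF E]) auto
  then have g2: "g holomorphic_on - {a}"
    by (rule holomorphic_transform) (auto simp: g_def)
  have "g holomorphic_on (ball a r \<union> - {a})"
    using g1 g2 by (intro holomorphic_on_Un) auto
  moreover have "ball a r \<union> - {a} = UNIV"
    using \<open>r > 0\<close> by auto
  ultimately have "g holomorphic_on UNIV"
    by simp
  moreover have "g a \<noteq> 0"
    using h(2,5) by (auto simp: g_def)
  moreover have "E z = (z - a) ^ m * g z" for z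
    using True \<open>m > 0\<close> by (auto simp: g_def)
  ultimately show ?thesis
    using that by blast
qed

lemma entire_factor_out_finite:
  fixes E :: "complex \<Rightarrow> complex"
  assumes "finite T" and "E holomorphic_on UNIV" and "E z0 \<noteq> 0"
  shows "\<exists>m g. g holomorphic_on UNIV \<and> (\<forall>a\<in>T. g a \<noteq> 0) \<and> (\<forall>z. E z = (\<Prod>a\<in>T. (z - a) ^ m a) * g z)"
  using assms(1)
proof (induction T rule: finite_induct)
  case empty
  then show ?case
    using assms(2) by (auto intro!: exI[of _ E])
next
  case (insert b T)
  then obtain m g where g: "g holomorphic_on UNIV" "\<forall>a\<in>T. g a \<noteq> 0"
      "\<forall>z. E z = (\<Prod>a\<in>T. (z - a) ^ m a) * g z"
    by blast
  then have "g z0 \<noteq> 0"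
    using assms(3) by auto
  then obtain k h where h: "h holomorphic_on UNIV" "h b \<noteq> 0" "\<And>z. g z = (z - b) ^ k * h z"
    using entire_factor_out_zero[OF g(1)] by metis
  have "(\<Prod>a\<in>insert b T. (z - a) ^ (m(b := k)) a) = (z - b) ^ k * (\<Prod>a\<in>T. (z - a) ^ m a)" for z
  proof -
    have "(\<Prod>a\<in>T. (z - a) ^ (m(b := k)) a) = (\<Prod>a\<in>T. (z - a) ^ m a)"
      by (rule prod.cong) (use insert.hyps in auto)
    then show ?thesis
      using insert.hyps by simp
  qed
  then have "\<forall>z. E z = (\<Prod>a\<in>insert b T. (z - a) ^ (m(b := k)) a) * h z"
    using g(3) h(3) by (simp add: mult_ac)
  moreover have "\<forall>a\<in>insert b T. h a \<noteq> 0"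
    using h g(2) by auto
  ultimately show ?case
    using h(1) by blast
qed

text \<open>The Cayley transform \<open>(G - g0)/(G + g0)\<close> takes the right half plane to the unit disc and \<open>g0\<close> to the
origin, so the Schwarz lemma applies.\<close>

lemma Caratheodory_half_plane:
  fixes G :: "complex \<Rightarrow> complex"
  assumes G: "G holomorphic_on ball 0 R" and pos: "\<And>z. z \<in> ball 0 R \<Longrightarrow> Re (G z) > 0"
    and G0: "G 0 = of_real g0" and z: "z \<in> ball 0 R"
  shows "norm (G z) \<le> g0 * (R + norm z) / (R - norm z)"
proof -
  have R: "R > 0" "norm z < R"
    using z by (auto intro: le_less_trans[OF norm_ge_zero])
  have g0: "g0 > 0"
    using pos[of 0] R by (simp add: G0)
  define \<phi> where "\<phi> = (\<lambda>w. (G (of_real R * w) - of_real g0) / (G (of_real R * w) + of_real g0))"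
  have in_ball: "of_real R * w \<in> ball 0 R" if "norm w < 1" for w :: complex
    using that R by (simp add: norm_mult)
  have den: "G w + of_real g0 \<noteq> 0" if "w \<in> ball 0 R" for w
    using pos[OF that] g0 by (auto simp: complex_eq_iff)
  have "\<phi> holomorphic_on ball 0 1"
    unfolding \<phi>_def
    by (intro holomorphic_intros holomorphic_on_compose_gen[OF _ G, unfolded o_def])
       (use in_ball den in auto)
  moreover have "\<phi> 0 = 0"
    by (simp add: \<phi>_def G0)
  moreover have "norm (\<phi> w) < 1" if "norm w < 1" for w
  proof -
    define x where "x = G (of_real R * w)"
    have "Re x > 0"
      using pos in_ball that by (simp add: x_def)
    then have "(norm (x - of_real g0))\<^sup>2 < (norm (x + of_real g0))\<^sup>2"
      using g0 unfolding cmod_power2 by (simp add: power2_eq_square algebra_simps)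
    then have "norm (x - of_real g0) < norm (x + of_real g0)"
      by (rule power_less_imp_less_base) simp
    then show ?thesis
      by (simp add: \<phi>_def x_def norm_divide divide_less_eq)
  qed
  moreover have "norm (z / of_real R) < 1"
    using R by (simp add: norm_divide)
  ultimately have "norm (\<phi> (z / of_real R)) \<le> norm (z / of_real R)"
    by (intro Schwarz_Lemma(1)) auto
  then have "norm (G z - of_real g0) \<le> norm z / R * norm (G z + of_real g0)"
    using R den[OF z] by (simp add: \<phi>_def norm_divide pos_divide_le_eq)
  moreover have "norm (G z) - g0 \<le> norm (G z - of_real g0)"
    using norm_triangle_ineq2[of "G z" "of_real g0"] g0 by simp
  moreover have "norm z / R * norm (G z + of_real g0) \<le> norm z / R * (norm (G z) + g0)"
    using norm_triangle_ineq[of "G z" "of_real g0"] g0 R by (intro mult_left_mono) auto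
  ultimately have "norm (G z) - g0 \<le> norm z / R * (norm (G z) + g0)"
    by linarith
  then show ?thesis
    using R by (simp add: field_simps)
qed

lemma entire_bound_on_cball:
  fixes f :: "complex \<Rightarrow> complex"
  assumes "f holomorphic_on UNIV" "0 < R" "\<And>z. norm z = R \<Longrightarrow> norm (f z) \<le> B" "norm z \<le> R"
  shows "norm (f z) \<le> B"
proof (rule maximum_modulus_frontier[of f "cball 0 R"])
  show "f holomorphic_on interior (cball 0 R)"
    using assms(1) holomorphic_on_subset by blast
  show "continuous_on (closure (cball 0 R)) f"
    using assms(1) holomorphic_on_imp_continuous_on continuous_on_subset by blast
qed (use assms in auto)

lemma has_field_derivative_prod_powers:
  fixes f :: "'a \<Rightarrow> complex \<Rightarrow> complex"
  assumes "finite T" and "\<And>a. a \<in> T \<Longrightarrow> (f a has_field_derivative f' a) (at z)"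
    and "\<And>a. a \<in> T \<Longrightarrow> f a z \<noteq> 0"
  shows "((\<lambda>z. \<Prod>a\<in>T. f a z ^ m a) has_field_derivative
           (\<Prod>a\<in>T. f a z ^ m a) * (\<Sum>a\<in>T. of_nat (m a) * f' a / f a z)) (at z)"
  using assms
proof (induction T rule: finite_induct)
  case (insert b T)
  have nz: "f b z \<noteq> 0" and df: "(f b has_field_derivative f' b) (at z)"
    using insert.prems by auto
  have "of_nat (m b) * f b z ^ (m b - 1) * f' b = f b z ^ m b * (of_nat (m b) * f' b / f b z)"
    using nz by (cases "m b") auto
  then have D: "((\<lambda>z. f b z ^ m b) has_field_derivative f b z ^ m b * (of_nat (m b) * f' b / f b z)) (at z)"
    using DERIV_power[OF df, of "m b"] by (simp add: mult_ac)
  have IH: "((\<lambda>z. \<Prod>a\<in>T. f a z ^ m a) has_field_derivative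
           (\<Prod>a\<in>T. f a z ^ m a) * (\<Sum>a\<in>T. of_nat (m a) * f' a / f a z)) (at z)"
    using insert by simp
  show ?case
    unfolding prod.insert[OF insert.hyps] sum.insert[OF insert.hyps]
    by (rule DERIV_cong[OF DERIV_mult[OF D IH]]) (simp only: distrib_left mult_ac)
qed simp

text \<open>Replacing the zeros of \<open>F\<close> in the disc of radius \<open>(s + R)/2\<close> by their mirror images in the circle of
radius \<open>R\<close> gives a function without zeros in that disc and with the same modulus on the circle. Its
logarithm is controlled by the half plane estimate; the zeros themselves contribute the sums, and the
increase of the modulus at the origin bounds their number, as in Jensen's formula.\<close>

lemma logderiv_and_min_modulus_off_zeros:
  fixes F :: "complex \<Rightarrow> complex"
  assumes F: "F holomorphic_on UNIV" and s: "0 < s" "s < R" and Y: "0 \<le> Y"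
    and bound: "\<And>z. norm z \<le> R \<Longrightarrow> norm (F z) \<le> exp Y" and F0: "exp (- c) \<le> norm (F 0)"
  shows "\<exists>T m. finite T \<and> (\<forall>a\<in>T. 1 \<le> m a) \<and> real (\<Sum>a\<in>T. m a) * (R - s) \<le> 2 * R * (Y + c) \<and>
    (\<forall>z. norm z \<le> s \<longrightarrow> z \<notin> T \<longrightarrow> F z \<noteq> 0 \<and>
      norm (deriv F z / F z) \<le> (\<Sum>a\<in>T. real (m a) * (1 / norm (z - a) + 1 / (R - s)))
          + 32 * R * (Y + c + 1) / (R - s)\<^sup>2 \<and>
      ln (norm (F z)) \<ge> (\<Sum>a\<in>T. real (m a) * ln (norm (z - a) / (2 * R)))
          - 8 * R * (Y + c + 1) / (R - s))"
proof -
  define s2 where "s2 = (s + R) / 2"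
  define d where "d = R - s"
  have d: "d > 0" and s2: "s < s2" "s2 < R" "0 < s2" "R - s2 = d / 2" and R: "R > 0"
    using s by (auto simp: s2_def d_def field_simps)
  have F0': "F 0 \<noteq> 0"
    using F0 by (metis exp_gt_zero norm_zero not_le)
  have Yc: "Y + c \<ge> 0"
    using order_trans[OF F0 bound[of 0]] R by simp
  define T where "T = {z \<in> cball 0 s2. F z = 0}"
  have finT: "finite T"
  proof (cases "F constant_on UNIV")
    case True
    then obtain y where y: "\<And>z. F z = y"
      unfolding constant_on_def by blast
    have "F z \<noteq> 0" for z
      using F0' y[of z] y[of 0] by simp
    then have "T = {}"
      by (auto simp: T_def)
    then show ?thesis
      by simp
  next
    case False
    show ?thesis
      unfolding T_def
      by (rule holomorphic_compact_finite_zeros[OF F open_UNIV connected_UNIV compact_cball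
            subset_UNIV False])
  qed
  from entire_factor_out_finite[OF finT F F0'] obtain m g where
    mg: "g holomorphic_on UNIV \<and> (\<forall>a\<in>T. g a \<noteq> 0) \<and> (\<forall>z. F z = (\<Prod>a\<in>T. (z - a) ^ m a) * g z)"
    by (elim exE)
  then have g: "g holomorphic_on UNIV" "\<forall>a\<in>T. g a \<noteq> 0"
    and Fg: "F z = (\<Prod>a\<in>T. (z - a) ^ m a) * g z" for z
    by simp_all
  have m1: "\<forall>a\<in>T. 1 \<le> m a"
  proof
    fix a assume a: "a \<in> T"
    then have "(\<Prod>b\<in>T. (a - b) ^ m b) = 0"
      using Fg[of a] g(2) by (auto simp: T_def)
    then obtain b where "b \<in> T" "(a - b) ^ m b = 0"
      using finT by (auto simp: prod_zero_iff)
    then show "1 \<le> m a"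
      by (cases "m b") auto
  qed
  define N where "N = (\<Sum>a\<in>T. m a)"
  have aT: "norm a \<le> s2" if "a \<in> T" for a
    using that by (simp add: T_def)
  have gnz: "g z \<noteq> 0" if "norm z \<le> s2" for z
    using that g(2) Fg[of z] by (cases "z \<in> T") (auto simp: T_def)
  \<comment> \<open>Each zero is replaced by its mirror image in the circle of radius \<open>R\<close>;
      this does not change the modulus on that circle.\<close>
  define B where "B = (\<lambda>a z. (of_real (R\<^sup>2) - cnj a * z) / of_real R)"
  define k where "k = (\<lambda>z. (\<Prod>a\<in>T. B a z ^ m a) * g z)"
  have Blow: "norm (of_real (R\<^sup>2) - cnj a * z) \<ge> R * (R - norm z)" if "a \<in> T" for a z
  proof -
    have "norm (cnj a * z) \<le> R * norm z"
      using aT[OF that] s2 by (auto simp: norm_mult intro!: mult_right_mono)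
    then have "R\<^sup>2 - R * norm z \<le> norm (of_real (R\<^sup>2) :: complex) - norm (cnj a * z)"
      unfolding norm_of_real by simp
    also have "\<dots> \<le> norm (of_real (R\<^sup>2) - cnj a * z)"
      by (rule norm_triangle_ineq2)
    finally show ?thesis
      by (simp add: power2_eq_square algebra_simps)
  qed
  have Bnz: "B a z \<noteq> 0" if "a \<in> T" "norm z < R" for a z
  proof -
    have "R * (R - norm z) > 0"
      using that(2) R by simp
    then have "norm (of_real (R\<^sup>2) - cnj a * z) > 0"
      using Blow[OF that(1), of z] by linarith
    then show ?thesis
      using R by (auto simp: B_def)
  qed
  have hol_k: "k holomorphic_on UNIV"
    unfolding k_def B_def using R by (intro holomorphic_intros g(1)) auto
  have B_circ: "norm (B a z) = norm (z - a)" if "norm z = R" for a z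
  proof -
    have "of_real (R\<^sup>2) - cnj a * z = z * cnj (z - a)"
      using that complex_norm_square[of z] by (simp add: algebra_simps)
    then have "norm (of_real (R\<^sup>2) - cnj a * z) = R * norm (z - a)"
      using that by (simp only: norm_mult complex_mod_cnj)
    then show ?thesis
      using R by (simp add: B_def norm_divide)
  qed
  have "norm (k z) \<le> exp Y" if "norm z = R" for z
    using bound[of z] that by (simp add: k_def Fg norm_mult norm_power B_circ prod_norm[symmetric])
  then have k_le: "norm (k z) \<le> exp Y" if "norm z \<le> R" for z
    using entire_bound_on_cball[OF hol_k R _ that] by blast
  have knz: "k z \<noteq> 0" if "norm z \<le> s2" for z
    using that s2 finT gnz Bnz by (auto simp: k_def)
  have pw: "(\<Prod>a\<in>T. x ^ m a) = x ^ N" for x :: real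
    by (simp add: N_def power_sum)
  have k0: "norm (k 0) = R ^ N * norm (g 0)"
    using R by (simp add: k_def B_def norm_mult norm_power norm_divide pw power2_eq_square
        prod_norm[symmetric])
  have "norm (F 0) \<le> s2 ^ N * norm (g 0)"
  proof -
    have "(\<Prod>a\<in>T. norm a ^ m a) \<le> (\<Prod>a\<in>T. s2 ^ m a)"
      by (intro prod_mono conjI power_mono) (use aT in auto)
    then show ?thesis
      by (auto simp: Fg norm_mult norm_power pw prod_norm[symmetric] intro!: mult_right_mono)
  qed
  then have "(R / s2) ^ N * exp (- c) \<le> (R / s2) ^ N * (s2 ^ N * norm (g 0))"
    using F0 R s2 by (intro mult_left_mono) auto
  also have "\<dots> = norm (k 0)"
    using s2 by (simp add: k0 power_divide)
  finally have k0_ge: "(R / s2) ^ N * exp (- c) \<le> norm (k 0)" .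
  have "1 \<le> (R / s2) ^ N"
    using s2 by (intro one_le_power) auto
  then have "1 * exp (- c) \<le> (R / s2) ^ N * exp (- c)"
    by (intro mult_right_mono) auto
  then have k0_c: "exp (- c) \<le> norm (k 0)"
    using k0_ge by linarith
  have "(R / s2) ^ N * exp (- c) \<le> exp Y"
    using k0_ge k_le[of 0] R by simp
  moreover have "(R / s2) ^ N * exp (- c) > 0"
    using R s2 by simp
  ultimately have "ln ((R / s2) ^ N * exp (- c)) \<le> ln (exp Y)"
    by (intro ln_mono) auto
  then have "real N * ln (R / s2) \<le> Y + c"
    using R s2 by (simp add: ln_mult ln_realpow)
  moreover have "d / (2 * R) \<le> ln (R / s2)"
  proof -
    have "ln (s2 / R) \<le> s2 / R - 1"
      using s2 R by (intro ln_le_minus_one) auto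
    moreover have "s2 / R - 1 = - (d / (2 * R))"
      using s2(4) R by (simp add: field_simps)
    ultimately show ?thesis
      using s2 R by (simp add: ln_div)
  qed
  ultimately have "real N * (d / (2 * R)) \<le> Y + c"
    by (meson mult_left_mono of_nat_0_le_iff order_trans)
  then have N_le: "real N * d \<le> 2 * R * (Y + c)"
    using R by (simp add: field_simps)
  have k_ball: "k holomorphic_on ball 0 s2" "\<And>z. z \<in> ball 0 s2 \<Longrightarrow> k z \<noteq> 0" "0 \<in> ball 0 s2"
    using holomorphic_on_subset[OF hol_k] knz s2 by auto
  obtain h where h: "h holomorphic_on ball 0 s2" "\<And>z. z \<in> ball 0 s2 \<Longrightarrow> exp (h z) = k z"
    by (rule holomorphic_logarithm_exists[OF convex_ball open_ball k_ball(1,2,3)], assumption)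
      (rule that, assumption, assumption)
  define G where "G = (\<lambda>z. of_real (Y + 1) - h z + \<i> * of_real (Im (h 0)))"
  have G: "G holomorphic_on ball 0 s2"
    unfolding G_def by (intro holomorphic_intros h)
  have Reh: "Re (h z) = ln (norm (k z))" if "norm z < s2" for z
    using h(2)[of z, symmetric] that by simp
  have ReG: "Re (G z) = Y + 1 - ln (norm (k z))" if "norm z < s2" for z
    using Reh[OF that] by (simp add: G_def)
  have ReG_pos: "Re (G z) > 0" if "z \<in> ball 0 s2" for z
  proof -
    have "norm (k z) \<le> exp Y" "norm (k z) > 0"
      using that k_le[of z] knz[of z] s2 by auto
    then have "ln (norm (k z)) \<le> ln (exp Y)"
      by (intro ln_mono) auto
    then show ?thesis
      using ReG that by auto
  qed
  define g0 where "g0 = Y + 1 - ln (norm (k 0))"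
  have G0: "G 0 = of_real g0"
    using ReG[of 0] s2 by (auto simp: complex_eq_iff g0_def) (simp add: G_def)
  have "ln (exp (- c)) \<le> ln (norm (k 0))"
    using k0_c by (intro ln_mono) auto
  then have g0: "g0 \<le> Y + c + 1"
    by (simp add: g0_def)
  define M where "M = 8 * R * (Y + c + 1) / d"
  have M: "norm (G z) \<le> M" if z: "norm z \<le> s + d / 4" for z
  proof -
    have sd: "s2 - (s + d / 4) = d / 4" "s + d/4 < R"
      using s by (auto simp: s2_def d_def field_simps)
    have z': "norm z < s2"
      using z sd d by linarith
    have "norm (G z) \<le> g0 * (s2 + norm z) / (s2 - norm z)"
      using z' by (intro Caratheodory_half_plane[OF G ReG_pos G0]) auto
    also have "\<dots> \<le> (Y + c + 1) * (2 * R) / (d / 4)"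
      using z z' sd s2 d R g0 Yc by (intro frac_le mult_mono) auto
    finally show ?thesis
      using d by (simp add: M_def field_simps)
  qed
  have dh: "norm (deriv h z) \<le> 32 * R * (Y + c + 1) / d\<^sup>2" if z: "norm z \<le> s" for z
  proof -
    have sd: "s + d / 4 < s2"
      using d by (auto simp: s2_def d_def field_simps)
    have sub: "cball z (d / 4) \<subseteq> ball 0 s2"
    proof
      fix w assume "w \<in> cball z (d / 4)"
      then have "norm w \<le> s + d / 4"
        using norm_triangle_ineq[of z "w - z"] z by (auto simp: dist_norm norm_minus_commute)
      then show "w \<in> ball 0 s2"
        using sd by simp
    qed
    have "norm ((deriv ^^ 1) G z) \<le> fact 1 * M / (d / 4) ^ 1"
    proof (rule Cauchy_inequality)
      show "G holomorphic_on ball z (d / 4)"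
        using sub by (intro holomorphic_on_subset[OF G]) auto
      show "continuous_on (cball z (d / 4)) G"
        using sub by (intro continuous_on_subset[OF holomorphic_on_imp_continuous_on[OF G]])
      fix w assume "norm (z - w) = d / 4"
      then show "norm (G w) \<le> M"
        using norm_triangle_ineq[of z "w - z"] z by (intro M) (auto simp: norm_minus_commute)
    qed (use d in auto)
    moreover have "deriv G z = - deriv h z"
    proof -
      have "h field_differentiable at z"
        using h(1) z s2 by (intro holomorphic_on_imp_differentiable_at[OF h(1)]) auto
      then show ?thesis
        unfolding G_def by (intro DERIV_imp_deriv) (auto intro!: derivative_eq_intros
            simp: DERIV_deriv_iff_field_differentiable)
    qed
    ultimately show ?thesis
      using d by (simp add: M_def field_simps power2_eq_square)
  qed
  have main: "F z \<noteq> 0 \<and>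
      norm (deriv F z / F z) \<le> (\<Sum>a\<in>T. real (m a) * (1 / norm (z - a) + 1 / d))
          + 32 * R * (Y + c + 1) / d\<^sup>2 \<and>
      ln (norm (F z)) \<ge> (\<Sum>a\<in>T. real (m a) * ln (norm (z - a) / (2 * R))) - M"
    if z: "norm z \<le> s" "z \<notin> T" for z
  proof (intro conjI)
    have zR: "norm z < R" "norm z < s2"
      using z s s2 by auto
    show Fz: "F z \<noteq> 0"
      using z s2 by (auto simp: T_def)
    have za: "z - a \<noteq> 0" if "a \<in> T" for a
      using that z by auto
    define SA where "SA = (\<Sum>a\<in>T. of_nat (m a) * 1 / (z - a))"
    define SB where "SB = (\<Sum>a\<in>T. of_nat (m a) * (- cnj a / of_real R) / B a z)"
    have dg: "(g has_field_derivative deriv g z) (at z)"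
      using g(1) by (simp add: holomorphic_derivI)
    have "((\<lambda>z. \<Prod>a\<in>T. (z - a) ^ m a) has_field_derivative (\<Prod>a\<in>T. (z - a) ^ m a) * SA) (at z)"
      unfolding SA_def using za
      by (intro has_field_derivative_prod_powers[where f = "\<lambda>a z. z - a" and f' = "\<lambda>_. 1"] finT)
         (auto intro!: derivative_eq_intros)
    from DERIV_mult[OF this dg] have "(F has_field_derivative
       (\<Prod>a\<in>T. (z - a) ^ m a) * SA * g z + deriv g z * (\<Prod>a\<in>T. (z - a) ^ m a)) (at z)"
      unfolding Fg[abs_def] .
    then have dF: "deriv F z / F z = SA + deriv g z / g z"
      using Fz gnz[of z] zR by (simp add: DERIV_imp_deriv Fg field_simps)
    have "((\<lambda>z. \<Prod>a\<in>T. B a z ^ m a) has_field_derivative (\<Prod>a\<in>T. B a z ^ m a) * SB) (at z)"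
      unfolding SB_def using Bnz zR(1)
      by (intro has_field_derivative_prod_powers[where f = B] finT)
         (auto simp: B_def intro!: derivative_eq_intros)
    from DERIV_mult[OF this dg] have "(k has_field_derivative
       (\<Prod>a\<in>T. B a z ^ m a) * SB * g z + deriv g z * (\<Prod>a\<in>T. B a z ^ m a)) (at z)"
      unfolding k_def .
    then have dk: "deriv k z / k z = SB + deriv g z / g z"
      using gnz[of z] knz[of z] zR by (simp add: DERIV_imp_deriv k_def field_simps)
    have "((\<lambda>z. exp (h z)) has_field_derivative exp (h z) * deriv h z) (at z)"
      using holomorphic_derivI[OF h(1) open_ball, of z] zR by (auto intro!: derivative_eq_intros)
    then have "(k has_field_derivative exp (h z) * deriv h z) (at z)"
      by (rule DERIV_cong_ev[THEN iffD1, rotated -1])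
         (use zR h(2) eventually_nhds_in_open[of "ball 0 s2" z] in \<open>auto elim!: eventually_mono\<close>)
    then have "deriv k z / k z = deriv h z"
      using h(2)[of z] knz[of z] zR by (simp add: DERIV_imp_deriv)
    then have eq: "deriv F z / F z = SA - SB + deriv h z"
      using dF dk by (simp add: add.commute add_diff_eq[symmetric] eq_diff_eq)
    have "norm SA \<le> (\<Sum>a\<in>T. real (m a) * (1 / norm (z - a)))"
      unfolding SA_def by (rule sum_norm_le) (simp add: norm_mult norm_divide)
    moreover have "norm SB \<le> (\<Sum>a\<in>T. real (m a) * (1 / d))"
      unfolding SB_def
    proof (rule sum_norm_le)
      fix a assume a: "a \<in> T"
      have "R * d \<le> R * (R - norm z)"
        using z R by (intro mult_left_mono) (auto simp: d_def)
      then have "R * d \<le> norm (of_real (R\<^sup>2) - cnj a * z)"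
        using Blow[OF a, of z] by (rule order_trans)
      then have "norm a / norm (of_real (R\<^sup>2) - cnj a * z) \<le> R / (R * d)"
        using aT[OF a] s2 R d by (intro frac_le) auto
      then have "real (m a) * (norm a / norm (of_real (R\<^sup>2) - cnj a * z)) \<le> real (m a) * (1 / d)"
        using R by (intro mult_left_mono) auto
      then show "norm (of_nat (m a) * (- cnj a / of_real R) / B a z) \<le> real (m a) * (1 / d)"
        using R by (simp add: B_def norm_mult norm_divide)
    qed
    ultimately have "norm SA + norm SB \<le> (\<Sum>a\<in>T. real (m a) * (1 / norm (z - a) + 1 / d))"
      by (simp add: sum.distrib distrib_left)
    moreover have "norm (deriv F z / F z) \<le> norm SA + norm SB + norm (deriv h z)"
      unfolding eq by (meson add_right_mono norm_triangle_ineq norm_triangle_ineq4 order_trans)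
    ultimately show "norm (deriv F z / F z) \<le> (\<Sum>a\<in>T. real (m a) * (1 / norm (z - a) + 1 / d))
          + 32 * R * (Y + c + 1) / d\<^sup>2"
      using dh[OF z(1)] by linarith
    have "Re (G z) \<le> M"
      using complex_Re_le_cmod[of "G z"] M[of z] z d by auto
    then have lnk: "ln (norm (k z)) \<ge> - M"
      using ReG[OF zR(2)] Y by linarith
    have kz: "norm (k z) = (\<Prod>a\<in>T. norm (B a z) ^ m a) * norm (g z)"
      by (simp add: k_def norm_mult norm_power prod_norm[symmetric])
    have Fz': "norm (F z) = (\<Prod>a\<in>T. norm (z - a) ^ m a) * norm (g z)"
      by (simp add: Fg norm_mult norm_power prod_norm[symmetric])
    have gpos: "norm (g z) > 0"
      using gnz[of z] zR by simp
    have lnF: "ln (norm (F z)) = (\<Sum>a\<in>T. real (m a) * ln (norm (z - a))) + ln (norm (g z))"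
      unfolding Fz' using za gpos finT
      by (subst ln_mult_pos) (auto simp: ln_prod ln_realpow intro!: prod_pos)
    have lnk': "ln (norm (k z)) = (\<Sum>a\<in>T. real (m a) * ln (norm (B a z))) + ln (norm (g z))"
      unfolding kz using Bnz zR gpos finT
      by (subst ln_mult_pos) (auto simp: ln_prod ln_realpow intro!: prod_pos)
    have "real (m a) * ln (norm (z - a) / (2 * R))
        \<le> real (m a) * ln (norm (z - a)) - real (m a) * ln (norm (B a z))" if a: "a \<in> T" for a
    proof -
      have "norm (of_real (R\<^sup>2) - cnj a * z) \<le> R\<^sup>2 + norm (cnj a * z)"
        using norm_triangle_ineq4[of "of_real (R\<^sup>2)" "cnj a * z"] unfolding norm_of_real by simp
      also have "norm (cnj a * z) \<le> R * R"
        unfolding norm_mult using aT[OF a] zR s2 R by (intro mult_mono) auto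
      finally have "norm (B a z) \<le> 2 * R"
        using R by (simp add: B_def norm_divide field_simps power2_eq_square)
      then have "ln (norm (B a z)) \<le> ln (2 * R)"
        using Bnz[OF a zR(1)] by (intro ln_mono) auto
      then have "ln (norm (z - a) / (2 * R)) \<le> ln (norm (z - a)) - ln (norm (B a z))"
        using za[OF a] R by (simp add: ln_div)
      from mult_left_mono[OF this, of "real (m a)"] show ?thesis
        by (simp add: algebra_simps)
    qed
    then have "(\<Sum>a\<in>T. real (m a) * ln (norm (z - a) / (2 * R)))
       \<le> (\<Sum>a\<in>T. real (m a) * ln (norm (z - a)) - real (m a) * ln (norm (B a z)))"
      by (rule sum_mono)
    then show "ln (norm (F z)) \<ge> (\<Sum>a\<in>T. real (m a) * ln (norm (z - a) / (2 * R))) - M"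
      using lnF lnk lnk' by (simp add: sum_subtractf)
  qed
  show ?thesis
    using N_le main unfolding N_def M_def d_def
    by (intro exI[of _ T] exI[of _ m] conjI finT m1 allI impI) simp_all
qed

text \<open>Pigeonhole: of \<open>card Z + 1\<close> disjoint subintervals at least one contains no point of \<open>Z\<close>, and its
midpoint will do.\<close>

lemma exists_radius_far_from_finite_set:
  fixes Z :: "real set"
  assumes "finite Z" "a < b"
  shows "\<exists>r. a \<le> r \<and> r \<le> b \<and> (\<forall>x\<in>Z. (b - a) / (2 * (real (card Z) + 1)) \<le> \<bar>r - x\<bar>)"
proof (rule ccontr)
  assume contra: "\<not> ?thesis"
  define n where "n = card Z"
  define \<delta> where "\<delta> = (b - a) / (2 * (real n + 1))"
  have \<delta>: "\<delta> > 0" "2 * (real n + 1) * \<delta> = b - a"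
    using assms by (auto simp: \<delta>_def)
  define p where "p = (\<lambda>j::nat. a + (2 * real j + 1) * \<delta>)"
  have p: "a \<le> p j \<and> p j \<le> b" if "j \<le> n" for j
  proof -
    have "(2 * real j + 1) * \<delta> \<le> 2 * (real n + 1) * \<delta>"
      using that \<delta>(1) by (intro mult_right_mono) auto
    then have "(2 * real j + 1) * \<delta> \<le> b - a"
      using \<delta>(2) by linarith
    moreover have "(2 * real j + 1) * \<delta> \<ge> 0"
      using \<delta>(1) by simp
    ultimately show ?thesis
      unfolding p_def by linarith
  qed
  have "\<forall>j\<in>{..n}. \<exists>x\<in>Z. \<bar>p j - x\<bar> < \<delta>"
  proof
    fix j assume "j \<in> {..n}"
    then have "a \<le> p j \<and> p j \<le> b"
      using p by simp
    then show "\<exists>x\<in>Z. \<bar>p j - x\<bar> < \<delta>"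
      using contra unfolding \<delta>_def n_def by (meson not_le)
  qed
  then obtain q where q: "\<And>j. j \<in> {..n} \<Longrightarrow> q j \<in> Z \<and> \<bar>p j - q j\<bar> < \<delta>"
    by metis
  have "inj_on q {..n}"
  proof (rule inj_onI)
    fix i j assume ij: "i \<in> {..n}" "j \<in> {..n}" "q i = q j"
    then have "\<bar>p i - p j\<bar> < 2 * \<delta>"
      using q[of i] q[of j] by linarith
    moreover have "\<bar>p i - p j\<bar> = 2 * \<delta> * \<bar>real i - real j\<bar>"
    proof -
      have "p i - p j = 2 * \<delta> * (real i - real j)"
        by (simp add: p_def algebra_simps)
      then show ?thesis
        using \<delta>(1) by (simp add: abs_mult)
    qed
    ultimately have "\<bar>real i - real j\<bar> < 1"
      using \<delta>(1) by simp
    then show "i = j"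
      by linarith
  qed
  then have "card {..n} \<le> card Z"
    using q assms(1) by (intro card_inj_on_le[of q]) auto
  then show False
    by (simp add: n_def)
qed

text \<open>Dividing by a power of \<open>z\<close> removes a zero at the origin, after which the constant \<open>c\<close> of the previous
estimate depends on \<open>F\<close> only and can be absorbed.\<close>

lemma entire_logderiv_and_min_modulus:
  fixes F :: "complex \<Rightarrow> complex"
  assumes F: "F holomorphic_on UNIV" and nz: "F z0 \<noteq> 0"
  shows "\<exists>C\<ge>1. \<forall>s R Y. 1 \<le> s \<longrightarrow> s < R \<longrightarrow> 1 \<le> Y \<longrightarrow> (\<forall>z. norm z \<le> R \<longrightarrow> norm (F z) \<le> exp Y) \<longrightarrow>
    (\<exists>T m. finite T \<and> (\<forall>a\<in>T. 1 \<le> m a) \<and> real (\<Sum>a\<in>T. m a) \<le> C * (Y * R / (R - s)) \<and>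
      (\<forall>z. 1 \<le> norm z \<longrightarrow> norm z \<le> s \<longrightarrow> z \<notin> T \<longrightarrow> F z \<noteq> 0 \<and>
      norm (deriv F z / F z) \<le> (\<Sum>a\<in>T. real (m a) * (1 / norm (z - a) + 1 / (R - s)))
          + C * (Y * R / (R - s))\<^sup>2 \<and>
      ln (norm (F z)) \<ge> (\<Sum>a\<in>T. real (m a) * ln (norm (z - a) / (2 * R)))
          - C * (Y * R / (R - s))))"
proof -
  obtain k g where g: "g holomorphic_on UNIV" "g 0 \<noteq> 0" and Fg: "\<And>z. F z = (z - 0) ^ k * g z"
    by (rule entire_factor_out_zero[OF F nz, where a = 0]) (rule that)
  define c where "c = \<bar>ln (norm (g 0))\<bar>"
  have c: "c \<ge> 0" "exp (- c) \<le> norm (g 0)"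
  proof -
    have "exp (- c) \<le> exp (ln (norm (g 0)))"
      by (subst exp_le_cancel_iff) (simp add: c_def)
    then show "exp (- c) \<le> norm (g 0)"
      using g(2) by simp
  qed (simp add: c_def)
  define C where "C = 32 * (2 + c) + real k"
  have "C \<ge> 1"
    using c by (simp add: C_def)
  moreover have "\<exists>T m. finite T \<and> (\<forall>a\<in>T. 1 \<le> m a) \<and> real (\<Sum>a\<in>T. m a) \<le> C * (Y * R / (R - s)) \<and>
      (\<forall>z. 1 \<le> norm z \<longrightarrow> norm z \<le> s \<longrightarrow> z \<notin> T \<longrightarrow> F z \<noteq> 0 \<and>
      norm (deriv F z / F z) \<le> (\<Sum>a\<in>T. real (m a) * (1 / norm (z - a) + 1 / (R - s)))
          + C * (Y * R / (R - s))\<^sup>2 \<and>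
      ln (norm (F z)) \<ge> (\<Sum>a\<in>T. real (m a) * ln (norm (z - a) / (2 * R)))
          - C * (Y * R / (R - s)))"
    if s: "1 \<le> s" "s < R" and Y: "1 \<le> Y" and bd: "\<forall>z. norm z \<le> R \<longrightarrow> norm (F z) \<le> exp Y" for s R Y
  proof -
    have "norm (g z) \<le> exp Y" if z: "norm z = R" for z
    proof -
      have "1 * norm (g z) \<le> norm z ^ k * norm (g z)"
        using z s by (intro mult_right_mono one_le_power) auto
      also have "\<dots> = norm (F z)"
        by (simp add: Fg norm_mult norm_power)
      finally show ?thesis
        using bd z by fastforce
    qed
    then have gb: "norm (g z) \<le> exp Y" if "norm z \<le> R" for z
      using entire_bound_on_cball[OF g(1) _ _ that] s by auto
    define X where "X = Y * R / (R - s)"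
    have R: "R > 0" "R \<ge> 1" and X1: "X \<ge> 1"
    proof -
      have "R \<le> Y * R"
        using Y s mult_right_mono[of 1 Y R] by simp
      then have "R - s \<le> Y * R"
        using s by linarith
      then show "X \<ge> 1"
        using s by (simp add: X_def)
    qed (use s in auto)
    obtain T m where T: "finite T" "\<forall>a\<in>T. 1 \<le> m a"
       and N: "real (\<Sum>a\<in>T. m a) * (R - s) \<le> 2 * R * (Y + c)"
       and main: "\<And>z. norm z \<le> s \<Longrightarrow> z \<notin> T \<Longrightarrow> g z \<noteq> 0 \<and>
        norm (deriv g z / g z) \<le> (\<Sum>a\<in>T. real (m a) * (1 / norm (z - a) + 1 / (R - s)))
            + 32 * R * (Y + c + 1) / (R - s)\<^sup>2 \<and>
        ln (norm (g z)) \<ge> (\<Sum>a\<in>T. real (m a) * ln (norm (z - a) / (2 * R)))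
            - 8 * R * (Y + c + 1) / (R - s)"
      using logderiv_and_min_modulus_off_zeros[OF g(1) _ s(2) _ gb c(2)] s Y by auto
    have Yc: "Y + c \<le> (1 + c) * Y" "Y + c + 1 \<le> (2 + c) * Y"
      using Y c mult_left_mono[of 1 Y c] by (auto simp: algebra_simps)
    have "real (\<Sum>a\<in>T. m a) \<le> 2 * R * (Y + c) / (R - s)"
      using N s by (simp add: field_simps)
    also have "\<dots> \<le> 2 * R * ((1 + c) * Y) / (R - s)"
      using Yc(1) R s by (intro divide_right_mono mult_left_mono) auto
    also have "\<dots> = 2 * (1 + c) * X"
      by (simp add: X_def)
    also have "\<dots> \<le> C * X"
      using c X1 by (intro mult_right_mono) (auto simp: C_def)
    finally have N': "real (\<Sum>a\<in>T. m a) \<le> C * X" .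
    have "8 * R * (Y + c + 1) / (R - s) \<le> 8 * R * ((2 + c) * Y) / (R - s)"
      using Yc(2) R s by (intro divide_right_mono mult_left_mono) auto
    also have "\<dots> = 8 * (2 + c) * X"
      by (simp add: X_def)
    also have "\<dots> \<le> C * X"
      using c X1 by (intro mult_right_mono) (auto simp: C_def)
    finally have L: "8 * R * (Y + c + 1) / (R - s) \<le> C * X" .
    have "32 * R * (Y + c + 1) / (R - s)\<^sup>2 \<le> 32 * R * ((2 + c) * Y) / (R - s)\<^sup>2"
      using Yc(2) R s by (intro divide_right_mono mult_left_mono) auto
    also have "\<dots> = 32 * (2 + c) * (Y * R / (R - s)\<^sup>2)"
      by simp
    also have "\<dots> \<le> 32 * (2 + c) * X\<^sup>2"
    proof (intro mult_left_mono)
      have "1 * (Y * R) \<le> (Y * R) * (Y * R)"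
        using Y R mult_mono[of 1 Y 1 R] by (intro mult_right_mono) auto
      then have "Y * R / (R - s)\<^sup>2 \<le> (Y * R) * (Y * R) / (R - s)\<^sup>2"
        by (intro divide_right_mono) auto
      then show "Y * R / (R - s)\<^sup>2 \<le> X\<^sup>2"
        by (simp add: X_def power2_eq_square)
    qed (use c in auto)
    finally have D: "32 * R * (Y + c + 1) / (R - s)\<^sup>2 + real k \<le> C * X\<^sup>2"
      using mult_left_mono[of 1 "X\<^sup>2" "real k"] X1 by (simp add: C_def algebra_simps)
    have fin: "F z \<noteq> 0 \<and>
      norm (deriv F z / F z) \<le> (\<Sum>a\<in>T. real (m a) * (1 / norm (z - a) + 1 / (R - s))) + C * X\<^sup>2 \<and>
      ln (norm (F z)) \<ge> (\<Sum>a\<in>T. real (m a) * ln (norm (z - a) / (2 * R))) - C * X"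
      if z: "1 \<le> norm z" "norm z \<le> s" "z \<notin> T" for z
    proof -
      have gz: "g z \<noteq> 0" and z0: "z \<noteq> 0"
        using main[OF z(2,3)] z by auto
      have dg: "(g has_field_derivative deriv g z) (at z)"
        using g(1) by (simp add: holomorphic_derivI)
      have "((\<lambda>z. z ^ k) has_field_derivative of_nat k * z ^ (k - 1)) (at z)"
        using DERIV_power[OF DERIV_ident, of k z] by simp
      from DERIV_mult[OF this dg]
      have "deriv F z = of_nat k * z ^ (k - 1) * g z + deriv g z * z ^ k"
        unfolding Fg[abs_def] by (simp add: DERIV_imp_deriv)
      then have "deriv F z / F z = of_nat k / z + deriv g z / g z"
        using gz z0 by (cases k) (simp_all add: Fg field_simps)
      then have "norm (deriv F z / F z) \<le> norm (of_nat k / z) + norm (deriv g z / g z)"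
        by (simp add: norm_triangle_ineq)
      moreover have "norm (of_nat k / z) \<le> real k"
        using z(1) by (simp add: norm_divide divide_le_eq mult_le_cancel_left1)
      moreover have "ln (norm (F z)) = real k * ln (norm z) + ln (norm (g z))"
        using gz z0 by (simp add: Fg norm_mult norm_power ln_mult ln_realpow)
      moreover have "real k * ln (norm z) \<ge> 0"
        using z(1) by simp
      moreover have "F z \<noteq> 0"
        using gz z0 by (simp add: Fg)
      ultimately show ?thesis
        using main[OF z(2,3)] D L by auto
    qed
    show ?thesis
      using N' fin unfolding X_def
      by (intro exI[of _ T] exI[of _ m] conjI T allI impI) simp_all
  qed
  ultimately show ?thesis
    by (intro exI[of _ C]) simp
qed

text \<open>Between any two radii there is a circle that avoids the zeros of all members of \<open>FF\<close> and on which
logarithmic derivatives and minimum moduli are controlled. The exponents \<open>Y F\<close> are individual: for the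
minimum modulus of a slowly growing member only its own growth counts as a factor, and that of the
others appears under a logarithm.\<close>

definition good_circles :: "(complex \<Rightarrow> complex) set \<Rightarrow> real \<Rightarrow> bool" where
  "good_circles FF C \<longleftrightarrow> (\<forall>s R Y Ymax. 1 \<le> s \<longrightarrow> s < R \<longrightarrow>
    (\<forall>F\<in>FF. 1 \<le> Y F \<and> Y F \<le> Ymax \<and> (\<forall>z. norm z \<le> R \<longrightarrow> norm (F z) \<le> exp (Y F))) \<longrightarrow>
    (\<exists>r. s \<le> r \<and> r \<le> (s + R) / 2 \<and> (\<forall>F\<in>FF. \<forall>z. norm z = r \<longrightarrow> F z \<noteq> 0 \<and>
      norm (deriv F z / F z) \<le> C * (Ymax * R / (R - s)) ^ 3 \<and>
      ln (norm (F z)) \<ge> - C * (Y F * R / (R - s)) * (1 + ln (Ymax * R / (R - s))))))"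

text \<open>The number of zeros in question is bounded in terms of the growth, so one radius keeps a definite
distance from the moduli of the zeros of all members of the finite family.\<close>

lemma ex_good_circles:
  fixes FF :: "(complex \<Rightarrow> complex) set"
  assumes fin: "finite FF" and hol: "\<And>F. F \<in> FF \<Longrightarrow> F holomorphic_on UNIV"
    and nz: "\<And>F. F \<in> FF \<Longrightarrow> \<exists>z. F z \<noteq> 0"
  shows "\<exists>C\<ge>1. good_circles FF C"
proof -
  define core where "core = (\<lambda>(C::real) (s::real) R Y F (T :: complex set) (m :: complex \<Rightarrow> nat).
      finite T \<and> (\<forall>a\<in>T. 1 \<le> m a) \<and> real (\<Sum>a\<in>T. m a) \<le> C * (Y * R / (R - s)) \<and>
      (\<forall>z. 1 \<le> norm z \<longrightarrow> norm z \<le> s \<longrightarrow> z \<notin> T \<longrightarrow> F z \<noteq> 0 \<and>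
      norm (deriv F z / F z) \<le> (\<Sum>a\<in>T. real (m a) * (1 / norm (z - a) + 1 / (R - s)))
          + C * (Y * R / (R - s))\<^sup>2 \<and>
      ln (norm (F z)) \<ge> (\<Sum>a\<in>T. real (m a) * ln (norm (z - a) / (2 * R)))
          - C * (Y * R / (R - s))))"
  have "\<forall>F\<in>FF. \<exists>C. C \<ge> 1 \<and> (\<forall>s R Y. 1 \<le> s \<longrightarrow> s < R \<longrightarrow> 1 \<le> Y \<longrightarrow>
      (\<forall>z. norm z \<le> R \<longrightarrow> norm (F z) \<le> exp Y) \<longrightarrow> (\<exists>T m. core C s R Y F T m))"
  proof
    fix F assume F: "F \<in> FF"
    obtain z0 where "F z0 \<noteq> 0"
      using nz[OF F] by (elim exE)
    from entire_logderiv_and_min_modulus[OF hol[OF F] this]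
    show "\<exists>C. C \<ge> 1 \<and> (\<forall>s R Y. 1 \<le> s \<longrightarrow> s < R \<longrightarrow> 1 \<le> Y \<longrightarrow>
      (\<forall>z. norm z \<le> R \<longrightarrow> norm (F z) \<le> exp Y) \<longrightarrow> (\<exists>T m. core C s R Y F T m))"
      unfolding core_def .
  qed
  from bchoice[OF this] obtain c where c_core: "\<forall>F\<in>FF. c F \<ge> 1 \<and> (\<forall>s R Y. 1 \<le> s \<longrightarrow> s < R \<longrightarrow> 1 \<le> Y \<longrightarrow>
      (\<forall>z. norm z \<le> R \<longrightarrow> norm (F z) \<le> exp Y) \<longrightarrow> (\<exists>T m. core (c F) s R Y F T m))"
    by (elim exE)
  have c: "c F \<ge> 1" if "F \<in> FF" for F
    using c_core that by (simp only:)
  have core: "\<exists>T m. core (c F) s R Y F T m" if "F \<in> FF" "1 \<le> s" "s < R"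
      "1 \<le> Y" "\<forall>z. norm z \<le> R \<longrightarrow> norm (F z) \<le> exp Y" for F s R Y
    using c_core[rule_format, OF that(1), THEN conjunct2, rule_format, OF that(2-4)] that(5) by (simp only:)
  define c1 where "c1 = 1 + (\<Sum>F\<in>FF. c F)"
  have c1: "c F \<le> c1" if "F \<in> FF" for F
    using member_le_sum[OF that, of c] c fin by (force simp: c1_def)
  have c1_1: "c1 \<ge> 1"
  proof -
    have "sum c FF \<ge> 0"
      by (rule sum_nonneg) (use c in force)
    then show ?thesis
      by (simp add: c1_def)
  qed
  define D where "D = 2 * real (card FF) * c1 + 1"
  have D: "D \<ge> 1"
    using c1_1 by (simp add: D_def)
  define C where "C = 22 * c1 * D"
  have c1D: "c1 * D \<ge> 1" "c1 * D \<ge> c1"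
    using c1_1 D mult_mono[of 1 c1 1 D] mult_left_mono[of 1 D c1] by auto
  have "C \<ge> 1"
    using c1D by (simp add: C_def)
  moreover have "\<exists>r. s \<le> r \<and> r \<le> (s + R) / 2 \<and> (\<forall>F\<in>FF. \<forall>z. norm z = r \<longrightarrow> F z \<noteq> 0 \<and>
      norm (deriv F z / F z) \<le> C * (Ymax * R / (R - s)) ^ 3 \<and>
      ln (norm (F z)) \<ge> - C * (Y F * R / (R - s)) * (1 + ln (Ymax * R / (R - s))))"
    if s: "1 \<le> s" "s < R" and Y: "\<forall>F\<in>FF. 1 \<le> Y F \<and> Y F \<le> Ymax \<and>
        (\<forall>z. norm z \<le> R \<longrightarrow> norm (F z) \<le> exp (Y F))" for s R Y Ymax
  proof (cases "FF = {}")
    case True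
    then show ?thesis
      using s by (intro exI[of _ s]) auto
  next
    case False
    then have Ymax: "Ymax \<ge> 1"
      using Y by force
    define s' where "s' = (s + R) / 2"
    have s': "1 \<le> s'" "s' < R" "s < s'" and Rs': "R - s' = (R - s) / 2" and ss': "s' - s = (R - s) / 2"
      using s by (auto simp: s'_def field_simps)
    have R: "R > 0" "R \<ge> 1" "R - s > 0"
      using s by auto
    define X where "X = Ymax * R / (R - s)"
    define XF where "XF = (\<lambda>F. Y F * R / (R - s))"
    have XF: "XF F \<le> X" "1 \<le> XF F" if "F \<in> FF" for F
    proof -
      show "XF F \<le> X"
        unfolding XF_def X_def using Y that R by (intro divide_right_mono mult_right_mono) auto
      have "1 * R \<le> Y F * R"
        using Y that R by (intro mult_right_mono) auto
      then have "R - s \<le> Y F * R"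
        using s by linarith
      then show "1 \<le> XF F"
        unfolding XF_def using s by simp
    qed
    then have X1: "X \<ge> 1"
      using False by force
    have RX: "R / (R - s) \<le> X"
      unfolding X_def using Ymax R mult_right_mono[of 1 Ymax R] by (intro divide_right_mono) simp_all
    have iX: "1 / (R - s) \<le> X"
      using R divide_right_mono[of 1 R "R - s"] RX by simp
    have "\<forall>F\<in>FF. \<exists>Tm. core (c F) s' R (Y F) F (fst Tm) (snd Tm)"
    proof
      fix F assume F: "F \<in> FF"
      have "\<exists>T m. core (c F) s' R (Y F) F T m"
        using Y F by (intro core[OF F s'(1,2)]) simp_all
      then show "\<exists>Tm. core (c F) s' R (Y F) F (fst Tm) (snd Tm)"
        by (metis fst_conv snd_conv)
    qed
    from bchoice[OF this] obtain Tm where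
      Tm: "\<forall>F\<in>FF. core (c F) s' R (Y F) F (fst (Tm F)) (snd (Tm F))"
      by (elim exE)
    define T where "T = (\<lambda>F. fst (Tm F))"
    define m where "m = (\<lambda>F. snd (Tm F))"
    have cr: "core (c F) s' R (Y F) F (T F) (m F)" if "F \<in> FF" for F
      using Tm that by (simp add: T_def m_def)
    define N where "N = (\<lambda>F. real (\<Sum>a\<in>T F. m F a))"
    have finT: "finite (T F)" if "F \<in> FF" for F
      using cr[OF that] by (simp add: core_def)
    have XF2: "Y F * R / (R - s') = 2 * XF F" for F
      by (simp add: Rs' XF_def)
    have N: "N F \<le> 2 * c1 * XF F" if F: "F \<in> FF" for F
    proof -
      have "N F \<le> c F * (2 * XF F)"
        using cr[OF F] unfolding core_def XF2 N_def by blast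
      also have "\<dots> \<le> c1 * (2 * XF F)"
        using c1[OF F] XF[OF F] by (intro mult_right_mono) auto
      finally show ?thesis
        by simp
    qed
    define Z where "Z = (\<Union>F\<in>FF. norm ` T F)"
    have finZ: "finite Z"
      unfolding Z_def using fin finT by auto
    have "card Z \<le> (\<Sum>F\<in>FF. card (norm ` T F))"
      unfolding Z_def using fin by (rule card_UN_le)
    then have "real (card Z) \<le> (\<Sum>F\<in>FF. real (card (norm ` T F)))"
      by (metis of_nat_le_iff of_nat_sum)
    also have "\<dots> \<le> (\<Sum>F\<in>FF. 2 * c1 * X)"
    proof (rule sum_mono)
      fix F assume F: "F \<in> FF"
      have "card (T F) = (\<Sum>a\<in>T F. 1)"
        by simp
      also have "\<dots> \<le> (\<Sum>a\<in>T F. m F a)"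
        using cr[OF F] by (intro sum_mono) (simp add: core_def)
      finally have "real (card (T F)) \<le> N F"
        unfolding N_def by (rule of_nat_mono)
      moreover have "real (card (norm ` T F)) \<le> real (card (T F))"
        using card_image_le[OF finT[OF F], of norm] by simp
      moreover have "2 * c1 * XF F \<le> 2 * c1 * X"
        using XF[OF F] c1_1 by (intro mult_left_mono) auto
      ultimately show "real (card (norm ` T F)) \<le> 2 * c1 * X"
        using N[OF F] by linarith
    qed
    also have "\<dots> = (D - 1) * X"
      by (simp add: D_def)
    finally have cardZ: "real (card Z) + 1 \<le> D * X"
      using X1 by (simp add: algebra_simps)
    define \<delta> where "\<delta> = (s' - s) / (2 * (real (card Z) + 1))"
    have \<delta>_pos: "\<delta> > 0"
      using s' by (simp add: \<delta>_def)
    obtain r where r: "s \<le> r" "r \<le> s'" "\<And>x. x \<in> Z \<Longrightarrow> \<delta> \<le> \<bar>r - x\<bar>"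
      using exists_radius_far_from_finite_set[OF finZ s'(3)] unfolding \<delta>_def by blast
    have i\<delta>: "1 / \<delta> = 4 * (real (card Z) + 1) * (1 / (R - s))"
      unfolding \<delta>_def ss' by simp
    have i\<delta>1: "1 / \<delta> \<le> 4 * D * X\<^sup>2"
    proof -
      have "4 * (real (card Z) + 1) * (1 / (R - s)) \<le> (4 * (D * X)) * X"
        using cardZ iX R X1 D by (intro mult_mono) auto
      then show ?thesis
        unfolding i\<delta> by (simp add: power2_eq_square mult_ac)
    qed
    have i\<delta>2: "2 * R / \<delta> \<le> 8 * D * X\<^sup>2"
    proof -
      have "2 * R / \<delta> = 2 * R * (1 / \<delta>)"
        by simp
      also have "\<dots> = 8 * (real (card Z) + 1) * (R / (R - s))"
        unfolding i\<delta> by simp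
      also have "\<dots> \<le> (8 * (D * X)) * X"
        using cardZ RX R X1 D by (intro mult_mono) auto
      finally show ?thesis
        by (simp add: power2_eq_square mult_ac)
    qed
    have \<delta>R: "\<delta> \<le> 2 * R"
    proof -
      have "\<delta> \<le> s' - s"
        unfolding \<delta>_def using s' by (simp add: divide_le_eq mult_le_cancel_left1)
      then show ?thesis
        using ss' s by simp
    qed
    have lnX: "ln X \<ge> 0"
      using X1 by simp
    have ln_bd: "ln (2 * R / \<delta>) \<le> (8 * D + 2) * (1 + ln X)"
    proof -
      have "ln (2 * R / \<delta>) \<le> ln (8 * D * X\<^sup>2)"
        using i\<delta>2 \<delta>_pos R by (intro ln_mono) auto
      also have "\<dots> = ln (8 * D) + 2 * ln X"
        using D X1 by (simp add: ln_mult ln_realpow)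
      also have "\<dots> \<le> 8 * D + 2 * ln X"
        using ln_le_minus_one[of "8 * D"] D by simp
      also have "\<dots> \<le> (8 * D + 2) * (1 + ln X)"
        using D lnX by (simp add: algebra_simps)
      finally show ?thesis .
    qed
    have ln0: "ln (2 * R / \<delta>) \<ge> 0"
      using \<delta>R \<delta>_pos by simp
    have goal: "F z \<noteq> 0 \<and> norm (deriv F z / F z) \<le> C * X ^ 3 \<and>
        ln (norm (F z)) \<ge> - C * XF F * (1 + ln X)" if F: "F \<in> FF" and z: "norm z = r" for F z
    proof -
      have dist: "\<delta> \<le> norm (z - a)" if "a \<in> T F" for a
      proof -
        have "norm a \<in> Z"
          using that F by (auto simp: Z_def)
        then have "\<delta> \<le> \<bar>norm z - norm a\<bar>"
          using r(3) z by simp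
        also have "\<dots> \<le> norm (z - a)"
          by (rule norm_triangle_ineq3)
        finally show ?thesis .
      qed
      have zT: "z \<notin> T F"
        using dist[of z] \<delta>_pos by auto
      have main: "F z \<noteq> 0 \<and>
      norm (deriv F z / F z) \<le> (\<Sum>a\<in>T F. real (m F a) * (1 / norm (z - a) + 1 / (R - s')))
          + c F * (2 * XF F)\<^sup>2 \<and>
      ln (norm (F z)) \<ge> (\<Sum>a\<in>T F. real (m F a) * ln (norm (z - a) / (2 * R)))
          - c F * (2 * XF F)"
        using cr[OF F] r z s zT unfolding core_def XF2 by auto
      have N0: "N F \<ge> 0"
        unfolding N_def by (rule of_nat_0_le_iff)
      have "(\<Sum>a\<in>T F. real (m F a) * (1 / norm (z - a) + 1 / (R - s')))
          \<le> (\<Sum>a\<in>T F. real (m F a) * (1 / \<delta> + 2 / (R - s)))"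
        using dist \<delta>_pos by (intro sum_mono mult_left_mono add_mono) (auto simp: Rs' intro!: frac_le)
      also have "\<dots> = N F * (1 / \<delta> + 2 * (1 / (R - s)))"
        by (simp add: N_def sum_distrib_right)
      also have "\<dots> \<le> (2 * c1 * X) * (4 * D * X\<^sup>2 + 2 * X)"
      proof (intro mult_mono)
        show "N F \<le> 2 * c1 * X"
          using N[OF F] XF(1)[OF F] c1_1 mult_left_mono[of "XF F" X "2 * c1"] by linarith
        show "1 / \<delta> + 2 * (1 / (R - s)) \<le> 4 * D * X\<^sup>2 + 2 * X"
          using i\<delta>1 iX by linarith
      qed (use c1_1 X1 \<delta>_pos R in auto)
      also have "\<dots> = 8 * (c1 * D) * X ^ 3 + 4 * c1 * X\<^sup>2"
        by (simp add: algebra_simps power2_eq_square power3_eq_cube)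
      finally have 1: "(\<Sum>a\<in>T F. real (m F a) * (1 / norm (z - a) + 1 / (R - s')))
          \<le> 8 * (c1 * D) * X ^ 3 + 4 * c1 * X\<^sup>2" .
      have "c F * (2 * XF F)\<^sup>2 \<le> c1 * (2 * X)\<^sup>2"
        using c[OF F] c1[OF F] XF[OF F] by (intro mult_mono power_mono) auto
      then have 2: "c F * (2 * XF F)\<^sup>2 \<le> 4 * c1 * X\<^sup>2"
        by (simp add: power2_eq_square mult_ac)
      have "8 * c1 * X\<^sup>2 \<le> 8 * (c1 * D) * X ^ 3"
        using c1D c1_1 X1 by (intro mult_mono power_increasing) auto
      moreover have "16 * (c1 * D) * X ^ 3 \<le> C * X ^ 3"
        using X1 c1_1 D by (intro mult_right_mono) (auto simp: C_def)
      ultimately have A: "norm (deriv F z / F z) \<le> C * X ^ 3"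
        using main 1 2 by linarith
      have "(\<Sum>a\<in>T F. real (m F a) * (- ln (2 * R / \<delta>)))
          \<le> (\<Sum>a\<in>T F. real (m F a) * ln (norm (z - a) / (2 * R)))"
      proof (intro sum_mono mult_left_mono)
        fix a assume a: "a \<in> T F"
        have "- ln (2 * R / \<delta>) = ln (\<delta> / (2 * R))"
          using \<delta>_pos R by (simp add: ln_div)
        also have "\<dots> \<le> ln (norm (z - a) / (2 * R))"
          using dist[OF a] \<delta>_pos R by (intro ln_mono divide_right_mono) auto
        finally show "- ln (2 * R / \<delta>) \<le> ln (norm (z - a) / (2 * R))" .
      qed auto
      moreover have "(\<Sum>a\<in>T F. real (m F a) * (- ln (2 * R / \<delta>))) = - (N F * ln (2 * R / \<delta>))"
        by (simp add: N_def sum_distrib_right sum_negf)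
      moreover have "N F * ln (2 * R / \<delta>) \<le> (2 * c1 * XF F) * ((8 * D + 2) * (1 + ln X))"
        using N[OF F] ln_bd ln0 c1_1 XF[OF F] by (intro mult_mono) auto
      moreover have "c F * (2 * XF F) \<le> c1 * (2 * XF F) * (1 + ln X)"
      proof -
        have "c F * (2 * XF F) \<le> c1 * (2 * XF F)"
          using c1[OF F] XF[OF F] by (intro mult_right_mono) auto
        moreover have "c1 * (2 * XF F) * 1 \<le> c1 * (2 * XF F) * (1 + ln X)"
          using lnX XF[OF F] c1_1 by (intro mult_left_mono) auto
        ultimately show ?thesis
          by linarith
      qed
      moreover have "(2 * c1 * XF F) * ((8 * D + 2) * (1 + ln X)) + c1 * (2 * XF F) * (1 + ln X)
          \<le> C * XF F * (1 + ln X)"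
      proof -
        have "(2 * c1 * XF F) * ((8 * D + 2) * (1 + ln X)) + c1 * (2 * XF F) * (1 + ln X)
           = (16 * (c1 * D) + 6 * c1) * (XF F * (1 + ln X))"
          by (simp add: algebra_simps)
        also have "\<dots> \<le> C * (XF F * (1 + ln X))"
        proof (rule mult_right_mono)
          show "16 * (c1 * D) + 6 * c1 \<le> C"
            using c1D(2) unfolding C_def by linarith
        qed (use lnX XF[OF F] in auto)
        finally show ?thesis
          by simp
      qed
      ultimately have "ln (norm (F z)) \<ge> - (C * XF F * (1 + ln X))"
        using main by linarith
      then show ?thesis
        using A main by simp
    qed
    show ?thesis
      using r goal unfolding X_def XF_def s'_def by (intro exI[of _ r]) auto
  qed
  ultimately show ?thesis
    unfolding good_circles_def by (intro exI[of _ C]) simp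
qed

lemma good_circlesD:
  assumes "good_circles FF C" "1 \<le> s" "s < R"
    "\<forall>F\<in>FF. 1 \<le> Y F \<and> Y F \<le> Ymax \<and> (\<forall>z. norm z \<le> R \<longrightarrow> norm (F z) \<le> exp (Y F))"
  shows "\<exists>r. s \<le> r \<and> r \<le> (s + R) / 2 \<and> (\<forall>F\<in>FF. \<forall>z. norm z = r \<longrightarrow> F z \<noteq> 0 \<and>
      norm (deriv F z / F z) \<le> C * (Ymax * R / (R - s)) ^ 3 \<and>
      ln (norm (F z)) \<ge> - C * (Y F * R / (R - s)) * (1 + ln (Ymax * R / (R - s))))"
  by (rule assms(1)[unfolded good_circles_def, THEN spec, THEN spec, THEN spec, THEN spec,
        THEN mp, OF assms(2), THEN mp, OF assms(3), THEN mp, OF assms(4)])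

section \<open>Clearing poles and the Poisson--Jensen inequality\<close>

lemma analytic_poly [analytic_intros]: "poly (q :: complex poly) analytic_on S"
proof -
  have "poly q analytic_on UNIV"
    by (subst analytic_on_open) (auto intro!: holomorphic_intros)
  then show ?thesis
    by (rule analytic_on_subset) simp
qed

text \<open>Multiplying by the polynomial that has the poles as zeros, with multiplicity, leaves removable
singularities only.\<close>

lemma clear_poles:
  assumes F: "F meromorphic_on UNIV" and fin: "finite {z. is_pole F z}"
  obtains E q where "E holomorphic_on UNIV" "\<And>z. poly q z = 0 \<longleftrightarrow> is_pole F z"
    "\<And>z. F analytic_on {z} \<Longrightarrow> F z * poly q z = E z"
    "\<And>z. eventually (\<lambda>w. F w * poly q w = E w) (at z)"
proof -
  define A where "A = {z. is_pole F z}"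
  define q where "q = (\<Prod>a\<in>A. [:- a, 1:] ^ nat (- zorder F a))"
  define E where "E = remove_sings (\<lambda>w. F w * poly q w)"
  have sing: "isolated_singularity_at F z" "not_essential F z" for z
    using F meromorphic_at_iff meromorphic_on_subset[OF F, of "{z}"] by auto
  have pole: "zorder F a < 0 \<and> (\<exists>r>0. zor_poly F a holomorphic_on cball a r \<and>
      (\<forall>w\<in>cball a r - {a}. F w = zor_poly F a w / (w - a) ^ nat (- zorder F a)))"
    if a: "a \<in> A" for a
  proof -
    obtain r where r: "r > 0" "F analytic_on ball a r - {a}"
      using sing(1)[of a] by (auto simp: isolated_singularity_at_def)
    show ?thesis
      using zorder_exist_pole[of F "ball a r" a] r a
      by (auto simp: A_def analytic_imp_holomorphic)
  qed
  have q: "poly q z = (\<Prod>a\<in>A. (z - a) ^ nat (- zorder F a))" for z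
    by (simp add: q_def poly_prod poly_power)
  have q0: "poly q z = 0 \<longleftrightarrow> is_pole F z" for z
    using fin pole by (auto simp: q A_def[symmetric] prod_zero_iff) (auto simp: A_def)
  have lim: "\<exists>c. (\<lambda>w. F w * poly q w) \<midarrow>z\<rightarrow> c" for z
  proof (cases "z \<in> A")
    case False
    then obtain c where "F \<midarrow>z\<rightarrow> c"
      using sing(2)[of z] by (auto simp: not_essential_def A_def)
    then show ?thesis
      by (intro exI tendsto_mult) (auto intro!: tendsto_intros)
  next
    case True
    obtain r where r: "r > 0" "zor_poly F z holomorphic_on cball z r"
       "\<And>w. w \<in> cball z r - {z} \<Longrightarrow> F w = zor_poly F z w / (w - z) ^ nat (- zorder F z)"
      using pole[OF True] by blast
    define p where "p = (\<lambda>w. \<Prod>a\<in>A - {z}. (w - a) ^ nat (- zorder F a))"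
    have "isCont (zor_poly F z) z"
      using r(1,2) by (metis centre_in_ball continuous_on_interior holomorphic_on_imp_continuous_on interior_cball)
    then have "(\<lambda>w. zor_poly F z w * p w) \<midarrow>z\<rightarrow> zor_poly F z z * p z"
      unfolding p_def by (intro tendsto_intros) (auto simp: isCont_def)
    moreover have "eventually (\<lambda>w. zor_poly F z w * p w = F w * poly q w) (at z)"
    proof -
      have "eventually (\<lambda>w. w \<in> ball z r - {z}) (at z)"
        using r(1) by (intro eventually_at_in_open) auto
      then show ?thesis
      proof eventually_elim
        case (elim w)
        have "poly q w = (w - z) ^ nat (- zorder F z) * p w"
          unfolding q p_def using True fin by (subst prod.remove[of _ z]) (auto simp: A_def)
        then show ?case
          using r(3)[of w] elim by auto
      qed
    qed
    ultimately have "(\<lambda>w. F w * poly q w) \<midarrow>z\<rightarrow> zor_poly F z z * p z"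
      by (rule Lim_transform_eventually)
    then show ?thesis ..
  qed
  have sing': "isolated_singularity_at (\<lambda>w. F w * poly q w) z" for z
    by (intro singularity_intros sing isolated_singularity_at_analytic not_essential_analytic analytic_intros)
  have "E analytic_on {z}" for z
    using lim[of z] sing' unfolding E_def by (auto intro: remove_sings_analytic_at)
  then have "E holomorphic_on UNIV"
    by (meson analytic_imp_holomorphic analytic_on_analytic_at)
  moreover have "F z * poly q z = E z" if "F analytic_on {z}" for z
    using that unfolding E_def by (subst remove_sings_at_analytic) (auto intro!: analytic_intros)
  moreover have "eventually (\<lambda>w. F w * poly q w = E w) (at z)" for z
    using eventually_remove_sings_eq_at[OF sing'] unfolding E_def
    by eventually_elim auto
  ultimately show ?thesis
    using q0 that by blast
qed

text \<open>This is the Poisson--Jensen inequality with the Poisson kernel replaced by its maximum. The zeros are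
reflected in the circle, which does not decrease the modulus inside; the logarithm of the resulting
function without zeros is represented by the Cauchy formula.\<close>

lemma ln_norm_le_mean_ln_plus:
  fixes F :: "complex \<Rightarrow> complex"
  assumes F: "F holomorphic_on UNIV" and w: "norm w < R" and Fw: "F w \<noteq> 0"
    and circ: "\<And>z. norm z = R \<Longrightarrow> F z \<noteq> 0"
  shows "ln (norm (F w)) \<le> (R + norm w) / (R - norm w) *
     (1 / (2 * pi) * integral {0..2 * pi} (\<lambda>t. max 0 (ln (norm (F (of_real R * cis t))))))"
proof -
  have R: "R > 0"
    using w norm_ge_zero[of w] by linarith
  define T where "T = {z \<in> cball 0 R. F z = 0}"
  have finT: "finite T"
  proof (cases "F constant_on UNIV")
    case True
    then obtain y where y: "\<And>z. F z = y"
      unfolding constant_on_def by blast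
    have "T = {}"
      using Fw y by (auto simp: T_def)
    then show ?thesis
      by simp
  next
    case False
    show ?thesis
      unfolding T_def
      by (rule holomorphic_compact_finite_zeros[OF F open_UNIV connected_UNIV compact_cball
            subset_UNIV False])
  qed
  from entire_factor_out_finite[OF finT F Fw] obtain m g where
    mg: "g holomorphic_on UNIV \<and> (\<forall>a\<in>T. g a \<noteq> 0) \<and> (\<forall>z. F z = (\<Prod>a\<in>T. (z - a) ^ m a) * g z)"
    by (elim exE)
  then have g: "g holomorphic_on UNIV" "\<forall>a\<in>T. g a \<noteq> 0"
    and Fg: "F z = (\<Prod>a\<in>T. (z - a) ^ m a) * g z" for z
    by simp_all
  have aT: "norm a < R" if "a \<in> T" for a
    using that circ[of a] by (cases "norm a = R") (auto simp: T_def)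
  have gnz: "g z \<noteq> 0" if "norm z \<le> R" for z
    using that g(2) Fg[of z] by (cases "z \<in> T") (auto simp: T_def)
  define B where "B = (\<lambda>a z. (of_real (R\<^sup>2) - cnj a * z) / of_real R)"
  define k where "k = (\<lambda>z. (\<Prod>a\<in>T. B a z ^ m a) * g z)"
  have nz: "of_real (R\<^sup>2) - cnj a * z \<noteq> 0" if "norm a < R" "norm z \<le> R" for a z
  proof
    assume "of_real (R\<^sup>2) - cnj a * z = 0"
    then have "norm (of_real (R\<^sup>2) :: complex) = norm (cnj a * z)"
      by simp
    then have "R\<^sup>2 = norm a * norm z"
      unfolding norm_of_real norm_mult by simp
    also have "\<dots> \<le> norm a * R"
      using that by (intro mult_left_mono) auto
    also have "\<dots> < R * R"
      using that R by simp
    finally show False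
      by (simp add: power2_eq_square)
  qed
  have hol_k: "k holomorphic_on UNIV"
    unfolding k_def B_def using R by (intro holomorphic_intros g(1)) auto
  have B_circ: "norm (B a z) = norm (z - a)" if "norm z = R" for a z
  proof -
    have "of_real (R\<^sup>2) - cnj a * z = z * cnj (z - a)"
      using that complex_norm_square[of z] by (simp add: algebra_simps)
    then have "norm (of_real (R\<^sup>2) - cnj a * z) = R * norm (z - a)"
      using that by (simp only: norm_mult complex_mod_cnj)
    then show ?thesis
      using R by (simp add: B_def norm_divide)
  qed
  have k_circ: "norm (k z) = norm (F z)" if "norm z = R" for z
    using that by (simp add: k_def Fg norm_mult norm_power B_circ prod_norm[symmetric])
  have knz: "k z \<noteq> 0" if "norm z \<le> R" for z
    using that finT gnz nz[OF aT] R by (auto simp: k_def B_def)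
  have B_in: "norm (z - a) \<le> norm (B a z)" if a: "a \<in> T" and z: "norm z \<le> R" for a z
  proof -
    have "(norm (of_real (R\<^sup>2) - cnj a * z))\<^sup>2 - (R * norm (z - a))\<^sup>2
        = (R\<^sup>2 - (norm a)\<^sup>2) * (R\<^sup>2 - (norm z)\<^sup>2)"
      unfolding power_mult_distrib cmod_power2 by (simp add: power2_eq_square algebra_simps)
    moreover have "(R\<^sup>2 - (norm a)\<^sup>2) * (R\<^sup>2 - (norm z)\<^sup>2) \<ge> 0"
      using aT[OF a] z by (intro mult_nonneg_nonneg) (auto intro!: power_mono)
    ultimately have "(R * norm (z - a))\<^sup>2 \<le> (norm (of_real (R\<^sup>2) - cnj a * z))\<^sup>2"
      by linarith
    then have "R * norm (z - a) \<le> norm (of_real (R\<^sup>2) - cnj a * z)"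
      by (rule power2_le_imp_le) simp
    then show ?thesis
      using R by (simp add: B_def norm_divide field_simps)
  qed
  have F_le_k: "norm (F w) \<le> norm (k w)"
  proof -
    have "(\<Prod>a\<in>T. norm (w - a) ^ m a) \<le> (\<Prod>a\<in>T. norm (B a w) ^ m a)"
      using B_in w by (intro prod_mono conjI power_mono) auto
    then show ?thesis
      by (auto simp: Fg k_def norm_mult norm_power prod_norm[symmetric] intro!: mult_right_mono)
  qed
  have "open {z. k z \<noteq> 0}"
    using holomorphic_on_imp_continuous_on[OF hol_k] by (intro open_Collect_neq) auto
  moreover have "cball 0 R \<subseteq> {z. k z \<noteq> 0}"
    using knz by auto
  ultimately obtain e where e: "e > 0" "(\<Union>x\<in>cball 0 R. ball x e) \<subseteq> {z. k z \<noteq> 0}"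
    using compact_subset_open_imp_ball_epsilon_subset[OF compact_cball, of "{z. k z \<noteq> 0}" 0 R] by metis
  have knz': "k z \<noteq> 0" if "z \<in> ball 0 (R + e)" for z
  proof (cases "norm z \<le> R")
    case False
    define x where "x = of_real (R / norm z) * z"
    have z0: "norm z > 0" "z \<noteq> 0"
      using False R by auto
    have "z - x = of_real (1 - R / norm z) * z"
      by (simp add: x_def algebra_simps)
    then have "norm (z - x) = \<bar>1 - R / norm z\<bar> * norm z"
      by (simp only: norm_mult norm_of_real)
    also have "\<dots> = norm z - R"
      using z0 False by (simp add: field_simps abs_if)
    finally have "norm (z - x) = norm z - R" .
    then have "z \<in> ball x e"
      using that by (simp add: dist_norm norm_minus_commute)
    moreover have "x \<in> cball 0 R"
      using z0 R by (simp add: x_def norm_mult norm_divide)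
    ultimately show ?thesis
      using e(2) by blast
  qed (use knz in auto)
  have k_ball: "k holomorphic_on ball 0 (R + e)" "0 \<in> ball 0 (R + e)"
    using holomorphic_on_subset[OF hol_k] R e by auto
  obtain h where h: "h holomorphic_on ball 0 (R + e)" "\<And>z. z \<in> ball 0 (R + e) \<Longrightarrow> exp (h z) = k z"
    by (rule holomorphic_logarithm_exists[OF convex_ball open_ball k_ball(1) knz' k_ball(2)], assumption)
      (rule that, assumption, assumption)
  have Reh: "Re (h z) = ln (norm (k z))" if "norm z \<le> R" for z
    using h(2)[of z, symmetric] that e by simp
  \<comment> \<open>The extra factor turns the Cauchy kernel into the Poisson kernel.\<close>
  define \<phi> where "\<phi> = (\<lambda>z. h z * of_real (R\<^sup>2 - (norm w)\<^sup>2) / (of_real (R\<^sup>2) - cnj w * z))"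
  have "h holomorphic_on cball 0 R"
    by (rule holomorphic_on_subset[OF h(1)]) (use e in auto)
  then have \<phi>_hol: "\<phi> holomorphic_on cball 0 R"
    unfolding \<phi>_def using nz[OF w] by (intro holomorphic_intros) auto
  have \<phi>w: "\<phi> w = h w"
  proof -
    have "of_real (R\<^sup>2) - cnj w * w = of_real (R\<^sup>2 - (norm w)\<^sup>2)"
      using complex_norm_square[of w] by (simp add: mult.commute)
    then show ?thesis
      using nz[OF w, of w] w by (simp add: \<phi>_def)
  qed
  have "((\<lambda>u. \<phi> u / (u - w)) has_contour_integral (2 * of_real pi * \<i> * \<phi> w)) (circlepath 0 R)"
    using w by (intro Cauchy_integral_circlepath holomorphic_on_imp_continuous_on
        holomorphic_on_subset[OF \<phi>_hol]) auto
  then have int: "((\<lambda>t. \<phi> (of_real R * cis t) / (of_real R * cis t - w) * of_real R * \<i> * cis t)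
      has_integral 2 * of_real pi * \<i> * h w) {0..2 * pi}"
    unfolding circlepath_def by (subst (asm) has_contour_integral_part_circlepath_iff) (auto simp: \<phi>w)
  define K where "K = (\<lambda>t. (R\<^sup>2 - (norm w)\<^sup>2) / (norm (of_real R * cis t - w))\<^sup>2)"
  define L where "L = (\<lambda>t. max 0 (ln (norm (F (of_real R * cis t)))))"
  have eq: "\<phi> (of_real R * cis t) / (of_real R * cis t - w) * of_real R * \<i> * cis t
      = \<i> * (h (of_real R * cis t) * of_real (K t))" for t
  proof -
    define u where "u = of_real R * cis t"
    have u: "norm u = R" "u \<noteq> 0"
      using R by (auto simp: u_def norm_mult)
    have "of_real (R\<^sup>2) - cnj w * u = u * cnj (u - w)"
      using u complex_norm_square[of u] by (simp add: algebra_simps)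
    then have "\<phi> u / (u - w) * u = h u * (of_real (R\<^sup>2 - (norm w)\<^sup>2) / ((u - w) * cnj (u - w)))"
      using u(2) by (simp add: \<phi>_def)
    also have "(u - w) * cnj (u - w) = of_real ((norm (u - w))\<^sup>2)"
      by (simp only: complex_norm_square)
    finally have *: "\<phi> u / (u - w) * u = h u * of_real (K t)"
      by (simp add: K_def u_def)
    have "\<phi> u / (u - w) * of_real R * \<i> * cis t = \<i> * (\<phi> u / (u - w) * u)"
      by (simp add: u_def)
    then show ?thesis
      unfolding * by (simp add: u_def)
  qed
  have "((\<lambda>t. \<i> * (h (of_real R * cis t) * of_real (K t))) has_integral 2 * of_real pi * \<i> * h w) {0..2 * pi}"
    using int unfolding eq .
  then have I: "((\<lambda>t. - \<i> * (\<i> * (h (of_real R * cis t) * of_real (K t)))) has_integral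
     - \<i> * (2 * of_real pi * \<i> * h w)) {0..2 * pi}"
    by (rule has_integral_mult_right)
  then have "((\<lambda>t. h (of_real R * cis t) * of_real (K t)) has_integral of_real (2 * pi) * h w) {0..2 * pi}"
  proof -
    have "- \<i> * (2 * of_real pi * \<i> * h w) = of_real (2 * pi) * h w"
      by (simp add: complex_eq_iff)
    moreover have "- \<i> * (\<i> * x) = x" for x
      by (simp add: complex_eq_iff)
    ultimately show ?thesis
      using I by (simp only:)
  qed
  from has_integral_Re[OF this]
  have int2: "((\<lambda>t. Re (h (of_real R * cis t)) * K t) has_integral 2 * pi * Re (h w)) {0..2 * pi}"
    by simp
  have circ': "F (of_real R * cis t) \<noteq> 0" for t
    using circ[of "of_real R * cis t"] R by (simp add: norm_mult)
  have contL: "continuous_on {0..2 * pi} L"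
    unfolding L_def
    by (intro continuous_intros continuous_on_compose2[OF holomorphic_on_imp_continuous_on[OF F]])
       (use circ' in \<open>auto simp: cis_def intro!: continuous_intros\<close>)
  define c where "c = (R + norm w) / (R - norm w)"
  have "2 * pi * Re (h w) \<le> integral {0..2 * pi} (\<lambda>t. c * L t)"
  proof (rule has_integral_le[OF int2])
    show "((\<lambda>t. c * L t) has_integral integral {0..2 * pi} (\<lambda>t. c * L t)) {0..2 * pi}"
      using contL by (intro integrable_integral integrable_continuous_real continuous_intros)
    fix t
    define u where "u = of_real R * cis t"
    have u: "norm u = R"
      using R by (simp add: u_def norm_mult)
    have "R - norm w \<le> norm (u - w)"
      using norm_triangle_ineq2[of u w] u by simp
    then have d: "norm (u - w) > 0" "(R - norm w)\<^sup>2 \<le> (norm (u - w))\<^sup>2"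
      using w by (auto intro!: power_mono)
    have "K t \<le> (R\<^sup>2 - (norm w)\<^sup>2) / (R - norm w)\<^sup>2"
      unfolding K_def u_def[symmetric] using d w by (intro divide_left_mono) (auto intro!: power_mono)
    also have "\<dots> = c"
      using w by (simp add: c_def power2_eq_square square_diff_square_factored)
    finally have K: "K t \<le> c" .
    have K0: "K t \<ge> 0"
      unfolding K_def using w by (intro divide_nonneg_nonneg) (auto intro!: power_mono)
    have "Re (h u) \<le> L t"
      using Reh[of u] k_circ[OF u] u by (simp add: L_def u_def)
    then have "Re (h u) * K t \<le> L t * K t"
      using K0 by (intro mult_right_mono)
    also have "\<dots> \<le> L t * c"
      using K by (intro mult_left_mono) (auto simp: L_def)
    finally show "Re (h (of_real R * cis t)) * K t \<le> c * L t"
      by (simp add: u_def mult.commute)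
  qed
  then have "Re (h w) \<le> c * (1 / (2 * pi) * integral {0..2 * pi} L)"
    by (simp add: field_simps)
  moreover have "ln (norm (F w)) \<le> Re (h w)"
    using F_le_k Fw Reh[of w] w by (simp add: ln_mono)
  ultimately show ?thesis
    unfolding c_def L_def by linarith
qed

section \<open>Order of growth of functions with finitely many poles\<close>

lemma poly_growth:
  fixes q :: "complex poly"
  shows "\<exists>B\<ge>1. \<exists>N. \<forall>z. 1 \<le> norm z \<longrightarrow> norm (poly q z) \<le> B * norm z ^ N"
proof -
  define B where "B = 1 + (\<Sum>i\<le>degree q. norm (coeff q i))"
  have "norm (poly q z) \<le> B * norm z ^ degree q" if z: "1 \<le> norm z" for z
  proof -
    have "norm (poly q z) \<le> (\<Sum>i\<le>degree q. norm (coeff q i * z ^ i))"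
      unfolding poly_altdef by (rule norm_sum)
    also have "\<dots> \<le> (\<Sum>i\<le>degree q. norm (coeff q i) * norm z ^ degree q)"
      using z by (intro sum_mono) (auto simp: norm_mult norm_power intro!: mult_left_mono power_increasing)
    also have "\<dots> = (B - 1) * norm z ^ degree q"
      by (simp add: B_def sum_distrib_right)
    also have "\<dots> \<le> B * norm z ^ degree q"
      by (intro mult_right_mono) auto
    finally show ?thesis .
  qed
  moreover have "B \<ge> 1"
    by (simp add: B_def sum_nonneg)
  ultimately show ?thesis
    by blast
qed

lemma poly_lower_bound_eventually:
  fixes q :: "complex poly"
  assumes "q \<noteq> 0"
  shows "\<exists>c>0. \<exists>r0\<ge>1. \<forall>z. r0 \<le> norm z \<longrightarrow> c \<le> norm (poly q z)"
proof (cases "degree q = 0")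
  case True
  then obtain a where a: "q = [:a:]"
    by (rule degree_eq_zeroE)
  then show ?thesis
    using assms by (intro exI[of _ "norm a"] conjI exI[of _ 1]) auto
next
  case False
  have "filterlim (poly q) at_infinity at_infinity"
    using False by (intro filterlim_poly_at_infinity) auto
  then have "eventually (\<lambda>z. 1 \<le> norm (poly q z)) at_infinity"
    by (auto simp: filterlim_at_infinity[of 0])
  then obtain r where "\<And>z. r \<le> norm z \<Longrightarrow> 1 \<le> norm (poly q z)"
    by (auto simp: eventually_at_infinity)
  then show ?thesis
    by (intro exI[of _ 1] conjI exI[of _ "max r 1"]) auto
qed

lemma M1_D:
  assumes "f \<in> M1"
  shows "f meromorphic_on UNIV" "finite {z. is_pole f z}" "\<not> is_pole f z \<Longrightarrow> f analytic_on {z}"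
    "is_pole f z \<Longrightarrow> f z = 0"
proof -
  have n: "f nicely_meromorphic_on UNIV" and "finite {z. is_pole f z}"
    using assms by (auto simp: M1_def)
  then show "f meromorphic_on UNIV" "finite {z. is_pole f z}"
    by (auto simp: nicely_meromorphic_on_def)
  show "f analytic_on {z}" if "\<not> is_pole f z"
    using nicely_meromorphic_on_imp_analytic_at[OF n _ that] by simp
  show "f z = 0" if "is_pole f z"
    using n that unfolding nicely_meromorphic_on_def
    by (metis UNIV_I is_pole_def not_tendsto_and_filterlim_at_infinity at_neq_bot)
qed

lemma pole_count_M1:
  assumes "f \<in> M1"
  shows "real (pole_count f t) = (\<Sum>a | is_pole f a. if norm a \<le> t then real (nat (- zorder f a)) else 0)"
proof -
  have "finite {z. is_pole f z}"
    by (rule M1_D[OF assms])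
  then have "(\<Sum>a | is_pole f a. if norm a \<le> t then real (nat (- zorder f a)) else 0)
     = (\<Sum>a\<in>{a. is_pole f a} \<inter> {a. norm a \<le> t}. real (nat (- zorder f a)))"
    by (simp add: sum.inter_restrict)
  also have "{a. is_pole f a} \<inter> {a. norm a \<le> t} = {z. z \<in> cball 0 t \<and> is_pole f z}"
    by auto
  finally show ?thesis
    by (simp add: pole_count_def)
qed

text \<open>Beyond the last of the finitely many poles the integrand of the counting function is a constant
divided by \<open>t\<close>.\<close>

lemma pole_counting_eq:
  assumes f: "f \<in> M1"
  shows "\<exists>c0 r0. r0 \<ge> 1 \<and> (\<forall>r\<ge>r0. pole_counting f r
            = c0 + (\<Sum>a | is_pole f a. real (nat (- zorder f a))) * ln r)"
proof -
  define A where "A = {a. is_pole f a}"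
  define m where "m = (\<lambda>a. real (nat (- zorder f a)))"
  have fin: "finite A"
    using M1_D[OF f] by (simp add: A_def)
  define r0 where "r0 = Max (insert 1 (norm ` A))"
  have r0: "r0 \<ge> 1" "\<And>a. a \<in> A \<Longrightarrow> norm a \<le> r0"
    using fin by (auto simp: r0_def)
  define A' where "A' = A - {0}"
  define c0 where "c0 = - (\<Sum>a\<in>A'. m a * ln (norm a))"
  have "pole_counting f r = c0 + (\<Sum>a\<in>A. m a) * ln r" if r: "r \<ge> r0" for r
  proof -
    have pc: "real (pole_count f t) = (\<Sum>a\<in>A. if norm a \<le> t then m a else 0)" for t
      unfolding A_def m_def by (rule pole_count_M1[OF f])
    have pc0: "real (pole_count f 0) = (\<Sum>a\<in>A - A'. m a)"
      unfolding pc using fin by (intro sum.mono_neutral_cong_right) (auto simp: A'_def)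
    have diff: "(real (pole_count f t) - real (pole_count f 0)) / t
        = (\<Sum>a\<in>A'. if t \<in> {norm a..r} then m a / t else 0)" if t: "t \<in> {0..r}" for t
    proof -
      have "real (pole_count f t) = (\<Sum>a\<in>A'. if norm a \<le> t then m a else 0)
          + (\<Sum>a\<in>A - A'. if norm a \<le> t then m a else 0)"
        unfolding pc using fin by (subst sum.subset_diff[of A' A]) (auto simp: A'_def)
      also have "(\<Sum>a\<in>A - A'. if norm a \<le> t then m a else 0) = (\<Sum>a\<in>A - A'. m a)"
        using t by (intro sum.cong) (auto simp: A'_def)
      finally have "real (pole_count f t) - real (pole_count f 0) = (\<Sum>a\<in>A'. if norm a \<le> t then m a else 0)"
        by (simp add: pc0)
      then show ?thesis
        using t by (auto simp: sum_divide_distrib intro!: sum.cong)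
    qed
    have "((\<lambda>t. if t \<in> {norm a..r} then m a / t else 0) has_integral m a * (ln r - ln (norm a))) {0..r}"
      if a: "a \<in> A'" for a
    proof -
      have a0: "norm a > 0" "norm a \<le> r"
        using a r0(2)[of a] r by (auto simp: A'_def)
      have "((\<lambda>t. m a / t) has_integral m a * ln r - m a * ln (norm a)) {norm a..r}"
      proof (rule fundamental_theorem_of_calculus)
        fix x assume "x \<in> {norm a..r}"
        then have "norm a \<le> x"
          by simp
        then have "x > 0"
          using a0(1) by linarith
        then show "((\<lambda>t. m a * ln t) has_vector_derivative m a / x) (at x within {norm a..r})"
          by (auto intro!: derivative_eq_intros
              simp: has_real_derivative_iff_has_vector_derivative[symmetric])
      qed (use a0 in auto)
      then show ?thesis
        by (subst has_integral_restrict) (auto simp: algebra_simps)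
    qed
    then have "((\<lambda>t. \<Sum>a\<in>A'. if t \<in> {norm a..r} then m a / t else 0) has_integral
        (\<Sum>a\<in>A'. m a * (ln r - ln (norm a)))) {0..r}"
      using fin by (intro has_integral_sum) (auto simp: A'_def)
    then have "((\<lambda>t. (real (pole_count f t) - real (pole_count f 0)) / t) has_integral
        (\<Sum>a\<in>A'. m a * (ln r - ln (norm a)))) {0..r}"
      by (rule has_integral_eq[rotated]) (simp only: diff)
    then have "pole_counting f r = (\<Sum>a\<in>A'. m a * (ln r - ln (norm a))) + (\<Sum>a\<in>A - A'. m a) * ln r"
      unfolding pole_counting_def by (simp add: integral_unique pc0)
    also have "\<dots> = c0 + ((\<Sum>a\<in>A'. m a) + (\<Sum>a\<in>A - A'. m a)) * ln r"
      by (simp add: c0_def right_diff_distrib sum_subtractf sum_distrib_right distrib_right)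
    also have "(\<Sum>a\<in>A'. m a) + (\<Sum>a\<in>A - A'. m a) = (\<Sum>a\<in>A. m a)"
      using fin by (subst sum.subset_diff[of A' A]) (auto simp: A'_def)
    finally show ?thesis .
  qed
  then show ?thesis
    using r0(1) unfolding A_def m_def by blast
qed

lemma pole_counting_nonneg:
  assumes f: "f \<in> M1" and r: "r \<ge> 1"
  shows "pole_counting f r \<ge> 0"
proof -
  have "real (pole_count f t) - real (pole_count f 0) \<ge> 0" if t: "t \<ge> 0" for t
  proof -
    have "real (pole_count f 0) \<le> real (pole_count f t)"
      unfolding pole_count_M1[OF f] using t by (intro sum_mono) auto
    then show ?thesis
      by simp
  qed
  then have "integral {0..r} (\<lambda>t. (real (pole_count f t) - real (pole_count f 0)) / t) \<ge> 0"
    by (cases "(\<lambda>t. (real (pole_count f t) - real (pole_count f 0)) / t) integrable_on {0..r}")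
       (auto intro!: integral_nonneg simp: not_integrable_integral)
  moreover have "real (pole_count f 0) * ln r \<ge> 0"
    using r by simp
  ultimately show ?thesis
    unfolding pole_counting_def by linarith
qed

lemma max_0_ln: "0 \<le> x \<Longrightarrow> max 0 (ln x) = ln (max 1 x)" for x :: real
  by (cases "x = 0"; cases "x \<le> 1") (auto simp: max_def)

lemma proximity_nonneg: "proximity f r \<ge> 0"
proof -
  have "integral {0..2 * pi} (\<lambda>t. max 0 (ln (cmod (f (complex_of_real r * cis t))))) \<ge> 0"
    by (cases "(\<lambda>t. max 0 (ln (cmod (f (complex_of_real r * cis t))))) integrable_on {0..2 * pi}")
       (auto intro!: integral_nonneg simp: not_integrable_integral)
  then show ?thesis
    by (simp add: proximity_def)
qed

lemma nevanlinna_T_nonneg: "f \<in> M1 \<Longrightarrow> r \<ge> 1 \<Longrightarrow> nevanlinna_T f r \<ge> 0"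
  using proximity_nonneg pole_counting_nonneg by (simp add: nevanlinna_T_def)

lemma continuous_on_ln_plus_circle:
  assumes "\<And>t. f analytic_on {complex_of_real r * cis t}"
  shows "continuous_on S (\<lambda>t. max 0 (ln (cmod (f (of_real r * cis t)))))"
proof -
  have "continuous_on (range (\<lambda>t. of_real r * cis t)) f"
    using analytic_at_imp_isCont[OF assms] by (intro continuous_at_imp_continuous_on) auto
  then have "continuous_on S (\<lambda>t. f (of_real r * cis t))"
    by (rule continuous_on_compose2) (auto intro!: continuous_intros)
  then have "continuous_on S (\<lambda>t. ln (max 1 (cmod (f (of_real r * cis t)))))"
    by (intro continuous_intros) auto
  then show ?thesis
    by (simp add: max_0_ln)
qed

text \<open>Poisson--Jensen on a circle of radius \<open>R\<close> between \<open>2s\<close> and \<open>3s\<close> that avoids the zeros of \<open>E\<close>; there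
\<open>(R + |w|)/(R - |w|)\<close> is at most \<open>3\<close>.\<close>

lemma ln_cleared_le_proximity:
  assumes f: "f \<in> M1" and E: "E holomorphic_on UNIV"
    and clear: "\<And>z. \<not> is_pole f z \<Longrightarrow> f z * poly q z = E z"
    and q: "\<And>z. 1 \<le> norm z \<Longrightarrow> norm (poly q z) \<le> B * norm z ^ N" and B: "B \<ge> 1"
  shows "\<exists>r0\<ge>1. \<forall>w s. r0 \<le> s \<longrightarrow> norm w \<le> s \<longrightarrow> E w \<noteq> 0 \<longrightarrow>
     (\<exists>R. 2 * s \<le> R \<and> R \<le> 3 * s \<and> ln (norm (E w)) \<le> 3 * (proximity f R + ln B + N * ln R))"
proof -
  define r0 where "r0 = Max (insert 1 (norm ` {a. is_pole f a}))"
  have r0: "r0 \<ge> 1" "\<And>a. is_pole f a \<Longrightarrow> norm a \<le> r0"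
    using M1_D[OF f] by (auto simp: r0_def)
  have "\<exists>R. 2 * s \<le> R \<and> R \<le> 3 * s \<and> ln (norm (E w)) \<le> 3 * (proximity f R + ln B + N * ln R)"
    if s: "r0 \<le> s" "norm w \<le> s" and w: "E w \<noteq> 0" for w s
  proof -
    have s1: "s \<ge> 1"
      using s r0 by linarith
    define Z where "Z = norm ` {z \<in> cball 0 (3 * s). E z = 0}"
    have "finite {z \<in> cball 0 (3 * s). E z = 0}"
    proof (cases "E constant_on UNIV")
      case True
      then obtain y where "\<And>z. E z = y"
        unfolding constant_on_def by blast
      then have "{z \<in> cball 0 (3 * s). E z = 0} = {}"
        using w by auto
      then show ?thesis
        by (simp only: finite.emptyI)
    next
      case False
      show ?thesis
        by (rule holomorphic_compact_finite_zeros[OF E open_UNIV connected_UNIV compact_cball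
              subset_UNIV False])
    qed
    then have finZ: "finite Z"
      by (simp add: Z_def)
    have "2 * s < 3 * s"
      using s1 by simp
    from exists_radius_far_from_finite_set[OF finZ this] obtain R where
      R: "2 * s \<le> R" "R \<le> 3 * s" "\<forall>x\<in>Z. (3 * s - 2 * s) / (2 * (real (card Z) + 1)) \<le> \<bar>R - x\<bar>"
      by (elim exE conjE)
    have RZ: "R \<notin> Z"
    proof
      assume "R \<in> Z"
      then have "(3 * s - 2 * s) / (2 * (real (card Z) + 1)) \<le> 0"
        using R(3) by fastforce
      moreover have "(3 * s - 2 * s) / (2 * (real (card Z) + 1)) > 0"
        using s1 by (intro divide_pos_pos) auto
      ultimately show False
        by linarith
    qed
    have circ: "E z \<noteq> 0" if "norm z = R" for z
    proof
      assume "E z = 0"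
      then have "R \<in> Z"
        unfolding Z_def using that R by force
      then show False
        using RZ by contradiction
    qed
    have Rw: "norm w < R" and R1: "R \<ge> 1"
      using s s1 R by auto
    define m where "m = (\<lambda>g :: complex \<Rightarrow> complex. \<lambda>t. max 0 (ln (cmod (g (of_real R * cis t)))))"
    have np: "\<not> is_pole f (of_real R * cis t)" for t
      using r0(2)[of "of_real R * cis t"] s s1 R by (auto simp: norm_mult)
    have contf: "continuous_on {0..2 * pi} (m f)"
      unfolding m_def by (intro continuous_on_ln_plus_circle M1_D(3)[OF f np])
    have contE: "continuous_on {0..2 * pi} (m E)"
      unfolding m_def by (intro continuous_on_ln_plus_circle holomorphic_on_imp_analytic_at[OF E]) auto
    have le: "m E t \<le> m f t + (ln B + N * ln R)" for t
    proof -
      define z where "z = of_real R * cis t"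
      have z: "norm z = R"
        using R1 by (simp add: z_def norm_mult)
      have Ez: "E z = f z * poly q z"
        using clear[OF np] by (simp add: z_def)
      then have nz: "f z \<noteq> 0" "poly q z \<noteq> 0"
        using circ[OF z] by auto
      have "ln (norm (poly q z)) \<le> ln (B * R ^ N)"
        using q[of z] z R1 nz by (intro ln_mono) auto
      also have "\<dots> = ln B + N * ln R"
        using B R1 by (simp add: ln_mult ln_realpow)
      finally have "ln (norm (E z)) \<le> ln (norm (f z)) + (ln B + N * ln R)"
        using nz by (simp add: Ez norm_mult ln_mult)
      moreover have "ln B + N * ln R \<ge> 0"
        using B R1 by simp
      ultimately show ?thesis
        by (simp add: m_def z_def)
    qed
    have "integral {0..2 * pi} (m E) \<le> integral {0..2 * pi} (\<lambda>t. m f t + (ln B + N * ln R))"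
      using contf contE le by (intro integral_le integrable_continuous_real continuous_intros) auto
    also have "\<dots> = integral {0..2 * pi} (m f) + 2 * pi * (ln B + N * ln R)"
      using contf by (subst integral_add) (auto intro!: integrable_continuous_real)
    finally have le': "integral {0..2 * pi} (m E) \<le> integral {0..2 * pi} (m f) + 2 * pi * (ln B + N * ln R)" .
    then have I: "1 / (2 * pi) * integral {0..2 * pi} (m E) \<le> proximity f R + (ln B + N * ln R)"
    proof -
      have "proximity f R = 1 / (2 * pi) * integral {0..2 * pi} (m f)"
        by (simp only: proximity_def m_def)
      then show ?thesis
        using le' by (simp add: field_simps)
    qed
    have "ln (norm (E w)) \<le> (R + norm w) / (R - norm w) * (1 / (2 * pi) * integral {0..2 * pi} (m E))"
      unfolding m_def by (rule ln_norm_le_mean_ln_plus[OF E Rw w circ])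
    also have "\<dots> \<le> 3 * (proximity f R + (ln B + N * ln R))"
    proof (intro mult_mono)
      show "(R + norm w) / (R - norm w) \<le> 3"
        using Rw R s by (simp add: pos_divide_le_eq)
      have "integral {0..2 * pi} (m E) \<ge> 0"
        using contE by (intro integral_nonneg integrable_continuous_real) (auto simp: m_def)
      then show "0 \<le> 1 / (2 * pi) * integral {0..2 * pi} (m E)"
        by simp
    qed (use I in auto)
    finally show ?thesis
      using R by (intro exI[of _ R]) simp
  qed
  then show ?thesis
    using r0(1) by blast
qed

text \<open>The Nevanlinna characteristic bounds the proximity function, which in turn bounds the logarithm of the
maximum modulus of the entire numerator at a comparable radius.\<close>

lemma growth_of_order_less:
  assumes f: "f \<in> M1" and ord: "nevanlinna_order f < ereal \<sigma>" and \<sigma>: "\<sigma> > 0"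
    and E: "E holomorphic_on UNIV" and clear: "\<And>z. \<not> is_pole f z \<Longrightarrow> f z * poly q z = E z"
  shows "\<exists>C\<ge>0. \<exists>r0\<ge>1. \<forall>z. r0 \<le> norm z \<longrightarrow> norm (E z) \<le> exp (C * norm z powr \<sigma>)"
proof -
  have "eventually (\<lambda>r. ereal (ln (nevanlinna_T f r) / ln r) < ereal \<sigma>) at_top"
    using ord unfolding nevanlinna_order_def by (rule Limsup_lessD)
  then obtain r1 where r1: "\<And>r. r \<ge> r1 \<Longrightarrow> ln (nevanlinna_T f r) / ln r < \<sigma>"
    by (auto simp: eventually_at_top_linorder)
  have T: "nevanlinna_T f r \<le> r powr \<sigma>" if r: "r \<ge> r1" "r > 1" for r
  proof (cases "nevanlinna_T f r > 0")
    case True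
    have "ln (nevanlinna_T f r) \<le> \<sigma> * ln r"
      using r1[OF r(1)] r(2) by (simp add: divide_less_eq)
    then have "exp (ln (nevanlinna_T f r)) \<le> exp (\<sigma> * ln r)"
      by (simp only: exp_le_cancel_iff)
    then show ?thesis
      using True r(2) by (simp add: powr_def)
  next
    case False
    then show ?thesis
      by (meson not_less order_trans powr_ge_zero)
  qed
  obtain B N where B: "B \<ge> 1" and q: "\<And>z. 1 \<le> norm z \<Longrightarrow> norm (poly q z) \<le> B * norm z ^ N"
    using poly_growth[of q] by blast
  obtain r2 where r2: "r2 \<ge> 1" and main: "\<And>w s. r2 \<le> s \<Longrightarrow> norm w \<le> s \<Longrightarrow> E w \<noteq> 0 \<Longrightarrow>
     \<exists>R. 2 * s \<le> R \<and> R \<le> 3 * s \<and> ln (norm (E w)) \<le> 3 * (proximity f R + ln B + N * ln R)"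
    using ln_cleared_le_proximity[OF f E clear q B] by blast
  define C where "C = 3 * (1 + N / \<sigma>) * 3 powr \<sigma> + 3 * ln B"
  define r0 where "r0 = max r1 (max r2 2)"
  have C: "C \<ge> 0"
    using B \<sigma> by (auto simp: C_def)
  have "norm (E z) \<le> exp (C * norm z powr \<sigma>)" if z: "r0 \<le> norm z" for z
  proof (cases "E z = 0")
    case False
    define s where "s = norm z"
    have s: "s \<ge> r1" "s \<ge> r2" "s \<ge> 2"
      using z by (auto simp: s_def r0_def)
    obtain R where R: "2 * s \<le> R" "R \<le> 3 * s" "ln (norm (E z)) \<le> 3 * (proximity f R + ln B + N * ln R)"
      using main[of s z] s False by (auto simp: s_def)
    have "proximity f R \<le> nevanlinna_T f R"
      using pole_counting_nonneg[OF f, of R] R s by (simp add: nevanlinna_T_def)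
    also have "\<dots> \<le> R powr \<sigma>"
      using R s by (intro T) auto
    finally have 1: "proximity f R \<le> R powr \<sigma>" .
    have "ln R \<le> R powr \<sigma> / \<sigma>"
      using R s \<sigma> by (intro ln_powr_bound) auto
    then have 2: "N * ln R \<le> N * (R powr \<sigma> / \<sigma>)"
      by (intro mult_left_mono) auto
    have 3: "R powr \<sigma> \<le> 3 powr \<sigma> * s powr \<sigma>"
      using R s \<sigma> by (subst powr_mult[symmetric]) (auto intro!: powr_mono2)
    have 4: "ln B * 1 \<le> ln B * s powr \<sigma>"
      using B s \<sigma> by (intro mult_left_mono) (auto intro!: ge_one_powr_ge_zero)
    have "proximity f R + ln B + N * ln R \<le> R powr \<sigma> + ln B + N * (R powr \<sigma> / \<sigma>)"
      using 1 2 by (intro add_mono) auto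
    then have "ln (norm (E z)) \<le> 3 * (R powr \<sigma> + ln B + N * (R powr \<sigma> / \<sigma>))"
      by (intro order_trans[OF R(3)] mult_left_mono) auto
    also have "\<dots> = 3 * ((1 + N / \<sigma>) * R powr \<sigma> + ln B)"
      by (simp add: algebra_simps)
    also have "\<dots> \<le> 3 * ((1 + N / \<sigma>) * (3 powr \<sigma> * s powr \<sigma>) + ln B * s powr \<sigma>)"
      using 3 4 \<sigma> by (intro mult_left_mono add_mono) auto
    also have "\<dots> = C * s powr \<sigma>"
      by (simp add: C_def algebra_simps)
    finally have "exp (ln (norm (E z))) \<le> exp (C * s powr \<sigma>)"
      by (simp only: exp_le_cancel_iff)
    then show ?thesis
      using False by (simp add: s_def)
  qed auto
  then show ?thesis
    using C r2 by (intro exI[of _ C] conjI exI[of _ r0]) (auto simp: r0_def)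
qed

text \<open>The counting function is of logarithmic growth, and powers of \<open>ln |z|\<close> do not affect the order.\<close>

lemma order_le_of_growth:
  assumes f: "f \<in> M1" and d: "d \<ge> 0" and C: "C \<ge> 0"
    and bd: "\<And>z. r0 \<le> norm z \<Longrightarrow> ln (norm (f z)) \<le> C * norm z powr d * ln (norm z) ^ K"
  shows "nevanlinna_order f \<le> ereal d"
proof -
  obtain c0 r1 where r1: "r1 \<ge> 1" "\<And>r. r \<ge> r1 \<Longrightarrow> pole_counting f r
            = c0 + (\<Sum>a | is_pole f a. real (nat (- zorder f a))) * ln r"
    using pole_counting_eq[OF f] by blast
  define N where "N = (\<Sum>a | is_pole f a. real (nat (- zorder f a)))"
  have N: "N \<ge> 0"
    by (simp add: N_def sum_nonneg)
  define D where "D = 1 + C + \<bar>c0\<bar> + N"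
  have D: "D \<ge> 1"
    using C N by (simp add: D_def)
  define r2 where "r2 = max (max r0 r1) (exp 1)"
  define h where "h = (\<lambda>r. (ln D + d * ln r + real (Suc K) * ln (ln r)) / ln r)"
  have T_le: "ln (nevanlinna_T f r) / ln r \<le> h r" if r: "r \<ge> r2" for r
  proof -
    have re: "r \<ge> exp 1" "r \<ge> r0" "r \<ge> r1"
      using r by (auto simp: r2_def)
    have "1 \<le> exp (1::real)"
      by simp
    then have r0': "r > 0" "r \<ge> 1"
      using re(1) by linarith+
    have lr: "ln r \<ge> 1"
      using re(1) r0' by (metis exp_gt_zero ln_exp ln_mono)
    have rd: "r powr d \<ge> 1"
      using r0' d by (intro ge_one_powr_ge_zero) auto
    have "proximity f r \<le> C * r powr d * ln r ^ K"
    proof -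
      have "integral {0..2 * pi} (\<lambda>t. max 0 (ln (cmod (f (of_real r * cis t)))))
         \<le> integral {0..2 * pi} (\<lambda>t. C * r powr d * ln r ^ K)"
      proof (cases "(\<lambda>t. max 0 (ln (cmod (f (complex_of_real r * cis t))))) integrable_on {0..2 * pi}")
        case True
        show ?thesis
        proof (rule integral_le[OF True])
          fix t
          have "norm (complex_of_real r * cis t) = r"
            using r0' by (simp add: norm_mult)
          then show "max 0 (ln (cmod (f (of_real r * cis t)))) \<le> C * r powr d * ln r ^ K"
            using bd[of "of_real r * cis t"] re C lr by simp
        qed auto
      qed (use C lr in \<open>auto simp: not_integrable_integral\<close>)
      then show ?thesis
        by (simp add: proximity_def field_simps)
    qed
    also have "\<dots> \<le> C * r powr d * ln r ^ Suc K"
      using C lr by (intro mult_left_mono power_increasing) auto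
    finally have 1: "proximity f r \<le> C * (r powr d * ln r ^ Suc K)"
      by (simp add: mult.assoc)
    have lK: "ln r ^ Suc K \<ge> ln r" "ln r ^ Suc K \<ge> 1"
      using lr power_increasing[of 1 "Suc K" "ln r"] one_le_power[OF lr, of "Suc K"]
      by (auto simp del: power_Suc)
    have big: "r powr d * ln r ^ Suc K \<ge> ln r" "r powr d * ln r ^ Suc K \<ge> 1"
      using mult_mono[of 1 "r powr d" "ln r" "ln r ^ Suc K"] mult_mono[of 1 "r powr d" 1 "ln r ^ Suc K"]
        rd lK lr by auto
    have "pole_counting f r \<le> \<bar>c0\<bar> * 1 + N * ln r"
      using r1(2)[OF re(3)] by (simp add: N_def)
    also have "\<dots> \<le> \<bar>c0\<bar> * (r powr d * ln r ^ Suc K) + N * (r powr d * ln r ^ Suc K)"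
      using big N by (intro add_mono mult_left_mono) auto
    finally have "nevanlinna_T f r \<le> (C + \<bar>c0\<bar> + N) * (r powr d * ln r ^ Suc K)"
      using 1 by (simp add: nevanlinna_T_def algebra_simps)
    also have "\<dots> \<le> D * (r powr d * ln r ^ Suc K)"
      using big by (intro mult_right_mono) (auto simp: D_def)
    finally have T: "nevanlinna_T f r \<le> D * (r powr d * ln r ^ Suc K)" .
    have "r \<noteq> 1"
      using lr by auto
    then have l: "ln (D * (r powr d * ln r ^ Suc K)) = ln D + d * ln r + real (Suc K) * ln (ln r)"
      using D r0' lr by (simp add: ln_mult ln_powr ln_realpow del: power_Suc)
    have "ln (nevanlinna_T f r) \<le> ln D + d * ln r + real (Suc K) * ln (ln r)"
    proof (cases "nevanlinna_T f r > 0")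
      case True
      then have "ln (nevanlinna_T f r) \<le> ln (D * (r powr d * ln r ^ Suc K))"
        using T by (intro ln_mono) auto
      then show ?thesis
        by (simp only: l)
    next
      case False
      then have "nevanlinna_T f r = 0"
        using nevanlinna_T_nonneg[OF f r0'(2)] by simp
      then show ?thesis
        using D d lr by simp
    qed
    then show ?thesis
      unfolding h_def using lr by (intro divide_right_mono) auto
  qed
  have h_lim: "(h \<longlongrightarrow> d) at_top"
    unfolding h_def by real_asymp
  have "nevanlinna_order f \<le> Limsup at_top (\<lambda>r. ereal (h r))"
    unfolding nevanlinna_order_def
    using T_le by (intro Limsup_mono eventually_at_top_linorderI[of r2]) auto
  also have "\<dots> = ereal d"
    using h_lim by (intro lim_imp_Limsup tendsto_ereal) auto
  finally show ?thesis .
qed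

text \<open>A negative order would make the characteristic tend to \<open>0\<close>; then there are no poles, and \<open>|f| \<le> 1\<close>
everywhere, so that the characteristic is identically \<open>0\<close>. But \<open>ln 0 = 0\<close> by convention, so the order
of such a function is \<open>0\<close>.\<close>

lemma order_nonneg:
  assumes f: "f \<in> M1"
  shows "nevanlinna_order f \<ge> 0"
proof (rule ccontr)
  assume "\<not> nevanlinna_order f \<ge> 0"
  then have "nevanlinna_order f < 0"
    by simp
  then obtain \<sigma> where \<sigma>: "nevanlinna_order f < ereal \<sigma>" "ereal \<sigma> < 0"
    using ereal_dense2 by blast
  then have \<sigma>0: "\<sigma> < 0"
    by simp
  have "eventually (\<lambda>r. ereal (ln (nevanlinna_T f r) / ln r) < ereal \<sigma>) at_top"
    using \<sigma>(1) unfolding nevanlinna_order_def by (rule Limsup_lessD)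
  then obtain r1 where r1: "\<And>r. r \<ge> r1 \<Longrightarrow> ln (nevanlinna_T f r) / ln r < \<sigma>"
    by (auto simp: eventually_at_top_linorder)
  have T: "nevanlinna_T f r > 0" "nevanlinna_T f r \<le> r powr \<sigma>" if r: "r \<ge> r1" "r > 1" for r
  proof -
    have "nevanlinna_T f r \<noteq> 0"
      using r1[OF r(1)] \<sigma>0 by auto
    then show pos: "nevanlinna_T f r > 0"
      using nevanlinna_T_nonneg[OF f, of r] r by simp
    have "ln (nevanlinna_T f r) \<le> \<sigma> * ln r"
      using r1[OF r(1)] r(2) by (simp add: divide_less_eq)
    then have "exp (ln (nevanlinna_T f r)) \<le> exp (\<sigma> * ln r)"
      by (simp only: exp_le_cancel_iff)
    then show "nevanlinna_T f r \<le> r powr \<sigma>"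
      using pos r(2) by (simp add: powr_def)
  qed
  have T1: "nevanlinna_T f r \<le> 1" if r: "r \<ge> r1" "r > 1" for r
    using T(2)[OF r] powr_mono[of \<sigma> 0 r] r \<sigma>0 by auto
  have no_pole: "\<not> is_pole f a" for a
  proof
    assume a: "is_pole f a"
    obtain c0 r2 where r2: "r2 \<ge> 1" "\<And>r. r \<ge> r2 \<Longrightarrow> pole_counting f r
            = c0 + (\<Sum>a | is_pole f a. real (nat (- zorder f a))) * ln r"
      using pole_counting_eq[OF f] by blast
    have "zorder f a < 0"
      using a M1_D(1)[OF f] meromorphic_at_iff meromorphic_on_subset[of f UNIV "{a}"]
      by (intro isolated_pole_imp_neg_zorder) auto
    then have "1 \<le> real (nat (- zorder f a))"
      by linarith
    also have "\<dots> \<le> (\<Sum>a | is_pole f a. real (nat (- zorder f a)))"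
      using M1_D(2)[OF f] a by (intro member_le_sum) auto
    finally have N: "(\<Sum>a | is_pole f a. real (nat (- zorder f a))) \<ge> 1" .
    define r where "r = max (max r1 r2) (exp (2 + \<bar>c0\<bar>))"
    have r: "r \<ge> r1" "r \<ge> r2" "r \<ge> exp (2 + \<bar>c0\<bar>)"
      by (auto simp: r_def)
    have r_gt: "r > 1"
      using r(3) one_less_exp_iff[of "2 + \<bar>c0\<bar>"] by linarith
    have "2 + \<bar>c0\<bar> \<le> ln r"
      using r(3) by (metis exp_gt_zero ln_exp ln_mono)
    also have "\<dots> \<le> (\<Sum>a | is_pole f a. real (nat (- zorder f a))) * ln r"
      using N r_gt mult_right_mono[OF N, of "ln r"] by simp
    finally have "pole_counting f r \<ge> 2"
      using r2(2)[OF r(2)] by linarith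
    then show False
      using T1[OF r(1) r_gt] proximity_nonneg[of f r] by (simp add: nevanlinna_T_def)
  qed
  have hol: "f holomorphic_on UNIV"
    using M1_D(3)[OF f no_pole] by (meson analytic_imp_holomorphic analytic_on_analytic_at)
  obtain r2 where r2: "r2 \<ge> 1" and main: "\<And>w s. r2 \<le> s \<Longrightarrow> norm w \<le> s \<Longrightarrow> f w \<noteq> 0 \<Longrightarrow>
     \<exists>R. 2 * s \<le> R \<and> R \<le> 3 * s \<and> ln (norm (f w)) \<le> 3 * (proximity f R + ln 1 + real 0 * ln R)"
    using ln_cleared_le_proximity[OF f hol, of 1 1 0] by auto
  have small: "ln (norm (f w)) \<le> 0" for w
  proof (cases "f w = 0")
    case False
    have "ln (norm (f w)) \<le> 0 + e" if e: "e > 0" for e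
    proof -
      have "((\<lambda>s::real. 3 * s powr \<sigma>) \<longlongrightarrow> 0) at_top"
        using \<sigma>0 by real_asymp
      then have "eventually (\<lambda>s::real. 3 * s powr \<sigma> < e) at_top"
        using e by (rule order_tendstoD)
      then obtain s0 where s0: "\<And>s. s \<ge> s0 \<Longrightarrow> 3 * s powr \<sigma> < e"
        by (auto simp: eventually_at_top_linorder)
      define s where "s = max (max s0 r1) (max (norm w) (max r2 2))"
      have s: "s \<ge> s0" "s \<ge> r1" "s \<ge> norm w" "s \<ge> r2" "s \<ge> 2"
        by (auto simp: s_def)
      obtain R where R: "2 * s \<le> R" "ln (norm (f w)) \<le> 3 * proximity f R"
        using main[OF s(4,3) False] by auto
      have "proximity f R \<le> nevanlinna_T f R"
        using pole_counting_nonneg[OF f, of R] R s by (simp add: nevanlinna_T_def)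
      also have "\<dots> \<le> R powr \<sigma>"
        using R s by (intro T) auto
      finally show ?thesis
        using R s0[of R] s by simp
    qed
    then show ?thesis
      by (rule field_le_epsilon)
  qed auto
  define r where "r = max r1 2"
  have "proximity f r = 0"
    unfolding proximity_def using small by (simp add: max_absorb1)
  moreover have "pole_count f t = 0" for t
    by (simp add: pole_count_def no_pole)
  then have "pole_counting f r = 0"
    by (simp add: pole_counting_def)
  ultimately have "nevanlinna_T f r = 0"
    by (simp add: nevanlinna_T_def)
  then show False
    using T(1)[of r] by (auto simp: r_def less_max_iff_disj)
qed

section \<open>Growth lemmas\<close>

text \<open>A growth lemma of Borel type. If \<open>y s\<close> exceeds a power of \<open>ln s\<close>, then the inequality with
\<open>R = s (1 + y s powr (-1/4))\<close> is violated unless \<open>y R \<ge> 16 y s\<close>. Iterating, the steps shrink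
geometrically and the radii stay below \<open>2s\<close>, while \<open>y\<close> increases beyond all bounds.\<close>

lemma polylog_growth:
  fixes y :: "real \<Rightarrow> real"
  assumes mono: "\<And>r s. r \<le> s \<Longrightarrow> y r \<le> y s" and y1: "\<And>r. 1 \<le> y r" and C: "1 \<le> C" and s0: "1 \<le> s0"
    and ineq: "\<And>s R. s0 \<le> s \<Longrightarrow> s < R \<Longrightarrow> R \<le> 2 * s \<Longrightarrow>
       y s \<le> C * (1 + ln (y R) + ln (R / (R - s)) + ln R)\<^sup>2 * (R / (R - s))"
  shows "\<exists>K s1. \<forall>s\<ge>s1. y s \<le> K * (ln s) ^ 8"
proof -
  \<comment> \<open>threshold beyond which a slow logarithm is beaten\<close>
  have "eventually (\<lambda>t::real. 2 * C * (1 + ln (16 * t) + ln (2 * t powr (1/4)) + t powr (1/8))\<^sup>2 * t powr (1/4) < t) at_top"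
    by real_asymp
  then obtain t0 where t0: "\<And>t. t \<ge> t0 \<Longrightarrow>
     2 * C * (1 + ln (16 * t) + ln (2 * t powr (1/4)) + t powr (1/8))\<^sup>2 * t powr (1/4) < t"
    by (auto simp: eventually_at_top_linorder)
  define K0 where "K0 = max t0 256"
  have grow: "y (s * (1 + y s powr (-1/4))) \<ge> 16 * y s"
    if s: "s0 \<le> s" and big: "K0 \<le> y s" and ls: "ln (2 * s) ^ 8 \<le> y s" for s
  proof (rule ccontr)
    define t where "t = y s"
    define R where "R = s * (1 + t powr (-1/4))"
    assume "\<not> 16 * y s \<le> y (s * (1 + y s powr (-1/4)))"
    then have yR: "y R < 16 * t"
      by (simp add: R_def t_def)
    have t: "t \<ge> t0" "t \<ge> 256" "t \<ge> 1"
      using big by (auto simp: K0_def t_def)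
    have p: "0 < t powr (-1/4)" "t powr (-1/4) \<le> 1"
      using t powr_mono[of "-1/4" 0 t] by auto
    have s1: "s \<ge> 1"
      using s s0 by simp
    have R: "s < R" "R \<le> 2 * s"
      using p s1 by (auto simp: R_def)
    have "R / (R - s) = (1 + t powr (-1/4)) / t powr (-1/4)"
      using s1 p by (simp add: R_def field_simps)
    also have "\<dots> \<le> 2 / t powr (-1/4)"
      using p by (intro divide_right_mono) auto
    also have "\<dots> = 2 * t powr (1/4)"
      by (simp add: powr_minus_divide)
    finally have q: "R / (R - s) \<le> 2 * t powr (1/4)" .
    have q1: "R / (R - s) \<ge> 1"
      using R s1 by simp
    have "ln R \<le> ln (2 * s)"
      using R s1 by (intro ln_mono) auto
    also have "ln (2 * s) \<le> t powr (1/8)"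
    proof -
      have l: "ln (2 * s) \<ge> 0"
        using s1 by simp
      have "(t powr (1/8)) ^ 8 = t powr (1/8 * real 8)"
        using t by (subst powr_power) auto
      also have "\<dots> = t"
        using t by simp
      finally have "ln (2 * s) ^ 8 \<le> (t powr (1/8)) ^ 8"
        using ls by (simp only: t_def)
      then show ?thesis
        using power_mono_iff[of "ln (2 * s)" "t powr (1/8)" 8] l by simp
    qed
    finally have lR: "ln R \<le> t powr (1/8)" .
    have ly: "ln (y R) \<le> ln (16 * t)" "0 \<le> ln (y R)"
      using yR y1[of R] by (auto intro!: ln_mono)
    have lq: "ln (R / (R - s)) \<le> ln (2 * t powr (1/4))" "0 \<le> ln (R / (R - s))"
      using q q1 by (auto intro!: ln_mono simp del: ln_divide_pos)
    have lR0: "0 \<le> ln R"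
      using R s1 by simp
    have "t \<le> C * (1 + ln (y R) + ln (R / (R - s)) + ln R)\<^sup>2 * (R / (R - s))"
      using ineq[OF s R] by (simp add: t_def)
    also have "\<dots> \<le> C * (1 + ln (16 * t) + ln (2 * t powr (1/4)) + t powr (1/8))\<^sup>2 * (2 * t powr (1/4))"
      using q q1 ly lq lR lR0 C by (intro mult_mono power_mono) auto
    finally show False
      using t0[OF t(1)] by simp
  qed
  have bound: "y s \<le> K0 + (ln (4 * s)) ^ 8" if s: "s \<ge> s0" for s
  proof (rule ccontr)
    assume "\<not> y s \<le> K0 + (ln (4 * s)) ^ 8"
    then have y0: "K0 + (ln (4 * s)) ^ 8 < y s"
      by simp
    have s1: "s \<ge> 1"
      using s s0 by simp
    have l8: "ln (2 * x) ^ 8 \<le> ln (4 * s) ^ 8" if "s \<le> x" "x \<le> 2 * s" for x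
      using that s1 by (intro power_mono ln_mono) auto
    have K0: "K0 \<ge> 256"
      by (simp add: K0_def)
    define r where "r = rec_nat s (\<lambda>_ x. x * (1 + y x powr (-1/4)))"
    have r0: "r 0 = s" and rS: "r (Suc i) = r i * (1 + y (r i) powr (-1/4))" for i
      by (simp_all add: r_def)
    have half: "s * (2 - 1 / 2 ^ i) \<le> 2 * s" for i :: nat
      using s1 mult_left_mono[of "2 - 1 / 2 ^ i" 2 s] by (simp add: mult.commute)
    have inv: "s \<le> r i \<and> r i \<le> s * (2 - 1 / 2 ^ i) \<and> 16 ^ i * y s \<le> y (r i)" for i
    proof (induction i)
      case (Suc i)
      have "0 \<le> ln (4 * s) ^ 8"
        using s1 by simp
      then have ys: "y s \<ge> 256"
        using y0 K0 by linarith
      have y16: "16 ^ i * y s \<ge> y s"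
        using ys mult_right_mono[of 1 "16 ^ i" "y s"] by simp
      have ri: "r i \<le> 2 * s"
        using Suc half[of i] by linarith
      have "K0 \<le> y (r i)" "ln (2 * r i) ^ 8 \<le> y (r i)"
        using Suc y16 y0 l8[of "r i"] ri K0 \<open>0 \<le> ln (4 * s) ^ 8\<close> by linarith+
      then have g: "16 * y (r i) \<le> y (r (Suc i))"
        unfolding rS using Suc s by (intro grow) auto
      have "y (r i) powr (-1/4) \<le> (16 ^ i * 256) powr (-1/4)"
      proof (intro powr_mono2')
        have "(16 ^ i :: real) * 256 \<le> 16 ^ i * y s"
          using ys by (intro mult_left_mono) auto
        then show "16 ^ i * 256 \<le> y (r i)"
          using Suc by linarith
      qed auto
      also have "(16 ^ i * 256 :: real) = (4 * 2 ^ i) powr 4"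
      proof -
        have "(4 * 2 ^ i) powr 4 = ((4 * 2 ^ i) ^ 4 :: real)"
          by simp
        also have "\<dots> = 256 * (2 ^ 4) ^ i"
          unfolding power_mult_distrib power_mult[symmetric] by (simp add: mult.commute)
        finally show ?thesis
          by simp
      qed
      also have "((4 * 2 ^ i) powr 4) powr (-1/4) = (4 * 2 ^ i :: real) powr (4 * (-1/4))"
        by (rule powr_powr)
      also have "\<dots> = 1 / (4 * 2 ^ i)"
        by (simp add: powr_minus_divide)
      finally have step: "y (r i) powr (-1/4) \<le> 1 / (4 * 2 ^ i)" .
      have "r (Suc i) = r i + r i * y (r i) powr (-1/4)"
        by (simp add: rS algebra_simps)
      also have "\<dots> \<le> s * (2 - 1 / 2 ^ i) + (2 * s) * (1 / (4 * 2 ^ i))"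
        using Suc ri step s1 by (intro add_mono mult_mono) auto
      also have "\<dots> = s * (2 - 1 / 2 ^ Suc i)"
        by (simp add: field_simps)
      finally have "r (Suc i) \<le> s * (2 - 1 / 2 ^ Suc i)" .
      moreover have "s \<le> r (Suc i)"
      proof -
        have "r i * 1 \<le> r i * (1 + y (r i) powr (-1/4))"
          using Suc s1 by (intro mult_left_mono) auto
        then show ?thesis
          using Suc by (simp add: rS)
      qed
      moreover have "16 ^ Suc i * y s \<le> y (r (Suc i))"
        using g Suc by simp
      ultimately show ?case
        by blast
    qed (use s1 in \<open>auto simp: r0\<close>)
    obtain i where i: "y (2 * s) < 16 ^ i"
      using real_arch_pow[of 16 "y (2 * s)"] by auto
    have "r i \<le> 2 * s"
      using inv[of i] half[of i] by linarith
    then have "y (r i) \<le> y (2 * s)"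
      by (rule mono)
    moreover have "16 ^ i * 1 \<le> 16 ^ i * y s"
      using y1 by (intro mult_left_mono) auto
    ultimately show False
      using inv[of i] i by linarith
  qed
  have "eventually (\<lambda>s::real. K0 + (ln (4 * s)) ^ 8 \<le> 2 * ln s ^ 8) at_top"
    by real_asymp
  then obtain s1 where s1: "\<And>s. s \<ge> s1 \<Longrightarrow> K0 + (ln (4 * s)) ^ 8 \<le> 2 * ln s ^ 8"
    by (auto simp: eventually_at_top_linorder)
  have "y s \<le> 2 * ln s ^ 8" if "max s0 s1 \<le> s" for s
    using bound[of s] s1[of s] that by linarith
  then show ?thesis
    by blast
qed

text \<open>The entire function \<open>\<Psi>\<close> satisfies a bound for \<open>ln |\<Psi>| + v\<close> in terms of the logarithmic derivatives of
the members of \<open>FF\<close>, where \<open>v\<close> is a nonnegative function whose size on circles controls \<open>y\<close>. On a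
first good circle the bound shows that \<open>ln |\<Psi>|\<close> is at most of the order of the logarithm of \<open>y\<close>. Hence
the minimum modulus of \<open>\<Psi>\<close> is not too small on a second, smaller circle, and there the bound shows
that \<open>v\<close>, and with it \<open>y\<close>, is at most of the order of the squared logarithm of \<open>y\<close>.\<close>

lemma polylog_of_auxiliary:
  fixes y :: "real \<Rightarrow> real" and v :: "complex \<Rightarrow> real" and FF :: "(complex \<Rightarrow> complex) set"
  assumes mono: "\<And>r s. r \<le> s \<Longrightarrow> y r \<le> y s" and y1: "\<And>r. 1 \<le> y r" and yln: "\<And>r. 1 \<le> r \<Longrightarrow> ln r \<le> y r"
    and fin: "finite FF" and hol: "\<And>F. F \<in> FF \<Longrightarrow> F holomorphic_on UNIV"
    and nz: "\<And>F. F \<in> FF \<Longrightarrow> \<exists>z. F z \<noteq> 0"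
    and \<Psi>: "\<Psi> holomorphic_on UNIV" "\<Psi> z1 \<noteq> 0"
    and C: "1 \<le> C1" "1 \<le> C2" "1 \<le> C3"
    and FF_bound: "\<And>F s R z. F \<in> FF \<Longrightarrow> 1 \<le> s \<Longrightarrow> s < R \<Longrightarrow> norm z \<le> s \<Longrightarrow>
        norm (F z) \<le> exp (C1 * (y R * (R / (R - s))))"
    and aux: "\<And>z L. r0 \<le> norm z \<Longrightarrow> 1 \<le> L \<Longrightarrow> (\<And>F. F \<in> FF \<Longrightarrow> F z \<noteq> 0 \<and> norm (deriv F z / F z) \<le> L) \<Longrightarrow>
        \<Psi> z \<noteq> 0 \<Longrightarrow> ln (norm (\<Psi> z)) + v z \<le> C2 * (1 + ln (norm z) + ln L)"
    and v0: "\<And>z. 0 \<le> v z"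
    and vy: "\<And>s r V. r0 \<le> s \<Longrightarrow> s \<le> r \<Longrightarrow> (\<And>z. norm z = r \<Longrightarrow> v z \<le> V) \<Longrightarrow> y s \<le> C3 * (1 + ln r + V)"
  shows "\<exists>K s1. \<forall>s\<ge>s1. y s \<le> K * ln s ^ 8"
proof -
  obtain c1 where c1: "c1 \<ge> 1" and good1: "good_circles FF c1"
    using ex_good_circles[of FF] fin hol nz by auto
  obtain c2 where c2: "c2 \<ge> 1" and good2: "good_circles (insert \<Psi> FF) c2"
  proof -
    have "finite (insert \<Psi> FF)" "\<And>F. F \<in> insert \<Psi> FF \<Longrightarrow> F holomorphic_on UNIV"
      "\<And>F. F \<in> insert \<Psi> FF \<Longrightarrow> \<exists>z. F z \<noteq> 0"
      using fin hol nz \<Psi> by auto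
    from ex_good_circles[OF this] show ?thesis
      using that by auto
  qed
  define a1 where "a1 = ln c1 + 3 * ln (16 * C1)"
  define b1 where "b1 = C2 * (a1 + 8)"
  define e2 where "e2 = 4 * C1 + 4 * b1"
  define a2 where "a2 = ln (2 * e2)"
  define c3 where "c3 = C2 * (2 + ln c2 + 3 * (a2 + 2)) + 2 * c2 * b1 * (a2 + 3)"
  define C where "C = C3 * (2 + c3)"
  have a1: "a1 \<ge> 0"
    using c1 C by (simp add: a1_def)
  have b1: "b1 \<ge> 1"
    using mult_mono[of 1 C2 1 "a1 + 8"] C a1 by (simp add: b1_def)
  have e2: "e2 \<ge> 1"
    using b1 C by (simp add: e2_def)
  have a2: "a2 \<ge> 0"
    using e2 by (simp add: a2_def)
  have c3: "c3 \<ge> 0"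
    using C c2 a2 b1 by (simp add: c3_def)
  have ln_cube: "ln (c * w ^ 3) = ln c + 3 * ln w" if "1 \<le> c" "1 \<le> w" for c w :: real
    using that by (simp add: ln_mult ln_realpow)
  define s0 where "s0 = max r0 1"
  have "y s \<le> C * (1 + ln (y R) + ln (R / (R - s)) + ln R)\<^sup>2 * (R / (R - s))"
    if s: "s0 \<le> s" "s < R" "R \<le> 2 * s" for s R
  proof -
    define d where "d = R - s"
    define q where "q = R / d"
    define \<Lambda> where "\<Lambda> = 1 + ln (y R) + ln q + ln R"
    define X where "X = y R * q"
    have s1: "1 \<le> s" "r0 \<le> s" and R1: "R \<ge> 1" and d: "d > 0"
      using s by (auto simp: s0_def d_def)
    have q1: "q \<ge> 1"
      using s s1 by (simp add: q_def d_def)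
    have yR: "y R \<ge> 1"
      by (rule y1)
    have nn: "ln (y R) \<ge> 0" "ln q \<ge> 0" "ln R \<ge> 0"
      using yR q1 R1 by auto
    have \<Lambda>1: "\<Lambda> \<ge> 1" "\<Lambda> \<ge> ln R" "\<Lambda> \<ge> ln q" "\<Lambda> \<ge> ln (y R) + ln q"
      using nn by (auto simp: \<Lambda>_def)
    have X1: "X \<ge> 1" "X \<ge> y R" "X \<ge> q"
      using yR q1 mult_mono[of 1 "y R" 1 q] mult_left_mono[of 1 q "y R"] mult_right_mono[of 1 "y R" q]
      by (auto simp: X_def)
    have lnX: "ln X = ln (y R) + ln q"
      using yR q1 by (simp add: X_def ln_mult)
    have \<Lambda>X: "\<Lambda> \<le> 4 * X"
    proof -
      have "ln (y R) \<le> y R" "ln q \<le> q"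
        using yR q1 ln_le_minus_one[of "y R"] ln_le_minus_one[of q] by auto
      then show ?thesis
        using yln[OF R1] X1 by (simp add: \<Lambda>_def)
    qed
    have lnXq: "ln (c * X * q) \<le> ln c + 2 * \<Lambda>" if "c > 0" for c
    proof -
      have "ln (c * X * q) = ln c + ln X + ln q"
        using that X1 q1 by (simp add: ln_mult)
      then show ?thesis
        using \<Lambda>1 lnX by linarith
    qed
    \<comment> \<open>Three nested radii: the first circle lies between \<open>sb\<close> and \<open>R3\<close>, the second between \<open>s\<close> and \<open>sb\<close>.\<close>
    define sb where "sb = s + d / 2"
    define R3 where "R3 = s + 3 * d / 4"
    have pts: "s < sb" "sb < R3" "R3 < R" "R3 - sb = d / 4" "R - R3 = d / 4" "sb - s = d / 2"
      using d by (auto simp: sb_def R3_def d_def field_simps)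
    define Y1 where "Y1 = 4 * C1 * X"
    have Y1: "Y1 \<ge> 1"
      using C X1 mult_mono[of 1 C1 1 X] by (simp add: Y1_def)
    have FFb: "norm (F z) \<le> exp Y1" if "F \<in> FF" "norm z \<le> R3" for F z
    proof -
      have "1 \<le> R3"
        using pts s1 by linarith
      then have "norm (F z) \<le> exp (C1 * (y R * (R / (R - R3))))"
        by (rule FF_bound[OF that(1) _ pts(3) that(2)])
      also have "C1 * (y R * (R / (R - R3))) = Y1"
        unfolding pts(5) by (simp add: Y1_def X_def q_def)
      finally show ?thesis .
    qed
    define L1 where "L1 = c1 * (16 * C1 * X * q) ^ 3"
    have base1: "16 * C1 * X * q \<ge> 1"
    proof -
      have "1 * 1 * 1 \<le> (16 * C1) * X * q"
        using C X1 q1 by (intro mult_mono) auto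
      then show ?thesis
        by simp
    qed
    have L1: "L1 \<ge> 1"
      using mult_mono[of 1 c1 1 "(16 * C1 * X * q) ^ 3"] c1 one_le_power[OF base1, of 3] by (simp add: L1_def)
    have lnL1: "ln L1 \<le> (a1 + 6) * \<Lambda>"
    proof -
      have "ln L1 = ln c1 + 3 * ln (16 * C1 * X * q)"
        unfolding L1_def by (rule ln_cube[OF c1 base1])
      also have "\<dots> \<le> ln c1 + 3 * (ln (16 * C1) + 2 * \<Lambda>)"
        using lnXq[of "16 * C1"] C by simp
      also have "\<dots> = a1 * 1 + 6 * \<Lambda>"
        by (simp add: a1_def)
      also have "\<dots> \<le> a1 * \<Lambda> + 6 * \<Lambda>"
        using a1 \<Lambda>1 by (intro add_mono mult_left_mono) auto
      finally show ?thesis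
        by (simp add: algebra_simps)
    qed
    have "\<forall>F\<in>FF. 1 \<le> Y1 \<and> Y1 \<le> Y1 \<and> (\<forall>z. norm z \<le> R3 \<longrightarrow> norm (F z) \<le> exp Y1)"
      using FFb Y1 by blast
    then obtain r1 where r1: "sb \<le> r1" "r1 \<le> (sb + R3) / 2" and
      ld1: "\<And>F z. F \<in> FF \<Longrightarrow> norm z = r1 \<Longrightarrow> F z \<noteq> 0 \<and> norm (deriv F z / F z) \<le> c1 * (Y1 * R3 / (R3 - sb)) ^ 3"
      using good_circlesD[OF good1, of sb R3 "\<lambda>_. Y1" Y1] pts s1 by auto
    have "r1 \<le> R3"
      using r1(2) pts(2) by simp
    then have r1R: "r1 \<le> R" "1 \<le> r1" "r0 \<le> r1"
      using r1(1) pts(1-3) s1 by auto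
    define Y\<Psi> where "Y\<Psi> = b1 * \<Lambda>"
    have Y\<Psi>: "Y\<Psi> \<ge> 1"
      using mult_mono[of 1 b1 1 \<Lambda>] b1 \<Lambda>1 by (simp add: Y\<Psi>_def)
    have "norm (\<Psi> z) \<le> exp Y\<Psi>" if z: "norm z = r1" for z
    proof (cases "\<Psi> z = 0")
      case False
      have "F z \<noteq> 0 \<and> norm (deriv F z / F z) \<le> L1" if F: "F \<in> FF" for F
      proof -
        have "Y1 * R3 / (R3 - sb) \<le> Y1 * R / (d / 4)"
          unfolding pts(4) using pts d Y1 by (intro divide_right_mono mult_left_mono) auto
        also have "\<dots> = 16 * C1 * X * q"
          by (simp add: Y1_def q_def)
        finally have "Y1 * R3 / (R3 - sb) \<le> 16 * C1 * X * q" .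
        moreover have "0 \<le> Y1 * R3 / (R3 - sb)"
          using Y1 pts s1 by (intro divide_nonneg_nonneg mult_nonneg_nonneg) linarith+
        ultimately have "c1 * (Y1 * R3 / (R3 - sb)) ^ 3 \<le> L1"
          unfolding L1_def using c1 by (intro mult_left_mono power_mono) auto
        then show ?thesis
          using ld1[OF F z] by linarith
      qed
      then have "ln (norm (\<Psi> z)) + v z \<le> C2 * (1 + ln r1 + ln L1)"
        using aux[of z L1] L1 False z r1R by blast
      moreover have "ln r1 \<le> \<Lambda>"
        using r1R \<Lambda>1(2) by (meson ln_mono order_trans less_le_trans zero_less_one)
      moreover have "C2 * (1 + ln r1 + ln L1) \<le> C2 * (\<Lambda> + \<Lambda> + (a1 + 6) * \<Lambda>)"
        using C \<Lambda>1 lnL1 calculation(2) by (intro mult_left_mono add_mono) auto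
      moreover have "C2 * (\<Lambda> + \<Lambda> + (a1 + 6) * \<Lambda>) = Y\<Psi>"
        by (simp add: Y\<Psi>_def b1_def algebra_simps)
      ultimately have "ln (norm (\<Psi> z)) \<le> Y\<Psi>"
        using v0[of z] by linarith
      then have "exp (ln (norm (\<Psi> z))) \<le> exp Y\<Psi>"
        by (simp only: exp_le_cancel_iff)
      then show ?thesis
        using False by simp
    qed auto
    then have \<Psi>b: "norm (\<Psi> z) \<le> exp Y\<Psi>" if "norm z \<le> sb" for z
      using entire_bound_on_cball[OF \<Psi>(1), of r1 "exp Y\<Psi>" z] r1R r1 that by force
    define Y where "Y = (\<lambda>F. if F = \<Psi> then Y\<Psi> else Y1)"
    define Ymax where "Ymax = Y1 + Y\<Psi>"
    define X2 where "X2 = Ymax * sb / (sb - s)"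
    have "\<forall>F\<in>insert \<Psi> FF. 1 \<le> Y F \<and> Y F \<le> Ymax \<and> (\<forall>z. norm z \<le> sb \<longrightarrow> norm (F z) \<le> exp (Y F))"
      using Y1 Y\<Psi> \<Psi>b FFb pts by (auto simp: Y_def Ymax_def)
    then obtain r where r: "s \<le> r" "r \<le> (s + sb) / 2" and
      ld: "\<And>F z. F \<in> insert \<Psi> FF \<Longrightarrow> norm z = r \<Longrightarrow> F z \<noteq> 0 \<and> norm (deriv F z / F z) \<le> c2 * X2 ^ 3 \<and>
        ln (norm (F z)) \<ge> - c2 * (Y F * sb / (sb - s)) * (1 + ln X2)"
      using good_circlesD[OF good2, of s sb Y Ymax] pts s1 unfolding X2_def by blast
    have sbq: "sb / (sb - s) \<le> 2 * q" "1 \<le> sb / (sb - s)"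
    proof -
      have "sb / (d / 2) \<le> R / (d / 2)"
        using pts d by (intro divide_right_mono) auto
      also have "R / (d / 2) = 2 * q"
        by (simp add: q_def)
      finally show "sb / (sb - s) \<le> 2 * q"
        unfolding pts(6) .
      show "1 \<le> sb / (sb - s)"
        using pts s1 by simp
    qed
    have Ymax: "1 \<le> Ymax" "Ymax \<le> e2 * X"
    proof -
      have "Y\<Psi> \<le> b1 * (4 * X)"
        unfolding Y\<Psi>_def using \<Lambda>X b1 by (intro mult_left_mono) auto
      then show "Ymax \<le> e2 * X"
        by (simp add: Ymax_def Y1_def e2_def algebra_simps)
      show "1 \<le> Ymax"
        using Y1 Y\<Psi> by (simp add: Ymax_def)
    qed
    have X2': "1 \<le> X2" "X2 \<le> 2 * e2 * X * q"
    proof -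
      have "X2 = Ymax * (sb / (sb - s))"
        by (simp add: X2_def)
      then show "1 \<le> X2"
        using mult_mono[of 1 Ymax 1 "sb / (sb - s)"] Ymax sbq by simp
      have "Ymax * (sb / (sb - s)) \<le> (e2 * X) * (2 * q)"
        using Ymax sbq by (intro mult_mono) auto
      then show "X2 \<le> 2 * e2 * X * q"
        using \<open>X2 = Ymax * (sb / (sb - s))\<close> by (simp add: mult_ac)
    qed
    have lnX2: "ln X2 \<le> (a2 + 2) * \<Lambda>" "0 \<le> ln X2"
    proof -
      have "ln X2 \<le> ln (2 * e2 * X * q)"
        using X2' by (intro ln_mono) auto
      also have "\<dots> \<le> a2 * 1 + 2 * \<Lambda>"
        using lnXq[of "2 * e2"] e2 by (simp add: a2_def)
      also have "\<dots> \<le> a2 * \<Lambda> + 2 * \<Lambda>"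
        using a2 \<Lambda>1 by (intro add_mono mult_left_mono) auto
      finally show "ln X2 \<le> (a2 + 2) * \<Lambda>"
        by (simp add: algebra_simps)
    qed (use X2' in auto)
    define L2 where "L2 = c2 * X2 ^ 3"
    have L2: "1 \<le> L2"
      using mult_mono[of 1 c2 1 "X2 ^ 3"] c2 one_le_power[OF X2'(1), of 3] by (simp add: L2_def)
    have lnL2: "ln L2 = ln c2 + 3 * ln X2"
      unfolding L2_def by (rule ln_cube[OF c2 X2'(1)])
    have "r \<le> sb"
      using r(2) pts(1) by simp
    then have rR: "r \<le> R" "1 \<le> r" "r0 \<le> r"
      using r(1) pts(1-3) s1 by auto
    have lnr: "ln r \<le> \<Lambda>" "0 \<le> ln r"
    proof -
      have "ln r \<le> ln R"
        using rR by (intro ln_mono) auto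
      then show "ln r \<le> \<Lambda>"
        using \<Lambda>1(2) by linarith
    qed (use rR in simp)
    define V where "V = c3 * (\<Lambda>\<^sup>2 * q)"
    have \<Lambda>2: "\<Lambda> \<le> \<Lambda>\<^sup>2 * q" "1 \<le> \<Lambda>\<^sup>2 * q"
    proof -
      have "\<Lambda> * 1 * 1 \<le> \<Lambda> * \<Lambda> * q"
        using \<Lambda>1 q1 by (intro mult_mono) auto
      then show "\<Lambda> \<le> \<Lambda>\<^sup>2 * q"
        by (simp add: power2_eq_square)
      then show "1 \<le> \<Lambda>\<^sup>2 * q"
        using \<Lambda>1 by linarith
    qed
    have vV: "v z \<le> V" if z: "norm z = r" for z
    proof -
      have \<Psi>z: "\<Psi> z \<noteq> 0" "ln (norm (\<Psi> z)) \<ge> - c2 * (Y\<Psi> * sb / (sb - s)) * (1 + ln X2)"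
        using ld[of \<Psi> z] z by (auto simp: Y_def)
      have "F z \<noteq> 0 \<and> norm (deriv F z / F z) \<le> L2" if "F \<in> FF" for F
        using ld[of F z] z that by (simp add: L2_def)
      then have 1: "ln (norm (\<Psi> z)) + v z \<le> C2 * (1 + ln r + ln L2)"
        using aux[of z L2] L2 \<Psi>z z rR by blast
      have "1 + ln r + ln L2 \<le> \<Lambda> + \<Lambda> + (ln c2 * \<Lambda> + 3 * ((a2 + 2) * \<Lambda>))"
        using lnL2 lnX2 lnr \<Lambda>1 c2 mult_left_mono[of 1 \<Lambda> "ln c2"] by auto
      also have "\<dots> = (2 + ln c2 + 3 * (a2 + 2)) * \<Lambda>"
        by (simp add: algebra_simps)
      also have "\<dots> \<le> (2 + ln c2 + 3 * (a2 + 2)) * (\<Lambda>\<^sup>2 * q)"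
        using \<Lambda>2 c2 a2 by (intro mult_left_mono) auto
      finally have "C2 * (1 + ln r + ln L2) \<le> C2 * ((2 + ln c2 + 3 * (a2 + 2)) * (\<Lambda>\<^sup>2 * q))"
        using C by (intro mult_left_mono) auto
      then have 2: "C2 * (1 + ln r + ln L2) \<le> C2 * (2 + ln c2 + 3 * (a2 + 2)) * (\<Lambda>\<^sup>2 * q)"
        by (simp add: mult.assoc)
      define t where "t = Y\<Psi> * sb / (sb - s)"
      have t: "0 \<le> t" "t \<le> Y\<Psi> * (2 * q)"
      proof -
        have "t = Y\<Psi> * (sb / (sb - s))"
          by (simp add: t_def)
        show "t \<le> Y\<Psi> * (2 * q)"
          unfolding \<open>t = Y\<Psi> * (sb / (sb - s))\<close>
          by (rule mult_left_mono[OF sbq(1)]) (use Y\<Psi> in linarith)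
        show "0 \<le> t"
          unfolding \<open>t = Y\<Psi> * (sb / (sb - s))\<close> by (rule mult_nonneg_nonneg) (use sbq Y\<Psi> in linarith)+
      qed
      have "c2 * t * (1 + ln X2) \<le> c2 * (Y\<Psi> * (2 * q)) * (\<Lambda> + (a2 + 2) * \<Lambda>)"
        using t c2 Y\<Psi> q1 lnX2 \<Lambda>1 by (intro mult_mono add_mono) auto
      then have "c2 * (Y\<Psi> * sb / (sb - s)) * (1 + ln X2)
          \<le> c2 * (Y\<Psi> * (2 * q)) * (\<Lambda> + (a2 + 2) * \<Lambda>)"
        by (simp only: t_def)
      also have "\<dots> = 2 * c2 * b1 * (a2 + 3) * (\<Lambda>\<^sup>2 * q)"
        by (simp add: Y\<Psi>_def power2_eq_square algebra_simps)
      finally have 3: "c2 * (Y\<Psi> * sb / (sb - s)) * (1 + ln X2) \<le> 2 * c2 * b1 * (a2 + 3) * (\<Lambda>\<^sup>2 * q)" .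
      have "V = C2 * (2 + ln c2 + 3 * (a2 + 2)) * (\<Lambda>\<^sup>2 * q) + 2 * c2 * b1 * (a2 + 3) * (\<Lambda>\<^sup>2 * q)"
        by (simp only: V_def c3_def distrib_right)
      moreover have "- c2 * (Y\<Psi> * sb / (sb - s)) * (1 + ln X2) = - (c2 * (Y\<Psi> * sb / (sb - s)) * (1 + ln X2))"
        by simp
      ultimately show ?thesis
        using 1 2 3 \<Psi>z(2) by linarith
    qed
    have "y s \<le> C3 * (1 + ln r + V)"
      using vy[OF s1(2) r(1) vV] .
    also have "\<dots> \<le> C3 * (\<Lambda>\<^sup>2 * q + \<Lambda>\<^sup>2 * q + V)"
      using C lnr \<Lambda>2 by (intro mult_left_mono add_mono) auto
    also have "\<dots> = C * \<Lambda>\<^sup>2 * q"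
      by (simp add: C_def V_def algebra_simps)
    finally show ?thesis
      by (simp add: \<Lambda>_def q_def d_def)
  qed
  moreover have "1 \<le> C"
    using mult_mono[of 1 C3 1 "2 + c3"] C c3 by (simp add: C_def)
  moreover have "1 \<le> s0"
    by (simp add: s0_def)
  ultimately show ?thesis
    by (intro polylog_growth[where y = y and C = C and ?s0.0 = s0] mono y1)
qed

section \<open>Functions without zeros and poles outside a finite set\<close>

lemma poly_ln_bound:
  fixes q :: "complex poly"
  assumes "q \<noteq> 0"
  shows "\<exists>C\<ge>0. \<exists>r0\<ge>3. \<forall>z. r0 \<le> norm z \<longrightarrow> poly q z \<noteq> 0 \<and> \<bar>ln (norm (poly q z))\<bar> \<le> C * ln (norm z)"
proof -
  obtain B N where B: "B \<ge> 1" "\<And>z. 1 \<le> norm z \<Longrightarrow> norm (poly q z) \<le> B * norm z ^ N"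
    using poly_growth[of q] by blast
  obtain c r0 where c: "c > 0" "r0 \<ge> 1" "\<And>z. r0 \<le> norm z \<Longrightarrow> c \<le> norm (poly q z)"
    using poly_lower_bound_eventually[OF assms] by blast
  define C where "C = ln B + real N + \<bar>ln c\<bar>"
  define r1 where "r1 = max r0 3"
  have "poly q z \<noteq> 0 \<and> \<bar>ln (norm (poly q z))\<bar> \<le> C * ln (norm z)" if z: "r1 \<le> norm z" for z
  proof -
    have z': "r0 \<le> norm z" "3 \<le> norm z"
      using z by (auto simp: r1_def)
    have "exp 1 \<le> norm z"
      using z'(2) exp_le by linarith
    then have "ln (exp 1) \<le> ln (norm z)"
      by (intro ln_mono) auto
    then have l1: "1 \<le> ln (norm z)"
      by simp
    have pos: "norm (poly q z) > 0"
      using c(3)[OF z'(1)] c(1) by linarith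
    have "ln (norm (poly q z)) \<le> ln (B * norm z ^ N)"
      using B(2)[of z] pos z' by (intro ln_mono) auto
    also have "\<dots> = ln B * 1 + N * ln (norm z)"
    proof -
      have "z \<noteq> 0"
        using z' by auto
      then show ?thesis
        using B by (simp add: ln_mult ln_realpow)
    qed
    also have "\<dots> \<le> ln B * ln (norm z) + N * ln (norm z)"
      using B l1 by (intro add_mono mult_left_mono) auto
    also have "\<dots> \<le> C * ln (norm z)"
      using l1 unfolding distrib_right[symmetric] by (intro mult_right_mono) (auto simp: C_def)
    finally have 1: "ln (norm (poly q z)) \<le> C * ln (norm z)" .
    have "\<bar>ln c\<bar> * 1 \<le> C * ln (norm z)"
      using B l1 by (intro mult_mono) (auto simp: C_def)
    moreover have "ln c \<le> ln (norm (poly q z))"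
      using c(3)[OF z'(1)] c(1) by (intro ln_mono) auto
    ultimately have "- (C * ln (norm z)) \<le> ln (norm (poly q z))"
      by linarith
    then show ?thesis
      using 1 pos by auto
  qed
  then show ?thesis
    using B by (intro exI[of _ C] conjI exI[of _ r1]) (auto simp: C_def r1_def)
qed

text \<open>By clearing poles and factoring out zeros, \<open>F\<close> is a quotient of polynomials times \<open>exp h\<close> with \<open>h\<close>
entire. The growth of \<open>F\<close> bounds \<open>Re h\<close> from above, hence \<open>|h|\<close> by the half plane estimate, so \<open>h\<close> is a
polynomial. Its degree is at most \<open>\<sigma>\<close>, thus at most \<open>d\<close>.\<close>

lemma ln_norm_bound_zero_free:
  fixes F :: "complex \<Rightarrow> complex" and d :: nat and \<sigma> C0 s0 :: real
  assumes F: "F meromorphic_on UNIV" and S: "finite S"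
    and lim: "\<And>z. z \<notin> S \<Longrightarrow> \<exists>l. l \<noteq> 0 \<and> F \<midarrow>z\<rightarrow> l"
    and \<sigma>: "0 < \<sigma>" "\<sigma> < real d + 1" and C0: "C0 \<ge> 0"
    and growth: "\<And>s. s \<ge> s0 \<Longrightarrow> \<exists>r. s \<le> r \<and> r \<le> 2 * s \<and>
        (\<forall>z. norm z = r \<longrightarrow> F analytic_on {z} \<and> norm (F z) \<le> exp (C0 * s powr \<sigma>))"
  shows "\<exists>C\<ge>0. \<exists>r0\<ge>3. \<forall>z. r0 \<le> norm z \<longrightarrow> F analytic_on {z} \<longrightarrow>
            F z \<noteq> 0 \<and> \<bar>ln (norm (F z))\<bar> \<le> C * (norm z ^ d * ln (norm z))"
proof -
  have poles: "{z. is_pole F z} \<subseteq> S"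
  proof
    fix z assume z: "z \<in> {z. is_pole F z}"
    show "z \<in> S"
    proof (rule ccontr)
      assume "z \<notin> S"
      then obtain l where "F \<midarrow>z\<rightarrow> l"
        using lim by blast
      then show False
        using z not_tendsto_and_filterlim_at_infinity[of "at z" F l] by (auto simp: is_pole_def)
    qed
  qed
  obtain E q where E: "E holomorphic_on UNIV" and q0: "\<And>z. poly q z = 0 \<longleftrightarrow> is_pole F z"
    and EF: "\<And>z. F analytic_on {z} \<Longrightarrow> F z * poly q z = E z"
    and evE: "\<And>z. eventually (\<lambda>w. F w * poly q w = E w) (at z)"
    using clear_poles[OF F finite_subset[OF poles S]] by blast
  have Enz: "E z \<noteq> 0" if z: "z \<notin> S" for z
  proof -
    obtain l where l: "l \<noteq> 0" "F \<midarrow>z\<rightarrow> l"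
      using lim[OF z] by blast
    have "(\<lambda>w. F w * poly q w) \<midarrow>z\<rightarrow> l * poly q z"
      by (intro tendsto_mult l) (auto intro!: tendsto_intros)
    then have "E \<midarrow>z\<rightarrow> l * poly q z"
      using evE by (rule Lim_transform_eventually)
    moreover have "E \<midarrow>z\<rightarrow> E z"
      using E holomorphic_on_imp_continuous_on[OF E] by (simp add: continuous_on_eq_continuous_at isCont_def)
    ultimately have "E z = l * poly q z"
      by (metis LIM_unique)
    moreover have "poly q z \<noteq> 0"
      using q0 z poles by auto
    ultimately show ?thesis
      using l by simp
  qed
  obtain z0 where z0: "z0 \<notin> S"
    using S ex_new_if_finite[OF infinite_UNIV_char_0] by blast
  have q: "q \<noteq> 0"
    using q0[of z0] z0 poles by auto
  from entire_factor_out_finite[OF S E Enz[OF z0]] obtain m g where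
    mg: "g holomorphic_on UNIV \<and> (\<forall>a\<in>S. g a \<noteq> 0) \<and> (\<forall>z. E z = (\<Prod>a\<in>S. (z - a) ^ m a) * g z)"
    by (elim exE)
  define p where "p = (\<Prod>a\<in>S. [:- a, 1:] ^ m a)"
  have g: "g holomorphic_on UNIV" and Eg: "E z = poly p z * g z" for z
    using mg by (simp_all add: p_def poly_prod poly_power)
  have p: "p \<noteq> 0"
    using Enz[OF z0] Eg[of z0] by auto
  have gnz: "g z \<noteq> 0" for z
    using mg Enz[of z] Eg[of z] by (cases "z \<in> S") auto
  obtain h where h: "h holomorphic_on UNIV" "\<And>z. exp (h z) = g z"
    by (rule holomorphic_logarithm_exists[OF convex_UNIV open_UNIV g gnz UNIV_I], rule that) auto
  have Reh: "Re (h z) = ln (norm (g z))" for z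
    using h(2)[of z, symmetric] by simp
  obtain Cq rq where Cq: "Cq \<ge> 0" "rq \<ge> 3" "\<And>z. rq \<le> norm z \<Longrightarrow> poly q z \<noteq> 0 \<and> \<bar>ln (norm (poly q z))\<bar> \<le> Cq * ln (norm z)"
    using poly_ln_bound[OF q] by blast
  obtain Cp rp where Cp: "Cp \<ge> 0" "rp \<ge> 3" "\<And>z. rp \<le> norm z \<Longrightarrow> poly p z \<noteq> 0 \<and> \<bar>ln (norm (poly p z))\<bar> \<le> Cp * ln (norm z)"
    using poly_ln_bound[OF p] by blast
  define s1 where "s1 = max s0 (max rq rp)"
  have ana: "F z \<noteq> 0 \<and> ln (norm (F z)) = Re (h z) + ln (norm (poly p z)) - ln (norm (poly q z))"
    if "F analytic_on {z}" "s1 \<le> norm z" for z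
  proof -
    have nz: "poly p z \<noteq> 0" "poly q z \<noteq> 0"
      using Cp(3) Cq(3) that by (auto simp: s1_def)
    have eq: "F z * poly q z = poly p z * g z"
      using EF[OF that(1)] Eg by simp
    then have Fz: "F z \<noteq> 0"
      using nz gnz by auto
    have "ln (norm (F z * poly q z)) = ln (norm (poly p z * g z))"
      by (simp only: eq)
    then show ?thesis
      using Fz nz gnz[of z] Reh[of z] by (simp add: norm_mult ln_mult)
  qed
  define C1 where "C1 = C0 + (Cp + Cq) * (2 powr \<sigma> / \<sigma>)"
  have C1: "C1 \<ge> 0"
    using C0 Cp Cq \<sigma> by (simp add: C1_def)
  have Reh_le: "Re (h z) \<le> C1 * s powr \<sigma>" if s: "s \<ge> s1" and z: "norm z \<le> s" for s z
  proof -
    have s3: "s \<ge> 3" "s \<ge> s0"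
      using s Cp Cq by (auto simp: s1_def)
    obtain r where r: "s \<le> r" "r \<le> 2 * s"
      "\<forall>z. norm z = r \<longrightarrow> F analytic_on {z} \<and> norm (F z) \<le> exp (C0 * s powr \<sigma>)"
      using growth[OF s3(2)] by blast
    have "norm (g w) \<le> exp (C1 * s powr \<sigma>)" if w: "norm w = r" for w
    proof -
      have Fw: "F analytic_on {w}" "norm (F w) \<le> exp (C0 * s powr \<sigma>)"
        using r w by auto
      have w1: "s1 \<le> norm w"
        using w r s by simp
      note an = ana[OF Fw(1) w1]
      have "ln (norm (F w)) \<le> ln (exp (C0 * s powr \<sigma>))"
        using Fw(2) an by (intro ln_mono) auto
      moreover have "\<bar>ln (norm (poly p w))\<bar> \<le> Cp * ln r" "\<bar>ln (norm (poly q w))\<bar> \<le> Cq * ln r"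
        using Cp(3)[of w] Cq(3)[of w] w w1 by (auto simp: s1_def)
      ultimately have "Re (h w) \<le> C0 * s powr \<sigma> + (Cp + Cq) * ln r"
        using an by (simp add: distrib_right)
      also have "ln r \<le> r powr \<sigma> / \<sigma>"
        using r s3 \<sigma> by (intro ln_powr_bound) auto
      also have "r powr \<sigma> \<le> (2 * s) powr \<sigma>"
        using r s3 \<sigma> by (intro powr_mono2) auto
      also have "(2 * s) powr \<sigma> = 2 powr \<sigma> * s powr \<sigma>"
        using s3 by (simp add: powr_mult)
      finally have "Re (h w) \<le> C0 * s powr \<sigma> + (Cp + Cq) * (2 powr \<sigma> * s powr \<sigma> / \<sigma>)"
        using Cp Cq \<sigma> by (simp add: mult_left_mono divide_right_mono)
      also have "\<dots> = C1 * s powr \<sigma>"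
        by (simp add: C1_def algebra_simps)
      finally have "Re (h w) \<le> C1 * s powr \<sigma>" .
      then have "exp (Re (h w)) \<le> exp (C1 * s powr \<sigma>)"
        by (simp only: exp_le_cancel_iff)
      then show ?thesis
        using h(2)[of w, symmetric] by simp
    qed
    then have "norm (g z) \<le> exp (C1 * s powr \<sigma>)"
      using entire_bound_on_cball[OF g, of r "exp (C1 * s powr \<sigma>)" z] r s3 z by force
    then have "ln (norm (g z)) \<le> ln (exp (C1 * s powr \<sigma>))"
      using gnz[of z] by (intro ln_mono) auto
    then show ?thesis
      by (simp add: Reh)
  qed
  define C2 where "C2 = 4 * (C1 * 2 powr \<sigma> + 1 + norm (h 0))"
  have C2: "C2 \<ge> 0"
    using C1 by (simp add: C2_def)
  have h_bd: "norm (h z) \<le> C2 * norm z powr \<sigma>" if z: "s1 \<le> norm z" for z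
  proof -
    define s where "s = norm z"
    define M where "M = C1 * (2 * s) powr \<sigma>"
    have s: "s \<ge> 3" "s1 \<le> 2 * s"
      using z Cp Cq by (auto simp: s1_def s_def)
    define G where "G = (\<lambda>w. of_real (M + 1) - h w + \<i> * of_real (Im (h 0)))"
    have "norm (G z) \<le> (M + 1 - Re (h 0)) * (2 * s + norm z) / (2 * s - norm z)"
    proof (rule Caratheodory_half_plane)
      show "G holomorphic_on ball 0 (2 * s)"
        unfolding G_def by (intro holomorphic_intros holomorphic_on_subset[OF h(1)]) auto
      show "Re (G w) > 0" if "w \<in> ball 0 (2 * s)" for w
        using Reh_le[OF s(2), of w] that by (simp add: G_def M_def)
      show "G 0 = of_real (M + 1 - Re (h 0))"
        by (simp add: G_def complex_eq_iff)
      show "z \<in> ball 0 (2 * s)"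
        using s unfolding s_def by (subst mem_ball_0) linarith
    qed
    also have "\<dots> = (M + 1 - Re (h 0)) * 3"
      using s unfolding s_def[symmetric] by simp
    also have "\<dots> \<le> (M + 1 + norm (h 0)) * 3"
      using abs_Re_le_cmod[of "h 0"] by (intro mult_right_mono) auto
    finally have Gz: "norm (G z) \<le> (M + 1 + norm (h 0)) * 3" .
    have M0: "M \<ge> 0"
      using C1 by (simp add: M_def)
    have "h z = of_real (M + 1) + \<i> * of_real (Im (h 0)) - G z"
      by (simp add: G_def)
    then have "norm (h z) \<le> norm (complex_of_real (M + 1)) + norm (\<i> * of_real (Im (h 0))) + norm (G z)"
      by (metis add_right_mono norm_triangle_ineq norm_triangle_ineq4 order_trans)
    also have "norm (complex_of_real (M + 1)) = M + 1"
      using M0 by (simp only: norm_of_real)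
    also have "norm (\<i> * of_real (Im (h 0))) \<le> norm (h 0)"
      using abs_Im_le_cmod[of "h 0"] by (simp add: norm_mult)
    finally have "norm (h z) \<le> 4 * (M + (1 + norm (h 0)) * 1)"
      using Gz by simp
    also have "\<dots> \<le> 4 * (M + (1 + norm (h 0)) * s powr \<sigma>)"
      using s \<sigma> by (intro mult_left_mono add_mono) (auto intro!: ge_one_powr_ge_zero)
    also have "\<dots> = C2 * s powr \<sigma>"
      using s by (simp add: C2_def M_def powr_mult algebra_simps)
    finally show ?thesis
      by (simp add: s_def)
  qed
  have s1_3: "s1 \<ge> 3"
    using Cp by (auto simp: s1_def)
  \<comment> \<open>The growth exponent is smaller than \<open>d + 1\<close>, so the Cauchy estimate kills this coefficient.\<close>
  have top: "(deriv ^^ (Suc d)) h 0 = 0"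
  proof -
    have "norm ((deriv ^^ (Suc d)) h 0) \<le> 0 + e" if e: "e > 0" for e
    proof -
      have "((\<lambda>r. r powr (\<sigma> - real (Suc d))) \<longlongrightarrow> 0) at_top"
      proof (rule tendsto_neg_powr)
        show "\<sigma> - real (Suc d) < 0"
          using \<sigma>(2) by simp
      qed (rule filterlim_ident)
      then have "((\<lambda>r. fact (Suc d) * C2 * r powr (\<sigma> - real (Suc d))) \<longlongrightarrow> fact (Suc d) * C2 * 0) at_top"
        by (rule tendsto_mult[OF tendsto_const])
      then have "eventually (\<lambda>r. fact (Suc d) * C2 * r powr (\<sigma> - real (Suc d)) < e) at_top"
        using e by (intro order_tendstoD(2)) simp_all
      then obtain r2 where r2: "\<And>r. r \<ge> r2 \<Longrightarrow> fact (Suc d) * C2 * r powr (\<sigma> - real (Suc d)) < e"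
        by (auto simp: eventually_at_top_linorder)
      define r where "r = max r2 s1"
      have r: "r \<ge> r2" "r \<ge> s1" "r > 0"
        using s1_3 by (auto simp: r_def)
      have "norm ((deriv ^^ (Suc d)) h 0) \<le> fact (Suc d) * (C2 * r powr \<sigma>) / r ^ Suc d"
        using h_bd r by (intro Cauchy_inequality holomorphic_on_subset[OF h(1)]
            holomorphic_on_imp_continuous_on) auto
      also have "\<dots> = fact (Suc d) * C2 * (r powr \<sigma> / r powr real (Suc d))"
        using r powr_realpow[of r "Suc d"] by (simp add: add.commute)
      also have "\<dots> = fact (Suc d) * C2 * r powr (\<sigma> - real (Suc d))"
        by (simp only: powr_diff)
      finally show ?thesis
        using r2[OF r(1)] by linarith
    qed
    then have "norm ((deriv ^^ (Suc d)) h 0) \<le> 0"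
      by (rule field_le_epsilon)
    then show ?thesis
      by (simp only: norm_le_zero_iff)
  qed
  define a where "a = (\<lambda>k. (deriv ^^ k) h 0 / fact k)"
  have h_poly: "h z = (\<Sum>k\<le>Suc d. a k * z ^ k)" for z
    unfolding a_def
  proof (rule Liouville_polynomial[OF h(1)])
    fix w :: complex assume w: "s1 \<le> norm w"
    have "norm w powr \<sigma> \<le> norm w powr real (Suc d)"
      using w s1_3 \<sigma> by (intro powr_mono) auto
    also have "\<dots> = norm w ^ Suc d"
      using w s1_3 by (intro powr_realpow) linarith
    finally show "norm (h w) \<le> C2 * norm w ^ Suc d"
      using h_bd[OF w] C2 by (meson mult_left_mono order_trans)
  qed
  define C3 where "C3 = (\<Sum>k\<le>d. norm (a k))"
  have h_d: "norm (h z) \<le> C3 * norm z ^ d" if z: "1 \<le> norm z" for z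
  proof -
    have "h z = (\<Sum>k\<le>d. a k * z ^ k)"
      using h_poly[of z] top by (simp add: a_def del: funpow.simps)
    also have "norm \<dots> \<le> (\<Sum>k\<le>d. norm (a k) * norm z ^ d)"
      using z by (intro sum_norm_le) (auto simp: norm_mult norm_power intro!: mult_left_mono power_increasing)
    finally show ?thesis
      by (simp add: C3_def sum_distrib_right)
  qed
  have C3: "C3 \<ge> 0"
    by (simp add: C3_def sum_nonneg)
  define C where "C = C3 + Cp + Cq"
  have "F z \<noteq> 0 \<and> \<bar>ln (norm (F z))\<bar> \<le> C * (norm z ^ d * ln (norm z))"
    if z: "s1 \<le> norm z" and Fz: "F analytic_on {z}" for z
  proof -
    have z3: "norm z \<ge> 3"
      using z s1_3 by simp
    have "exp 1 \<le> norm z"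
      using z3 exp_le by linarith
    then have "ln (exp 1) \<le> ln (norm z)"
      by (intro ln_mono) auto
    then have l1: "1 \<le> ln (norm z)"
      by simp
    have zd: "1 \<le> norm z ^ d"
      using z3 by (intro one_le_power) auto
    have "\<bar>ln (norm (F z))\<bar> \<le> norm (h z) + \<bar>ln (norm (poly p z))\<bar> + \<bar>ln (norm (poly q z))\<bar>"
      using ana[OF Fz z] abs_Re_le_cmod[of "h z"] by linarith
    also have "\<dots> \<le> C3 * norm z ^ d * 1 + Cp * (1 * ln (norm z)) + Cq * (1 * ln (norm z))"
      using h_d[of z] Cp(3)[of z] Cq(3)[of z] z z3 by (intro add_mono) (auto simp: s1_def)
    also have "\<dots> \<le> C3 * norm z ^ d * ln (norm z) + Cp * (norm z ^ d * ln (norm z)) + Cq * (norm z ^ d * ln (norm z))"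
      using l1 zd C3 Cp Cq by (intro add_mono mult_left_mono mult_right_mono) auto
    also have "\<dots> = C * (norm z ^ d * ln (norm z))"
      by (simp add: C_def algebra_simps)
    finally show ?thesis
      using ana[OF Fz z] by simp
  qed
  then show ?thesis
    using C3 Cp Cq s1_3 by (intro exI[of _ C] conjI exI[of _ s1]) (auto simp: C_def)
qed

section \<open>The auxiliary function\<close>

text \<open>The logarithmic derivative of \<open>A'/A\<^sup>2\<close>, that is, of the derivative of \<open>1/A\<close>.\<close>

definition dlog_quot :: "(complex \<Rightarrow> complex) \<Rightarrow> complex \<Rightarrow> complex" where
  "dlog_quot A z = deriv (deriv A) z / deriv A z - 2 * deriv A z / A z"

lemma zero_local_form:
  fixes A :: "complex \<Rightarrow> complex"
  assumes A: "A holomorphic_on U0" "open U0" "z0 \<in> U0" and A0: "A z0 = 0"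
    and ev: "eventually (\<lambda>z. A z \<noteq> 0) (at z0)"
  obtains a v U where "open U" "z0 \<in> U" "U \<subseteq> U0" "1 \<le> a" "v holomorphic_on U" "\<And>z. z \<in> U \<Longrightarrow> v z \<noteq> 0"
    "\<And>z. z \<in> U \<Longrightarrow> A z = (z - z0) ^ a * v z"
proof -
  obtain r where r: "r > 0" "ball z0 r \<subseteq> U0"
    using A openE by blast
  have nc: "\<not> A constant_on ball z0 r"
  proof
    assume "A constant_on ball z0 r"
    then have "A z = A z0" if "z \<in> ball z0 r" for z
      using that r unfolding constant_on_def by (metis centre_in_ball)
    then have "eventually (\<lambda>z. A z = 0) (at z0)"
      using r A0 by (intro eventually_at_in_open'[of "ball z0 r" z0, THEN eventually_mono]) auto
    with ev have "eventually (\<lambda>z. False) (at z0)"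
      by eventually_elim auto
    then show False
      by simp
  qed
  obtain h e m where h: "0 < m" "0 < e" "ball z0 e \<subseteq> ball z0 r" "h holomorphic_on ball z0 e"
      "\<And>w. w \<in> ball z0 e \<Longrightarrow> A w = (w - z0) ^ m * h w" "\<And>w. w \<in> ball z0 e \<Longrightarrow> h w \<noteq> 0"
    using holomorphic_factor_zero_nonconstant[OF holomorphic_on_subset[OF A(1) r(2)] open_ball connected_ball _ A0 nc]
      r(1) by (metis centre_in_ball)
  show ?thesis
    by (rule that[of "ball z0 e" m h]) (use h r in auto)
qed

lemma deriv_local_form:
  fixes A v :: "complex \<Rightarrow> complex"
  assumes U: "open U" and v: "v holomorphic_on U" and a: "1 \<le> a"
    and A: "\<And>z. z \<in> U \<Longrightarrow> A z = (z - z0) ^ a * v z" and z: "z \<in> U"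
  shows "deriv A z = (z - z0) ^ (a - 1) * (of_nat a * v z + (z - z0) * deriv v z)"
proof -
  have dv: "(v has_field_derivative deriv v z) (at z)"
    using holomorphic_derivI[OF v U z] .
  have "((\<lambda>z. (z - z0) ^ a * v z) has_field_derivative
     of_nat a * (z - z0) ^ (a - 1) * v z + (z - z0) ^ a * deriv v z) (at z)"
    using dv by (auto intro!: derivative_eq_intros)
  then have "(A has_field_derivative of_nat a * (z - z0) ^ (a - 1) * v z + (z - z0) ^ a * deriv v z) (at z)"
    by (rule has_field_derivative_transform_within_open[OF _ U z]) (simp add: A)
  then have "deriv A z = of_nat a * (z - z0) ^ (a - 1) * v z + (z - z0) ^ a * deriv v z"
    by (rule DERIV_imp_deriv)
  also have "(z - z0) ^ a = (z - z0) ^ (a - 1) * (z - z0)"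
    using a by (cases a) auto
  finally show ?thesis
    by (simp add: algebra_simps)
qed

text \<open>At a zero of \<open>A\<close> there is at most a simple pole. At a simple zero the constant term of the expansion
cancels, so that two such functions differ by a function with a zero.\<close>

lemma dlog_quot_local_form:
  fixes A v :: "complex \<Rightarrow> complex"
  assumes U: "open U" "z0 \<in> U" and v: "v holomorphic_on U" "\<And>z. z \<in> U \<Longrightarrow> v z \<noteq> 0" and a: "1 \<le> a"
    and A: "\<And>z. z \<in> U \<Longrightarrow> A z = (z - z0) ^ a * v z"
  obtains u l m where "isCont u z0" "isCont l z0" "isCont m z0"
    "eventually (\<lambda>z. deriv A z = (z - z0) ^ (a - 1) * u z) (at z0)"
    "eventually (\<lambda>z. dlog_quot A z = l z / (z - z0)) (at z0)"
    "a = 1 \<Longrightarrow> eventually (\<lambda>z. dlog_quot A z = - 2 / (z - z0) + (z - z0) * m z) (at z0)"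
proof -
  define u where "u = (\<lambda>z. of_nat a * v z + (z - z0) * deriv v z)"
  define l where "l = (\<lambda>z. (of_nat (a - 1) * u z + (z - z0) * deriv u z) / u z - 2 * u z / v z)"
  define m where "m = (\<lambda>z. (deriv (deriv v) z * v z - 2 * (deriv v z)\<^sup>2) / (u z * v z))"
  have hol: "deriv v holomorphic_on U" "u holomorphic_on U" "deriv u holomorphic_on U"
     "deriv (deriv v) holomorphic_on U"
    unfolding u_def using U v by (auto intro!: holomorphic_intros holomorphic_deriv)
  have cont: "isCont F z0" if "F holomorphic_on U" for F :: "complex \<Rightarrow> complex"
    using that U by (metis continuous_on_eq_continuous_at holomorphic_on_imp_continuous_on)
  have vz: "v z0 \<noteq> 0" and uz: "u z0 \<noteq> 0"
    using v(2)[OF U(2)] a by (auto simp: u_def)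
  have cont_lmu: "isCont l z0" "isCont m z0" "isCont u z0"
    unfolding l_def m_def using vz uz cont[OF v(1)] cont[OF hol(1)] cont[OF hol(2)] cont[OF hol(3)] cont[OF hol(4)]
    by (auto intro!: continuous_intros)
  have dA: "deriv A z = (z - z0) ^ (a - 1) * u z" if "z \<in> U" for z
    unfolding u_def by (rule deriv_local_form[OF U(1) v(1) a A that])
  have d2A: "(z - z0) * deriv (deriv A) z = (z - z0) ^ (a - 1) * (of_nat (a - 1) * u z + (z - z0) * deriv u z)"
    if z: "z \<in> U" for z
  proof (cases "a = 1")
    case True
    have "(u has_field_derivative deriv u z) (at z)"
      using holomorphic_derivI[OF hol(2) U(1) z] .
    then have "(deriv A has_field_derivative deriv u z) (at z)"
      by (rule has_field_derivative_transform_within_open[OF _ U(1) z]) (use dA True in simp)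
    then show ?thesis
      using True by (simp add: DERIV_imp_deriv)
  next
    case False
    then have a': "1 \<le> a - 1"
      using a by simp
    have "(z - z0) ^ (a - 1) = (z - z0) * (z - z0) ^ (a - 1 - 1)"
      using a' by (cases "a - 1") auto
    then show ?thesis
      using deriv_local_form[OF U(1) hol(2) a' dA z] by (simp add: mult_ac)
  qed
  have ev1: "eventually (\<lambda>z. u z \<noteq> 0) (at z0)"
    using cont_lmu(3) uz by (intro tendsto_imp_eventually_ne[of u "u z0"]) (auto simp: isCont_def)
  have "eventually (\<lambda>z. z \<in> U - {z0}) (at z0)"
    using U by (intro eventually_at_in_open) auto
  with ev1 have ev: "eventually (\<lambda>z. u z \<noteq> 0 \<and> z \<in> U \<and> z \<noteq> z0) (at z0)"
    by eventually_elim auto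
  have evd: "eventually (\<lambda>z. deriv A z = (z - z0) ^ (a - 1) * u z) (at z0)"
    using ev by eventually_elim (use dA in blast)
  have evl: "eventually (\<lambda>z. dlog_quot A z = l z / (z - z0)) (at z0)"
    using ev
  proof eventually_elim
    case (elim z)
    define t where "t = z - z0"
    have t: "t \<noteq> 0"
      using elim by (simp add: t_def)
    have vz: "v z \<noteq> 0"
      using v elim by blast
    define k where "k = t ^ (a - 1)"
    have k: "k \<noteq> 0" "t ^ a = t * k"
      using t a by (cases a; simp add: k_def)+
    have 1: "deriv A z = k * u z" "A z = t * k * v z"
      using dA A elim k by (auto simp: t_def k_def)
    have "t * deriv (deriv A) z = k * (of_nat (a - 1) * u z + t * deriv u z)"
      using d2A elim by (simp add: t_def k_def)
    then have 2: "deriv (deriv A) z = k * (of_nat (a - 1) * u z + t * deriv u z) / t"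
      using t by (simp add: field_simps)
    have "dlog_quot A z = k * (of_nat (a - 1) * u z + t * deriv u z) / t / (k * u z) - 2 * (k * u z) / (t * k * v z)"
      by (simp add: dlog_quot_def 1 2)
    also have "\<dots> = l z / t"
    proof -
      have lz: "l z = (of_nat (a - 1) * u z + t * deriv u z) / u z - 2 * u z / v z"
        by (simp add: l_def t_def)
      show ?thesis
        unfolding lz using t k(1) elim vz by (simp add: field_simps)
    qed
    finally show ?case
      by (simp add: t_def)
  qed
  have evm: "eventually (\<lambda>z. dlog_quot A z = - 2 / (z - z0) + (z - z0) * m z) (at z0)" if a1: "a = 1"
    using ev evl
  proof eventually_elim
    case (elim z)
    define t where "t = z - z0"
    have t: "t \<noteq> 0"
      using elim by (simp add: t_def)
    have vz: "v z \<noteq> 0" and zU: "z \<in> U"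
      using v elim by blast+
    have u: "u z = v z + t * deriv v z"
      by (simp add: u_def a1 t_def)
    have "(u has_field_derivative deriv v z + (deriv v z + t * deriv (deriv v) z)) (at z)"
      unfolding u_def t_def a1
      using holomorphic_derivI[OF v(1) U(1) zU] holomorphic_derivI[OF hol(1) U(1) zU]
      by (auto intro!: derivative_eq_intros)
    then have du: "deriv u z = deriv v z + (deriv v z + t * deriv (deriv v) z)"
      by (rule DERIV_imp_deriv)
    have uz: "u z \<noteq> 0"
      using elim by simp
    have "l z = t * deriv u z / u z - 2 * u z / v z"
      by (simp add: l_def a1 t_def)
    also have "\<dots> = (t * deriv u z * v z - 2 * u z * u z) / (u z * v z)"
      using vz uz by (simp add: field_simps)
    also have "t * deriv u z * v z - 2 * u z * u z
        = - 2 * (u z * v z) + t\<^sup>2 * (deriv (deriv v) z * v z - 2 * (deriv v z)\<^sup>2)"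
      unfolding du u by (simp add: power2_eq_square algebra_simps)
    also have "\<dots> / (u z * v z) = - 2 + t\<^sup>2 * m z"
      unfolding m_def using vz uz by (simp add: field_simps)
    finally have "l z / t = - 2 / t + t * m z"
      using t by (simp add: field_simps power2_eq_square)
    then show ?case
      using elim by (simp add: t_def)
  qed
  show ?thesis
    by (rule that[of u l m]) (use evd evl evm cont_lmu in auto)
qed

text \<open>The power \<open>5\<close> is the smallest one that makes up for the poles at common zeros of \<open>W(f)\<close> and \<open>W(g)\<close>
that are not simple for both; the square of the last factor cancels the denominator at common simple
zeros. The polynomial \<open>Q\<close> is the radical of \<open>W'\<close> and cancels the poles at critical points.\<close>

definition aux_fun :: "complex poly \<Rightarrow> complex poly \<Rightarrow> (complex \<Rightarrow> complex) \<Rightarrow> (complex \<Rightarrow> complex) \<Rightarrow> complex \<Rightarrow> complex" where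
  "aux_fun W Q f g z = (deriv f z * deriv g z) ^ 5 * (poly Q (f z) * poly Q (g z))\<^sup>2 *
      (dlog_quot (\<lambda>z. poly W (f z)) z - dlog_quot (\<lambda>z. poly W (g z)) z)\<^sup>2 /
      (poly W (f z) * poly W (g z))"

lemma deriv_poly_comp:
  assumes "f field_differentiable at z"
  shows "deriv (\<lambda>z. poly W (f z)) z = poly (pderiv W) (f z) * deriv f z"
proof (rule DERIV_imp_deriv)
  show "((\<lambda>z. poly W (f z)) has_field_derivative poly (pderiv W) (f z) * deriv f z) (at z)"
    using DERIV_chain2[where f = "poly W" and g = f, OF poly_DERIV] assms
    by (simp add: DERIV_deriv_iff_field_differentiable)
qed

lemma deriv2_poly_comp:
  assumes f: "f holomorphic_on U" and U: "open U" "z \<in> U"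
  shows "deriv (deriv (\<lambda>z. poly W (f z))) z
     = poly (pderiv (pderiv W)) (f z) * (deriv f z)\<^sup>2 + poly (pderiv W) (f z) * deriv (deriv f) z"
proof (rule DERIV_imp_deriv)
  have diff: "f field_differentiable at w" if "w \<in> U" for w
    using holomorphic_on_imp_differentiable_at[OF f U(1) that] .
  have d1: "((\<lambda>z. poly (pderiv W) (f z)) has_field_derivative poly (pderiv (pderiv W)) (f z) * deriv f z) (at z)"
    using DERIV_chain2[where f = "poly (pderiv W)" and g = f, OF poly_DERIV] diff[OF U(2)]
    by (simp add: DERIV_deriv_iff_field_differentiable)
  have d2: "(deriv f has_field_derivative deriv (deriv f) z) (at z)"
    using holomorphic_derivI[OF holomorphic_deriv[OF f U(1)] U] .
  have "((\<lambda>z. poly (pderiv W) (f z) * deriv f z) has_field_derivative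
     poly (pderiv (pderiv W)) (f z) * (deriv f z)\<^sup>2 + poly (pderiv W) (f z) * deriv (deriv f) z) (at z)"
    using DERIV_mult[OF d1 d2] by (simp add: power2_eq_square mult_ac add.commute)
  then show "(deriv (\<lambda>z. poly W (f z)) has_field_derivative
     poly (pderiv (pderiv W)) (f z) * (deriv f z)\<^sup>2 + poly (pderiv W) (f z) * deriv (deriv f) z) (at z)"
    by (rule has_field_derivative_transform_within_open[OF _ U]) (simp add: deriv_poly_comp diff)
qed

text \<open>At a common zero of multiplicities \<open>a\<close> and \<open>b\<close> that are not both \<open>1\<close>, the numerator vanishes to order at
least \<open>5 (a - 1) + 5 (b - 1) - 2 \<ge> a + b\<close>, where the \<open>-2\<close> accounts for the pole of the squared
difference. At a common simple zero, that squared difference itself vanishes to order \<open>2\<close>. Away from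
the zeros, the poles of \<open>dlog_quot\<close> come from zeros of \<open>W'(f)\<close> and \<open>f'\<close> and are removed by \<open>Q(f)\<close> and
\<open>f'\<close>.\<close>

lemma aux_fun_tendsto:
  fixes f g :: "complex \<Rightarrow> complex" and W Q V :: "complex poly"
  assumes f: "f holomorphic_on U" and g: "g holomorphic_on U" and U: "open U" "z0 \<in> U"
    and share: "poly W (f z0) = 0 \<longleftrightarrow> poly W (g z0) = 0"
    and simple: "\<And>x. poly W x = 0 \<Longrightarrow> poly (pderiv W) x \<noteq> 0"
    and V: "pderiv (pderiv W) * Q = V * pderiv W"
    and evf: "eventually (\<lambda>z. poly W (f z) \<noteq> 0 \<and> poly (pderiv W) (f z) \<noteq> 0 \<and> deriv f z \<noteq> 0) (at z0)"
    and evg: "eventually (\<lambda>z. poly W (g z) \<noteq> 0 \<and> poly (pderiv W) (g z) \<noteq> 0 \<and> deriv g z \<noteq> 0) (at z0)"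
  shows "\<exists>c. aux_fun W Q f g \<midarrow>z0\<rightarrow> c"
proof (cases "poly W (f z0) = 0")
  case False
  have Vx: "poly (pderiv (pderiv W)) x * poly Q x = poly V x * poly (pderiv W) x" for x
    using arg_cong[OF V, of "\<lambda>p. poly p x"] by simp
  define X where "X = (\<lambda>f z. deriv (deriv f) z * poly Q (f z) + (deriv f z)\<^sup>2 * poly V (f z)
      - 2 * (deriv f z)\<^sup>2 * poly Q (f z) * poly (pderiv W) (f z) / poly W (f z))"
  define \<phi> where "\<phi> = (\<lambda>z. (deriv f z * deriv g z) ^ 3 *
      (deriv g z * poly Q (g z) * X f z - deriv f z * poly Q (f z) * X g z)\<^sup>2 / (poly W (f z) * poly W (g z)))"
  have X: "deriv h z * poly Q (h z) * dlog_quot (\<lambda>z. poly W (h z)) z = X h z"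
    if h: "h holomorphic_on U" and z: "z \<in> U" and nz: "poly (pderiv W) (h z) \<noteq> 0" "deriv h z \<noteq> 0" for h z
  proof -
    define w1 where "w1 = poly (pderiv W) (h z)"
    define w2 where "w2 = poly (pderiv (pderiv W)) (h z)"
    have d1: "deriv (\<lambda>z. poly W (h z)) z = w1 * deriv h z"
      unfolding w1_def by (intro deriv_poly_comp holomorphic_on_imp_differentiable_at[OF h U(1) z])
    have d2: "deriv (deriv (\<lambda>z. poly W (h z))) z = w2 * (deriv h z)\<^sup>2 + w1 * deriv (deriv h) z"
      unfolding w1_def w2_def by (rule deriv2_poly_comp[OF h U(1) z])
    have w: "w2 * poly Q (h z) = poly V (h z) * w1" "w1 \<noteq> 0"
      using Vx nz by (auto simp: w1_def w2_def)
    have "deriv h z * poly Q (h z) * ((w2 * (deriv h z)\<^sup>2 + w1 * deriv (deriv h) z) / (w1 * deriv h z))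
       = ((w2 * poly Q (h z)) * (deriv h z)\<^sup>2 + w1 * poly Q (h z) * deriv (deriv h) z) / w1"
      using nz w by (simp add: field_simps)
    also have "\<dots> = poly V (h z) * (deriv h z)\<^sup>2 + poly Q (h z) * deriv (deriv h) z"
      unfolding w(1) using w(2) by (simp add: add_divide_distrib)
    finally show ?thesis
      unfolding dlog_quot_def d1 d2 X_def w1_def[symmetric]
      by (simp add: right_diff_distrib power2_eq_square mult_ac)
  qed
  have "eventually (\<lambda>z. z \<in> U) (at z0)"
    using eventually_at_in_open'[OF U] .
  then have "eventually (\<lambda>z. \<phi> z = aux_fun W Q f g z) (at z0)"
    using evf evg
  proof eventually_elim
    case (elim z)
    define a where "a = deriv f z"
    define b where "b = deriv g z"
    define x where "x = poly Q (f z)"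
    define y where "y = poly Q (g z)"
    define l1 where "l1 = dlog_quot (\<lambda>z. poly W (f z)) z"
    define l2 where "l2 = dlog_quot (\<lambda>z. poly W (g z)) z"
    note defs = a_def b_def x_def y_def l1_def l2_def
    have Xf: "X f z = a * x * l1" and Xg: "X g z = b * y * l2"
      using X[OF f elim(1)] X[OF g elim(1)] elim by (auto simp: defs)
    have "(a * b) ^ 3 * (b * y * (a * x * l1) - a * x * (b * y * l2))\<^sup>2
        = (a * b) ^ 5 * (x * y)\<^sup>2 * (l1 - l2)\<^sup>2"
      by (simp add: algebra_simps power2_eq_square eval_nat_numeral)
    then show ?case
      by (simp add: \<phi>_def aux_fun_def Xf Xg flip: defs)
  qed
  moreover have "isCont \<phi> z0"
  proof -
    have cont: "isCont F z0" if "F holomorphic_on U" for F :: "complex \<Rightarrow> complex"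
      using that U by (metis continuous_on_eq_continuous_at holomorphic_on_imp_continuous_on)
    have "isCont f z0" "isCont g z0" "isCont (deriv f) z0" "isCont (deriv g) z0"
       "isCont (deriv (deriv f)) z0" "isCont (deriv (deriv g)) z0"
      using f g U by (auto intro!: cont holomorphic_deriv)
    then show ?thesis
      unfolding \<phi>_def X_def using False share by (intro continuous_intros) auto
  qed
  ultimately have "aux_fun W Q f g \<midarrow>z0\<rightarrow> \<phi> z0"
    unfolding isCont_def by (rule Lim_transform_eventually[rotated])
  then show ?thesis ..
next
  case True
  then have True': "poly W (g z0) = 0"
    using share by simp
  have loc: "\<exists>a u l m v. 1 \<le> a \<and> isCont u z0 \<and> isCont l z0 \<and> isCont m z0 \<and> isCont v z0 \<and> v z0 \<noteq> 0 \<and>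
    eventually (\<lambda>z. poly W (h z) = (z - z0) ^ a * v z) (at z0) \<and>
    eventually (\<lambda>z. deriv h z = (z - z0) ^ (a - 1) * u z) (at z0) \<and>
    eventually (\<lambda>z. dlog_quot (\<lambda>z. poly W (h z)) z = l z / (z - z0)) (at z0) \<and>
    (a = 1 \<longrightarrow> eventually (\<lambda>z. dlog_quot (\<lambda>z. poly W (h z)) z = - 2 / (z - z0) + (z - z0) * m z) (at z0))"
    if h: "h holomorphic_on U" and h0: "poly W (h z0) = 0"
      and ev: "eventually (\<lambda>z. poly W (h z) \<noteq> 0 \<and> poly (pderiv W) (h z) \<noteq> 0 \<and> deriv h z \<noteq> 0) (at z0)" for h
  proof -
    have hol: "(\<lambda>z. poly W (h z)) holomorphic_on U"
      using h by (intro holomorphic_intros)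
    have ev': "eventually (\<lambda>z. poly W (h z) \<noteq> 0) (at z0)"
      using ev by eventually_elim auto
    obtain a v U' where v: "open U'" "z0 \<in> U'" "U' \<subseteq> U" "1 \<le> a" "v holomorphic_on U'" "\<And>z. z \<in> U' \<Longrightarrow> v z \<noteq> 0"
       "\<And>z. z \<in> U' \<Longrightarrow> poly W (h z) = (z - z0) ^ a * v z"
      by (rule zero_local_form[OF hol U h0 ev']) (rule that; assumption)
    obtain u l m where ulm: "isCont u z0" "isCont l z0" "isCont m z0"
      "eventually (\<lambda>z. deriv (\<lambda>z. poly W (h z)) z = (z - z0) ^ (a - 1) * u z) (at z0)"
      "eventually (\<lambda>z. dlog_quot (\<lambda>z. poly W (h z)) z = l z / (z - z0)) (at z0)"
      "a = 1 \<Longrightarrow> eventually (\<lambda>z. dlog_quot (\<lambda>z. poly W (h z)) z = - 2 / (z - z0) + (z - z0) * m z) (at z0)"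
      by (rule dlog_quot_local_form[OF v(1,2,5,6,4,7)]) (assumption | rule that)+
    have inU: "eventually (\<lambda>z. z \<in> U') (at z0)"
      using eventually_at_in_open'[OF v(1,2)] .
    have "eventually (\<lambda>z. deriv h z = (z - z0) ^ (a - 1) * (u z / poly (pderiv W) (h z))) (at z0)"
      using ulm(4) ev inU
    proof eventually_elim
      case (elim z)
      have "h field_differentiable at z"
        using holomorphic_on_imp_differentiable_at[OF h U(1)] elim v(3) by auto
      then show ?case
        using elim deriv_poly_comp[of h z W] by (simp add: field_simps)
    qed
    moreover have "isCont (\<lambda>z. u z / poly (pderiv W) (h z)) z0"
    proof -
      have "isCont h z0"
        using h U by (metis continuous_on_eq_continuous_at holomorphic_on_imp_continuous_on)
      then show ?thesis
        using ulm(1) simple[OF h0] by (intro continuous_intros) auto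
    qed
    moreover have "isCont v z0"
      using v by (metis continuous_on_eq_continuous_at holomorphic_on_imp_continuous_on)
    moreover have "eventually (\<lambda>z. poly W (h z) = (z - z0) ^ a * v z) (at z0)"
      using inU by eventually_elim (rule v(7))
    ultimately show ?thesis
      using v(4) v(6)[OF v(2)] ulm(2,3,5,6)
      by (intro exI[of _ a] exI[of _ "\<lambda>z. u z / poly (pderiv W) (h z)"] exI[of _ l] exI[of _ m] exI[of _ v]
          conjI impI) simp_all
  qed
  obtain a u l m v where F: "1 \<le> a" "isCont u z0" "isCont l z0" "isCont m z0" "isCont v z0" "v z0 \<noteq> 0"
    "eventually (\<lambda>z. poly W (f z) = (z - z0) ^ a * v z) (at z0)"
    "eventually (\<lambda>z. deriv f z = (z - z0) ^ (a - 1) * u z) (at z0)"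
    "eventually (\<lambda>z. dlog_quot (\<lambda>z. poly W (f z)) z = l z / (z - z0)) (at z0)"
    "a = 1 \<longrightarrow> eventually (\<lambda>z. dlog_quot (\<lambda>z. poly W (f z)) z = - 2 / (z - z0) + (z - z0) * m z) (at z0)"
    using loc[OF f True evf] by (elim exE conjE)
  obtain b u' l' m' v' where G: "1 \<le> b" "isCont u' z0" "isCont l' z0" "isCont m' z0" "isCont v' z0" "v' z0 \<noteq> 0"
    "eventually (\<lambda>z. poly W (g z) = (z - z0) ^ b * v' z) (at z0)"
    "eventually (\<lambda>z. deriv g z = (z - z0) ^ (b - 1) * u' z) (at z0)"
    "eventually (\<lambda>z. dlog_quot (\<lambda>z. poly W (g z)) z = l' z / (z - z0)) (at z0)"
    "b = 1 \<longrightarrow> eventually (\<lambda>z. dlog_quot (\<lambda>z. poly W (g z)) z = - 2 / (z - z0) + (z - z0) * m' z) (at z0)"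
    using loc[OF g True' evg] by (elim exE conjE)
  have cf: "isCont f z0" "isCont g z0"
    using f g U by (metis continuous_on_eq_continuous_at holomorphic_on_imp_continuous_on)+
  define R where "R = (\<lambda>z. (u z * u' z) ^ 5 * (poly Q (f z) * poly Q (g z))\<^sup>2 / (v z * v' z))"
  have R: "isCont R z0"
    unfolding R_def using F G cf by (intro continuous_intros) auto
  have ne: "eventually (\<lambda>z. z \<noteq> z0) (at z0)"
    by (simp add: eventually_at_filter)
  show ?thesis
  proof (cases "a = 1 \<and> b = 1")
    case True
    have "eventually (\<lambda>z. R z * (m z - m' z)\<^sup>2 = aux_fun W Q f g z) (at z0)"
      using F(7,8) G(7,8) F(10)[rule_format, OF conjunct1[OF True]] G(10)[rule_format, OF conjunct2[OF True]] ne
    proof eventually_elim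
      case (elim z)
      define t where "t = z - z0"
      have t: "t \<noteq> 0"
        using elim by (simp add: t_def)
      have e: "poly W (f z) = t * v z" "poly W (g z) = t * v' z" "deriv f z = u z" "deriv g z = u' z"
        using elim True by (auto simp: t_def)
      have "dlog_quot (\<lambda>z. poly W (f z)) z - dlog_quot (\<lambda>z. poly W (g z)) z = t * (m z - m' z)"
        using elim by (simp add: t_def right_diff_distrib)
      then have "aux_fun W Q f g z = (u z * u' z) ^ 5 * (poly Q (f z) * poly Q (g z))\<^sup>2 * (t * (m z - m' z))\<^sup>2
          / (t * v z * (t * v' z))"
        by (simp only: aux_fun_def e)
      also have "\<dots> = R z * (m z - m' z)\<^sup>2"
        using t by (simp add: R_def power2_eq_square)
      finally show ?case ..
    qed
    moreover have "isCont (\<lambda>z. R z * (m z - m' z)\<^sup>2) z0"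
      using R F G by (intro continuous_intros)
    ultimately show ?thesis
      unfolding isCont_def by (intro exI) (rule Lim_transform_eventually[rotated])
  next
    case False
    \<comment> \<open>The excess \<open>5 (a - 1) + 5 (b - 1) - (a + b + 2)\<close>, nonnegative because \<open>a + b \<ge> 3\<close>.\<close>
    define c where "c = 4 * (a + b) - 12"
    have exps: "5 * (a - 1) + 5 * (b - 1) = c + (a + b + 2)"
      using False F(1) G(1) by (auto simp: c_def)
    have "eventually (\<lambda>z. (z - z0) ^ c * (R z * (l z - l' z)\<^sup>2) = aux_fun W Q f g z) (at z0)"
      using F(7,8,9) G(7,8,9) ne
    proof eventually_elim
      case (elim z)
      define t where "t = z - z0"
      have t: "t \<noteq> 0"
        using elim by (simp add: t_def)
      have e: "poly W (f z) = t ^ a * v z" "poly W (g z) = t ^ b * v' z"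
         "deriv f z = t ^ (a - 1) * u z" "deriv g z = t ^ (b - 1) * u' z"
        using elim by (auto simp: t_def)
      have d: "dlog_quot (\<lambda>z. poly W (f z)) z - dlog_quot (\<lambda>z. poly W (g z)) z = (l z - l' z) / t"
        using elim by (simp add: t_def diff_divide_distrib)
      have p: "(t ^ (a - 1) * u z * (t ^ (b - 1) * u' z)) ^ 5 = t ^ c * (t ^ a * t ^ b * t\<^sup>2) * (u z * u' z) ^ 5"
      proof -
        have "(t ^ (a - 1) * u z * (t ^ (b - 1) * u' z)) ^ 5 = t ^ (5 * (a - 1) + 5 * (b - 1)) * (u z * u' z) ^ 5"
          by (simp add: power_mult_distrib power_add power_mult[symmetric] mult.commute mult.left_commute)
        also have "t ^ (5 * (a - 1) + 5 * (b - 1)) = t ^ c * (t ^ a * t ^ b * t\<^sup>2)"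
          unfolding exps power_add by simp
        finally show ?thesis .
      qed
      have "aux_fun W Q f g z = t ^ c * (t ^ a * t ^ b * t\<^sup>2) * (u z * u' z) ^ 5 *
          (poly Q (f z) * poly Q (g z))\<^sup>2 * ((l z - l' z) / t)\<^sup>2 / (t ^ a * v z * (t ^ b * v' z))"
        by (simp only: aux_fun_def e d p)
      also have "\<dots> = t ^ c * (R z * (l z - l' z)\<^sup>2)"
      proof -
        have "t ^ c * (x * y * t\<^sup>2) * A * B * ((l z - l' z) / t)\<^sup>2 / (x * v z * (y * v' z))
           = t ^ c * (A * B / (v z * v' z) * (l z - l' z)\<^sup>2)" if "x \<noteq> 0" "y \<noteq> 0" for x y A B
          using that t by (simp add: power_divide)
        from this[of "t ^ a" "t ^ b" "(u z * u' z) ^ 5" "(poly Q (f z) * poly Q (g z))\<^sup>2"]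
        show ?thesis
          unfolding R_def using t by (simp only: power_not_zero not_False_eq_True simp_thms)
      qed
      finally show ?case
        by (simp add: t_def)
    qed
    moreover have "isCont (\<lambda>z. (z - z0) ^ c * (R z * (l z - l' z)\<^sup>2)) z0"
      using R F G by (intro continuous_intros)
    ultimately show ?thesis
      unfolding isCont_def by (intro exI) (rule Lim_transform_eventually[rotated])
  qed
qed

section \<open>Quotients of an entire function by a polynomial\<close>

lemma poly_prod_logderiv:
  fixes m :: "complex \<Rightarrow> nat"
  assumes "finite T" "x \<notin> T"
  shows "poly (pderiv (smult c (\<Prod>a\<in>T. [:- a, 1:] ^ m a))) x
     = poly (smult c (\<Prod>a\<in>T. [:- a, 1:] ^ m a)) x * (\<Sum>a\<in>T. of_nat (m a) / (x - a))"
proof -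
  define W where "W = smult c (\<Prod>a\<in>T. [:- a, 1:] ^ m a)"
  have W: "poly W = (\<lambda>x. c * (\<Prod>a\<in>T. (x - a) ^ m a))"
    by (auto simp: W_def poly_prod poly_power)
  have "((\<lambda>x. \<Prod>a\<in>T. (x - a) ^ m a) has_field_derivative
      (\<Prod>a\<in>T. (x - a) ^ m a) * (\<Sum>a\<in>T. of_nat (m a) * 1 / (x - a))) (at x)"
    using assms
    by (intro has_field_derivative_prod_powers[where f = "\<lambda>a x. x - a" and f' = "\<lambda>_. 1"])
       (auto intro!: derivative_eq_intros)
  then have "((\<lambda>x. c * (\<Prod>a\<in>T. (x - a) ^ m a)) has_field_derivative
      c * ((\<Prod>a\<in>T. (x - a) ^ m a) * (\<Sum>a\<in>T. of_nat (m a) * 1 / (x - a)))) (at x)"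
    by (rule DERIV_cmult)
  then have "(poly W has_field_derivative poly W x * (\<Sum>a\<in>T. of_nat (m a) / (x - a))) (at x)"
    unfolding W by (simp add: mult.assoc)
  then have "poly (pderiv W) x = poly W x * (\<Sum>a\<in>T. of_nat (m a) / (x - a))"
    using poly_DERIV[of W x] DERIV_unique by blast
  then show ?thesis
    by (simp only: W_def)
qed

lemma poly_eqI_cofinite:
  fixes p q :: "complex poly"
  assumes "finite T" "\<And>x. x \<notin> T \<Longrightarrow> poly p x = poly q x"
  shows "p = q"
proof (rule ccontr)
  assume "p \<noteq> q"
  then have "finite {x. poly (p - q) x = 0}"
    by (intro poly_roots_finite) auto
  moreover have "- T \<subseteq> {x. poly (p - q) x = 0}"
    using assms(2) by auto
  ultimately have "finite (- T)"
    by (rule finite_subset[rotated])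
  then have "finite (UNIV :: complex set)"
    using assms(1) by (metis Compl_partition finite_Un)
  then show False
    by (simp add: infinite_UNIV_char_0)
qed

text \<open>The logarithmic derivative of a polynomial has simple poles only.\<close>

lemma pderiv_times_radical:
  fixes m :: "complex \<Rightarrow> nat"
  assumes T: "finite T" and W: "W = smult c (\<Prod>a\<in>T. [:- a, 1:] ^ m a)"
  shows "\<exists>V. pderiv W * (\<Prod>a\<in>T. [:- a, 1:]) = V * W"
proof
  define V where "V = (\<Sum>a\<in>T. smult (of_nat (m a)) (\<Prod>b\<in>T - {a}. [:- b, 1:]))"
  show "pderiv W * (\<Prod>a\<in>T. [:- a, 1:]) = V * W"
  proof (rule poly_eqI_cofinite[OF T])
    fix x assume x: "x \<notin> T"
    have "(\<Sum>a\<in>T. of_nat (m a) / (x - a)) * (\<Prod>a\<in>T. x - a) = poly V x"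
      unfolding V_def poly_sum sum_distrib_right
    proof (rule sum.cong)
      fix a assume a: "a \<in> T"
      have "(\<Prod>a\<in>T. x - a) = (x - a) * (\<Prod>b\<in>T - {a}. x - b)"
        using T a by (rule prod.remove)
      moreover have "x - a \<noteq> 0"
        using x a by auto
      ultimately show "of_nat (m a) / (x - a) * (\<Prod>a\<in>T. x - a) = poly (smult (of_nat (m a)) (\<Prod>b\<in>T - {a}. [:- b, 1:])) x"
        by (simp add: poly_prod)
    qed simp
    moreover have "poly (pderiv W) x = poly W x * (\<Sum>a\<in>T. of_nat (m a) / (x - a))"
      unfolding W by (rule poly_prod_logderiv[OF T x])
    ultimately show "poly (pderiv W * (\<Prod>a\<in>T. [:- a, 1:])) x = poly (V * W) x"
      by (simp add: poly_prod mult_ac)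
  qed
qed

text \<open>With \<open>a0\<close> the point of \<open>SA\<close> closest to \<open>w\<close>, all other \<open>|w - a|\<close> are at least a multiple of \<open>1 + |w|\<close>.
One of the five factors \<open>|d|\<close> cancels \<open>|w - a0|\<close>; the other four and \<open>Q\<^sup>2\<close> have together degree \<open>2k + 4\<close>
in \<open>w\<close>, and this is less than the number \<open>n - 1\<close> of the remaining factors of the denominator.\<close>

lemma aux_pointwise:
  fixes SA G :: "complex set"
  assumes SA: "finite SA" and G: "finite G" and c: "c \<noteq> 0" and card: "2 * card G + 6 \<le> card SA"
  shows "\<exists>C\<ge>1. \<forall>w (d::complex) L. 1 \<le> L \<longrightarrow> (\<forall>a\<in>SA. w \<noteq> a \<and> norm d \<le> L * norm (w - a)) \<longrightarrow>
     norm d ^ 5 * norm (\<Prod>b\<in>G. w - b) ^ 2 / norm (c * (\<Prod>a\<in>SA. w - a)) \<le> C * L ^ 5 / (1 + norm w)"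
proof -
  define n where "n = card SA"
  define k where "k = card G"
  have nk: "2 * k + 6 \<le> n"
    using card by (simp add: n_def k_def)
  have SA_ne: "SA \<noteq> {}"
    using card by auto
  define M where "M = 1 + (\<Sum>b\<in>SA \<union> G. norm b)"
  have M: "1 + norm b \<le> M" if "b \<in> SA \<union> G" for b
    using member_le_sum[OF that, of norm] SA G by (simp add: M_def)
  have M1: "M \<ge> 1"
    by (simp add: M_def sum_nonneg)
  define D where "D = insert 1 ((\<lambda>(a, b). norm (a - b)) ` {(a, b) \<in> SA \<times> SA. a \<noteq> b})"
  define \<sigma> where "\<sigma> = Min D"
  have finD: "finite D"
  proof -
    have "finite {(a, b) \<in> SA \<times> SA. a \<noteq> b}"
      by (rule finite_subset[of _ "SA \<times> SA"]) (use SA in auto)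
    then show ?thesis
      by (simp add: D_def)
  qed
  have \<sigma>: "\<sigma> > 0"
    unfolding \<sigma>_def using finD by (subst Min_gr_iff) (auto simp: D_def)
  have sep: "\<sigma> \<le> norm (a - b)" if "a \<in> SA" "b \<in> SA" "a \<noteq> b" for a b
    unfolding \<sigma>_def using finD that by (intro Min_le) (auto simp: D_def image_iff)
  define K where "K = 2 * M / \<sigma> + 1"
  have K: "K \<ge> 1"
    using M1 \<sigma> by (simp add: K_def)
  define C where "C = M ^ (4 + 2 * k) * K ^ (n - 1) / norm c + 1"
  have C0: "M ^ (4 + 2 * k) * K ^ (n - 1) / norm c \<ge> 0"
    using M1 K by simp
  have "norm d ^ 5 * norm (\<Prod>b\<in>G. w - b) ^ 2 / norm (c * (\<Prod>a\<in>SA. w - a)) \<le> C * L ^ 5 / (1 + norm w)"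
    if L: "1 \<le> L" and d: "\<forall>a\<in>SA. w \<noteq> a \<and> norm d \<le> L * norm (w - a)" for w d :: complex and L
  proof -
    define x where "x = 1 + norm w"
    have x: "x \<ge> 1"
      by (simp add: x_def)
    have up: "norm (w - b) \<le> M * x" if "b \<in> SA \<union> G" for b
    proof -
      have "norm (w - b) \<le> norm w + norm b"
        by (rule norm_triangle_ineq4)
      also have "\<dots> \<le> (1 + norm b) * (1 + norm w)"
        by (simp add: algebra_simps)
      also have "\<dots> \<le> M * x"
        unfolding x_def using M[OF that] by (intro mult_right_mono) auto
      finally show ?thesis .
    qed
    have "Min ((\<lambda>a. norm (w - a)) ` SA) \<in> (\<lambda>a. norm (w - a)) ` SA"
      using SA SA_ne by (intro Min_in) auto
    then obtain a0 where a0: "a0 \<in> SA" "Min ((\<lambda>a. norm (w - a)) ` SA) = norm (w - a0)"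
      by auto
    have near: "norm (w - a0) \<le> norm (w - a)" if "a \<in> SA" for a
      unfolding a0(2)[symmetric] using SA that by (intro Min_le) auto
    have far: "x / K \<le> norm (w - a)" if a: "a \<in> SA - {a0}" for a
    proof -
      have "\<sigma> \<le> norm (a - a0)"
        using sep a a0 by auto
      also have "\<dots> \<le> norm (w - a0) + norm (w - a)"
        using norm_triangle_ineq4[of "w - a0" "w - a"] by simp
      also have "\<dots> \<le> 2 * norm (w - a)"
        using near[of a] a by simp
      finally have s: "\<sigma> \<le> 2 * norm (w - a)" .
      have "norm w \<le> norm a + norm (w - a)"
        using norm_triangle_ineq[of a "w - a"] by simp
      then have "x \<le> M + norm (w - a)"
        using M[of a] a by (simp add: x_def)
      moreover have "M * 1 \<le> M * (2 * norm (w - a) / \<sigma>)"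
        using s \<sigma> M1 by (intro mult_left_mono) auto
      moreover have "K * norm (w - a) = M * (2 * norm (w - a) / \<sigma>) + norm (w - a)"
        by (simp add: K_def algebra_simps)
      ultimately have "x \<le> K * norm (w - a)"
        by linarith
      then show ?thesis
        using K by (simp add: pos_divide_le_eq mult.commute)
    qed
    define \<epsilon> where "\<epsilon> = norm (w - a0)"
    have \<epsilon>: "\<epsilon> > 0"
      using d a0 by (auto simp: \<epsilon>_def)
    have "(x / K) ^ (n - 1) = (\<Prod>a\<in>SA - {a0}. x / K)"
      using a0 SA by (simp add: n_def)
    also have "\<dots> \<le> (\<Prod>a\<in>SA - {a0}. norm (w - a))"
      using far x K by (intro prod_mono) auto
    finally have low: "(x / K) ^ (n - 1) \<le> (\<Prod>a\<in>SA - {a0}. norm (w - a))" .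
    have "norm (\<Prod>a\<in>SA. w - a) = \<epsilon> * (\<Prod>a\<in>SA - {a0}. norm (w - a))"
      using prod.remove[OF SA a0(1), of "\<lambda>a. norm (w - a)"] by (simp add: prod_norm \<epsilon>_def)
    then have den: "norm (c * (\<Prod>a\<in>SA. w - a)) \<ge> norm c * (\<epsilon> * (x / K) ^ (n - 1))"
      using low \<epsilon> by (auto simp: norm_mult intro!: mult_left_mono)
    have "norm (\<Prod>b\<in>G. w - b) = (\<Prod>b\<in>G. norm (w - b))"
      by (simp add: prod_norm)
    also have "\<dots> \<le> (\<Prod>b\<in>G. M * x)"
      using up by (intro prod_mono) auto
    finally have "norm (\<Prod>b\<in>G. w - b) \<le> (M * x) ^ k"
      by (simp add: k_def)
    then have Q: "norm (\<Prod>b\<in>G. w - b) ^ 2 \<le> ((M * x) ^ k) ^ 2"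
      by (intro power_mono) auto
    have d1: "norm d \<le> L * \<epsilon>"
      using d a0 by (simp add: \<epsilon>_def)
    also have "\<dots> \<le> L * (M * x)"
      unfolding \<epsilon>_def using up[of a0] a0 L by (intro mult_left_mono) auto
    finally have "norm d ^ 4 \<le> (L * (M * x)) ^ 4"
      by (intro power_mono) auto
    then have "norm d * norm d ^ 4 \<le> (L * \<epsilon>) * (L * (M * x)) ^ 4"
      using d1 \<epsilon> L by (intro mult_mono) auto
    then have "norm d ^ 5 \<le> (L * \<epsilon>) * (L * (M * x)) ^ 4"
      by (simp add: power_Suc[symmetric] del: power_Suc)
    then have num: "norm d ^ 5 * norm (\<Prod>b\<in>G. w - b) ^ 2 \<le> (L * \<epsilon>) * (L * (M * x)) ^ 4 * ((M * x) ^ k) ^ 2"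
      using Q \<epsilon> L M1 x by (intro mult_mono) auto
    have eq: "(L * \<epsilon>) * (L * (M * x)) ^ 4 * ((M * x) ^ k) ^ 2 = L ^ 5 * \<epsilon> * (M ^ (4 + 2 * k) * x ^ (4 + 2 * k))"
    proof -
      have "(L * (M * x)) ^ 4 * ((M * x) ^ k) ^ 2 = L ^ 4 * ((M * x) ^ 4 * (M * x) ^ (2 * k))"
        by (simp add: power_mult_distrib power_mult[symmetric] mult.commute mult.left_commute)
      also have "(M * x) ^ 4 * (M * x) ^ (2 * k) = (M * x) ^ (4 + 2 * k)"
        by (rule power_add[symmetric])
      also have "\<dots> = M ^ (4 + 2 * k) * x ^ (4 + 2 * k)"
        by (rule power_mult_distrib)
      finally show ?thesis
        by (simp add: mult.assoc eval_nat_numeral)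
    qed
    have pos: "norm c * (\<epsilon> * (x / K) ^ (n - 1)) > 0"
      using c \<epsilon> x K by (intro mult_pos_pos zero_less_power divide_pos_pos) auto
    have "norm d ^ 5 * norm (\<Prod>b\<in>G. w - b) ^ 2 / norm (c * (\<Prod>a\<in>SA. w - a))
       \<le> L ^ 5 * \<epsilon> * (M ^ (4 + 2 * k) * x ^ (4 + 2 * k)) / (norm c * (\<epsilon> * (x / K) ^ (n - 1)))"
      using num den pos L \<epsilon> M1 x unfolding eq by (intro frac_le mult_nonneg_nonneg zero_le_power) auto
    also have "\<dots> = M ^ (4 + 2 * k) * K ^ (n - 1) / norm c * L ^ 5 * (x ^ (4 + 2 * k) / x ^ (n - 1))"
      using \<epsilon> by (simp add: power_divide)
    also have "\<dots> \<le> M ^ (4 + 2 * k) * K ^ (n - 1) / norm c * L ^ 5 * (1 / x)"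
    proof (intro mult_left_mono)
      have "x ^ (4 + 2 * k) * x = x ^ Suc (4 + 2 * k)"
        by (rule power_Suc2[symmetric])
      also have "\<dots> \<le> x ^ (n - 1)"
        using nk x by (intro power_increasing) auto
      finally show "x ^ (4 + 2 * k) / x ^ (n - 1) \<le> 1 / x"
        using x by (simp add: field_simps)
      show "M ^ (4 + 2 * k) * K ^ (n - 1) / norm c * L ^ 5 \<ge> 0"
        using C0 L by (intro mult_nonneg_nonneg) auto
    qed
    also have "\<dots> \<le> C * L ^ 5 * (1 / x)"
      using x L by (intro mult_right_mono) (auto simp: C_def)
    finally show ?thesis
      by (simp add: x_def)
  qed
  moreover have "C \<ge> 1"
    using C0 by (simp add: C_def)
  ultimately show ?thesis
    by (intro exI[of _ C]) simp
qed

text \<open>The numerator of the derivative of \<open>f1/p\<close> over \<open>p\<^sup>2\<close>.\<close>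

definition wronski :: "(complex \<Rightarrow> complex) \<Rightarrow> complex poly \<Rightarrow> complex \<Rightarrow> complex" where
  "wronski f1 p z = deriv f1 z * poly p z - f1 z * poly (pderiv p) z"

text \<open>If \<open>f = f1/p\<close>, then off the zeros of \<open>p\<close> these entire functions vanish exactly where \<open>f'\<close> or one of
the \<open>f - x\<close> with \<open>x \<in> X\<close> vanishes.\<close>

definition numerators :: "(complex \<Rightarrow> complex) \<Rightarrow> complex poly \<Rightarrow> complex set \<Rightarrow> (complex \<Rightarrow> complex) set" where
  "numerators f1 p X = insert (wronski f1 p) ((\<lambda>x z. f1 z - x * poly p z) ` X)"

lemma open_poly_nonzero: "open {z. poly (p :: complex poly) z \<noteq> 0}"
  by (intro open_Collect_neq continuous_intros)

lemma deriv_quotient: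
  fixes f f1 :: "complex \<Rightarrow> complex"
  assumes f1: "f1 holomorphic_on UNIV" and f: "\<And>z. poly p z \<noteq> 0 \<Longrightarrow> f z = f1 z / poly p z" and z: "poly p z \<noteq> 0"
  shows "(f has_field_derivative wronski f1 p z / (poly p z)\<^sup>2) (at z)"
proof -
  have d1: "(f1 has_field_derivative deriv f1 z) (at z)"
    using f1 by (simp add: holomorphic_derivI)
  have "((\<lambda>z. f1 z / poly p z) has_field_derivative
       (deriv f1 z * poly p z - f1 z * poly (pderiv p) z) / (poly p z * poly p z)) (at z)"
    by (rule DERIV_divide[OF d1 poly_DERIV z])
  then have "((\<lambda>z. f1 z / poly p z) has_field_derivative wronski f1 p z / (poly p z)\<^sup>2) (at z)"
    by (simp add: wronski_def power2_eq_square)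
  then show ?thesis
    by (rule has_field_derivative_transform_within_open[OF _ open_poly_nonzero[of p]]) (use z f in auto)
qed

lemma holomorphic_quotient:
  assumes f1: "f1 holomorphic_on UNIV" and f: "\<And>z. poly p z \<noteq> 0 \<Longrightarrow> f z = f1 z / poly p z"
  shows "f holomorphic_on {z. poly p z \<noteq> 0}"
  unfolding holomorphic_on_open[OF open_poly_nonzero] using deriv_quotient[OF f1 f] by blast

lemma holomorphic_wronski: "f1 holomorphic_on UNIV \<Longrightarrow> wronski f1 p holomorphic_on UNIV"
  unfolding wronski_def by (intro holomorphic_intros holomorphic_deriv) auto

lemma quotient_logderiv:
  fixes f f1 :: "complex \<Rightarrow> complex"
  assumes f1: "f1 holomorphic_on UNIV" and f: "\<And>z. poly p z \<noteq> 0 \<Longrightarrow> f z = f1 z / poly p z" and z: "poly p z \<noteq> 0"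
  shows "f1 z - x * poly p z \<noteq> 0 \<Longrightarrow> deriv f z = (f z - x) *
      (deriv (\<lambda>z. f1 z - x * poly p z) z / (f1 z - x * poly p z) - deriv (poly p) z / poly p z)"
    and "wronski f1 p z \<noteq> 0 \<Longrightarrow> deriv (deriv f) z = deriv f z *
      (deriv (wronski f1 p) z / wronski f1 p z - 2 * (deriv (poly p) z / poly p z))"
proof -
  have dp: "deriv (poly p) z = poly (pderiv p) z"
    by (rule DERIV_imp_deriv[OF poly_DERIV])
  have d1: "(f1 has_field_derivative deriv f1 z) (at z)"
    using f1 by (simp add: holomorphic_derivI)
  have df: "deriv f z = wronski f1 p z / (poly p z)\<^sup>2" if "poly p z \<noteq> 0" for z
    by (rule DERIV_imp_deriv[OF deriv_quotient[OF f1 f that]])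
  {
    assume nz: "f1 z - x * poly p z \<noteq> 0"
    have dl: "deriv (\<lambda>z. f1 z - x * poly p z) z = deriv f1 z - x * poly (pderiv p) z"
      by (intro DERIV_imp_deriv DERIV_diff d1 DERIV_cmult poly_DERIV)
    have "f z - x = (f1 z - x * poly p z) / poly p z"
      using z by (simp add: f diff_divide_distrib)
    then show "deriv f z = (f z - x) *
      (deriv (\<lambda>z. f1 z - x * poly p z) z / (f1 z - x * poly p z) - deriv (poly p) z / poly p z)"
      unfolding dl dp df[OF z] wronski_def using nz z by (simp add: field_simps power2_eq_square)
  }
  {
    assume nz: "wronski f1 p z \<noteq> 0"
    have dw: "(wronski f1 p has_field_derivative deriv (wronski f1 p) z) (at z)"
      by (rule holomorphic_derivI[OF holomorphic_wronski[OF f1] open_UNIV UNIV_I])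
    have "((\<lambda>z. wronski f1 p z / (poly p z)\<^sup>2) has_field_derivative
      (deriv (wronski f1 p) z * (poly p z)\<^sup>2 - wronski f1 p z * (2 * poly p z * poly (pderiv p) z)) /
       ((poly p z)\<^sup>2 * (poly p z)\<^sup>2)) (at z)"
      using z by (intro DERIV_divide dw) (auto intro!: derivative_eq_intros poly_DERIV)
    then have "(deriv f has_field_derivative
      (deriv (wronski f1 p) z * (poly p z)\<^sup>2 - wronski f1 p z * (2 * poly p z * poly (pderiv p) z)) /
       ((poly p z)\<^sup>2 * (poly p z)\<^sup>2)) (at z)"
      by (rule has_field_derivative_transform_within_open[OF _ open_poly_nonzero[of p]]) (use z df in auto)
    then have dd: "deriv (deriv f) z = (deriv (wronski f1 p) z * (poly p z)\<^sup>2 - wronski f1 p z * (2 * poly p z * poly (pderiv p) z)) /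
       ((poly p z)\<^sup>2 * (poly p z)\<^sup>2)"
      by (rule DERIV_imp_deriv)
    show "deriv (deriv f) z = deriv f z *
      (deriv (wronski f1 p) z / wronski f1 p z - 2 * (deriv (poly p) z / poly p z))"
      unfolding dp dd df[OF z] using nz z by (simp add: field_simps power2_eq_square)
  }
qed

text \<open>Everything in the auxiliary function is a combination of logarithmic derivatives of finitely many
entire functions, which good circles control.\<close>

lemma quotient_logderiv_bounds:
  fixes f f1 :: "complex \<Rightarrow> complex"
  assumes f1: "f1 holomorphic_on UNIV" and f: "\<And>z. poly p z \<noteq> 0 \<Longrightarrow> f z = f1 z / poly p z"
    and SA: "finite SA" and G: "finite G" and c: "c \<noteq> 0" "c' \<noteq> 0"
    and W: "W = smult c (\<Prod>a\<in>SA. [:- a, 1:])" and W': "pderiv W = smult c' (\<Prod>a\<in>G. [:- a, 1:] ^ m a)"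
    and reg: "\<And>F. F \<in> insert (poly p) (numerators f1 p (SA \<union> G)) \<Longrightarrow> F z \<noteq> 0 \<and> norm (deriv F z / F z) \<le> L"
  shows "\<forall>x\<in>SA \<union> G. f z \<noteq> x \<and> norm (deriv f z) \<le> (2 * L) * norm (f z - x)"
    and "norm (dlog_quot (\<lambda>z. poly W (f z)) z) \<le> (3 + 2 * (\<Sum>a\<in>G. real (m a)) + 4 * real (card SA)) * L"
    and "deriv f z \<noteq> 0" and "poly W (f z) \<noteq> 0" and "poly (pderiv W) (f z) \<noteq> 0"
proof -
  have pz: "poly p z \<noteq> 0" and lp: "norm (deriv (poly p) z / poly p z) \<le> L"
    using reg[of "poly p"] by auto
  have wz: "wronski f1 p z \<noteq> 0" and lw: "norm (deriv (wronski f1 p) z / wronski f1 p z) \<le> L"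
    using reg[of "wronski f1 p"] by (auto simp: numerators_def)
  have lin: "f1 z - x * poly p z \<noteq> 0 \<and>
     norm (deriv (\<lambda>z. f1 z - x * poly p z) z / (f1 z - x * poly p z)) \<le> L" if "x \<in> SA \<union> G" for x
    using reg[of "\<lambda>z. f1 z - x * poly p z"] that by (auto simp: numerators_def)
  have L: "L \<ge> 0"
    using lp norm_ge_zero order_trans by blast
  have fx: "f z \<noteq> x" "norm (deriv f z / (f z - x)) \<le> 2 * L" if x: "x \<in> SA \<union> G" for x
  proof -
    have "f z - x = (f1 z - x * poly p z) / poly p z"
      using pz by (simp add: f diff_divide_distrib)
    then show fx: "f z \<noteq> x"
      using lin[OF x] pz by auto
    have "deriv f z / (f z - x) =
      deriv (\<lambda>z. f1 z - x * poly p z) z / (f1 z - x * poly p z) - deriv (poly p) z / poly p z"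
      using quotient_logderiv(1)[OF f1 f pz conjunct1[OF lin[OF x]]] fx by simp
    also have "norm \<dots> \<le> L + L"
      using lin[OF x] lp by (intro order_trans[OF norm_triangle_ineq4] add_mono) auto
    finally show "norm (deriv f z / (f z - x)) \<le> 2 * L"
      by simp
  qed
  show "\<forall>x\<in>SA \<union> G. f z \<noteq> x \<and> norm (deriv f z) \<le> (2 * L) * norm (f z - x)"
  proof (intro ballI conjI)
    fix x assume x: "x \<in> SA \<union> G"
    show "f z \<noteq> x"
      by (rule fx(1)[OF x])
    show "norm (deriv f z) \<le> (2 * L) * norm (f z - x)"
      using fx[OF x] by (simp add: norm_divide pos_divide_le_eq)
  qed
  have df: "deriv f z = wronski f1 p z / (poly p z)\<^sup>2"
    by (rule DERIV_imp_deriv[OF deriv_quotient[OF f1 f pz]])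
  show dfnz: "deriv f z \<noteq> 0"
    using wz pz by (simp add: df)
  have pW: "poly W x = c * (\<Prod>a\<in>SA. x - a)" for x
    by (simp add: W poly_prod)
  have pW': "poly (pderiv W) x = c' * (\<Prod>a\<in>G. (x - a) ^ m a)" for x
    by (simp add: W' poly_prod poly_power)
  show Wnz: "poly W (f z) \<noteq> 0"
    unfolding pW using c SA fx(1) by (auto simp: prod_zero_iff)
  show W'nz: "poly (pderiv W) (f z) \<noteq> 0"
    unfolding pW' using c G fx(1) by (auto simp: prod_zero_iff)
  have hol: "f holomorphic_on {z. poly p z \<noteq> 0}"
    by (rule holomorphic_quotient[OF f1 f])
  have zU: "z \<in> {z. poly p z \<noteq> 0}"
    using pz by simp
  have d1: "deriv (\<lambda>z. poly W (f z)) z = poly (pderiv W) (f z) * deriv f z"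
    by (intro deriv_poly_comp holomorphic_on_imp_differentiable_at[OF hol open_poly_nonzero zU])
  have d2: "deriv (deriv (\<lambda>z. poly W (f z))) z
     = poly (pderiv (pderiv W)) (f z) * (deriv f z)\<^sup>2 + poly (pderiv W) (f z) * deriv (deriv f) z"
    by (rule deriv2_poly_comp[OF hol open_poly_nonzero zU])
  have e1: "poly (pderiv W) (f z) = poly W (f z) * (\<Sum>a\<in>SA. 1 / (f z - a))"
    using poly_prod_logderiv[OF SA, of "f z" c "\<lambda>_. 1"] fx(1) by (auto simp: W)
  have e2: "poly (pderiv (pderiv W)) (f z) = poly (pderiv W) (f z) * (\<Sum>a\<in>G. of_nat (m a) / (f z - a))"
    unfolding W' using fx(1) by (intro poly_prod_logderiv G) auto
  define S1 where "S1 = (\<Sum>a\<in>SA. deriv f z / (f z - a))"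
  define S2 where "S2 = (\<Sum>a\<in>G. of_nat (m a) * (deriv f z / (f z - a)))"
  define S3 where "S3 = deriv (deriv f) z / deriv f z"
  have "deriv (\<lambda>z. poly W (f z)) z / poly W (f z) = (\<Sum>a\<in>SA. 1 / (f z - a)) * deriv f z"
    unfolding d1 using Wnz by (subst e1) simp
  then have A: "deriv (\<lambda>z. poly W (f z)) z / poly W (f z) = S1"
    by (simp add: S1_def sum_distrib_right)
  have "deriv (deriv (\<lambda>z. poly W (f z))) z / deriv (\<lambda>z. poly W (f z)) z
     = (\<Sum>a\<in>G. of_nat (m a) / (f z - a)) * deriv f z + S3"
    unfolding d1 d2 e2 S3_def using W'nz dfnz by (simp add: field_simps power2_eq_square)
  then have B: "deriv (deriv (\<lambda>z. poly W (f z))) z / deriv (\<lambda>z. poly W (f z)) z = S2 + S3"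
    by (simp add: S2_def sum_distrib_right)
  have "dlog_quot (\<lambda>z. poly W (f z)) z = S2 + S3 - 2 * S1"
    unfolding dlog_quot_def B A[symmetric] by simp
  then have "norm (dlog_quot (\<lambda>z. poly W (f z)) z) \<le> norm S2 + norm S3 + 2 * norm S1"
    using norm_triangle_ineq4[of "S2 + S3" "2 * S1"] norm_triangle_ineq[of S2 S3] by (simp add: norm_mult)
  also have "norm S1 \<le> (\<Sum>a\<in>SA. 2 * L)"
    unfolding S1_def using fx(2) by (intro sum_norm_le) auto
  also have "norm S2 \<le> (\<Sum>a\<in>G. real (m a) * (2 * L))"
    unfolding S2_def
  proof (rule sum_norm_le)
    fix a assume "a \<in> G"
    then have "real (m a) * norm (deriv f z / (f z - a)) \<le> real (m a) * (2 * L)"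
      using fx(2)[of a] by (intro mult_left_mono) auto
    then show "norm (of_nat (m a) * (deriv f z / (f z - a))) \<le> real (m a) * (2 * L)"
      by (simp only: norm_mult norm_of_nat)
  qed
  also have "norm S3 \<le> 3 * L"
  proof -
    have "S3 = deriv (wronski f1 p) z / wronski f1 p z - 2 * (deriv (poly p) z / poly p z)"
      unfolding S3_def using quotient_logderiv(2)[OF f1 f pz wz] dfnz by simp
    also have "norm \<dots> \<le> L + norm (2 * (deriv (poly p) z / poly p z))"
      using lw by (intro order_trans[OF norm_triangle_ineq4] add_mono) auto
    also have "norm (2 * (deriv (poly p) z / poly p z)) \<le> 2 * L"
      using lp unfolding norm_mult by simp
    finally show ?thesis
      by simp
  qed
  finally show "norm (dlog_quot (\<lambda>z. poly W (f z)) z) \<le> (3 + 2 * (\<Sum>a\<in>G. real (m a)) + 4 * real (card SA)) * L"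
    by (simp add: algebra_simps sum_distrib_left sum_distrib_right)
qed

section \<open>A pair of functions sharing the roots of a polynomial\<close>

lemma eventually_entire_nonzero:
  assumes "F holomorphic_on UNIV" "\<exists>z. F z \<noteq> 0"
  shows "eventually (\<lambda>z. F z \<noteq> 0) (at z0)"
proof -
  obtain \<beta> where "F \<beta> \<noteq> 0"
    using assms(2) by blast
  then show ?thesis
    using non_zero_neighbour_alt[OF assms(1) open_UNIV connected_UNIV UNIV_I UNIV_I] by auto
qed

lemma meromorphic_poly_comp:
  assumes "f meromorphic_on S"
  shows "(\<lambda>z. poly W (f z)) meromorphic_on S"
  unfolding poly_altdef using assms by (intro meromorphic_intros)

text \<open>Two non-constant functions with common denominator \<open>p\<close> that share the roots of \<open>W\<close>; these form the set
\<open>SA\<close>, and \<open>G\<close> is the set of critical points of \<open>W\<close>. That \<open>wronski f1 p\<close> does not vanish identically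
means that \<open>f\<close> is not constant.\<close>

locale shared_pair =
  fixes f g f1 g1 :: "complex \<Rightarrow> complex" and p W :: "complex poly" and SA G :: "complex set"
    and c c' :: complex and m :: "complex \<Rightarrow> nat"
  assumes f1: "f1 holomorphic_on UNIV" and g1: "g1 holomorphic_on UNIV" and p: "p \<noteq> 0"
    and f: "\<And>z. poly p z \<noteq> 0 \<Longrightarrow> f z = f1 z / poly p z"
    and g: "\<And>z. poly p z \<noteq> 0 \<Longrightarrow> g z = g1 z / poly p z"
    and f_mero: "f meromorphic_on UNIV" and g_mero: "g meromorphic_on UNIV"
    and SA: "finite SA" and G: "finite G" and c: "c \<noteq> 0" and c': "c' \<noteq> 0"
    and W: "W = smult c (\<Prod>a\<in>SA. [:- a, 1:])"
    and W': "pderiv W = smult c' (\<Prod>a\<in>G. [:- a, 1:] ^ m a)"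
    and disj: "SA \<inter> G = {}"
    and share: "\<And>z. poly p z \<noteq> 0 \<Longrightarrow> poly W (f z) = 0 \<longleftrightarrow> poly W (g z) = 0"
    and ncf: "\<exists>z. wronski f1 p z \<noteq> 0" and ncg: "\<exists>z. wronski g1 p z \<noteq> 0"
begin

text \<open>Outside the zeros of these functions, \<open>f\<close>, \<open>g\<close> and their derivatives are regular for the auxiliary
function.\<close>

definition FF :: "(complex \<Rightarrow> complex) set" where
  "FF = insert (poly p) (numerators f1 p (SA \<union> G) \<union> numerators g1 p (SA \<union> G))"

definition reg :: "complex \<Rightarrow> bool" where
  "reg z \<longleftrightarrow> (\<forall>F\<in>FF. F z \<noteq> 0)"

lemma finite_FF: "finite FF"
  using SA G by (simp add: FF_def numerators_def)

lemma holomorphic_FF: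
  assumes "F \<in> FF"
  shows "F holomorphic_on UNIV"
proof -
  have lin: "(\<lambda>z. h z - x * poly p z) holomorphic_on UNIV" if "h holomorphic_on UNIV" for h x
    using that by (intro holomorphic_intros)
  have "poly p holomorphic_on UNIV"
    using poly_holomorphic_on[of "\<lambda>z. z" UNIV p] by simp
  then show ?thesis
    using assms lin f1 g1 holomorphic_wronski unfolding FF_def numerators_def by blast
qed

lemma nonzero_FF:
  assumes "F \<in> FF"
  shows "\<exists>z. F z \<noteq> 0"
proof -
  have lin: "\<exists>z. h z - x * poly p z \<noteq> 0" if h: "\<exists>z. wronski h p z \<noteq> 0" for h x
  proof (rule ccontr)
    assume "\<not> (\<exists>z. h z - x * poly p z \<noteq> 0)"
    then have "h = (\<lambda>z. x * poly p z)"
      by auto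
    then have "wronski h p z = 0" for z
      unfolding wronski_def by (simp add: DERIV_imp_deriv[OF DERIV_cmult[OF poly_DERIV]])
    then show False
      using h by simp
  qed
  have "\<exists>z. poly p z \<noteq> 0"
    using p poly_all_0_iff_0 by blast
  then show ?thesis
    using assms lin ncf ncg unfolding FF_def numerators_def by blast
qed

lemma eventually_reg: "eventually reg (at z0)"
  unfolding reg_def using finite_FF eventually_entire_nonzero[OF holomorphic_FF nonzero_FF]
  by (intro eventually_ball_finite) auto

lemma open_reg: "open {z. reg z}"
proof -
  have "{z. reg z} = (\<Inter>F\<in>FF. {z. F z \<noteq> 0})"
    by (auto simp: reg_def)
  moreover have "open {z. F z \<noteq> 0}" if "F \<in> FF" for F
    using holomorphic_on_imp_continuous_on[OF holomorphic_FF[OF that]] by (intro open_Collect_neq) auto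
  ultimately show ?thesis
    using finite_FF by (auto intro!: open_INT)
qed

lemma reg_p: "reg z \<Longrightarrow> poly p z \<noteq> 0"
  by (auto simp: reg_def FF_def)

lemma bounds_f:
  assumes "\<And>F. F \<in> insert (poly p) (numerators f1 p (SA \<union> G)) \<Longrightarrow> F z \<noteq> 0 \<and> norm (deriv F z / F z) \<le> L"
  shows "\<forall>x\<in>SA \<union> G. f z \<noteq> x \<and> norm (deriv f z) \<le> (2 * L) * norm (f z - x)"
    and "norm (dlog_quot (\<lambda>z. poly W (f z)) z) \<le> (3 + 2 * (\<Sum>a\<in>G. real (m a)) + 4 * real (card SA)) * L"
    and "deriv f z \<noteq> 0" and "poly W (f z) \<noteq> 0" and "poly (pderiv W) (f z) \<noteq> 0"
  subgoal by (rule quotient_logderiv_bounds(1)[OF f1 f SA G c c' W W' assms])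
  subgoal by (rule quotient_logderiv_bounds(2)[OF f1 f SA G c c' W W' assms])
  subgoal by (rule quotient_logderiv_bounds(3)[OF f1 f SA G c c' W W' assms])
  subgoal by (rule quotient_logderiv_bounds(4)[OF f1 f SA G c c' W W' assms])
  subgoal by (rule quotient_logderiv_bounds(5)[OF f1 f SA G c c' W W' assms])
  done

lemma bounds_g:
  assumes "\<And>F. F \<in> insert (poly p) (numerators g1 p (SA \<union> G)) \<Longrightarrow> F z \<noteq> 0 \<and> norm (deriv F z / F z) \<le> L"
  shows "\<forall>x\<in>SA \<union> G. g z \<noteq> x \<and> norm (deriv g z) \<le> (2 * L) * norm (g z - x)"
    and "norm (dlog_quot (\<lambda>z. poly W (g z)) z) \<le> (3 + 2 * (\<Sum>a\<in>G. real (m a)) + 4 * real (card SA)) * L"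
    and "deriv g z \<noteq> 0" and "poly W (g z) \<noteq> 0" and "poly (pderiv W) (g z) \<noteq> 0"
  subgoal by (rule quotient_logderiv_bounds(1)[OF g1 g SA G c c' W W' assms])
  subgoal by (rule quotient_logderiv_bounds(2)[OF g1 g SA G c c' W W' assms])
  subgoal by (rule quotient_logderiv_bounds(3)[OF g1 g SA G c c' W W' assms])
  subgoal by (rule quotient_logderiv_bounds(4)[OF g1 g SA G c c' W W' assms])
  subgoal by (rule quotient_logderiv_bounds(5)[OF g1 g SA G c c' W W' assms])
  done

lemma reg_facts:
  assumes "reg z"
  shows "\<And>x. x \<in> SA \<union> G \<Longrightarrow> f z \<noteq> x \<and> g z \<noteq> x"
    "deriv f z \<noteq> 0" "poly W (f z) \<noteq> 0" "poly (pderiv W) (f z) \<noteq> 0"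
    "deriv g z \<noteq> 0" "poly W (g z) \<noteq> 0" "poly (pderiv W) (g z) \<noteq> 0"
proof -
  define L where "L = (\<Sum>F\<in>FF. norm (deriv F z / F z))"
  have L: "F z \<noteq> 0 \<and> norm (deriv F z / F z) \<le> L" if "F \<in> FF" for F
    using assms that finite_FF member_le_sum[OF that, of "\<lambda>F. norm (deriv F z / F z)"]
    by (auto simp: L_def reg_def)
  have Lf: "F z \<noteq> 0 \<and> norm (deriv F z / F z) \<le> L" if "F \<in> insert (poly p) (numerators f1 p (SA \<union> G))" for F
    using that by (intro L) (auto simp: FF_def)
  have Lg: "F z \<noteq> 0 \<and> norm (deriv F z / F z) \<le> L" if "F \<in> insert (poly p) (numerators g1 p (SA \<union> G))" for F
    using that by (intro L) (auto simp: FF_def)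
  show "\<And>x. x \<in> SA \<union> G \<Longrightarrow> f z \<noteq> x \<and> g z \<noteq> x"
    "deriv f z \<noteq> 0" "poly W (f z) \<noteq> 0" "poly (pderiv W) (f z) \<noteq> 0"
    "deriv g z \<noteq> 0" "poly W (g z) \<noteq> 0" "poly (pderiv W) (g z) \<noteq> 0"
    using bounds_f(1,3,4,5)[of z L] bounds_g(1,3,4,5)[of z L] Lf Lg by simp_all
qed

lemma hol_f: "f holomorphic_on {z. poly p z \<noteq> 0}"
  by (rule holomorphic_quotient[OF f1 f])

lemma hol_g: "g holomorphic_on {z. poly p z \<noteq> 0}"
  by (rule holomorphic_quotient[OF g1 g])

definition Q :: "complex poly" where "Q = (\<Prod>a\<in>G. [:- a, 1:])"

definition \<Phi> :: "complex \<Rightarrow> complex" where "\<Phi> = aux_fun W Q f g"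

lemma holomorphic_\<Phi>: "\<Phi> holomorphic_on {z. reg z}"
proof -
  have sub: "{z. reg z} \<subseteq> {z. poly p z \<noteq> 0}"
    using reg_p by auto
  note hf = holomorphic_on_subset[OF hol_f sub] and hg = holomorphic_on_subset[OF hol_g sub]
  have dnz: "deriv (\<lambda>z. poly W (f z)) z \<noteq> 0" "deriv (\<lambda>z. poly W (g z)) z \<noteq> 0" if "reg z" for z
    using reg_facts[OF that] that
      deriv_poly_comp[OF holomorphic_on_imp_differentiable_at[OF hf open_reg], of z W]
      deriv_poly_comp[OF holomorphic_on_imp_differentiable_at[OF hg open_reg], of z W] by simp_all
  have Wf: "(\<lambda>z. poly W (f z)) holomorphic_on {z. reg z}" "(\<lambda>z. poly W (g z)) holomorphic_on {z. reg z}"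
    using hf hg by (auto intro!: holomorphic_intros)
  note der = holomorphic_deriv[OF _ open_reg]
  have dl: "dlog_quot (\<lambda>z. poly W (f z)) holomorphic_on {z. reg z}"
       "dlog_quot (\<lambda>z. poly W (g z)) holomorphic_on {z. reg z}"
    unfolding dlog_quot_def
    by (intro holomorphic_on_diff holomorphic_on_divide holomorphic_on_mult holomorphic_on_const
          der[OF der[OF Wf(1)]] der[OF der[OF Wf(2)]] der[OF Wf(1)] der[OF Wf(2)] Wf;
        use dnz reg_facts in simp)+
  show ?thesis
    unfolding \<Phi>_def aux_fun_def
    by (intro holomorphic_on_diff holomorphic_on_divide holomorphic_on_mult holomorphic_on_power
          poly_holomorphic_on hf hg der[OF hf] der[OF hg] dl) (use reg_facts in simp)
qed

lemma analytic_\<Phi>: "reg z \<Longrightarrow> \<Phi> analytic_on {z}"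
  using holomorphic_\<Phi> open_reg by (meson analytic_at mem_Collect_eq)

lemma simple_zeros: "poly W x = 0 \<Longrightarrow> poly (pderiv W) x \<noteq> 0"
proof -
  assume "poly W x = 0"
  then have "x \<in> SA"
    using c SA by (auto simp: W poly_prod prod_zero_iff)
  then have "x \<notin> G"
    using disj by auto
  then show "poly (pderiv W) x \<noteq> 0"
    using c' G by (auto simp: W' poly_prod poly_power prod_zero_iff)
qed

lemma meromorphic_\<Phi>: "\<Phi> meromorphic_on UNIV"
  unfolding \<Phi>_def aux_fun_def dlog_quot_def
  by (intro meromorphic_intros meromorphic_poly_comp f_mero g_mero)

lemma poles_\<Phi>: "is_pole \<Phi> z \<Longrightarrow> poly p z = 0"
proof (rule ccontr)
  assume pole: "is_pole \<Phi> z" and pz: "poly p z \<noteq> 0"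
  obtain V where V: "pderiv (pderiv W) * Q = V * pderiv W"
    using pderiv_times_radical[OF G W'] unfolding Q_def by blast
  have "eventually (\<lambda>z. poly W (f z) \<noteq> 0 \<and> poly (pderiv W) (f z) \<noteq> 0 \<and> deriv f z \<noteq> 0) (at z)"
    using eventually_reg[of z] by eventually_elim (use reg_facts in blast)
  moreover have "eventually (\<lambda>z. poly W (g z) \<noteq> 0 \<and> poly (pderiv W) (g z) \<noteq> 0 \<and> deriv g z \<noteq> 0) (at z)"
    using eventually_reg[of z] by eventually_elim (use reg_facts in blast)
  moreover have "z \<in> {z. poly p z \<noteq> 0}"
    using pz by simp
  ultimately obtain l where "aux_fun W Q f g \<midarrow>z\<rightarrow> l"
    using aux_fun_tendsto[OF hol_f hol_g open_poly_nonzero _ share[OF pz] simple_zeros V] by blast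
  then show False
    using pole not_tendsto_and_filterlim_at_infinity[of "at z" \<Phi> l] by (auto simp: is_pole_def \<Phi>_def)
qed

text \<open>The growth of the pair is measured by \<open>y\<close>, which is increasing, at least \<open>1\<close> and at least \<open>ln R\<close>. The
maximum with \<open>1\<close> extends these properties to all real \<open>R\<close>.\<close>

definition u :: "complex \<Rightarrow> real" where "u z = 1 + norm (f1 z) + norm (g1 z)"

definition U :: "real \<Rightarrow> real" where "U R = Sup (u ` cball 0 (max 1 R))"

definition y :: "real \<Rightarrow> real" where "y R = 1 + ln (max 1 R) + ln (U R)"

lemma u_bdd: "bdd_above (u ` cball 0 R)"
proof -
  have "continuous_on (cball 0 R) u"
    unfolding u_def using f1 g1
    by (intro continuous_intros holomorphic_on_imp_continuous_on holomorphic_on_subset[OF f1]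
        holomorphic_on_subset[OF g1]) auto
  then have "compact (u ` cball 0 R)"
    by (rule compact_continuous_image) simp
  then show ?thesis
    by (simp add: bounded_imp_bdd_above compact_imp_bounded)
qed

lemma u_le_U: "norm z \<le> max 1 R \<Longrightarrow> u z \<le> U R"
  unfolding U_def by (intro cSUP_upper u_bdd) auto

lemma U_le: "(\<And>z. norm z \<le> max 1 R \<Longrightarrow> u z \<le> b) \<Longrightarrow> U R \<le> b"
  unfolding U_def by (intro cSUP_least) auto

lemma U_ge_1: "U R \<ge> 1"
proof -
  have "1 \<le> u 0"
    unfolding u_def using norm_ge_zero[of "f1 0"] norm_ge_zero[of "g1 0"] by linarith
  also have "u 0 \<le> U R"
    by (rule u_le_U) simp
  finally show ?thesis .
qed

lemma y_mono: "r \<le> s \<Longrightarrow> y r \<le> y s"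
proof -
  assume rs: "r \<le> s"
  have "U r \<le> U s"
    using rs by (intro U_le u_le_U) auto
  then show ?thesis
    using rs U_ge_1[of r] unfolding y_def by (intro add_mono ln_mono) auto
qed

lemma y_ge_1: "1 \<le> y r"
  using U_ge_1[of r] by (simp add: y_def)

lemma ln_le_y: "1 \<le> r \<Longrightarrow> ln r \<le> y r"
  using U_ge_1[of r] by (simp add: y_def max_def)

text \<open>Growth controlled by \<open>y\<close>. The factor \<open>R/(R - s)\<close> makes the class closed under differentiation, by
the Cauchy estimate at an intermediate radius.\<close>

definition dominated :: "(complex \<Rightarrow> complex) \<Rightarrow> bool" where
  "dominated F \<longleftrightarrow> (\<exists>C\<ge>1. \<forall>s R z. 1 \<le> s \<longrightarrow> s < R \<longrightarrow> norm z \<le> s \<longrightarrow>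
      norm (F z) \<le> exp (C * (y R * (R / (R - s)))))"

lemma growth_factor_ge:
  assumes "1 \<le> s" "s < R"
  shows "1 \<le> y R * (R / (R - s))" "y R \<le> y R * (R / (R - s))" "R / (R - s) \<le> y R * (R / (R - s))"
proof -
  have q: "1 \<le> R / (R - s)"
    using assms by simp
  then show "y R \<le> y R * (R / (R - s))" "R / (R - s) \<le> y R * (R / (R - s))"
    using mult_left_mono[OF q, of "y R"] mult_right_mono[OF y_ge_1[of R], of "R / (R - s)"] y_ge_1[of R] by auto
  then show "1 \<le> y R * (R / (R - s))"
    using q by linarith
qed

lemma dominated_f1: "dominated f1" and dominated_g1: "dominated g1"
proof -
  have "norm (f1 z) \<le> exp (1 * (y R * (R / (R - s)))) \<and> norm (g1 z) \<le> exp (1 * (y R * (R / (R - s))))"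
    if s: "1 \<le> s" "s < R" "norm z \<le> s" for s R z
  proof -
    have "u z \<le> U R"
      using s by (intro u_le_U) auto
    also have "U R = exp (ln (U R))"
      using U_ge_1[of R] by simp
    also have "\<dots> \<le> exp (1 * (y R * (R / (R - s))))"
    proof -
      have "ln (U R) \<le> y R"
        by (simp add: y_def)
      then show ?thesis
        using growth_factor_ge(2)[OF s(1,2)] by (subst exp_le_cancel_iff) linarith
    qed
    finally show ?thesis
      unfolding u_def using norm_ge_zero[of "f1 z"] norm_ge_zero[of "g1 z"] by linarith
  qed
  then show "dominated f1" "dominated g1"
    unfolding dominated_def by (intro exI[of _ 1]; simp)+
qed

lemma dominated_const: "dominated (\<lambda>_. a)"
  unfolding dominated_def
proof (intro exI[of _ "1 + norm a"] conjI allI impI)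
  fix s R :: real and z :: complex
  assume s: "1 \<le> s" "s < R"
  have "norm a \<le> exp (norm a)"
    using exp_ge_add_one_self[of "norm a"] by linarith
  also have "\<dots> \<le> exp ((1 + norm a) * (y R * (R / (R - s))))"
    using growth_factor_ge(1)[OF s] mult_left_mono[OF growth_factor_ge(1)[OF s], of "1 + norm a"] by (subst exp_le_cancel_iff) simp
  finally show "norm a \<le> exp ((1 + norm a) * (y R * (R / (R - s))))" .
qed simp

lemma dominated_id: "dominated (\<lambda>z. z)"
  unfolding dominated_def
proof (intro exI[of _ 1] conjI allI impI)
  fix s R :: real and z :: complex
  assume s: "1 \<le> s" "s < R" and z: "norm z \<le> s"
  have "norm z \<le> exp (ln R)"
    using s z by simp
  also have "\<dots> \<le> exp (1 * (y R * (R / (R - s))))"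
    using growth_factor_ge(2)[OF s] ln_le_y[of R] s by (subst exp_le_cancel_iff) linarith
  finally show "norm z \<le> exp (1 * (y R * (R / (R - s))))" .
qed simp

lemma dominated_mult:
  assumes "dominated F" "dominated H"
  shows "dominated (\<lambda>z. F z * H z)"
proof -
  obtain a b where a: "a \<ge> 1" "\<forall>s R z. 1 \<le> s \<longrightarrow> s < R \<longrightarrow> norm z \<le> s \<longrightarrow>
      norm (F z) \<le> exp (a * (y R * (R / (R - s))))"
    and b: "b \<ge> 1" "\<forall>s R z. 1 \<le> s \<longrightarrow> s < R \<longrightarrow> norm z \<le> s \<longrightarrow>
      norm (H z) \<le> exp (b * (y R * (R / (R - s))))"
    using assms unfolding dominated_def by (elim exE conjE)
  show ?thesis
    unfolding dominated_def
  proof (intro exI[of _ "a + b"] conjI allI impI)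
    fix s R :: real and z :: complex
    assume s: "1 \<le> s" "s < R" "norm z \<le> s"
    have "norm (F z) * norm (H z) \<le> exp (a * (y R * (R / (R - s)))) * exp (b * (y R * (R / (R - s))))"
      using a(2) b(2) s by (intro mult_mono) auto
    then show "norm (F z * H z) \<le> exp ((a + b) * (y R * (R / (R - s))))"
      unfolding norm_mult distrib_right exp_add .
  qed (use a b in simp)
qed

lemma dominated_add:
  assumes "dominated F" "dominated H"
  shows "dominated (\<lambda>z. F z + H z)"
proof -
  obtain a b where a: "a \<ge> 1" "\<forall>s R z. 1 \<le> s \<longrightarrow> s < R \<longrightarrow> norm z \<le> s \<longrightarrow>
      norm (F z) \<le> exp (a * (y R * (R / (R - s))))"
    and b: "b \<ge> 1" "\<forall>s R z. 1 \<le> s \<longrightarrow> s < R \<longrightarrow> norm z \<le> s \<longrightarrow>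
      norm (H z) \<le> exp (b * (y R * (R / (R - s))))"
    using assms unfolding dominated_def by (elim exE conjE)
  show ?thesis
    unfolding dominated_def
  proof (intro exI[of _ "a + b"] conjI allI impI)
    fix s R :: real and z :: complex
    assume s: "1 \<le> s" "s < R" "norm z \<le> s"
    define X where "X = y R * (R / (R - s))"
    have X: "X \<ge> 1"
      unfolding X_def by (rule growth_factor_ge(1)[OF s(1,2)])
    have e: "2 \<le> exp (a * X)" "2 \<le> exp (b * X)"
      using mult_mono[of 1 a 1 X] mult_mono[of 1 b 1 X] a(1) b(1) X
        exp_ge_add_one_self[of "a * X"] exp_ge_add_one_self[of "b * X"] by linarith+
    have "norm (F z + H z) \<le> exp (a * X) + exp (b * X)"
      using a(2) b(2) s unfolding X_def by (intro order_trans[OF norm_triangle_ineq] add_mono) auto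
    also have "\<dots> \<le> exp (a * X) * exp (b * X)"
    proof -
      have "1 * 1 \<le> (exp (a * X) - 1) * (exp (b * X) - 1)"
        using e by (intro mult_mono) linarith+
      then show ?thesis
        by (simp add: algebra_simps)
    qed
    finally show "norm (F z + H z) \<le> exp ((a + b) * (y R * (R / (R - s))))"
      unfolding X_def[symmetric] distrib_right exp_add .
  qed (use a b in simp)
qed

lemma dominated_poly: "dominated (poly q)"
proof (induction q)
  case 0
  then show ?case
    using dominated_const[of 0] by (simp add: poly_0[abs_def])
next
  case (pCons a q)
  have "poly (pCons a q) = (\<lambda>z. a + z * poly q z)"
    by auto
  then show ?case
    using dominated_add[OF dominated_const dominated_mult[OF dominated_id pCons.IH], of a] by simp
qed

lemma dominated_deriv:
  assumes F: "F holomorphic_on UNIV" and "dominated F"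
  shows "dominated (deriv F)"
proof -
  obtain a where a: "a \<ge> 1" "\<forall>s R z. 1 \<le> s \<longrightarrow> s < R \<longrightarrow> norm z \<le> s \<longrightarrow>
      norm (F z) \<le> exp (a * (y R * (R / (R - s))))"
    using assms(2) unfolding dominated_def by (elim exE conjE)
  show ?thesis
    unfolding dominated_def
  proof (intro exI[of _ "2 * a + 2"] conjI allI impI)
    fix s R :: real and z :: complex
    assume s: "1 \<le> s" "s < R" "norm z \<le> s"
    define X where "X = y R * (R / (R - s))"
    define e where "e = (R - s) / 2"
    have e: "e > 0" "s + e < R" "R - (s + e) = e"
      using s by (auto simp: e_def field_simps)
    have bound: "norm (F w) \<le> exp (2 * a * X)" if "norm w \<le> s + e" for w
    proof -
      have "norm (F w) \<le> exp (a * (y R * (R / (R - (s + e)))))"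
        by (rule a(2)[rule_format]) (use s e that in auto)
      also have "a * (y R * (R / (R - (s + e)))) = 2 * a * X"
        unfolding e(3) by (simp add: X_def e_def)
      finally show ?thesis .
    qed
    have "norm ((deriv ^^ 1) F z) \<le> fact 1 * exp (2 * a * X) / e ^ 1"
    proof (rule Cauchy_inequality)
      show "F holomorphic_on ball z e" "continuous_on (cball z e) F"
        using F holomorphic_on_subset holomorphic_on_imp_continuous_on by blast+
      show "norm (F w) \<le> exp (2 * a * X)" if "norm (z - w) = e" for w
        using norm_triangle_ineq[of z "w - z"] s that by (intro bound) (simp add: norm_minus_commute)
    qed (rule e)
    then have "norm (deriv F z) \<le> exp (2 * a * X) * (1 / e)"
      by simp
    also have "\<dots> \<le> exp (2 * a * X) * exp (2 * X)"
    proof (intro mult_left_mono)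
      have "1 / e \<le> R / e"
        using s e by (intro divide_right_mono) auto
      also have "\<dots> = 2 * (R / (R - s))"
        by (simp add: e_def)
      also have "\<dots> \<le> 2 * X"
        unfolding X_def using growth_factor_ge(3)[OF s(1,2)] by simp
      also have "\<dots> \<le> exp (2 * X)"
        using exp_ge_add_one_self[of "2 * X"] by linarith
      finally show "1 / e \<le> exp (2 * X)" .
    qed simp
    finally show "norm (deriv F z) \<le> exp ((2 * a + 2) * (y R * (R / (R - s))))"
      unfolding X_def[symmetric] distrib_right exp_add .
  qed (use a in simp)
qed

lemma dominated_FF:
  assumes "F \<in> FF"
  shows "dominated F"
proof -
  have lin: "dominated (\<lambda>z. h z - x * poly p z)" if "dominated h" for h x
    using dominated_add[OF that dominated_mult[OF dominated_const dominated_poly], of "- x" p] by simp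
  have wr: "dominated (wronski h p)" if "dominated h" "h holomorphic_on UNIV" for h
    using dominated_add[OF dominated_mult[OF dominated_deriv[OF that(2,1)] dominated_poly] dominated_mult[OF dominated_const dominated_mult[OF that(1) dominated_poly]],
        of p "- 1" "pderiv p"] unfolding wronski_def[abs_def] by simp
  show ?thesis
    using assms lin wr dominated_f1 dominated_g1 f1 g1 dominated_poly unfolding FF_def numerators_def by blast
qed

lemma FF_uniform_bound:
  "\<exists>C\<ge>1. \<forall>F\<in>FF. \<forall>s R z. 1 \<le> s \<longrightarrow> s < R \<longrightarrow> norm z \<le> s \<longrightarrow>
      norm (F z) \<le> exp (C * (y R * (R / (R - s))))"
proof -
  have "\<forall>F\<in>FF. \<exists>C. C \<ge> 1 \<and> (\<forall>s R z. 1 \<le> s \<longrightarrow> s < R \<longrightarrow> norm z \<le> s \<longrightarrow>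
      norm (F z) \<le> exp (C * (y R * (R / (R - s)))))"
    using dominated_FF unfolding dominated_def by blast
  from bchoice[OF this] obtain k where k: "\<forall>F\<in>FF. k F \<ge> 1 \<and> (\<forall>s R z. 1 \<le> s \<longrightarrow> s < R \<longrightarrow> norm z \<le> s \<longrightarrow>
      norm (F z) \<le> exp (k F * (y R * (R / (R - s)))))"
    by (elim exE)
  define C where "C = 1 + (\<Sum>F\<in>FF. k F)"
  have kC: "k F \<le> C" if "F \<in> FF" for F
    using member_le_sum[OF that, of k] k finite_FF by (force simp: C_def)
  show ?thesis
  proof (intro exI[of _ C] conjI ballI allI impI)
    show "1 \<le> C"
      unfolding C_def using sum_nonneg[of FF k] k by fastforce
    fix F and s R :: real and z :: complex
    assume F: "F \<in> FF" and s: "1 \<le> s" "s < R" "norm z \<le> s"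
    have "norm (F z) \<le> exp (k F * (y R * (R / (R - s))))"
      using k F s by blast
    also have "\<dots> \<le> exp (C * (y R * (R / (R - s))))"
      using kC[OF F] growth_factor_ge(1)[OF s(1,2)] by (subst exp_le_cancel_iff) (intro mult_right_mono, auto)
    finally show "norm (F z) \<le> exp (C * (y R * (R / (R - s))))" .
  qed
qed

end

context shared_pair
begin

text \<open>The two factors \<open>1 + |f|\<close> and \<open>1 + |g|\<close> are the gain from \<open>n \<ge> 2k + 6\<close>. The exponent \<open>12\<close> counts five
factors \<open>L\<close> for each of \<open>f\<close> and \<open>g\<close> and two for the squared difference.\<close>

lemma ln_aux_fun_bound:
  assumes card: "2 * card G + 6 \<le> card SA"
  shows "\<exists>K\<ge>0. \<forall>z L. 1 \<le> L \<longrightarrow> (\<forall>F\<in>FF. F z \<noteq> 0 \<and> norm (deriv F z / F z) \<le> L) \<longrightarrow> \<Phi> z \<noteq> 0 \<longrightarrow>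
     ln (norm (\<Phi> z)) + (ln (1 + norm (f z)) + ln (1 + norm (g z))) \<le> K + 12 * ln L"
proof -
  obtain P where P: "P \<ge> 1" and pw: "\<forall>w (d::complex) L. 1 \<le> L \<longrightarrow> (\<forall>a\<in>SA. w \<noteq> a \<and> norm d \<le> L * norm (w - a)) \<longrightarrow>
     norm d ^ 5 * norm (\<Prod>b\<in>G. w - b) ^ 2 / norm (c * (\<Prod>a\<in>SA. w - a)) \<le> P * L ^ 5 / (1 + norm w)"
    using aux_pointwise[OF SA G c card] by (elim exE conjE)
  define D where "D = 3 + 2 * (\<Sum>a\<in>G. real (m a)) + 4 * real (card SA)"
  have "(\<Sum>a\<in>G. real (m a)) \<ge> 0"
    by (rule sum_nonneg) simp
  then have D: "D \<ge> 1"
    by (simp add: D_def)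
  define c0 where "c0 = (32 * P) * (32 * P) * (2 * D)\<^sup>2"
  have c0: "c0 \<ge> 1"
  proof -
    have "1 * 1 * 1\<^sup>2 \<le> (32 * P) * (32 * P) * (2 * D)\<^sup>2"
      using P D by (intro mult_mono power_mono) auto
    then show ?thesis
      by (simp add: c0_def)
  qed
  have "ln (norm (\<Phi> z)) + (ln (1 + norm (f z)) + ln (1 + norm (g z))) \<le> ln c0 + 12 * ln L"
    if L: "1 \<le> L" and reg: "\<forall>F\<in>FF. F z \<noteq> 0 \<and> norm (deriv F z / F z) \<le> L" and nz: "\<Phi> z \<noteq> 0" for z L
  proof -
    have regf: "\<And>F. F \<in> insert (poly p) (numerators f1 p (SA \<union> G)) \<Longrightarrow> F z \<noteq> 0 \<and> norm (deriv F z / F z) \<le> L"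
      and regg: "\<And>F. F \<in> insert (poly p) (numerators g1 p (SA \<union> G)) \<Longrightarrow> F z \<noteq> 0 \<and> norm (deriv F z / F z) \<le> L"
      using reg by (auto simp: FF_def)
    have pQ: "poly Q x = (\<Prod>b\<in>G. x - b)" and pW: "poly W x = c * (\<Prod>a\<in>SA. x - a)" for x
      by (simp_all add: Q_def W poly_prod)
    have L2: "1 \<le> 2 * L"
      using L by simp
    define x where "x = 1 + norm (f z)"
    define x' where "x' = 1 + norm (g z)"
    have x: "x \<ge> 1" "x' \<ge> 1"
      by (auto simp: x_def x'_def)
    define Tf where "Tf = norm (deriv f z) ^ 5 * norm (poly Q (f z)) ^ 2 / norm (poly W (f z))"
    define Tg where "Tg = norm (deriv g z) ^ 5 * norm (poly Q (g z)) ^ 2 / norm (poly W (g z))"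
    have Tf: "Tf \<le> P * (2 * L) ^ 5 / x"
      unfolding Tf_def pQ pW x_def using bounds_f(1)[of z L] regf by (intro pw[rule_format, OF L2]) auto
    have Tg: "Tg \<le> P * (2 * L) ^ 5 / x'"
      unfolding Tg_def pQ pW x'_def using bounds_g(1)[of z L] regg by (intro pw[rule_format, OF L2]) auto
    define \<Delta> where "\<Delta> = dlog_quot (\<lambda>z. poly W (f z)) z - dlog_quot (\<lambda>z. poly W (g z)) z"
    have "norm \<Delta> \<le> D * L + D * L"
      unfolding \<Delta>_def D_def using bounds_f(2)[of z L] bounds_g(2)[of z L] regf regg
      by (intro order_trans[OF norm_triangle_ineq4] add_mono) auto
    then have \<Delta>: "norm \<Delta> ^ 2 \<le> (2 * D * L) ^ 2"
      by (intro power_mono) auto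
    have eq: "norm (\<Phi> z) = Tf * Tg * norm \<Delta> ^ 2"
      unfolding \<Phi>_def aux_fun_def Tf_def Tg_def \<Delta>_def
      by (simp add: norm_mult norm_divide norm_power power_mult_distrib)
    have "norm (\<Phi> z) \<le> (P * (2 * L) ^ 5 / x) * (P * (2 * L) ^ 5 / x') * (2 * D * L) ^ 2"
      unfolding eq using Tf Tg \<Delta> P L x
      by (intro mult_mono) (auto simp: Tf_def Tg_def)
    also have "\<dots> = c0 * L ^ 12 / (x * x')"
    proof -
      have "(P * (2 * L) ^ 5) * (P * (2 * L) ^ 5) * (2 * D * L) ^ 2 = c0 * L ^ 12"
        by (simp add: c0_def power_mult_distrib eval_nat_numeral)
      then show ?thesis
        using x by simp
    qed
    finally have "norm (\<Phi> z) * (x * x') \<le> c0 * L ^ 12"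
      using x by (simp add: pos_le_divide_eq)
    then have "ln (norm (\<Phi> z) * (x * x')) \<le> ln (c0 * L ^ 12)"
      using nz x by (intro ln_mono) auto
    moreover have "ln (norm (\<Phi> z) * (x * x')) = ln (norm (\<Phi> z)) + (ln x + ln x')"
      using nz x by (simp add: ln_mult)
    moreover have "ln (c0 * L ^ 12) = ln c0 + 12 * ln L"
      using c0 L by (simp add: ln_mult ln_realpow)
    ultimately show ?thesis
      by (simp add: x_def x'_def)
  qed
  then show ?thesis
    using c0 by (intro exI[of _ "ln c0"]) auto
qed

text \<open>Otherwise \<open>\<Phi>\<close>, cleared of its poles, is an entire function \<open>\<Psi>\<close> that does not vanish identically but is
small where \<open>f\<close> or \<open>g\<close> is large. This forces polylogarithmic growth of \<open>ln |f|\<close>, hence order \<open>0\<close>.\<close>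

lemma dlog_quot_eq:
  assumes fM: "f \<in> M1" and ord: "noninteger_finite_order f" and card: "2 * card G + 6 \<le> card SA"
    and reg_z: "reg z"
  shows "dlog_quot (\<lambda>z. poly W (f z)) z = dlog_quot (\<lambda>z. poly W (g z)) z"
proof (rule ccontr)
  assume neq: "dlog_quot (\<lambda>z. poly W (f z)) z \<noteq> dlog_quot (\<lambda>z. poly W (g z)) z"
  have fin_poles: "finite {z. is_pole \<Phi> z}"
    by (rule finite_subset[OF _ poly_roots_finite[OF p]]) (use poles_\<Phi> in auto)
  obtain \<Psi> q where \<Psi>: "\<Psi> holomorphic_on UNIV" and q0: "\<And>z. poly q z = 0 \<longleftrightarrow> is_pole \<Phi> z"
    and \<Psi>eq: "\<And>z. \<Phi> analytic_on {z} \<Longrightarrow> \<Phi> z * poly q z = \<Psi> z"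
    by (rule clear_poles[OF meromorphic_\<Phi> fin_poles]) (rule that; assumption)
  have qz: "poly q z \<noteq> 0" if "reg z" for z
    using q0 analytic_at_imp_no_pole[OF analytic_\<Phi>[OF that]] by simp
  have q: "q \<noteq> 0"
    using qz[OF reg_z] by auto
  have Qnz: "poly Q (f z) \<noteq> 0" "poly Q (g z) \<noteq> 0"
    using reg_facts(1)[OF reg_z] G by (auto simp: Q_def poly_prod prod_zero_iff)
  have "\<Phi> z \<noteq> 0"
    using reg_facts[OF reg_z] neq Qnz by (simp add: \<Phi>_def aux_fun_def)
  then have \<Psi>z: "\<Psi> z \<noteq> 0"
    using \<Psi>eq[OF analytic_\<Phi>[OF reg_z]] qz[OF reg_z] by (metis mult_eq_0_iff)
  obtain C1 where C1: "C1 \<ge> 1" and FF_bd: "\<forall>F\<in>FF. \<forall>s R z. 1 \<le> s \<longrightarrow> s < R \<longrightarrow> norm z \<le> s \<longrightarrow>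
      norm (F z) \<le> exp (C1 * (y R * (R / (R - s))))"
    using FF_uniform_bound by (elim exE conjE)
  obtain K where K: "K \<ge> 0" and \<Phi>_bd: "\<forall>z L. 1 \<le> L \<longrightarrow> (\<forall>F\<in>FF. F z \<noteq> 0 \<and> norm (deriv F z / F z) \<le> L) \<longrightarrow> \<Phi> z \<noteq> 0 \<longrightarrow>
     ln (norm (\<Phi> z)) + (ln (1 + norm (f z)) + ln (1 + norm (g z))) \<le> K + 12 * ln L"
    using ln_aux_fun_bound[OF card] by (elim exE conjE)
  obtain Cq rq where Cq: "Cq \<ge> 0" "rq \<ge> 3" "\<And>z. rq \<le> norm z \<Longrightarrow> poly q z \<noteq> 0 \<and> \<bar>ln (norm (poly q z))\<bar> \<le> Cq * ln (norm z)"
    using poly_ln_bound[OF q] by blast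
  obtain Cp rp where Cp: "Cp \<ge> 0" "rp \<ge> 3" "\<And>z. rp \<le> norm z \<Longrightarrow> poly p z \<noteq> 0 \<and> \<bar>ln (norm (poly p z))\<bar> \<le> Cp * ln (norm z)"
    using poly_ln_bound[OF p] by blast
  define r0 where "r0 = max rq rp"
  define v where "v = (\<lambda>z. ln (1 + norm (f z)) + ln (1 + norm (g z)))"
  define C2 where "C2 = K + 12 + Cq + 1"
  define C3 where "C3 = 4 + Cp"
  have polylog: "\<exists>K s1. \<forall>s\<ge>s1. y s \<le> K * ln s ^ 8"
  proof (rule polylog_of_auxiliary[where FF = FF and \<Psi> = \<Psi> and ?z1.0 = z and ?C1.0 = C1 and ?C2.0 = C2 and ?C3.0 = C3
        and ?r0.0 = r0 and v = v])
    show "norm (F z) \<le> exp (C1 * (y R * (R / (R - s))))" if "F \<in> FF" "1 \<le> s" "s < R" "norm z \<le> s" for F s R z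
      using FF_bd that by blast
    show "ln (norm (\<Psi> z)) + v z \<le> C2 * (1 + ln (norm z) + ln L)"
      if z: "r0 \<le> norm z" and L: "1 \<le> L" and reg: "\<And>F. F \<in> FF \<Longrightarrow> F z \<noteq> 0 \<and> norm (deriv F z / F z) \<le> L"
        and nz: "\<Psi> z \<noteq> 0" for z L
    proof -
      have rz: "reg z"
        using reg by (auto simp: reg_def)
      have eq: "\<Psi> z = \<Phi> z * poly q z"
        using \<Psi>eq[OF analytic_\<Phi>[OF rz]] by simp
      then have nz': "\<Phi> z \<noteq> 0" "poly q z \<noteq> 0"
        using nz by auto
      have "ln (norm (\<Psi> z)) = ln (norm (\<Phi> z)) + ln (norm (poly q z))"
        using nz' by (simp add: eq norm_mult ln_mult)
      moreover have "ln (norm (\<Phi> z)) + v z \<le> K + 12 * ln L"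
        unfolding v_def using \<Phi>_bd L reg nz' by blast
      moreover have "ln (norm (poly q z)) \<le> Cq * ln (norm z)"
        using Cq(3)[of z] z by (auto simp: r0_def)
      moreover have "K + 12 * ln L + Cq * ln (norm z) \<le> C2 * 1 + C2 * ln L + C2 * ln (norm z)"
        using K Cq L z by (intro add_mono mult_right_mono) (auto simp: C2_def r0_def)
      ultimately show ?thesis
        by (simp add: algebra_simps)
    qed
    show "0 \<le> v z" for z
      by (simp add: v_def)
    show "y s \<le> C3 * (1 + ln r + V)" if s: "r0 \<le> s" "s \<le> r" and V: "\<And>z. norm z = r \<Longrightarrow> v z \<le> V" for s r V
    proof -
      have r3: "r \<ge> 3" "rp \<le> r" "s \<ge> 3"
        using s Cp Cq by (auto simp: r0_def)
      define b where "b = exp (V + Cp * ln r)"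
      have circ: "norm (h1 z) \<le> b" if z: "norm z = r" and h: "\<And>z. poly p z \<noteq> 0 \<Longrightarrow> h z = h1 z / poly p z"
        and hv: "ln (1 + norm (h z)) \<le> v z" for h h1 z
      proof -
        have pz: "poly p z \<noteq> 0" "ln (norm (poly p z)) \<le> Cp * ln r"
          using Cp(3)[of z] z r3 by auto
        have "norm (h1 z) = norm (h z) * norm (poly p z)"
          using h[OF pz(1)] pz(1) by (simp add: norm_divide)
        also have "\<dots> \<le> exp V * exp (Cp * ln r)"
        proof (intro mult_mono)
          have "1 + norm (h z) = exp (ln (1 + norm (h z)))"
            using norm_ge_zero[of "h z"] by (subst exp_ln) linarith+
          also have "\<dots> \<le> exp V"
            using hv V[OF z] by (subst exp_le_cancel_iff) linarith
          finally show "norm (h z) \<le> exp V"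
            by linarith
          have "norm (poly p z) = exp (ln (norm (poly p z)))"
            using pz by simp
          also have "\<dots> \<le> exp (Cp * ln r)"
            using pz by (subst exp_le_cancel_iff)
          finally show "norm (poly p z) \<le> exp (Cp * ln r)" .
        qed auto
        finally show ?thesis
          by (simp add: b_def exp_add)
      qed
      have hv: "ln (1 + norm (f z)) \<le> v z" "ln (1 + norm (g z)) \<le> v z" for z
        by (auto simp: v_def)
      have circ_f: "norm (f1 z) \<le> b" and circ_g: "norm (g1 z) \<le> b" if "norm z = r" for z
        by (rule circ[OF that f hv(1)], assumption) (rule circ[OF that g hv(2)], assumption)
      have "0 < r"
        using r3 by simp
      then have "norm (f1 z) \<le> b" "norm (g1 z) \<le> b" if "norm z \<le> r" for z
        using entire_bound_on_cball[OF f1 _ circ_f that] entire_bound_on_cball[OF g1 _ circ_g that] by auto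
      then have uz: "u z \<le> 1 + b + b" if "norm z \<le> max 1 s" for z
        using that s r3 unfolding u_def by (intro add_mono) auto
      have V0: "V \<ge> 0"
      proof -
        have "0 \<le> v (of_real r)"
          by (simp add: v_def)
        also have "v (of_real r) \<le> V"
          using r3 by (intro V) simp
        finally show ?thesis .
      qed
      have lnr: "ln r \<ge> 0"
        using r3 by simp
      have b1: "b \<ge> 1"
        unfolding b_def using V0 Cp lnr by simp
      have "U s \<le> 1 + b + b"
        by (rule U_le) (rule uz)
      also have "\<dots> \<le> 3 * b"
        using b1 by simp
      finally have "ln (U s) \<le> ln (3 * b)"
        using U_ge_1[of s] by (intro ln_mono) auto
      also have "\<dots> = ln 3 + (V + Cp * ln r)"
        by (simp add: ln_mult b_def)
      finally have "ln (U s) \<le> ln 3 + (V + Cp * ln r)" .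
      moreover have "ln (3::real) \<le> 2"
        using ln_le_minus_one[of 3] by simp
      moreover have "ln (max 1 s) \<le> ln r"
        using s r3 by (intro ln_mono) auto
      ultimately have "y s \<le> 3 * 1 + (1 + Cp) * ln r + 1 * V"
        by (simp add: y_def algebra_simps)
      also have "\<dots> \<le> C3 * 1 + C3 * ln r + C3 * V"
        using Cp V0 lnr by (intro add_mono mult_right_mono) (auto simp: C3_def)
      finally show ?thesis
        by (simp add: algebra_simps)
    qed
  qed (use y_mono y_ge_1 ln_le_y finite_FF holomorphic_FF nonzero_FF \<Psi> \<Psi>z C1 K Cq Cp in \<open>auto simp: C2_def C3_def\<close>)
  then obtain K' s1 where K': "\<And>s. s \<ge> s1 \<Longrightarrow> y s \<le> K' * ln s ^ 8"
    by blast
  define s2 where "s2 = max (max s1 rp) 3"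
  have "nevanlinna_order f \<le> ereal 0"
  proof (rule order_le_of_growth[OF fM])
    fix z :: complex assume z: "s2 \<le> norm z"
    have z3: "norm z \<ge> 3" "norm z \<ge> s1" "norm z \<ge> rp"
      using z by (auto simp: s2_def)
    have "exp 1 \<le> norm z"
      using z3 exp_le by linarith
    then have "ln (exp 1) \<le> ln (norm z)"
      by (intro ln_mono) auto
    then have l1: "1 \<le> ln (norm z)"
      by simp
    have l8: "ln (norm z) \<le> ln (norm z) ^ 8"
      using power_increasing[OF _ l1, of 1 8] by simp
    have pz: "poly p z \<noteq> 0" "\<bar>ln (norm (poly p z))\<bar> \<le> Cp * ln (norm z)"
      using Cp(3) z3 by auto
    show "ln (norm (f z)) \<le> (\<bar>K'\<bar> + Cp) * norm z powr 0 * ln (norm z) ^ 8"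
    proof (cases "f z = 0")
      case False
      then have f1z: "f1 z \<noteq> 0"
        using f[OF pz(1)] by auto
      have "norm (f1 z) \<le> u z"
        by (simp add: u_def)
      also have "\<dots> \<le> U (norm z)"
        by (rule u_le_U) auto
      finally have "ln (norm (f1 z)) \<le> ln (U (norm z))"
        using f1z by (intro ln_mono) auto
      also have "\<dots> \<le> y (norm z)"
        by (simp add: y_def)
      also have "\<dots> \<le> K' * ln (norm z) ^ 8"
        by (rule K'[OF z3(2)])
      also have "\<dots> \<le> \<bar>K'\<bar> * ln (norm z) ^ 8"
        using l1 by (intro mult_right_mono) auto
      finally have 1: "ln (norm (f1 z)) \<le> \<bar>K'\<bar> * ln (norm z) ^ 8" .
      have "ln (norm (f z)) = ln (norm (f1 z)) - ln (norm (poly p z))"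
        using f[OF pz(1)] f1z pz by (simp add: norm_divide ln_div)
      also have "\<dots> \<le> \<bar>K'\<bar> * ln (norm z) ^ 8 + Cp * ln (norm z) ^ 8"
        using 1 pz(2) mult_left_mono[OF l8 Cp(1)] by linarith
      finally have "ln (norm (f z)) \<le> (\<bar>K'\<bar> + Cp) * 1 * ln (norm z) ^ 8"
        by (simp add: distrib_right)
      moreover have "norm z powr 0 = 1"
        using z3 by auto
      ultimately show ?thesis
        by (simp only:)
    qed (use l1 Cp in auto)
  qed (use Cp in auto)
  moreover obtain \<rho> where \<rho>: "nevanlinna_order f = ereal \<rho>" "\<rho> \<notin> \<int>"
    using ord by (auto simp: noninteger_finite_order_def)
  ultimately have "\<rho> = 0"
    using order_nonneg[OF fM] by auto
  then show False
    using \<rho>(2) by simp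
qed

end

text \<open>With \<open>R = 2s\<close> the factors \<open>R/(R - s)\<close> are constant.\<close>

lemma doubling_good_circle:
  assumes good: "good_circles FF C" and C: "1 \<le> C" and s: "1 \<le> s"
    and Y: "\<And>F. F \<in> FF \<Longrightarrow> 1 \<le> Y F \<and> Y F \<le> Ymax" and Ymax: "1 \<le> Ymax"
    and bd: "\<And>F z. F \<in> FF \<Longrightarrow> norm z \<le> 2 * s \<Longrightarrow> norm (F z) \<le> exp (Y F)"
  shows "\<exists>r. s \<le> r \<and> r \<le> 2 * s \<and> (\<forall>F\<in>FF. \<forall>z. norm z = r \<longrightarrow> F z \<noteq> 0 \<and>
      ln (norm (F z)) \<ge> - (4 * C) * (Y F * (1 + ln Ymax)))"
proof -
  have s2: "s < 2 * s"
    using s by simp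
  have prem: "\<forall>F\<in>FF. 1 \<le> Y F \<and> Y F \<le> Ymax \<and> (\<forall>z. norm z \<le> 2 * s \<longrightarrow> norm (F z) \<le> exp (Y F))"
    using Y bd by simp
  from good_circlesD[OF good s s2 prem] obtain r where r: "s \<le> r" "r \<le> (s + 2 * s) / 2" and
    lo: "\<forall>F\<in>FF. \<forall>z. norm z = r \<longrightarrow> F z \<noteq> 0 \<and>
      norm (deriv F z / F z) \<le> C * (Ymax * (2 * s) / (2 * s - s)) ^ 3 \<and>
      ln (norm (F z)) \<ge> - C * (Y F * (2 * s) / (2 * s - s)) * (1 + ln (Ymax * (2 * s) / (2 * s - s)))"
    by (elim exE conjE)
  have X: "t * (2 * s) / (2 * s - s) = 2 * t" for t
    using s by simp
  have l: "1 + ln (2 * Ymax) \<le> 2 * (1 + ln Ymax)"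
  proof -
    have eq: "ln (2 * Ymax) = ln 2 + ln Ymax"
      using Ymax by (simp add: ln_mult)
    have "ln (2::real) \<le> 1"
      using ln_le_minus_one[of 2] by simp
    then have "1 + (ln 2 + ln Ymax) \<le> 2 * (1 + ln Ymax)"
      using ln_ge_zero[OF Ymax] by argo
    then show ?thesis
      by (simp only: eq)
  qed
  have "F z \<noteq> 0 \<and> ln (norm (F z)) \<ge> - (4 * C) * (Y F * (1 + ln Ymax))" if F: "F \<in> FF" and z: "norm z = r" for F z
  proof -
    have "C * (2 * Y F) * (1 + ln (2 * Ymax)) \<le> C * (2 * Y F) * (2 * (1 + ln Ymax))"
      using C Y[OF F] by (intro mult_left_mono l) auto
    moreover have "C * (2 * Y F) * (2 * (1 + ln Ymax)) = (4 * C) * (Y F * (1 + ln Ymax))"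
      by (simp add: algebra_simps)
    moreover have "F z \<noteq> 0 \<and> ln (norm (F z)) \<ge> - C * (2 * Y F) * (1 + ln (2 * Ymax))"
      using lo F z unfolding X by blast
    moreover have "- C * (2 * Y F) * (1 + ln (2 * Ymax)) = - (C * (2 * Y F) * (1 + ln (2 * Ymax)))"
      "- (4 * C) * (Y F * (1 + ln Ymax)) = - ((4 * C) * (Y F * (1 + ln Ymax)))"
      by simp_all
    ultimately show ?thesis
      by linarith
  qed
  then show ?thesis
    using r s by (intro exI[of _ r]) auto
qed

text \<open>For large arguments \<open>|W|\<close> lies between two multiples of the same power of the modulus.\<close>

lemma poly_value_comparison:
  fixes W :: "complex poly"
  assumes W: "degree W > 0"
  shows "\<exists>K\<ge>1. \<forall>x y. poly W y = a * poly W x \<longrightarrow> norm y \<le> K * (1 + norm x)"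
proof -
  define n where "n = degree W"
  define B where "B = 1 + (\<Sum>i\<le>n. norm (coeff W i))"
  define l where "l = norm (lead_coeff W)"
  have l: "l > 0"
    using W by (auto simp: l_def)
  define K where "K = 1 + 2 * (norm a + 1) * B / l"
  have B: "B \<ge> 1"
    by (simp add: B_def sum_nonneg)
  have K: "K \<ge> 1" "l * K > 2 * (norm a * B)" "l * K \<ge> 2 * B"
  proof -
    have "2 * (norm a + 1) * B / l \<ge> 0"
      using B l by simp
    then show "K \<ge> 1"
      by (simp add: K_def)
    have "l * K = l + 2 * (norm a + 1) * B"
      using l by (simp add: K_def field_simps)
    then show "l * K > 2 * (norm a * B)" "l * K \<ge> 2 * B"
      using l B by (auto simp: algebra_simps)
  qed
  have upper: "norm (poly W x) \<le> B * (1 + norm x) ^ n" for x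
  proof -
    have "norm (poly W x) \<le> (\<Sum>i\<le>n. norm (coeff W i) * (1 + norm x) ^ n)"
      unfolding poly_altdef n_def[symmetric]
    proof (rule sum_norm_le)
      fix i assume i: "i \<in> {..n}"
      have "norm x ^ i \<le> (1 + norm x) ^ i"
        by (intro power_mono) auto
      also have "\<dots> \<le> (1 + norm x) ^ n"
        using i by (intro power_increasing) auto
      finally show "norm (coeff W i * x ^ i) \<le> norm (coeff W i) * (1 + norm x) ^ n"
        by (simp add: norm_mult norm_power mult_left_mono)
    qed
    also have "\<dots> \<le> B * (1 + norm x) ^ n"
      unfolding sum_distrib_right[symmetric] by (intro mult_right_mono) (auto simp: B_def)
    finally show ?thesis .
  qed
  have lower: "l / 2 * norm y ^ n \<le> norm (poly W y)" if y: "norm y \<ge> K" for y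
  proof -
    have y1: "norm y \<ge> 1"
      using y K by simp
    obtain n' where n': "n = Suc n'"
      using W by (cases n) (auto simp: n_def)
    have "poly W y = (\<Sum>i\<le>n'. coeff W i * y ^ i) + lead_coeff W * y ^ n"
      unfolding poly_altdef n_def[symmetric] by (simp add: n')
    then have "lead_coeff W * y ^ n = poly W y - (\<Sum>i\<le>n'. coeff W i * y ^ i)"
      by simp
    then have "l * norm y ^ n \<le> norm (poly W y) + norm (\<Sum>i\<le>n'. coeff W i * y ^ i)"
      by (metis l_def norm_mult norm_power norm_triangle_ineq4)
    also have "norm (\<Sum>i\<le>n'. coeff W i * y ^ i) \<le> (\<Sum>i\<le>n'. norm (coeff W i) * norm y ^ n')"
      using y1 by (intro sum_norm_le) (auto simp: norm_mult norm_power intro!: mult_left_mono power_increasing)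
    also have "\<dots> \<le> B * norm y ^ n'"
      unfolding sum_distrib_right[symmetric] by (intro mult_right_mono) (auto simp: B_def n')
    also have "B * norm y ^ n' \<le> l / 2 * norm y ^ n"
    proof -
      have "B \<le> l / 2 * K"
        using K(3) by simp
      also have "\<dots> \<le> l / 2 * norm y"
        using y l by (intro mult_left_mono) auto
      finally have "B * norm y ^ n' \<le> l / 2 * norm y * norm y ^ n'"
        by (intro mult_right_mono) auto
      then show ?thesis
        by (simp add: n')
    qed
    finally show ?thesis
      by simp
  qed
  have "norm y \<le> K * (1 + norm x)" if eq: "poly W y = a * poly W x" for x y
  proof (rule ccontr)
    assume "\<not> norm y \<le> K * (1 + norm x)"
    then have big: "K * (1 + norm x) < norm y"
      by simp
    have "K * 1 \<le> K * (1 + norm x)"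
      using K by (intro mult_left_mono) auto
    then have yK: "norm y \<ge> K"
      using big by simp
    obtain n' where n': "n = Suc n'"
      using W by (cases n) (auto simp: n_def)
    define t where "t = (1 + norm x) ^ n"
    have t: "t > 0"
      unfolding t_def by (intro zero_less_power) (use norm_ge_zero[of x] in linarith)
    have "K * t \<le> K ^ n * t"
      using K t power_increasing[of 1 n K] by (intro mult_right_mono) (auto simp: n')
    also have "\<dots> = (K * (1 + norm x)) ^ n"
      by (simp add: t_def power_mult_distrib)
    also have "\<dots> \<le> norm y ^ n"
      using big K by (intro power_mono) auto
    finally have "l / 2 * (K * t) \<le> l / 2 * norm y ^ n"
      using l by (intro mult_left_mono) auto
    also have "\<dots> \<le> norm (poly W y)"
      by (rule lower[OF yK])
    also have "\<dots> \<le> norm a * (B * t)"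
      unfolding eq norm_mult t_def by (intro mult_left_mono upper) auto
    finally have "(l * K) * t \<le> (2 * (norm a * B)) * t"
      by (simp add: algebra_simps)
    then show False
      using K(2) t by simp
  qed
  then show ?thesis
    using K by blast
qed

lemma isCont_eventually_zero:
  fixes h :: "complex \<Rightarrow> complex"
  assumes "isCont h z" "eventually (\<lambda>z. h z = 0) (at z)"
  shows "h z = 0"
proof -
  have "((\<lambda>_. 0) \<longlongrightarrow> h z) (at z)"
    using assms(1) unfolding isCont_def by (rule Lim_transform_eventually) (use assms(2) in auto)
  then show ?thesis
    using tendsto_unique[of "at z" "\<lambda>_. 0" "h z" 0] by simp
qed

context shared_pair
begin

lemma isCont_fg:
  assumes "poly p z \<noteq> 0"
  shows "isCont f z" "isCont g z"
  using assms hol_f hol_g open_poly_nonzero[of p]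
  by (metis (mono_tags, lifting) continuous_on_eq_continuous_at holomorphic_on_imp_continuous_on mem_Collect_eq)+

lemma analytic_fg:
  assumes "poly p z \<noteq> 0"
  shows "f analytic_on {z}" "g analytic_on {z}"
  using assms hol_f hol_g open_poly_nonzero[of p] by (auto simp: analytic_at)

lemma connected_reg: "connected {z. reg z}"
proof -
  have "countable {z. F z = 0}" if F: "F \<in> FF" for F
    using holomorphic_countable_equal_UNIV[of F "\<lambda>_. 0"] holomorphic_FF[OF F] nonzero_FF[OF F] by auto
  then have "countable (\<Union>F\<in>FF. {z. F z = 0})"
    using finite_FF by (intro countable_UN) (auto simp: countable_finite)
  then have "connected (UNIV - (\<Union>F\<in>FF. {z. F z = 0}))"
    by (intro connected_open_diff_countable) auto
  moreover have "UNIV - (\<Union>F\<in>FF. {z. F z = 0}) = {z. reg z}"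
    by (auto simp: reg_def)
  ultimately show ?thesis
    by simp
qed

lemma exists_reg: "\<exists>z. reg z"
proof -
  have "eventually reg (at (0::complex))"
    by (rule eventually_reg)
  then show ?thesis
    using eventually_happens[of reg "at (0::complex)"] by auto
qed

text \<open>Equality of the logarithmic derivatives of \<open>(1/A)'\<close> and \<open>(1/B)'\<close> makes first their quotient and then
\<open>1/A - \<kappa>/B\<close> constant on the connected set of regular points. Continuity extends the relation.\<close>

lemma moebius_relation:
  assumes eq: "\<And>z. reg z \<Longrightarrow> dlog_quot (\<lambda>z. poly W (f z)) z = dlog_quot (\<lambda>z. poly W (g z)) z"
  shows "\<exists>a b. a \<noteq> 0 \<and> (\<forall>z. poly p z \<noteq> 0 \<longrightarrow>
      poly W (g z) = a * poly W (f z) + b * poly W (f z) * poly W (g z))"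
proof -
  define A where "A = (\<lambda>z. poly W (f z))"
  define B where "B = (\<lambda>z. poly W (g z))"
  let ?R = "{z. reg z}"
  have sub: "?R \<subseteq> {z. poly p z \<noteq> 0}"
    using reg_p by auto
  have holA: "A holomorphic_on ?R" and holB: "B holomorphic_on ?R"
    unfolding A_def B_def using holomorphic_on_subset[OF hol_f sub] holomorphic_on_subset[OF hol_g sub]
    by (auto intro!: holomorphic_intros)
  have dA: "(A has_field_derivative deriv A z) (at z)" "(deriv A has_field_derivative deriv (deriv A) z) (at z)"
    and dB: "(B has_field_derivative deriv B z) (at z)" "(deriv B has_field_derivative deriv (deriv B) z) (at z)"
    if "z \<in> ?R" for z
    using that holomorphic_derivI[OF holA open_reg] holomorphic_derivI[OF holB open_reg]
      holomorphic_derivI[OF holomorphic_deriv[OF holA open_reg] open_reg]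
      holomorphic_derivI[OF holomorphic_deriv[OF holB open_reg] open_reg] by blast+
  have nz: "A z \<noteq> 0 \<and> B z \<noteq> 0 \<and> deriv A z \<noteq> 0 \<and> deriv B z \<noteq> 0" if z: "z \<in> ?R" for z
  proof -
    have "f field_differentiable at z" "g field_differentiable at z"
      using holomorphic_on_imp_differentiable_at[OF hol_f open_poly_nonzero]
        holomorphic_on_imp_differentiable_at[OF hol_g open_poly_nonzero] reg_p z by auto
    then show ?thesis
      using reg_facts[of z] z unfolding A_def B_def by (simp add: deriv_poly_comp)
  qed
  \<comment> \<open>The quotient \<open>(1/A)' / (1/B)'\<close>.\<close>
  define \<theta> where "\<theta> = (\<lambda>z. deriv A z * (B z)\<^sup>2 / ((A z)\<^sup>2 * deriv B z))"
  have "(\<theta> has_field_derivative 0) (at z)" if z: "z \<in> ?R" for z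
  proof -
    define a0 a1 a2 b0 b1 b2 where "a0 = A z" and "a1 = deriv A z" and "a2 = deriv (deriv A) z"
      and "b0 = B z" and "b1 = deriv B z" and "b2 = deriv (deriv B) z"
    note defs = this
    have n: "a0 \<noteq> 0" "b0 \<noteq> 0" "a1 \<noteq> 0" "b1 \<noteq> 0"
      using nz[OF z] by (auto simp: defs)
    have "a2 / a1 - 2 * a1 / a0 = b2 / b1 - 2 * b1 / b0"
      using eq z unfolding dlog_quot_def A_def[symmetric] B_def[symmetric] by (simp add: defs)
    then have E: "(a2 / a1 - 2 * a1 / a0) * (a1 * a0 * b1 * b0) = (b2 / b1 - 2 * b1 / b0) * (a1 * a0 * b1 * b0)"
      by (simp only:)
    have key: "a2 * a0 * b1 * b0 - 2 * a1\<^sup>2 * b1 * b0 = b2 * b0 * a1 * a0 - 2 * b1\<^sup>2 * a1 * a0"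
    proof -
      have "(a2 / a1 - 2 * a1 / a0) * (a1 * a0 * b1 * b0) = a2 * a0 * b1 * b0 - 2 * a1\<^sup>2 * b1 * b0"
        using n by (simp add: field_simps power2_eq_square)
      moreover have "(b2 / b1 - 2 * b1 / b0) * (a1 * a0 * b1 * b0) = b2 * b0 * a1 * a0 - 2 * b1\<^sup>2 * a1 * a0"
        using n by (simp add: field_simps power2_eq_square)
      ultimately show ?thesis
        using E by (simp only:)
    qed
    have "(\<theta> has_field_derivative
       (((a2 * b0\<^sup>2 + (2 * b0 * b1) * a1) * (a0\<^sup>2 * b1) - (a1 * b0\<^sup>2) * ((2 * a0 * a1) * b1 + b2 * a0\<^sup>2)) /
        ((a0\<^sup>2 * b1) * (a0\<^sup>2 * b1)))) (at z)"
      unfolding \<theta>_def defs using n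
      by (intro DERIV_divide DERIV_mult dA[OF z] dB[OF z])
         (auto intro!: derivative_eq_intros dA[OF z] dB[OF z] simp: defs)
    moreover have "(a2 * b0\<^sup>2 + (2 * b0 * b1) * a1) * (a0\<^sup>2 * b1) - (a1 * b0\<^sup>2) * ((2 * a0 * a1) * b1 + b2 * a0\<^sup>2)
       = a0 * b0 * ((a2 * a0 * b1 * b0 - 2 * a1\<^sup>2 * b1 * b0) - (b2 * b0 * a1 * a0 - 2 * b1\<^sup>2 * a1 * a0))"
      by (simp add: algebra_simps power2_eq_square)
    ultimately show ?thesis
      by (simp add: key)
  qed
  then obtain \<kappa> where \<kappa>: "\<And>z. z \<in> ?R \<Longrightarrow> \<theta> z = \<kappa>"
    using DERIV_zero_connected_constant[OF connected_reg open_reg, of "{}" \<theta>]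
    by (metis DERIV_isCont Diff_empty continuous_at_imp_continuous_on finite.emptyI)
  obtain z0 where z0: "z0 \<in> ?R"
    using exists_reg by auto
  have \<kappa>0: "\<kappa> \<noteq> 0"
    using \<kappa>[OF z0] nz[OF z0] by (auto simp: \<theta>_def)
  define \<psi> where "\<psi> = (\<lambda>z. 1 / A z - \<kappa> / B z)"
  have "(\<psi> has_field_derivative 0) (at z)" if z: "z \<in> ?R" for z
  proof -
    have "(\<psi> has_field_derivative (0 * A z - 1 * deriv A z) / (A z * A z) - (0 * B z - \<kappa> * deriv B z) / (B z * B z)) (at z)"
      unfolding \<psi>_def using nz[OF z] by (intro DERIV_diff DERIV_divide DERIV_const dA[OF z] dB[OF z]) auto
    moreover have "deriv A z * (B z)\<^sup>2 = \<kappa> * ((A z)\<^sup>2 * deriv B z)"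
      using \<kappa>[OF z] nz[OF z] by (simp add: \<theta>_def field_simps)
    then have "(0 * A z - 1 * deriv A z) / (A z * A z) - (0 * B z - \<kappa> * deriv B z) / (B z * B z) = 0"
      using nz[OF z] by (simp add: field_simps power2_eq_square)
    ultimately show ?thesis
      by simp
  qed
  then obtain b where b: "\<And>z. z \<in> ?R \<Longrightarrow> \<psi> z = b"
    using DERIV_zero_connected_constant[OF connected_reg open_reg, of "{}" \<psi>]
    by (metis DERIV_isCont Diff_empty continuous_at_imp_continuous_on finite.emptyI)
  have "B z = \<kappa> * A z + b * A z * B z" if pz: "poly p z \<noteq> 0" for z
  proof -
    define h where "h = (\<lambda>z. B z - (\<kappa> * A z + b * A z * B z))"
    have "isCont h z"
      unfolding h_def A_def B_def using isCont_fg[OF pz] by (intro continuous_intros) auto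
    moreover have "eventually (\<lambda>z. h z = 0) (at z)"
      using eventually_reg
    proof eventually_elim
      case (elim z)
      then have "1 / A z - \<kappa> / B z = b" "A z \<noteq> 0" "B z \<noteq> 0"
        using b[of z] nz[of z] by (auto simp: \<psi>_def)
      then show ?case
        by (auto simp: h_def field_simps)
    qed
    ultimately have "h z = 0"
      by (rule isCont_eventually_zero)
    then show ?thesis
      by (simp add: h_def)
  qed
  then show ?thesis
    using \<kappa>0 unfolding A_def B_def by blast
qed

end

section \<open>Consequences of finite non-integer order\<close>

text \<open>The order lies strictly between \<open>d\<close> and \<open>d + 1\<close>. Two further exponents are interposed: \<open>f\<close> grows at
most like \<open>exp (C |z| powr \<sigma>)\<close>, and quotients formed from \<open>f\<close> and \<open>g\<close> satisfy such a bound with the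
larger \<open>\<tau>\<close> only, because the minimum modulus estimate loses a logarithm.\<close>

lemma noninteger_order_data:
  assumes f: "f \<in> M1" and ord: "noninteger_finite_order f"
  shows "\<exists>\<rho> \<sigma> \<tau> (d::nat). nevanlinna_order f = ereal \<rho> \<and> real d < \<rho> \<and> \<rho> < \<sigma> \<and> \<sigma> < \<tau> \<and> \<tau> < real d + 1"
proof -
  obtain \<rho> where \<rho>: "nevanlinna_order f = ereal \<rho>" "\<rho> \<notin> \<int>"
    using ord by (auto simp: noninteger_finite_order_def)
  have "\<rho> \<ge> 0"
    using order_nonneg[OF f] \<rho>(1) by simp
  define d where "d = nat \<lfloor>\<rho>\<rfloor>"
  have fl: "real d = of_int \<lfloor>\<rho>\<rfloor>"
    using \<open>\<rho> \<ge> 0\<close> by (simp add: d_def)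
  have "real d \<le> \<rho>" "\<rho> < real d + 1"
    unfolding fl by linarith+
  moreover have "real d \<noteq> \<rho>"
    using \<rho>(2) by auto
  ultimately have d: "real d < \<rho>" "\<rho> < real d + 1"
    by auto
  obtain \<tau> where \<tau>: "\<rho> < \<tau>" "\<tau> < real d + 1"
    using dense[OF d(2)] by blast
  obtain \<sigma> where "\<rho> < \<sigma>" "\<sigma> < \<tau>"
    using dense[OF \<tau>(1)] by blast
  then show ?thesis
    using \<rho>(1) d \<tau> by blast
qed

text \<open>Powers of \<open>ln |z|\<close> do not lift the order above \<open>d\<close>; this is how \<open>\<rho> > d\<close> enters.\<close>

lemma growth_contradiction:
  assumes f: "f \<in> M1" and ord: "nevanlinna_order f = ereal \<rho>" "real d < \<rho>" and C: "C \<ge> 0" and r0: "r0 > 0"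
    and bd: "\<And>z. r0 \<le> norm z \<Longrightarrow> ln (norm (f z)) \<le> C * (norm z ^ d * ln (norm z) ^ K)"
  shows False
proof -
  have "nevanlinna_order f \<le> ereal (real d)"
  proof (rule order_le_of_growth[OF f _ C])
    fix z :: complex assume z: "r0 \<le> norm z"
    have "norm z powr real d = norm z ^ d"
      using z r0 by (intro powr_realpow) linarith
    then show "ln (norm (f z)) \<le> C * norm z powr real d * ln (norm z) ^ K"
      using bd[OF z] by (simp add: mult.assoc)
  qed simp
  then show False
    using ord by simp
qed

lemma exp_plus_le: "0 \<le> a \<Longrightarrow> 0 \<le> b \<Longrightarrow> exp a + b \<le> exp (a + b)" for a b :: real
proof -
  assume ab: "0 \<le> a" "0 \<le> b"
  have "1 * b \<le> exp a * b"
    using ab by (intro mult_right_mono) auto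
  moreover have "exp a * (1 + b) \<le> exp a * exp b"
    by (intro mult_left_mono exp_ge_add_one_self) auto
  ultimately show ?thesis
    by (simp add: exp_add algebra_simps)
qed

lemma ln_ge_1: "3 \<le> x \<Longrightarrow> 1 \<le> ln x" for x :: real
proof -
  assume x: "3 \<le> x"
  have "exp 1 \<le> x"
    using x exp_le by linarith
  then have "ln (exp 1) \<le> ln x"
    by (intro ln_mono) auto
  then show ?thesis
    by simp
qed

lemma times_ln_le_powr:
  fixes Y \<eta> :: real
  assumes "1 \<le> Y" "0 < \<eta>"
  shows "Y * (1 + ln Y) \<le> (1 + 1 / \<eta>) * Y powr (1 + \<eta>)"
proof -
  have "1 \<le> Y powr \<eta>"
    using assms by (intro ge_one_powr_ge_zero) auto
  moreover have "ln Y \<le> Y powr \<eta> / \<eta>"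
    using assms by (intro ln_powr_bound) auto
  ultimately have "Y * (1 + ln Y) \<le> Y * (Y powr \<eta> + Y powr \<eta> / \<eta>)"
    using assms by (intro mult_left_mono) auto
  also have "\<dots> = (1 + 1 / \<eta>) * Y powr (1 + \<eta>)"
    using assms by (simp add: powr_add algebra_simps)
  finally show ?thesis .
qed

locale finite_order_pair = shared_pair +
  fixes \<rho> \<sigma> \<tau> :: real and d :: nat
  assumes fM: "f \<in> M1" and gM: "g \<in> M1" and f_clear: "\<And>z. \<not> is_pole f z \<Longrightarrow> f z * poly p z = f1 z"
    and ord: "nevanlinna_order f = ereal \<rho>" and exps: "real d < \<rho>" "\<rho> < \<sigma>" "\<sigma> < \<tau>" "\<tau> < real d + 1"
begin

lemma \<sigma>_pos: "\<sigma> > 0" and \<tau>_pos: "\<tau> > 0"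
  using exps by linarith+

lemma f_growth: "\<exists>C\<ge>1. \<exists>r0\<ge>3. \<forall>z. r0 \<le> norm z \<longrightarrow> poly p z \<noteq> 0 \<and> 1 + norm (f z) \<le> exp (C * norm z powr \<sigma>) \<and>
    norm (poly p z) \<le> exp (C * norm z powr \<sigma>) \<and> \<bar>ln (norm (poly p z))\<bar> \<le> C * ln (norm z)"
proof -
  have "nevanlinna_order f < ereal \<sigma>"
    using ord exps by simp
  from growth_of_order_less[OF fM this \<sigma>_pos f1 f_clear]
  obtain C0 r1 where C0: "C0 \<ge> 0" and r1: "\<And>z. r1 \<le> norm z \<Longrightarrow> norm (f1 z) \<le> exp (C0 * norm z powr \<sigma>)"
    by blast
  obtain Cp rp where Cp: "Cp \<ge> 0" "rp \<ge> 3" "\<And>z. rp \<le> norm z \<Longrightarrow> poly p z \<noteq> 0 \<and> \<bar>ln (norm (poly p z))\<bar> \<le> Cp * ln (norm z)"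
    using poly_ln_bound[OF p] by blast
  define C where "C = C0 + Cp / \<sigma> + Cp + 1"
  define r0 where "r0 = max r1 rp"
  have "poly p z \<noteq> 0 \<and> 1 + norm (f z) \<le> exp (C * norm z powr \<sigma>) \<and>
    norm (poly p z) \<le> exp (C * norm z powr \<sigma>) \<and> \<bar>ln (norm (poly p z))\<bar> \<le> C * ln (norm z)"
    if z: "r0 \<le> norm z" for z
  proof -
    have z': "r1 \<le> norm z" "rp \<le> norm z" "3 \<le> norm z"
      using z Cp by (auto simp: r0_def)
    have pz: "poly p z \<noteq> 0" "\<bar>ln (norm (poly p z))\<bar> \<le> Cp * ln (norm z)"
      using Cp(3)[OF z'(2)] by auto
    define T where "T = norm z powr \<sigma>"
    have T: "T \<ge> 1"
      unfolding T_def using z' \<sigma>_pos by (intro ge_one_powr_ge_zero) auto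
    have "ln (norm z) \<le> T / \<sigma>"
      unfolding T_def using z' \<sigma>_pos by (intro ln_powr_bound) auto
    then have "Cp * ln (norm z) \<le> Cp * (T / \<sigma>)"
      using Cp(1) by (intro mult_left_mono)
    then have lp: "\<bar>ln (norm (poly p z))\<bar> \<le> Cp / \<sigma> * T"
      using pz(2) by simp
    have "norm (poly p z) = exp (ln (norm (poly p z)))"
      using pz by simp
    also have "\<dots> \<le> exp (C * T)"
    proof -
      have "Cp / \<sigma> * T \<le> C * T"
        using T C0 Cp(1) by (intro mult_right_mono) (auto simp: C_def)
      then show ?thesis
        using lp by (subst exp_le_cancel_iff) linarith
    qed
    finally have 1: "norm (poly p z) \<le> exp (C * T)" .
    have "1 / norm (poly p z) = exp (- ln (norm (poly p z)))"
      using pz by (simp add: exp_minus inverse_eq_divide)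
    also have "\<dots> \<le> exp (Cp / \<sigma> * T)"
      using lp by (subst exp_le_cancel_iff) linarith
    finally have "norm (f1 z) * (1 / norm (poly p z)) \<le> exp (C0 * T) * exp (Cp / \<sigma> * T)"
      using r1[OF z'(1)] unfolding T_def[symmetric] by (intro mult_mono) auto
    then have "norm (f z) \<le> exp ((C0 + Cp / \<sigma>) * T)"
      using f[OF pz(1)] by (simp add: norm_divide exp_add distrib_right)
    then have "norm (f z) + 1 \<le> exp ((C0 + Cp / \<sigma>) * T) + 1"
      by simp
    also have "\<dots> \<le> exp ((C0 + Cp / \<sigma>) * T + 1)"
      using C0 Cp(1) \<sigma>_pos T by (intro exp_plus_le mult_nonneg_nonneg) auto
    also have "\<dots> \<le> exp (C * T)"
    proof -
      have "(C0 + Cp / \<sigma>) * T + 1 \<le> (C0 + Cp / \<sigma>) * T + (Cp + 1) * T"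
        using mult_mono[of 1 "Cp + 1" 1 T] Cp(1) T by simp
      also have "\<dots> = C * T"
        by (simp add: C_def algebra_simps)
      finally show ?thesis
        by (subst exp_le_cancel_iff)
    qed
    finally have 2: "1 + norm (f z) \<le> exp (C * T)"
      by simp
    have "0 \<le> ln (norm z)"
      using z' by simp
    then have "Cp * ln (norm z) \<le> C * ln (norm z)"
      using C0 Cp(1) \<sigma>_pos by (intro mult_right_mono) (auto simp: C_def)
    then show ?thesis
      using 1 2 pz unfolding T_def by simp
  qed
  moreover have "C \<ge> 1"
    using C0 Cp(1) \<sigma>_pos by (simp add: C_def)
  ultimately show ?thesis
    using Cp by (intro exI[of _ C] conjI exI[of _ r0]) (auto simp: r0_def)
qed

text \<open>If \<open>f\<close> omitted \<open>\<kappa>\<close>, then \<open>f - \<kappa>\<close> would have no zeros and finitely many poles, so its growth would be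
that of \<open>exp\<close> of a polynomial of degree \<open>d\<close>.\<close>

lemma f_takes_value: "\<exists>z. poly p z \<noteq> 0 \<and> f z = \<kappa>"
proof (rule ccontr)
  assume "\<not> ?thesis"
  then have omit: "f z \<noteq> \<kappa>" if "poly p z \<noteq> 0" for z
    using that by blast
  obtain C r0 where C: "C \<ge> 1" and r0: "r0 \<ge> 3" and gr: "\<forall>z. r0 \<le> norm z \<longrightarrow> poly p z \<noteq> 0 \<and> 1 + norm (f z) \<le> exp (C * norm z powr \<sigma>) \<and>
    norm (poly p z) \<le> exp (C * norm z powr \<sigma>) \<and> \<bar>ln (norm (poly p z))\<bar> \<le> C * ln (norm z)"
    using f_growth by (elim exE conjE)
  have mero: "(\<lambda>z. f z - \<kappa>) meromorphic_on UNIV"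
    by (intro meromorphic_intros f_mero)
  have lim: "\<exists>l. l \<noteq> 0 \<and> (\<lambda>z. f z - \<kappa>) \<midarrow>z\<rightarrow> l" if "z \<notin> {z. poly p z = 0}" for z
  proof -
    have pz: "poly p z \<noteq> 0"
      using that by simp
    have "isCont (\<lambda>z. f z - \<kappa>) z"
      using isCont_fg(1)[OF pz] by (intro continuous_intros)
    then show ?thesis
      using omit[OF pz] unfolding isCont_def by (intro exI[of _ "f z - \<kappa>"]) auto
  qed
  have growth: "\<exists>r. s \<le> r \<and> r \<le> 2 * s \<and> (\<forall>z. norm z = r \<longrightarrow> (\<lambda>z. f z - \<kappa>) analytic_on {z} \<and>
      norm (f z - \<kappa>) \<le> exp ((C + norm \<kappa>) * s powr \<sigma>))" if s: "s \<ge> r0" for s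
  proof (intro exI[of _ s] conjI allI impI)
    fix z :: complex assume z: "norm z = s"
    then have pz: "poly p z \<noteq> 0" and b: "1 + norm (f z) \<le> exp (C * s powr \<sigma>)"
      using gr s by auto
    show "(\<lambda>z. f z - \<kappa>) analytic_on {z}"
      using analytic_fg(1)[OF pz] by (intro analytic_intros)
    have s1: "1 \<le> s powr \<sigma>"
      using s r0 \<sigma>_pos by (intro ge_one_powr_ge_zero) auto
    have "norm (f z - \<kappa>) \<le> exp (C * s powr \<sigma>) + norm \<kappa>"
      using b norm_triangle_ineq4[of "f z" \<kappa>] by linarith
    also have "\<dots> \<le> exp (C * s powr \<sigma> + norm \<kappa>)"
      using C by (intro exp_plus_le) auto
    also have "\<dots> \<le> exp ((C + norm \<kappa>) * s powr \<sigma>)"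
      using mult_left_mono[OF s1, of "norm \<kappa>"] by (subst exp_le_cancel_iff) (simp add: distrib_right)
    finally show "norm (f z - \<kappa>) \<le> exp ((C + norm \<kappa>) * s powr \<sigma>)" .
  qed (use s r0 in auto)
  have "\<sigma> < real d + 1"
    using exps by simp
  then have "\<exists>C\<ge>0. \<exists>r0\<ge>3. \<forall>z. r0 \<le> norm z \<longrightarrow> (\<lambda>z. f z - \<kappa>) analytic_on {z} \<longrightarrow>
      f z - \<kappa> \<noteq> 0 \<and> \<bar>ln (norm (f z - \<kappa>))\<bar> \<le> C * (norm z ^ d * ln (norm z))"
    using C by (intro ln_norm_bound_zero_free[OF mero poly_roots_finite[OF p] lim \<sigma>_pos _ _ growth]) auto
  then obtain C' r1 where C': "C' \<ge> 0" and r1: "r1 \<ge> 3" and bd: "\<And>z. r1 \<le> norm z \<Longrightarrow> (\<lambda>z. f z - \<kappa>) analytic_on {z} \<Longrightarrow>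
      \<bar>ln (norm (f z - \<kappa>))\<bar> \<le> C' * (norm z ^ d * ln (norm z))"
    by blast
  show False
  proof (rule growth_contradiction[OF fM ord exps(1)])
    fix z :: complex assume z: "max r0 r1 \<le> norm z"
    then have pz: "poly p z \<noteq> 0" and z3: "norm z \<ge> 3"
      using gr r0 by auto
    define D where "D = norm z ^ d * ln (norm z)"
    have D: "D \<ge> 1"
      using mult_mono[of 1 "norm z ^ d" 1 "ln (norm z)"] ln_ge_1[OF z3] one_le_power[of "norm z" d] z3
      by (simp add: D_def)
    have an: "(\<lambda>z. f z - \<kappa>) analytic_on {z}"
      using analytic_fg(1)[OF pz] by (intro analytic_intros)
    have "ln (norm (f z - \<kappa>)) \<le> C' * D"
      using bd[OF _ an] z by (auto simp: D_def)
    then have "exp (ln (norm (f z - \<kappa>))) \<le> exp (C' * D)"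
      by (simp only: exp_le_cancel_iff)
    then have "norm (f z - \<kappa>) \<le> exp (C' * D)"
      using omit[OF pz] by simp
    then have "norm (f z) \<le> exp (C' * D) + norm \<kappa>"
      using norm_triangle_ineq[of "f z - \<kappa>" \<kappa>] by simp
    also have "\<dots> \<le> exp (C' * D + norm \<kappa>)"
      using C' D by (intro exp_plus_le) auto
    also have "\<dots> \<le> exp ((C' + norm \<kappa>) * D)"
      using mult_left_mono[OF D, of "norm \<kappa>"] by (subst exp_le_cancel_iff) (simp add: distrib_right)
    finally have le: "norm (f z) \<le> exp ((C' + norm \<kappa>) * D)" .
    have "ln (norm (f z)) \<le> (C' + norm \<kappa>) * D"
    proof (cases "f z = 0")
      case False
      then have "ln (norm (f z)) \<le> ln (exp ((C' + norm \<kappa>) * D))"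
        using le by (intro ln_mono) auto
      then show ?thesis
        by simp
    qed (use C' D in auto)
    then show "ln (norm (f z)) \<le> (C' + norm \<kappa>) * (norm z ^ d * ln (norm z) ^ 1)"
      by (simp add: D_def)
  qed (use C' r0 in auto)
qed

end

locale related_pair = finite_order_pair +
  fixes a :: complex
  assumes a: "a \<noteq> 0" and rel: "\<And>z. poly p z \<noteq> 0 \<Longrightarrow> poly W (g z) = a * poly W (f z)"
    and degW: "degree W > 0"
begin

lemma fg_comparison:
  "\<exists>K\<ge>1. \<forall>z. poly p z \<noteq> 0 \<longrightarrow> norm (g z) \<le> K * (1 + norm (f z)) \<and> norm (f z) \<le> K * (1 + norm (g z))"
proof -
  obtain K1 where K1: "K1 \<ge> 1" "\<forall>x y. poly W y = a * poly W x \<longrightarrow> norm y \<le> K1 * (1 + norm x)"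
    using poly_value_comparison[OF degW, of a] by (elim exE conjE)
  obtain K2 where K2: "K2 \<ge> 1" "\<forall>x y. poly W y = (1 / a) * poly W x \<longrightarrow> norm y \<le> K2 * (1 + norm x)"
    using poly_value_comparison[OF degW, of "1 / a"] by (elim exE conjE)
  have "norm (g z) \<le> max K1 K2 * (1 + norm (f z)) \<and> norm (f z) \<le> max K1 K2 * (1 + norm (g z))"
    if pz: "poly p z \<noteq> 0" for z
  proof
    have "norm (g z) \<le> K1 * (1 + norm (f z))"
      using K1(2) rel[OF pz] by blast
    also have "\<dots> \<le> max K1 K2 * (1 + norm (f z))"
      by (intro mult_right_mono) auto
    finally show "norm (g z) \<le> max K1 K2 * (1 + norm (f z))" .
    have "poly W (f z) = (1 / a) * poly W (g z)"
      using rel[OF pz] a by simp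
    then have "norm (f z) \<le> K2 * (1 + norm (g z))"
      using K2(2) by blast
    also have "\<dots> \<le> max K1 K2 * (1 + norm (g z))"
      by (intro mult_right_mono) auto
    finally show "norm (f z) \<le> max K1 K2 * (1 + norm (g z))" .
  qed
  then show ?thesis
    using K1 by (intro exI[of _ "max K1 K2"]) auto
qed

lemma hol_lin_g: "(\<lambda>z. g1 z - x * poly p z) holomorphic_on UNIV"
  using g1 by (intro holomorphic_intros)

lemma nonzero_lin_g: "\<exists>z. g1 z - x * poly p z \<noteq> 0"
proof (rule ccontr)
  assume "\<not> (\<exists>z. g1 z - x * poly p z \<noteq> 0)"
  then have "g1 = (\<lambda>z. x * poly p z)"
    by auto
  then have "wronski g1 p z = 0" for z
    unfolding wronski_def by (simp add: DERIV_imp_deriv[OF DERIV_cmult[OF poly_DERIV]])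
  then show False
    using ncg by simp
qed

lemma lin_g_bound:
  "\<exists>C\<ge>1. \<exists>r0\<ge>3. \<forall>s\<ge>r0. \<forall>z. norm z \<le> s \<longrightarrow> norm (g1 z - x * poly p z) \<le> exp (C * s powr \<sigma>)"
proof -
  obtain C r0 where C: "C \<ge> 1" and r0: "r0 \<ge> 3" and gr: "\<forall>z. r0 \<le> norm z \<longrightarrow> poly p z \<noteq> 0 \<and> 1 + norm (f z) \<le> exp (C * norm z powr \<sigma>) \<and>
    norm (poly p z) \<le> exp (C * norm z powr \<sigma>) \<and> \<bar>ln (norm (poly p z))\<bar> \<le> C * ln (norm z)"
    using f_growth by (elim exE conjE)
  obtain K where K: "K \<ge> 1" "\<forall>z. poly p z \<noteq> 0 \<longrightarrow> norm (g z) \<le> K * (1 + norm (f z)) \<and> norm (f z) \<le> K * (1 + norm (g z))"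
    using fg_comparison by (elim exE conjE)
  define L where "L = K + norm x"
  have "norm (g1 z - x * poly p z) \<le> exp ((2 * C + L) * s powr \<sigma>)" if s: "s \<ge> r0" and z: "norm z \<le> s" for s z
  proof (rule entire_bound_on_cball[OF hol_lin_g _ _ z])
    show "0 < s"
      using s r0 by simp
    fix w :: complex assume w: "norm w = s"
    define T where "T = s powr \<sigma>"
    have T: "T \<ge> 1"
      unfolding T_def using s r0 \<sigma>_pos by (intro ge_one_powr_ge_zero) auto
    have pw: "poly p w \<noteq> 0" "1 + norm (f w) \<le> exp (C * T)" "norm (poly p w) \<le> exp (C * T)"
      using gr w s by (auto simp: T_def)
    have e1: "1 \<le> exp (C * T)"
      using C T by simp
    have "norm (g w - x) \<le> norm (g w) + norm x"
      by (rule norm_triangle_ineq4)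
    also have "\<dots> \<le> K * (1 + norm (f w)) + norm x * 1"
      using K(2) pw(1) by (intro add_mono) auto
    also have "\<dots> \<le> K * exp (C * T) + norm x * exp (C * T)"
      using pw(2) e1 K(1) by (intro add_mono mult_left_mono) auto
    also have "\<dots> = L * exp (C * T)"
      by (simp add: L_def distrib_right)
    also have "\<dots> \<le> exp (L * T) * exp (C * T)"
    proof (intro mult_right_mono)
      have "L * 1 \<le> L * T"
        using T K(1) by (intro mult_left_mono) (auto simp: L_def)
      then show "L \<le> exp (L * T)"
        using exp_ge_add_one_self[of "L * T"] by linarith
    qed auto
    finally have "norm (g w - x) * norm (poly p w) \<le> (exp (L * T) * exp (C * T)) * exp (C * T)"
      using pw(3) by (intro mult_mono) auto
    moreover have "g1 w - x * poly p w = (g w - x) * poly p w"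
      using g[OF pw(1)] pw(1) by (simp add: left_diff_distrib)
    moreover have "exp ((2 * C + L) * T) = (exp (L * T) * exp (C * T)) * exp (C * T)"
      by (simp add: exp_add[symmetric] algebra_simps)
    ultimately show "norm (g1 w - x * poly p w) \<le> exp ((2 * C + L) * s powr \<sigma>)"
      by (simp add: norm_mult T_def)
  qed
  then show ?thesis
    using C K(1) r0 by (intro exI[of _ "2 * C + L"] conjI exI[of _ r0]) (auto simp: L_def add_increasing2)
qed

text \<open>Let \<open>e\<close> and \<open>e'\<close> be the multiplicities of \<open>\<beta>\<close> and \<open>\<delta>\<close> as roots of \<open>W - W(\<beta>)\<close> and \<open>W - W(\<delta>)\<close>. Where
\<open>f = \<beta>\<close>, and hence \<open>g = \<delta>\<close>, the equation \<open>W(g) - W(\<delta>) = a (W(f) - W(\<beta>))\<close> shows that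
\<open>(f - \<beta>)\<^sup>e\<close> and \<open>(g - \<delta>)\<^sup>e'\<close> have the same order of vanishing. Their quotient thus has no zeros and no
poles except where \<open>f\<close> and \<open>g\<close> have poles.\<close>

lemma ratio_of_powers:
  assumes \<delta>: "poly W \<delta> = a * poly W \<beta>" and pts: "\<And>z. poly p z \<noteq> 0 \<Longrightarrow> f z = \<beta> \<longleftrightarrow> g z = \<delta>"
  shows "\<exists>e e' C r0. 1 \<le> (e::nat) \<and> 1 \<le> (e'::nat) \<and> 0 \<le> C \<and> 3 \<le> r0 \<and>
    (\<forall>z. r0 \<le> norm z \<longrightarrow> poly p z \<noteq> 0 \<longrightarrow> f z \<noteq> \<beta> \<longrightarrow>
       \<bar>real e * ln (norm (f z - \<beta>)) - real e' * ln (norm (g z - \<delta>))\<bar> \<le> C * (norm z ^ d * ln (norm z))) \<and>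
    (\<forall>z. poly p z \<noteq> 0 \<longrightarrow> (\<exists>l. (\<lambda>z. (f z - \<beta>) ^ e / (g z - \<delta>) ^ e') \<midarrow>z\<rightarrow> l))"
proof -
  have nzW: "W - [:w:] \<noteq> 0" for w
  proof
    assume "W - [:w:] = 0"
    then have "W = [:w:]"
      by simp
    then show False
      using degW by simp
  qed
  have dec: "\<exists>e q. 1 \<le> e \<and> W - [:poly W x:] = [:- x, 1:] ^ e * q \<and> poly q x \<noteq> 0" for x
  proof -
    obtain q where q: "W - [:poly W x:] = [:- x, 1:] ^ order x (W - [:poly W x:]) * q" "\<not> [:- x, 1:] dvd q"
      using order_decomp[OF nzW] by blast
    have "poly (W - [:poly W x:]) x = 0"
      by simp
    then have "order x (W - [:poly W x:]) \<noteq> 0"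
      using nzW[of "poly W x"] unfolding order_root by blast
    then show ?thesis
      using q by (intro exI[of _ "order x (W - [:poly W x:])"] exI[of _ q]) (auto simp: poly_eq_0_iff_dvd)
  qed
  obtain e q where e: "1 \<le> e" "W - [:poly W \<beta>:] = [:- \<beta>, 1:] ^ e * q" "poly q \<beta> \<noteq> 0"
    using dec by blast
  obtain e' q' where e': "1 \<le> e'" "W - [:poly W \<delta>:] = [:- \<delta>, 1:] ^ e' * q'" "poly q' \<delta> \<noteq> 0"
    using dec by blast
  have W\<beta>: "poly W x - poly W \<beta> = (x - \<beta>) ^ e * poly q x" and W\<delta>: "poly W x - poly W \<delta> = (x - \<delta>) ^ e' * poly q' x" for x
    using arg_cong[OF e(2), of "\<lambda>p. poly p x"] arg_cong[OF e'(2), of "\<lambda>p. poly p x"] by (simp_all add: poly_power)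
  define F where "F = (\<lambda>z. (f z - \<beta>) ^ e / (g z - \<delta>) ^ e')"
  have mero: "F meromorphic_on UNIV"
    unfolding F_def by (intro meromorphic_intros f_mero g_mero)
  have lim: "\<exists>l. l \<noteq> 0 \<and> F \<midarrow>z\<rightarrow> l" if "z \<notin> {z. poly p z = 0}" for z
  proof -
    have pz: "poly p z \<noteq> 0"
      using that by simp
    note c = isCont_fg[OF pz]
    show ?thesis
    proof (cases "f z = \<beta>")
      case False
      then have "isCont F z" "F z \<noteq> 0"
        unfolding F_def using pts[OF pz] c by (auto intro!: continuous_intros)
      then show ?thesis
        unfolding isCont_def by blast
    next
      case True
      then have gz: "g z = \<delta>"
        using pts[OF pz] by simp
      \<comment> \<open>The relation between \<open>W(f)\<close> and \<open>W(g)\<close> identifies \<open>F\<close> with this function off \<open>z\<close>.\<close>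
      define H where "H = (\<lambda>z. poly q' (g z) / (a * poly q (f z)))"
      have H: "isCont H z" "H z \<noteq> 0"
        unfolding H_def using True gz e(3) e'(3) a c by (auto intro!: continuous_intros)
      have ev1: "eventually (\<lambda>z. g1 z - \<delta> * poly p z \<noteq> 0) (at z)"
        by (rule eventually_entire_nonzero[OF hol_lin_g nonzero_lin_g])
      have ev2: "eventually (\<lambda>z. z \<in> {z. poly p z \<noteq> 0}) (at z)"
        using pz by (intro eventually_at_in_open' open_poly_nonzero) auto
      have ev3: "eventually (\<lambda>z. poly q (f z) \<noteq> 0) (at z)"
      proof -
        have "isCont (\<lambda>z. poly q (f z)) z"
          using c by (intro continuous_intros)
        then show ?thesis
          using e(3) True by (intro tendsto_imp_eventually_ne[of _ "poly q (f z)"]) (auto simp: isCont_def)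
      qed
      have "eventually (\<lambda>z. H z = F z) (at z)"
        using ev1 ev2 ev3
      proof eventually_elim
        case (elim w)
        then have pw: "poly p w \<noteq> 0"
          by simp
        have gw: "g w \<noteq> \<delta>"
          using elim(1) g[OF pw] pw by auto
        have "(g w - \<delta>) ^ e' * poly q' (g w) = a * ((f w - \<beta>) ^ e * poly q (f w))"
          unfolding W\<beta>[symmetric] W\<delta>[symmetric] using rel[OF pw] \<delta> by (simp add: right_diff_distrib)
        then show ?case
          unfolding H_def F_def using gw elim(3) a by (simp add: field_simps)
      qed
      then have "F \<midarrow>z\<rightarrow> H z"
        using H(1) unfolding isCont_def by (rule Lim_transform_eventually[rotated])
      then show ?thesis
        using H(2) by blast
    qed
  qed
  obtain C r0 where C: "C \<ge> 1" and r0: "r0 \<ge> 3" and gr: "\<forall>z. r0 \<le> norm z \<longrightarrow> poly p z \<noteq> 0 \<and> 1 + norm (f z) \<le> exp (C * norm z powr \<sigma>) \<and>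
    norm (poly p z) \<le> exp (C * norm z powr \<sigma>) \<and> \<bar>ln (norm (poly p z))\<bar> \<le> C * ln (norm z)"
    using f_growth by (elim exE conjE)
  define G1 where "G1 = (\<lambda>z. g1 z - \<delta> * poly p z)"
  obtain Cg rg where Cg: "Cg \<ge> 1" and rg: "rg \<ge> 3" and G1b: "\<forall>s\<ge>rg. \<forall>z. norm z \<le> s \<longrightarrow> norm (G1 z) \<le> exp (Cg * s powr \<sigma>)"
    using lin_g_bound[of \<delta>] unfolding G1_def by (elim exE conjE)
  have "\<exists>C\<ge>1. good_circles {G1} C"
    using hol_lin_g[of \<delta>] nonzero_lin_g[of \<delta>] by (intro ex_good_circles) (auto simp: G1_def)
  then obtain c0 where c0: "c0 \<ge> 1" "good_circles {G1} c0"
    by (elim exE conjE)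
  \<comment> \<open>The factor \<open>1 + ln Y\<close> of the minimum modulus estimate is absorbed by raising the exponent from \<open>\<sigma>\<close> to \<open>\<tau>\<close>.\<close>
  define \<eta> where "\<eta> = \<tau> / \<sigma> - 1"
  have \<eta>: "\<eta> > 0" "1 + \<eta> = \<tau> / \<sigma>"
    using exps(3) \<sigma>_pos by (auto simp: \<eta>_def)
  define M1 where "M1 = 4 * c0 * ((1 + 1 / \<eta>) * (Cg powr (\<tau> / \<sigma>) * 2 powr \<tau>))"
  have M1: "M1 \<ge> 0"
    using c0 \<eta> by (simp add: M1_def)
  define M2 where "M2 = C * 2 powr \<tau>"
  define C0 where "C0 = real e * (M2 + norm \<beta>) + real e' * (M2 + M1)"
  have C0: "C0 \<ge> 0"
    using C M1 by (simp add: C0_def M2_def)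
  have growth: "\<exists>r. s \<le> r \<and> r \<le> 2 * s \<and> (\<forall>z. norm z = r \<longrightarrow> F analytic_on {z} \<and> norm (F z) \<le> exp (C0 * s powr \<tau>))"
    if s: "s \<ge> max r0 rg" for s
  proof -
    have s3: "s \<ge> 3" "s \<ge> r0" "s \<ge> rg"
      using s r0 by auto
    define Y where "Y = Cg * (2 * s) powr \<sigma>"
    have "1 \<le> (2 * s) powr \<sigma>"
      using s3 \<sigma>_pos by (intro ge_one_powr_ge_zero) auto
    then have Y: "Y \<ge> 1"
      using mult_mono[of 1 Cg 1 "(2 * s) powr \<sigma>"] Cg by (simp add: Y_def)
    define T where "T = s powr \<tau>"
    have T: "T \<ge> 1"
      unfolding T_def using s3 \<tau>_pos by (intro ge_one_powr_ge_zero) auto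
    have "norm (G1 z) \<le> exp Y" if "norm z \<le> 2 * s" for z
      using G1b that s3 by (auto simp: Y_def)
    then obtain r where r: "s \<le> r" "r \<le> 2 * s" and lo: "\<And>z. norm z = r \<Longrightarrow> G1 z \<noteq> 0 \<and> ln (norm (G1 z)) \<ge> - (4 * c0) * (Y * (1 + ln Y))"
      using doubling_good_circle[OF c0(2,1), of s "\<lambda>_. Y" Y] s3 Y by auto
    have "Y * (1 + ln Y) \<le> (1 + 1 / \<eta>) * Y powr (1 + \<eta>)"
      by (rule times_ln_le_powr[OF Y \<eta>(1)])
    also have "Y powr (1 + \<eta>) = Cg powr (\<tau> / \<sigma>) * 2 powr \<tau> * T"
      unfolding \<eta>(2) Y_def T_def using Cg s3 \<sigma>_pos by (simp add: powr_mult powr_powr)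
    finally have "4 * c0 * (Y * (1 + ln Y)) \<le> 4 * c0 * ((1 + 1 / \<eta>) * (Cg powr (\<tau> / \<sigma>) * 2 powr \<tau> * T))"
      using c0 by (intro mult_left_mono) auto
    also have "\<dots> = M1 * T"
      by (simp add: M1_def)
    finally have M: "4 * c0 * (Y * (1 + ln Y)) \<le> M1 * T" .
    have "F analytic_on {z} \<and> norm (F z) \<le> exp (C0 * T)" if z: "norm z = r" for z
    proof -
      have pz: "poly p z \<noteq> 0" "1 + norm (f z) \<le> exp (C * r powr \<sigma>)" "norm (poly p z) \<le> exp (C * r powr \<sigma>)"
        using gr z r s3 by auto
      have "r powr \<sigma> \<le> (2 * s) powr \<sigma>"
        using r s3 \<sigma>_pos by (intro powr_mono2) auto
      also have "\<dots> \<le> (2 * s) powr \<tau>"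
        using s3 exps(3) by (intro powr_mono) auto
      also have "\<dots> = 2 powr \<tau> * T"
        using s3 by (simp add: powr_mult T_def)
      finally have "exp (C * r powr \<sigma>) \<le> exp (M2 * T)"
        using C by (subst exp_le_cancel_iff) (simp add: M2_def mult_left_mono mult.assoc)
      then have fz: "1 + norm (f z) \<le> exp (M2 * T)" and pz2: "norm (poly p z) \<le> exp (M2 * T)"
        using pz by linarith+
      have G1z: "G1 z \<noteq> 0" "ln (norm (G1 z)) \<ge> - (M1 * T)"
        using lo[OF z] M by auto
      have G1eq: "G1 z = (g z - \<delta>) * poly p z"
        using g[OF pz(1)] pz(1) by (simp add: G1_def left_diff_distrib)
      then have gz: "g z - \<delta> \<noteq> 0"
        using G1z by auto
      have an: "F analytic_on {z}"
        unfolding F_def using analytic_fg[OF pz(1)] gz by (intro analytic_intros) auto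
      have "norm (f z - \<beta>) \<le> exp (M2 * T) + norm \<beta>"
        using fz norm_triangle_ineq4[of "f z" \<beta>] by linarith
      also have "\<dots> \<le> exp (M2 * T + norm \<beta>)"
        using C T by (intro exp_plus_le) (auto simp: M2_def)
      also have "\<dots> \<le> exp ((M2 + norm \<beta>) * T)"
        using mult_left_mono[OF T, of "norm \<beta>"] by (subst exp_le_cancel_iff) (simp add: distrib_right)
      finally have 1: "norm (f z - \<beta>) ^ e \<le> exp ((M2 + norm \<beta>) * T) ^ e"
        by (intro power_mono) auto
      have "1 / norm (G1 z) = exp (- ln (norm (G1 z)))"
        using G1z by (simp add: exp_minus inverse_eq_divide)
      also have "\<dots> \<le> exp (M1 * T)"
        using G1z by (subst exp_le_cancel_iff) linarith
      finally have "norm (poly p z) * (1 / norm (G1 z)) \<le> exp (M2 * T) * exp (M1 * T)"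
        using pz2 by (intro mult_mono) auto
      moreover have "1 / norm (g z - \<delta>) = norm (poly p z) * (1 / norm (G1 z))"
        using pz(1) gz by (simp add: G1eq norm_mult)
      ultimately have "1 / norm (g z - \<delta>) \<le> exp ((M2 + M1) * T)"
        by (simp add: exp_add distrib_right)
      then have 2: "(1 / norm (g z - \<delta>)) ^ e' \<le> exp ((M2 + M1) * T) ^ e'"
        by (intro power_mono) auto
      have "norm (F z) = norm (f z - \<beta>) ^ e * (1 / norm (g z - \<delta>)) ^ e'"
        by (simp add: F_def norm_divide norm_power power_divide)
      also have "\<dots> \<le> exp ((M2 + norm \<beta>) * T) ^ e * exp ((M2 + M1) * T) ^ e'"
        using 1 2 by (intro mult_mono) auto
      also have "\<dots> = exp (C0 * T)"
        by (simp add: C0_def exp_of_nat_mult[symmetric] exp_add[symmetric] algebra_simps)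
      finally show ?thesis
        using an by blast
    qed
    then show ?thesis
      using r by (auto simp: T_def)
  qed
  have "\<exists>C\<ge>0. \<exists>r0\<ge>3. \<forall>z. r0 \<le> norm z \<longrightarrow> F analytic_on {z} \<longrightarrow>
      F z \<noteq> 0 \<and> \<bar>ln (norm (F z))\<bar> \<le> C * (norm z ^ d * ln (norm z))"
    by (rule ln_norm_bound_zero_free[OF mero poly_roots_finite[OF p] lim \<tau>_pos exps(4) C0 growth])
  then obtain C' r1 where C': "C' \<ge> 0" and r1: "r1 \<ge> 3" and bd: "\<And>z. r1 \<le> norm z \<Longrightarrow> F analytic_on {z} \<Longrightarrow>
      \<bar>ln (norm (F z))\<bar> \<le> C' * (norm z ^ d * ln (norm z))"
    by blast
  have "\<bar>real e * ln (norm (f z - \<beta>)) - real e' * ln (norm (g z - \<delta>))\<bar> \<le> C' * (norm z ^ d * ln (norm z))"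
    if z: "r1 \<le> norm z" and pz: "poly p z \<noteq> 0" and fz: "f z \<noteq> \<beta>" for z
  proof -
    have gz: "g z \<noteq> \<delta>"
      using pts[OF pz] fz by simp
    have "F analytic_on {z}"
      unfolding F_def using analytic_fg[OF pz] gz by (intro analytic_intros) auto
    moreover have "ln (norm (F z)) = real e * ln (norm (f z - \<beta>)) - real e' * ln (norm (g z - \<delta>))"
      using fz gz by (simp add: F_def norm_divide norm_power ln_div ln_realpow)
    ultimately show ?thesis
      using bd[OF z] by simp
  qed
  moreover have "\<exists>l. F \<midarrow>z\<rightarrow> l" if "poly p z \<noteq> 0" for z
    using lim[of z] that by auto
  ultimately show ?thesis
    using e(1) e'(1) C' r1 unfolding F_def
    by (intro exI[of _ e] exI[of _ e'] exI[of _ C'] exI[of _ r1]) auto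
qed

end

section \<open>The second shared set\<close>

lemma power_ln_doubling:
  fixes s :: real
  assumes "3 \<le> s"
  shows "(2 * s) ^ d * ln (2 * s) \<le> 2 ^ Suc d * (s ^ d * ln s)"
proof -
  have "ln 2 \<le> ln s"
    using assms by (intro ln_mono) auto
  then have "ln (2 * s) \<le> 2 * ln s"
    using assms by (simp add: ln_mult)
  then have "(2 * s) ^ d * ln (2 * s) \<le> (2 * s) ^ d * (2 * ln s)"
    using assms by (intro mult_left_mono) auto
  also have "\<dots> = 2 ^ Suc d * (s ^ d * ln s)"
    by (simp add: power_mult_distrib)
  finally show ?thesis .
qed

text \<open>On good circles \<open>|E|\<close> is bounded below by \<open>exp (- C |z|\<^sup>d ln\<^sup>2 |z|)\<close>, the second logarithm being lost in
the minimum modulus estimate.\<close>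

lemma entire_bound_from_product:
  fixes E H :: "complex \<Rightarrow> complex" and d :: nat
  assumes E: "E holomorphic_on UNIV" "\<exists>z. E z \<noteq> 0" and H: "H holomorphic_on UNIV"
    and C: "C \<ge> 1" and r0: "r0 \<ge> 3"
    and bE: "\<And>z. r0 \<le> norm z \<Longrightarrow> norm (E z) \<le> exp (C * (norm z ^ d * ln (norm z)))"
    and bHE: "\<And>z. r0 \<le> norm z \<Longrightarrow> norm (H z * E z) \<le> exp (C * (norm z ^ d * ln (norm z)))"
  shows "\<exists>C'\<ge>1. \<forall>z. r0 \<le> norm z \<longrightarrow> norm (H z) \<le> exp (C' * (norm z ^ d * ln (norm z) ^ 2))"
proof -
  have "\<exists>c\<ge>1. good_circles {E} c"
    using E by (intro ex_good_circles) auto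
  then obtain c where c: "c \<ge> 1" "good_circles {E} c"
    by (elim exE conjE)
  define A :: real where "A = C * 2 ^ Suc d"
  have A: "A \<ge> 1"
    unfolding A_def using C mult_mono[of 1 C 1 "2 ^ Suc d"] one_le_power[of "2::real" "Suc d"] by simp
  define B where "B = ln A + real d + 2"
  have B: "B \<ge> 1"
    using A by (simp add: B_def)
  have main: "norm (H z) \<le> exp ((A + 4 * c * A * B) * (norm z ^ d * ln (norm z) ^ 2))" if z: "r0 \<le> norm z" for z
  proof -
    define s where "s = norm z"
    have s: "s \<ge> 3" "s \<ge> r0"
      using z r0 by (auto simp: s_def)
    define T where "T = s ^ d * ln s"
    have l1: "1 \<le> ln s"
      by (rule ln_ge_1[OF s(1)])
    have sd: "1 \<le> s ^ d"
      using s by (intro one_le_power) auto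
    have T: "T \<ge> 1"
      using mult_mono[of 1 "s ^ d" 1 "ln s"] l1 sd by (simp add: T_def)
    define Y where "Y = A * T"
    have Y: "Y \<ge> 1"
      using mult_mono[of 1 A 1 T] A T by (simp add: Y_def)
    have mono: "C * (x ^ d * ln x) \<le> Y" if x: "s \<le> x" "x \<le> 2 * s" for x
    proof -
      have "x ^ d * ln x \<le> (2 * s) ^ d * ln (2 * s)"
        using x s by (intro mult_mono power_mono ln_mono) auto
      also have "\<dots> \<le> 2 ^ Suc d * T"
        unfolding T_def by (rule power_ln_doubling[OF s(1)])
      finally have "C * (x ^ d * ln x) \<le> C * (2 ^ Suc d * T)"
        using C by (intro mult_left_mono) auto
      then show ?thesis
        by (simp add: Y_def A_def mult.assoc)
    qed
    have "norm (E w) \<le> exp Y" if "norm w \<le> 2 * s" for w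
    proof (rule entire_bound_on_cball[OF E(1) _ _ that])
      fix v :: complex assume v: "norm v = 2 * s"
      have "norm (E v) \<le> exp (C * (norm v ^ d * ln (norm v)))"
        using v s by (intro bE) auto
      also have "\<dots> \<le> exp Y"
        using mono[of "norm v"] v s by (subst exp_le_cancel_iff) auto
      finally show "norm (E v) \<le> exp Y" .
    qed (use s in auto)
    then obtain r where r: "s \<le> r" "r \<le> 2 * s" and lo: "\<And>w. norm w = r \<Longrightarrow> E w \<noteq> 0 \<and> ln (norm (E w)) \<ge> - (4 * c) * (Y * (1 + ln Y))"
      using doubling_good_circle[OF c(2,1), of s "\<lambda>_. Y" Y] s Y by auto
    have lY: "1 + ln Y \<le> B * ln s"
    proof -
      have "ln (ln s) \<le> ln s"
        using l1 ln_le_minus_one[of "ln s"] by linarith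
      moreover have "ln Y = ln A + (real d * ln s + ln (ln s))"
        unfolding Y_def T_def using A s l1 by (simp add: ln_mult ln_realpow)
      moreover have "(ln A + 1) * 1 \<le> (ln A + 1) * ln s"
        using A l1 by (intro mult_left_mono) auto
      ultimately have "1 + ln Y \<le> (ln A + 1) * ln s + (real d * ln s + ln s)"
        by simp
      then show ?thesis
        by (simp add: B_def algebra_simps)
    qed
    define Q where "Q = s ^ d * ln s ^ 2"
    have Q: "T * ln s = Q"
      by (simp add: T_def Q_def power2_eq_square)
    have "T * 1 \<le> T * ln s"
      using T l1 by (intro mult_left_mono) auto
    then have YQ: "Y \<le> A * Q"
      unfolding Q Y_def using A by simp
    have "4 * c * (Y * (1 + ln Y)) \<le> 4 * c * (Y * (B * ln s))"
      using c Y lY by (intro mult_left_mono) auto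
    also have "\<dots> = 4 * c * A * B * Q"
      by (simp add: Q[symmetric] Y_def)
    finally have low: "4 * c * (Y * (1 + ln Y)) \<le> 4 * c * A * B * Q" .
    have "norm (H z) \<le> exp ((A + 4 * c * A * B) * Q)"
    proof (rule entire_bound_on_cball[OF H, of r])
      fix w :: complex assume w: "norm w = r"
      have Ew: "E w \<noteq> 0" "- ln (norm (E w)) \<le> 4 * c * A * B * Q"
        using lo[OF w] low by auto
      have "norm (H w * E w) \<le> exp (C * (norm w ^ d * ln (norm w)))"
        using w r s by (intro bHE) auto
      also have "\<dots> \<le> exp (A * Q)"
        using mono[of r] YQ w r by (subst exp_le_cancel_iff) auto
      finally have 1: "norm (H w * E w) \<le> exp (A * Q)" .
      have "1 / norm (E w) = exp (- ln (norm (E w)))"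
        using Ew by (simp add: exp_minus inverse_eq_divide)
      also have "\<dots> \<le> exp (4 * c * A * B * Q)"
        using Ew by (subst exp_le_cancel_iff)
      finally have "norm (H w * E w) * (1 / norm (E w)) \<le> exp (A * Q) * exp (4 * c * A * B * Q)"
        using 1 by (intro mult_mono) auto
      then show "norm (H w) \<le> exp ((A + 4 * c * A * B) * Q)"
        using Ew by (simp add: norm_mult exp_add distrib_right)
    qed (use r s in \<open>auto simp: s_def\<close>)
    then show ?thesis
      by (simp add: Q_def s_def)
  qed
  have "A + 4 * c * A * B \<ge> 1"
    using A c B by (simp add: add_increasing2)
  then show ?thesis
    using main by blast
qed

lemma norm_le_of_eventually:
  fixes h :: "complex \<Rightarrow> complex" and b :: "complex \<Rightarrow> real"
  assumes "isCont h z" "isCont b z" "eventually (\<lambda>w. norm (h w) \<le> b w) (at z)"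
  shows "norm (h z) \<le> b z"
  using assms by (intro tendsto_le[of "at z" b "b z" "\<lambda>w. norm (h w)" "norm (h z)"])
    (auto simp: isCont_def intro!: tendsto_norm)

lemma abs_ln_diff_le:
  fixes x y A :: real
  assumes "0 < x" "0 < y" "1 \<le> A" "x \<le> A * y" "y \<le> A * x"
  shows "\<bar>ln x - ln y\<bar> \<le> ln A"
proof -
  have "ln x \<le> ln (A * y)" "ln y \<le> ln (A * x)"
    using assms by (intro ln_mono; simp)+
  then show ?thesis
    using assms by (simp add: ln_mult abs_le_iff)
qed

context related_pair
begin

lemma ln_distance_comparison:
  "\<exists>M\<ge>1. \<exists>L\<ge>0. \<forall>z. poly p z \<noteq> 0 \<longrightarrow> M \<le> norm (f z) \<longrightarrow>
     \<bar>ln (norm (f z - \<beta>)) - ln (norm (f z))\<bar> \<le> L \<and> \<bar>ln (norm (g z - \<delta>)) - ln (norm (f z))\<bar> \<le> L \<and> f z \<noteq> \<beta>"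
proof -
  obtain K where K: "K \<ge> 1" "\<forall>z. poly p z \<noteq> 0 \<longrightarrow> norm (g z) \<le> K * (1 + norm (f z)) \<and> norm (f z) \<le> K * (1 + norm (g z))"
    using fg_comparison by (elim exE conjE)
  define M where "M = 1 + 2 * norm \<beta> + 2 * K * (1 + norm \<delta>)"
  define A where "A = 2 * K + 1"
  have nn: "0 \<le> 2 * K * (1 + norm \<delta>)"
    using K by (intro mult_nonneg_nonneg) auto
  have M: "M \<ge> 1" "M \<ge> 1 + 2 * norm \<beta>" "M \<ge> 1 + 2 * K * (1 + norm \<delta>)"
    using nn by (auto simp: M_def)
  have "\<bar>ln (norm (f z - \<beta>)) - ln (norm (f z))\<bar> \<le> ln A \<and> \<bar>ln (norm (g z - \<delta>)) - ln (norm (f z))\<bar> \<le> ln A \<and> f z \<noteq> \<beta>"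
    if pz: "poly p z \<noteq> 0" and big: "M \<le> norm (f z)" for z
  proof (intro conjI abs_ln_diff_le)
    have f1: "norm (f z) \<ge> 1" "norm (f z) > 2 * norm \<beta>" "norm (f z) > 2 * K * (1 + norm \<delta>)"
      using big M by linarith+
    have k: "2 * (1 + norm \<delta>) \<le> 2 * K * (1 + norm \<delta>)"
      using K by (intro mult_right_mono) auto
    have tA: "2 * norm (f z) \<le> A * norm (f z)" "2 * norm (f z - \<beta>) \<le> A * norm (f z - \<beta>)"
      using K by (auto intro!: mult_right_mono simp: A_def)
    have up: "norm (f z - \<beta>) \<le> norm (f z) + norm \<beta>" "norm (f z) \<le> norm (f z - \<beta>) + norm \<beta>"
      using norm_triangle_ineq4[of "f z" \<beta>] norm_triangle_ineq[of "f z - \<beta>" \<beta>] by auto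
    show "0 < norm (f z - \<beta>)"
      using up f1 norm_ge_zero[of \<beta>] by linarith
    then show "f z \<noteq> \<beta>"
      by auto
    show "norm (f z - \<beta>) \<le> A * norm (f z)" "norm (f z) \<le> A * norm (f z - \<beta>)"
      using up f1 tA norm_ge_zero[of \<beta>] by linarith+
    have ug: "norm (g z - \<delta>) \<le> norm (g z) + norm \<delta>" "norm (g z) \<le> norm (g z - \<delta>) + norm \<delta>"
      using norm_triangle_ineq4[of "g z" \<delta>] norm_triangle_ineq[of "g z - \<delta>" \<delta>] by auto
    have g1: "norm (g z) \<le> K + K * norm (f z)" "norm (f z) \<le> K * (1 + norm (g z))"
      using K(2) pz by (auto simp: distrib_left)
    have "norm (f z) \<le> K * (1 + norm \<delta>) + K * norm (g z - \<delta>)"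
      using g1(2) mult_left_mono[OF ug(2), of K] K(1) by (simp add: distrib_left)
    then have lo: "norm (f z) \<le> 2 * (K * norm (g z - \<delta>))"
      using f1(3) by simp
    show "norm (g z - \<delta>) \<le> A * norm (f z)"
    proof -
      have "K * 1 \<le> K * norm (f z)"
        using K f1 by (intro mult_left_mono) auto
      moreover have "norm \<delta> \<le> norm (f z)"
        using f1(3) k norm_ge_zero[of \<delta>] by argo
      ultimately have "norm (g z - \<delta>) \<le> 2 * (K * norm (f z)) + norm (f z)"
        using ug(1) g1(1) by linarith
      then show ?thesis
        by (simp add: A_def distrib_right)
    qed
    show "norm (f z) \<le> A * norm (g z - \<delta>)"
      using lo by (simp add: A_def distrib_right add_increasing2)
    show "0 < norm (g z - \<delta>)"
      using lo f1(1) by (cases "norm (g z - \<delta>) = 0") auto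
    show "0 < norm (f z)" "0 < norm (f z)"
      using f1 by linarith+
    show "1 \<le> A" "1 \<le> A"
      using K by (auto simp: A_def)
  qed
  moreover have "ln A \<ge> 0"
    using K by (simp add: A_def)
  ultimately show ?thesis
    using M(1) by blast
qed

text \<open>The exponents \<open>e\<close> and \<open>e'\<close> of the preceding quotient are equal: where \<open>|f|\<close> is large, \<open>ln |f - \<beta>|\<close> and
\<open>ln |g - \<delta>|\<close> both differ from \<open>ln |f|\<close> by a bounded amount, so \<open>e \<noteq> e'\<close> would bound \<open>ln |f|\<close> by
\<open>O(|z|\<^sup>d ln |z|)\<close>.\<close>

lemma ratio_bounds:
  assumes \<delta>: "poly W \<delta> = a * poly W \<beta>" and pts: "\<And>z. poly p z \<noteq> 0 \<Longrightarrow> f z = \<beta> \<longleftrightarrow> g z = \<delta>"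
  shows "\<exists>C\<ge>0. \<exists>r0\<ge>3. (\<forall>z. r0 \<le> norm z \<longrightarrow> poly p z \<noteq> 0 \<longrightarrow> f z \<noteq> \<beta> \<longrightarrow>
         norm ((f z - \<beta>) / (g z - \<delta>)) \<le> exp (C * (norm z ^ d * ln (norm z)))) \<and>
    (\<forall>z. poly p z \<noteq> 0 \<longrightarrow> (\<exists>B. eventually (\<lambda>w. norm ((f w - \<beta>) / (g w - \<delta>)) \<le> B) (at z)))"
proof -
  have "\<exists>e e' C r0. 1 \<le> (e::nat) \<and> 1 \<le> (e'::nat) \<and> 0 \<le> C \<and> 3 \<le> r0 \<and>
    (\<forall>z. r0 \<le> norm z \<longrightarrow> poly p z \<noteq> 0 \<longrightarrow> f z \<noteq> \<beta> \<longrightarrow>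
       \<bar>real e * ln (norm (f z - \<beta>)) - real e' * ln (norm (g z - \<delta>))\<bar> \<le> C * (norm z ^ d * ln (norm z))) \<and>
    (\<forall>z. poly p z \<noteq> 0 \<longrightarrow> (\<exists>l. (\<lambda>z. (f z - \<beta>) ^ e / (g z - \<delta>) ^ e') \<midarrow>z\<rightarrow> l))"
    by (rule ratio_of_powers[OF \<delta> pts])
  then obtain e e' :: nat and C r0 where e: "1 \<le> e" "1 \<le> e'" and C: "0 \<le> C" and r0: "3 \<le> r0" and
    main: "\<forall>z. r0 \<le> norm z \<longrightarrow> poly p z \<noteq> 0 \<longrightarrow> f z \<noteq> \<beta> \<longrightarrow>
       \<bar>real e * ln (norm (f z - \<beta>)) - real e' * ln (norm (g z - \<delta>))\<bar> \<le> C * (norm z ^ d * ln (norm z))" and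
    lim: "\<forall>z. poly p z \<noteq> 0 \<longrightarrow> (\<exists>l. (\<lambda>z. (f z - \<beta>) ^ e / (g z - \<delta>) ^ e') \<midarrow>z\<rightarrow> l)"
    by (elim exE conjE)
  obtain M L where M: "M \<ge> 1" and L: "L \<ge> 0" and cmp: "\<forall>z. poly p z \<noteq> 0 \<longrightarrow> M \<le> norm (f z) \<longrightarrow>
     \<bar>ln (norm (f z - \<beta>)) - ln (norm (f z))\<bar> \<le> L \<and> \<bar>ln (norm (g z - \<delta>)) - ln (norm (f z))\<bar> \<le> L \<and> f z \<noteq> \<beta>"
    using ln_distance_comparison[of \<beta> \<delta>] by (elim exE conjE)
  obtain C1 r1 where r1: "r1 \<ge> 3" and gr: "\<forall>z. r1 \<le> norm z \<longrightarrow> poly p z \<noteq> 0 \<and> 1 + norm (f z) \<le> exp (C1 * norm z powr \<sigma>) \<and>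
    norm (poly p z) \<le> exp (C1 * norm z powr \<sigma>) \<and> \<bar>ln (norm (poly p z))\<bar> \<le> C1 * ln (norm z)"
    using f_growth by (elim exE conjE)
  have "e = e'"
  proof (rule ccontr)
    assume "e \<noteq> e'"
    then have ne: "1 \<le> \<bar>real e - real e'\<bar>"
      by linarith
    define C2 where "C2 = C + real e * L + real e' * L + ln M"
    have C2: "C2 \<ge> 0"
      using C L M by (simp add: C2_def)
    show False
    proof (rule growth_contradiction[OF fM ord exps(1) C2])
      fix z :: complex assume z: "max r0 r1 \<le> norm z"
      then have pz: "poly p z \<noteq> 0" and z3: "norm z \<ge> 3" and zr: "r0 \<le> norm z"
        using gr r0 by auto
      define D where "D = norm z ^ d * ln (norm z)"
      have D: "D \<ge> 1"
        using mult_mono[of 1 "norm z ^ d" 1 "ln (norm z)"] ln_ge_1[OF z3] one_le_power[of "norm z" d] z3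
        by (simp add: D_def)
      have scale: "t \<le> t * D" if "t \<ge> 0" for t
        using mult_left_mono[OF D that] by simp
      have "ln (norm (f z)) \<le> C2 * D"
      proof (cases "M \<le> norm (f z)")
        case True
        define x y w where "x = ln (norm (f z - \<beta>))" and "y = ln (norm (g z - \<delta>))" and "w = ln (norm (f z))"
        have xy: "\<bar>x - w\<bar> \<le> L" "\<bar>y - w\<bar> \<le> L" "\<bar>real e * x - real e' * y\<bar> \<le> C * D"
          using cmp main pz True zr by (auto simp: x_def y_def w_def D_def)
        have w0: "w \<ge> 0"
          using True M by (simp add: w_def)
        have "w \<le> \<bar>real e - real e'\<bar> * w"
          using mult_right_mono[OF ne w0] by simp
        also have "\<dots> = \<bar>(real e - real e') * w\<bar>"
          using w0 by (simp add: abs_mult)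
        also have "(real e - real e') * w = (real e * x - real e' * y) - real e * (x - w) + real e' * (y - w)"
          by (simp add: algebra_simps)
        also have "\<bar>\<dots>\<bar> \<le> \<bar>real e * x - real e' * y\<bar> + \<bar>real e * (x - w)\<bar> + \<bar>real e' * (y - w)\<bar>"
          by linarith
        also have "\<dots> \<le> C * D + real e * L + real e' * L"
          using xy by (intro add_mono) (auto simp: abs_mult intro!: mult_left_mono)
        also have "\<dots> \<le> C * D + (real e * L) * D + (real e' * L) * D + ln M * D"
        proof -
          have "0 \<le> ln M * D"
            using ln_ge_zero[OF M] D by (intro mult_nonneg_nonneg) auto
          moreover have "real e * L \<le> (real e * L) * D" "real e' * L \<le> (real e' * L) * D"
            using L by (intro scale mult_nonneg_nonneg; simp)+
          ultimately show ?thesis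
            by linarith
        qed
        also have "\<dots> = C2 * D"
          by (simp add: C2_def algebra_simps)
        finally show ?thesis
          by (simp add: w_def)
      next
        case False
        have "ln (norm (f z)) \<le> ln M"
        proof (cases "f z = 0")
          case False
          then show ?thesis
            using \<open>\<not> M \<le> norm (f z)\<close> by (intro ln_mono) auto
        qed (use M in auto)
        also have "\<dots> \<le> ln M * D"
          using scale[of "ln M"] M by simp
        also have "\<dots> \<le> C2 * D"
          using C L D by (intro mult_right_mono) (auto simp: C2_def)
        finally show ?thesis .
      qed
      then show "ln (norm (f z)) \<le> C2 * (norm z ^ d * ln (norm z) ^ 1)"
        by (simp add: D_def)
    qed (use r0 in auto)
  qed
  have "norm ((f z - \<beta>) / (g z - \<delta>)) \<le> exp (C * (norm z ^ d * ln (norm z)))"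
    if z: "r0 \<le> norm z" and pz: "poly p z \<noteq> 0" and fz: "f z \<noteq> \<beta>" for z
  proof -
    have gz: "g z \<noteq> \<delta>"
      using pts[OF pz] fz by simp
    define t where "t = ln (norm (f z - \<beta>)) - ln (norm (g z - \<delta>))"
    have "\<bar>real e * t\<bar> \<le> C * (norm z ^ d * ln (norm z))"
      using main z pz fz unfolding \<open>e = e'\<close>[symmetric] by (simp add: t_def right_diff_distrib)
    moreover have "t \<le> \<bar>real e * t\<bar>"
    proof -
      have "1 * \<bar>t\<bar> \<le> real e * \<bar>t\<bar>"
        using e by (intro mult_right_mono) auto
      then show ?thesis
        by (simp add: abs_mult)
    qed
    ultimately have "exp t \<le> exp (C * (norm z ^ d * ln (norm z)))"
      by (subst exp_le_cancel_iff) linarith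
    moreover have "exp t = norm ((f z - \<beta>) / (g z - \<delta>))"
      using fz gz by (simp add: t_def exp_diff norm_divide)
    ultimately show ?thesis
      by simp
  qed
  moreover have "\<exists>B. eventually (\<lambda>w. norm ((f w - \<beta>) / (g w - \<delta>)) \<le> B) (at z)" if pz: "poly p z \<noteq> 0" for z
  proof -
    obtain l where "(\<lambda>z. (f z - \<beta>) ^ e / (g z - \<delta>) ^ e) \<midarrow>z\<rightarrow> l"
      using lim pz unfolding \<open>e = e'\<close>[symmetric] by blast
    then have "((\<lambda>z. norm ((f z - \<beta>) ^ e / (g z - \<delta>) ^ e)) \<longlongrightarrow> norm l) (at z)"
      by (rule tendsto_norm)
    then have "eventually (\<lambda>w. norm ((f w - \<beta>) ^ e / (g w - \<delta>) ^ e) < norm l + 1) (at z)"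
      by (rule order_tendstoD) simp
    then have "eventually (\<lambda>w. norm ((f w - \<beta>) / (g w - \<delta>)) \<le> norm l + 1) (at z)"
    proof eventually_elim
      case (elim w)
      define u where "u = norm ((f w - \<beta>) / (g w - \<delta>))"
      have "u ^ e < norm l + 1"
        using elim by (simp add: u_def norm_divide norm_power power_divide)
      also have "norm l + 1 \<le> (norm l + 1) ^ e"
        using e power_increasing[of 1 e "norm l + 1"] by simp
      finally have "u < norm l + 1"
        by (rule power_less_imp_less_base) simp
      then show ?case
        by (simp add: u_def)
    qed
    then show ?thesis
      by blast
  qed
  ultimately show ?thesis
    using C r0 by (intro exI[of _ C] conjI exI[of _ r0]) auto
qed

text \<open>With \<open>u\<^sub>i = (f - \<beta>\<^sub>i)/(g - \<delta>\<^sub>i)\<close>, the left-hand side divided by \<open>(g - \<delta>1) (g - \<delta>2)\<close> is \<open>D = u1 - u2\<close>,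
and \<open>g D = \<beta>2 - \<beta>1 + u1 \<delta>1 - u2 \<delta>2\<close>. Both \<open>D\<close> and \<open>g D\<close> have at most the growth of the \<open>u\<^sub>i\<close>; if \<open>D\<close>
did not vanish identically, division would bound the growth of \<open>g\<close>, and hence that of \<open>f\<close>, by one of
order \<open>d < \<rho>\<close>.\<close>

lemma linear_relation:
  assumes ne: "\<beta>1 \<noteq> \<beta>2" "\<delta>1 \<noteq> \<delta>2"
    and \<delta>1: "poly W \<delta>1 = a * poly W \<beta>1" and pts1: "\<And>z. poly p z \<noteq> 0 \<Longrightarrow> f z = \<beta>1 \<longleftrightarrow> g z = \<delta>1"
    and \<delta>2: "poly W \<delta>2 = a * poly W \<beta>2" and pts2: "\<And>z. poly p z \<noteq> 0 \<Longrightarrow> f z = \<beta>2 \<longleftrightarrow> g z = \<delta>2"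
    and pz: "poly p z \<noteq> 0"
  shows "f z * (\<delta>1 - \<delta>2) - g z * (\<beta>1 - \<beta>2) + (\<beta>1 * \<delta>2 - \<beta>2 * \<delta>1) = 0"
proof (rule ccontr)
  define V where "V = (\<lambda>z. f z * (\<delta>1 - \<delta>2) - g z * (\<beta>1 - \<beta>2) + (\<beta>1 * \<delta>2 - \<beta>2 * \<delta>1))"
  define u1 u2 where "u1 = (\<lambda>z. (f z - \<beta>1) / (g z - \<delta>1))" and "u2 = (\<lambda>z. (f z - \<beta>2) / (g z - \<delta>2))"
  define D where "D = (\<lambda>z. V z / ((g z - \<delta>1) * (g z - \<delta>2)))"
  assume "f z * (\<delta>1 - \<delta>2) - g z * (\<beta>1 - \<beta>2) + (\<beta>1 * \<delta>2 - \<beta>2 * \<delta>1) \<noteq> 0"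
  then have Vz: "V z \<noteq> 0"
    by (simp add: V_def)
  have D_diff: "D w = u1 w - u2 w" if "g w \<noteq> \<delta>1" "g w \<noteq> \<delta>2" for w
  proof -
    define x y where "x = g w - \<delta>1" and "y = g w - \<delta>2"
    have "V w = (f w - \<beta>1) * y - (f w - \<beta>2) * x"
      by (simp add: V_def x_def y_def algebra_simps)
    then show ?thesis
      using that unfolding D_def u1_def u2_def x_def[symmetric] y_def[symmetric]
      by (simp add: diff_divide_distrib x_def y_def)
  qed
  have gD: "g w * D w = \<beta>2 - \<beta>1 + u1 w * \<delta>1 - u2 w * \<delta>2" if "g w \<noteq> \<delta>1" "g w \<noteq> \<delta>2" for w
  proof -
    have "u1 w * (g w - \<delta>1) = f w - \<beta>1" "u2 w * (g w - \<delta>2) = f w - \<beta>2"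
      using that by (simp_all add: u1_def u2_def)
    then have "g w * u1 w = f w - \<beta>1 + u1 w * \<delta>1" "g w * u2 w = f w - \<beta>2 + u2 w * \<delta>2"
      by (simp_all add: algebra_simps)
    then show ?thesis
      unfolding D_diff[OF that] right_diff_distrib by simp
  qed
  have Dmero: "D meromorphic_on UNIV"
    unfolding D_def V_def by (intro meromorphic_intros f_mero g_mero)
  have an_V: "V analytic_on {w}" if "poly p w \<noteq> 0" for w
    unfolding V_def using analytic_fg[OF that] by (intro analytic_intros)
  have an_D: "D analytic_on {w}" if "poly p w \<noteq> 0" "g w \<noteq> \<delta>1" "g w \<noteq> \<delta>2" for w
    unfolding D_def using that an_V[OF that(1)] analytic_fg[OF that(1)] by (intro analytic_intros) auto
  have generic: "eventually (\<lambda>w. poly p w \<noteq> 0 \<and> g w \<noteq> \<delta>1 \<and> g w \<noteq> \<delta>2) (at v)" for v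
  proof -
    have "eventually (\<lambda>w. g1 w - \<delta>1 * poly p w \<noteq> 0) (at v)" "eventually (\<lambda>w. g1 w - \<delta>2 * poly p w \<noteq> 0) (at v)"
      by (rule eventually_entire_nonzero[OF hol_lin_g nonzero_lin_g])+
    moreover have "eventually (\<lambda>w. poly p w \<noteq> 0) (at v)"
      by (rule eventually_entire_nonzero) (use pz in \<open>auto intro!: holomorphic_intros\<close>)
    ultimately show ?thesis
    proof eventually_elim
      case (elim w)
      then show ?case
        using g[of w] by auto
    qed
  qed
  obtain Ca ra where Ca: "Ca \<ge> 0" and ra: "ra \<ge> 3" and b1: "\<forall>z. ra \<le> norm z \<longrightarrow> poly p z \<noteq> 0 \<longrightarrow> f z \<noteq> \<beta>1 \<longrightarrow>
         norm ((f z - \<beta>1) / (g z - \<delta>1)) \<le> exp (Ca * (norm z ^ d * ln (norm z)))" and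
    c1: "\<forall>z. poly p z \<noteq> 0 \<longrightarrow> (\<exists>B. eventually (\<lambda>w. norm ((f w - \<beta>1) / (g w - \<delta>1)) \<le> B) (at z))"
  proof -
    have "\<exists>C\<ge>0. \<exists>r0\<ge>3. (\<forall>z. r0 \<le> norm z \<longrightarrow> poly p z \<noteq> 0 \<longrightarrow> f z \<noteq> \<beta>1 \<longrightarrow>
         norm ((f z - \<beta>1) / (g z - \<delta>1)) \<le> exp (C * (norm z ^ d * ln (norm z)))) \<and>
    (\<forall>z. poly p z \<noteq> 0 \<longrightarrow> (\<exists>B. eventually (\<lambda>w. norm ((f w - \<beta>1) / (g w - \<delta>1)) \<le> B) (at z)))"
      by (rule ratio_bounds[OF \<delta>1 pts1])
    then show ?thesis
      by (elim exE conjE) (rule that; assumption)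
  qed
  obtain Cb rb where Cb: "Cb \<ge> 0" and rb: "rb \<ge> 3" and b2: "\<forall>z. rb \<le> norm z \<longrightarrow> poly p z \<noteq> 0 \<longrightarrow> f z \<noteq> \<beta>2 \<longrightarrow>
         norm ((f z - \<beta>2) / (g z - \<delta>2)) \<le> exp (Cb * (norm z ^ d * ln (norm z)))" and
    c2: "\<forall>z. poly p z \<noteq> 0 \<longrightarrow> (\<exists>B. eventually (\<lambda>w. norm ((f w - \<beta>2) / (g w - \<delta>2)) \<le> B) (at z))"
  proof -
    have "\<exists>C\<ge>0. \<exists>r0\<ge>3. (\<forall>z. r0 \<le> norm z \<longrightarrow> poly p z \<noteq> 0 \<longrightarrow> f z \<noteq> \<beta>2 \<longrightarrow>
         norm ((f z - \<beta>2) / (g z - \<delta>2)) \<le> exp (C * (norm z ^ d * ln (norm z)))) \<and>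
    (\<forall>z. poly p z \<noteq> 0 \<longrightarrow> (\<exists>B. eventually (\<lambda>w. norm ((f w - \<beta>2) / (g w - \<delta>2)) \<le> B) (at z)))"
      by (rule ratio_bounds[OF \<delta>2 pts2])
    then show ?thesis
      by (elim exE conjE) (rule that; assumption)
  qed
  have no_pole: "\<not> is_pole D v" if pv: "poly p v \<noteq> 0" for v
  proof
    assume pole: "is_pole D v"
    obtain B1 where B1: "eventually (\<lambda>w. norm ((f w - \<beta>1) / (g w - \<delta>1)) \<le> B1) (at v)"
      using c1 pv by blast
    obtain B2 where B2: "eventually (\<lambda>w. norm ((f w - \<beta>2) / (g w - \<delta>2)) \<le> B2) (at v)"
      using c2 pv by blast
    have "eventually (\<lambda>w. norm (D w) \<ge> \<bar>B1\<bar> + \<bar>B2\<bar> + 1) (at v)"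
      using pole unfolding is_pole_def filterlim_at_infinity[OF order_refl] by auto
    then have "eventually (\<lambda>w. False) (at v)"
      using B1 B2 generic
    proof eventually_elim
      case (elim w)
      have "norm (D w) \<le> norm (u1 w) + norm (u2 w)"
        using elim D_diff by (simp add: norm_triangle_ineq4)
      also have "\<dots> \<le> B1 + B2"
        using elim by (simp add: u1_def u2_def)
      finally show ?case
        using elim by linarith
    qed
    then show False
      by simp
  qed
  have "{z. is_pole D z} \<subseteq> {z. poly p z = 0}"
    using no_pole by auto
  then have "finite {z. is_pole D z}"
    using poly_roots_finite[OF p] finite_subset by blast
  from clear_poles[OF Dmero this] obtain E q where E: "E holomorphic_on UNIV"
    and q0: "\<And>z. poly q z = 0 \<longleftrightarrow> is_pole D z" and Eq: "\<And>z. D analytic_on {z} \<Longrightarrow> D z * poly q z = E z"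
    by metis
  have "q \<noteq> 0"
    using q0[of z] no_pole[OF pz] by auto
  obtain Cq rq where Cq: "Cq \<ge> 0" and rq: "rq \<ge> 3" and qb: "\<forall>z. rq \<le> norm z \<longrightarrow> poly q z \<noteq> 0 \<and> \<bar>ln (norm (poly q z))\<bar> \<le> Cq * ln (norm z)"
    using poly_ln_bound[OF \<open>q \<noteq> 0\<close>] by (elim exE conjE)
  obtain Cp rp where Cp: "Cp \<ge> 0" and rp: "rp \<ge> 3" and pb: "\<forall>z. rp \<le> norm z \<longrightarrow> poly p z \<noteq> 0 \<and> \<bar>ln (norm (poly p z))\<bar> \<le> Cp * ln (norm z)"
    using poly_ln_bound[OF p] by (elim exE conjE)
  have nzE: "\<exists>w. E w \<noteq> 0"
  proof -
    have "isCont V z"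
      using an_V[OF pz] by (rule analytic_at_imp_isCont)
    then have "eventually (\<lambda>w. V w \<noteq> 0) (at z)"
      using Vz by (intro tendsto_imp_eventually_ne[of _ "V z"]) (auto simp: isCont_def)
    moreover have "eventually (\<lambda>w. poly q w \<noteq> 0) (at z)"
      using \<open>q \<noteq> 0\<close> q0[of z] no_pole[OF pz]
      by (intro eventually_entire_nonzero) (auto intro!: holomorphic_intros)
    ultimately have "eventually (\<lambda>w. E w \<noteq> 0) (at z)"
      using generic[of z]
    proof eventually_elim
      case (elim w)
      then show ?case
        using Eq[OF an_D[of w]] by (auto simp: D_def)
    qed
    then show ?thesis
      using eventually_happens[of "\<lambda>w. E w \<noteq> 0" "at z"] by auto
  qed
  define L where "L = norm (\<beta>2 - \<beta>1) + norm \<delta>1 + norm \<delta>2 + 2"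
  define C where "C = 1 + L + (Ca + Cb) + Cq + Cp"
  have L: "L \<ge> 2"
    by (simp add: L_def)
  have C: "C \<ge> 1"
    using L Ca Cb Cp Cq by (simp add: C_def)
  define r0 where "r0 = Max {ra, rb, rq, rp}"
  have r0: "r0 \<ge> ra" "r0 \<ge> rb" "r0 \<ge> rq" "r0 \<ge> rp"
    by (auto simp: r0_def)
  have r03: "r0 \<ge> 3"
    using r0 ra by linarith
  have pointwise: "norm (E w) \<le> exp (C * (norm w ^ d * ln (norm w))) \<and> norm (g1 w * E w) \<le> exp (C * (norm w ^ d * ln (norm w)))"
    if w: "r0 \<le> norm w" and gw: "g w \<noteq> \<delta>1" "g w \<noteq> \<delta>2" for w
  proof -
    define T where "T = norm w ^ d * ln (norm w)"
    have w3: "3 \<le> norm w"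
      using w r03 by linarith
    have l1: "1 \<le> ln (norm w)"
      by (rule ln_ge_1[OF w3])
    have lT: "ln (norm w) \<le> T"
      using mult_right_mono[of 1 "norm w ^ d" "ln (norm w)"] one_le_power[of "norm w" d] l1 w3 by (simp add: T_def)
    then have T: "T \<ge> 1"
      using l1 by linarith
    have pw: "poly p w \<noteq> 0" "\<bar>ln (norm (poly p w))\<bar> \<le> Cp * ln (norm w)" and qw: "poly q w \<noteq> 0" "\<bar>ln (norm (poly q w))\<bar> \<le> Cq * ln (norm w)"
      using pb qb w r0 by auto
    have poly_le: "norm (poly h w) \<le> exp (Ch * T)" if "poly h w \<noteq> 0" "\<bar>ln (norm (poly h w))\<bar> \<le> Ch * ln (norm w)" "Ch \<ge> 0" for h Ch
    proof -
      have "Ch * ln (norm w) \<le> Ch * T"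
        using lT that by (intro mult_left_mono)
      then have "exp (ln (norm (poly h w))) \<le> exp (Ch * T)"
        using that by (subst exp_le_cancel_iff) linarith
      then show ?thesis
        using that by simp
    qed
    note pq = poly_le[OF pw Cp] poly_le[OF qw Cq]
    have fw: "f w \<noteq> \<beta>1" "f w \<noteq> \<beta>2"
      using gw pts1 pts2 pw by auto
    have u: "norm (u1 w) \<le> exp ((Ca + Cb) * T)" "norm (u2 w) \<le> exp ((Ca + Cb) * T)"
    proof -
      have "norm (u1 w) \<le> exp (Ca * T)" "norm (u2 w) \<le> exp (Cb * T)"
        using b1 b2 fw pw w r0 by (auto simp: u1_def u2_def T_def)
      moreover have "exp (Ca * T) \<le> exp ((Ca + Cb) * T)" "exp (Cb * T) \<le> exp ((Ca + Cb) * T)"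
        using T Ca Cb by (auto intro!: mult_right_mono)
      ultimately show "norm (u1 w) \<le> exp ((Ca + Cb) * T)" "norm (u2 w) \<le> exp ((Ca + Cb) * T)"
        by linarith+
    qed
    have LT: "L \<le> exp (L * T)"
    proof -
      have "L * 1 \<le> L * T"
        using T L by (intro mult_left_mono) auto
      then show ?thesis
        using exp_ge_add_one_self[of "L * T"] by linarith
    qed
    define U where "U = exp ((Ca + Cb) * T)"
    have U: "U \<ge> 1"
      using Ca Cb T by (simp add: U_def)
    have Dw: "norm (D w) \<le> exp (L * T) * U"
    proof -
      have "norm (D w) \<le> norm (u1 w) + norm (u2 w)"
        using D_diff[OF gw] by (simp add: norm_triangle_ineq4)
      also have "\<dots> \<le> 2 * U"
        using u by (simp add: U_def)
      also have "\<dots> \<le> exp (L * T) * U"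
        using LT L U by (intro mult_right_mono) auto
      finally show ?thesis .
    qed
    have gDw: "norm (g w * D w) \<le> exp (L * T) * U"
    proof -
      have "norm (g w * D w) \<le> norm (\<beta>2 - \<beta>1) + norm (u1 w * \<delta>1) + norm (u2 w * \<delta>2)"
        unfolding gD[OF gw] by (intro order_trans[OF norm_triangle_ineq4] add_mono norm_triangle_ineq order_refl)
      also have "\<dots> \<le> norm (\<beta>2 - \<beta>1) * U + U * norm \<delta>1 + U * norm \<delta>2"
      proof (intro add_mono)
        show "norm (\<beta>2 - \<beta>1) \<le> norm (\<beta>2 - \<beta>1) * U"
          using mult_left_mono[OF U, of "norm (\<beta>2 - \<beta>1)"] by simp
        show "norm (u1 w * \<delta>1) \<le> U * norm \<delta>1" "norm (u2 w * \<delta>2) \<le> U * norm \<delta>2"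
          using u by (auto simp: norm_mult U_def intro!: mult_right_mono)
      qed
      also have "\<dots> \<le> L * U"
        using U by (simp add: L_def algebra_simps)
      also have "\<dots> \<le> exp (L * T) * U"
        using LT U by (intro mult_right_mono) auto
      finally show ?thesis .
    qed
    have Ew: "E w = D w * poly q w"
      using Eq[OF an_D[OF pw(1) gw]] by simp
    have "norm (E w) \<le> (exp (L * T) * U) * exp (Cq * T)"
      unfolding Ew norm_mult using Dw pq(2) U by (intro mult_mono) auto
    also have "\<dots> = exp ((L + (Ca + Cb) + Cq) * T)"
      by (simp add: U_def exp_add[symmetric] distrib_right)
    also have "\<dots> \<le> exp (C * T)"
      using T Cp by (subst exp_le_cancel_iff, intro mult_right_mono) (auto simp: C_def)
    finally have 1: "norm (E w) \<le> exp (C * T)" .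
    have "g1 w * E w = (g w * D w) * poly q w * poly p w"
      unfolding Ew using g[OF pw(1)] pw(1) by simp
    then have "norm (g1 w * E w) = norm (g w * D w) * norm (poly q w) * norm (poly p w)"
      by (simp only: norm_mult)
    also have "\<dots> \<le> (exp (L * T) * U) * exp (Cq * T) * exp (Cp * T)"
      using gDw pq U by (intro mult_mono mult_nonneg_nonneg) auto
    also have "\<dots> = exp ((L + (Ca + Cb) + Cq + Cp) * T)"
      by (simp add: U_def exp_add[symmetric] distrib_right)
    also have "\<dots> \<le> exp (C * T)"
      using T by (subst exp_le_cancel_iff, intro mult_right_mono) (auto simp: C_def)
    finally have 2: "norm (g1 w * E w) \<le> exp (C * T)" .
    show ?thesis
      using 1 2 by (simp add: T_def)
  qed
  \<comment> \<open>The exceptional points are isolated, so the bounds extend to them by continuity.\<close>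
  have ev: "eventually (\<lambda>w. norm (E w) \<le> exp (C * (norm w ^ d * ln (norm w))) \<and> norm (g1 w * E w) \<le> exp (C * (norm w ^ d * ln (norm w)))) (at v)"
    if v: "r0 < norm v" for v
  proof -
    have "eventually (\<lambda>w. w \<in> {w. r0 < norm w}) (at v)"
      using v by (intro eventually_at_in_open' open_Collect_less continuous_intros) auto
    then show ?thesis
      using generic[of v]
    proof eventually_elim
      case (elim w)
      then show ?case
        using pointwise[of w] by simp
    qed
  qed
  have cont: "isCont E v" "isCont g1 v" for v
    using E g1 by (metis UNIV_I continuous_on_eq_continuous_at holomorphic_on_imp_continuous_on open_UNIV)+
  have contb: "isCont (\<lambda>w. exp (C * (norm w ^ d * ln (norm w)))) v" if "r0 < norm v" for v :: complex
    using that r03 by (intro continuous_intros) auto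
  have bE: "norm (E v) \<le> exp (C * (norm v ^ d * ln (norm v)))" if "r0 + 1 \<le> norm v" for v
    using that ev[of v] cont contb[of v] by (intro norm_le_of_eventually[of v E "\<lambda>w. exp (C * (norm w ^ d * ln (norm w)))"]) (auto elim: eventually_mono)
  have bgE: "norm (g1 v * E v) \<le> exp (C * (norm v ^ d * ln (norm v)))" if "r0 + 1 \<le> norm v" for v
    using that ev[of v] cont contb[of v]
    by (intro norm_le_of_eventually[of v "\<lambda>v. g1 v * E v" "\<lambda>w. exp (C * (norm w ^ d * ln (norm w)))"] continuous_mult)
      (auto elim: eventually_mono)
  have r04: "3 \<le> r0 + 1"
    using r03 by simp
  have "\<exists>C'\<ge>1. \<forall>z. r0 + 1 \<le> norm z \<longrightarrow> norm (g1 z) \<le> exp (C' * (norm z ^ d * ln (norm z) ^ 2))"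
    by (rule entire_bound_from_product[OF E nzE g1 C r04 bE bgE])
  then obtain C' where C': "C' \<ge> 1" and g1b: "\<forall>z. r0 + 1 \<le> norm z \<longrightarrow> norm (g1 z) \<le> exp (C' * (norm z ^ d * ln (norm z) ^ 2))"
    by (elim exE conjE)
  obtain K where K: "K \<ge> 1" "\<forall>z. poly p z \<noteq> 0 \<longrightarrow> norm (g z) \<le> K * (1 + norm (f z)) \<and> norm (f z) \<le> K * (1 + norm (g z))"
    using fg_comparison by (elim exE conjE)
  have C2: "K + C' + Cp + 1 \<ge> 0"
    using K C' Cp by simp
  show False
  proof (rule growth_contradiction[OF fM ord exps(1) C2])
    show "0 < r0 + 1"
      using r04 by linarith
    fix w :: complex assume w: "r0 + 1 \<le> norm w"
    define T where "T = norm w ^ d * ln (norm w) ^ 2"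
    have w3: "3 \<le> norm w"
      using w r03 by linarith
    have l1: "1 \<le> ln (norm w)"
      by (rule ln_ge_1[OF w3])
    have lT: "ln (norm w) \<le> T"
    proof -
      have "1 * (ln (norm w) * 1) \<le> norm w ^ d * (ln (norm w) * ln (norm w))"
        using l1 w3 by (intro mult_mono one_le_power) auto
      then show ?thesis
        by (simp add: T_def power2_eq_square)
    qed
    then have T: "T \<ge> 1"
      using l1 by linarith
    have pw: "poly p w \<noteq> 0" "\<bar>ln (norm (poly p w))\<bar> \<le> Cp * ln (norm w)"
      using pb w r0 by auto
    have "Cp * ln (norm w) \<le> Cp * T"
      using lT Cp by (intro mult_left_mono)
    then have "exp (- ln (norm (poly p w))) \<le> exp (Cp * T)"
      using pw by (subst exp_le_cancel_iff) linarith
    then have "1 / norm (poly p w) \<le> exp (Cp * T)"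
      using pw by (simp add: exp_minus inverse_eq_divide)
    moreover have "norm (g1 w) \<le> exp (C' * T)"
      using g1b w by (simp add: T_def)
    ultimately have "norm (g1 w) * (1 / norm (poly p w)) \<le> exp (C' * T) * exp (Cp * T)"
      by (intro mult_mono) auto
    then have "norm (g w) \<le> exp ((C' + Cp) * T)"
      using g[OF pw(1)] by (simp add: norm_divide exp_add distrib_right)
    then have "1 + norm (g w) \<le> exp ((C' + Cp) * T) + 1"
      by simp
    also have "\<dots> \<le> exp ((C' + Cp) * T + 1)"
      using C' Cp T by (intro exp_plus_le) auto
    also have "\<dots> \<le> exp ((C' + Cp) * T + 1 * T)"
      using T by (subst exp_le_cancel_iff) simp
    finally have g2: "1 + norm (g w) \<le> exp ((C' + Cp) * T + 1 * T)" .
    have KT: "K \<le> exp (K * T)"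
    proof -
      have "K * 1 \<le> K * T"
        using T K by (intro mult_left_mono) auto
      then show ?thesis
        using exp_ge_add_one_self[of "K * T"] by linarith
    qed
    have "norm (f w) \<le> K * (1 + norm (g w))"
      using K pw by simp
    also have "\<dots> \<le> exp (K * T) * exp ((C' + Cp) * T + 1 * T)"
      using KT g2 by (intro mult_mono) auto
    also have "\<dots> = exp ((K + C' + Cp + 1) * T)"
      by (simp add: exp_add[symmetric] distrib_right)
    finally have le: "norm (f w) \<le> exp ((K + C' + Cp + 1) * T)" .
    have "ln (norm (f w)) \<le> (K + C' + Cp + 1) * T"
    proof (cases "f w = 0")
      case False
      then have "ln (norm (f w)) \<le> ln (exp ((K + C' + Cp + 1) * T))"
        using le by (intro ln_mono) auto
      then show ?thesis
        by simp
    qed (use C2 T in auto)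
    then show "ln (norm (f w)) \<le> (K + C' + Cp + 1) * (norm w ^ d * ln (norm w) ^ 2)"
      by (simp add: T_def)
  qed
qed

end

section \<open>The uniqueness theorem\<close>

lemma sum_order_eq_degree:
  fixes q :: "complex poly"
  assumes "q \<noteq> 0"
  shows "(\<Sum>x | poly q x = 0. order x q) = degree q"
proof -
  have "degree (\<Prod>z | poly q z = 0. [:- z, 1:] ^ order z q) = (\<Sum>x | poly q x = 0. order x q)"
    by (subst degree_prod_eq_sum_degree) (auto simp: degree_power_eq)
  moreover have "degree (smult (lead_coeff q) (\<Prod>z | poly q z = 0. [:- z, 1:] ^ order z q)) = degree q"
    by (simp only: complex_poly_decompose)
  ultimately show ?thesis
    using assms by simp
qed

text \<open>A point where \<open>W\<close> takes a value with multiplicity \<open>m\<close> is a zero of \<open>W'\<close> of multiplicity \<open>m - 1\<close>. So the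
two fibres miss \<open>2n\<close> points by at most \<open>n - 1\<close>.\<close>

lemma card_preimages_of_two_values:
  fixes W :: "complex poly"
  assumes W: "degree W > 0" and uv: "u \<noteq> v"
  shows "degree W + 1 \<le> card {x. poly W x = u} + card {x. poly W x = v}"
proof -
  let ?o = "\<lambda>x. order x (pderiv W)"
  have W'0: "pderiv W \<noteq> 0"
    using W by (simp add: pderiv_eq_0_iff)
  have nz: "W - [:w:] \<noteq> 0" for w
  proof
    assume "W - [:w:] = 0"
    then have "W = [:w:]"
      by simp
    then show False
      using W by simp
  qed
  have eqS: "{x. poly (W - [:w:]) x = 0} = {x. poly W x = w}" for w
    by auto
  have fin: "finite {x. poly W x = w}" for w
    using poly_roots_finite[OF nz[of w]] by (simp only: eqS)
  have count: "degree W = card {x. poly W x = w} + sum ?o {x. poly W x = w}" for w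
  proof -
    have "degree (W - [:w:]) = degree W"
      unfolding diff_conv_add_uminus by (rule degree_add_eq_left) (use W in simp)
    then have "degree W = (\<Sum>x | poly W x = w. order x (W - [:w:]))"
      using sum_order_eq_degree[OF nz[of w]] by (simp only: eqS)
    also have "\<dots> = (\<Sum>x | poly W x = w. Suc (?o x))"
    proof (intro sum.cong refl)
      fix x assume "x \<in> {x. poly W x = w}"
      then have "order x (W - [:w:]) = Suc (order x (pderiv (W - [:w:])))"
        by (intro order_pderiv nz) auto
      then show "order x (W - [:w:]) = Suc (?o x)"
        by (simp add: pderiv_diff pderiv_pCons)
    qed
    also have "\<dots> = card {x. poly W x = w} + sum ?o {x. poly W x = w}"
      by (subst sum_Suc) simp
    finally show ?thesis .
  qed
  have "sum ?o {x. poly W x = u} + sum ?o {x. poly W x = v} = sum ?o ({x. poly W x = u} \<union> {x. poly W x = v})"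
    using fin uv by (intro sum.union_disjoint[symmetric]) auto
  also have "\<dots> \<le> sum ?o (({x. poly W x = u} \<union> {x. poly W x = v}) \<union> {x. poly (pderiv W) x = 0})"
    using fin poly_roots_finite[OF W'0] by (intro sum_mono2) auto
  also have "\<dots> = sum ?o {x. poly (pderiv W) x = 0}"
    using fin poly_roots_finite[OF W'0] by (intro sum.mono_neutral_right) (auto simp: order_0I)
  also have "\<dots> \<le> degree (pderiv W)"
    by (rule sum_order_le_degree[OF W'0])
  also have "\<dots> = degree W - 1"
    by (rule degree_pderiv)
  finally show ?thesis
    using count[of u] count[of v] W by linarith
qed

lemma wronski_zero_imp_constant:
  assumes E: "E holomorphic_on UNIV" and p: "p \<noteq> 0"
    and f: "\<And>z. poly p z \<noteq> 0 \<Longrightarrow> f z = E z / poly p z" and w: "\<And>z. wronski E p z = 0"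
  shows "\<exists>c. \<forall>z. poly p z \<noteq> 0 \<longrightarrow> f z = c"
proof -
  let ?R = "{z. poly p z \<noteq> 0}"
  define h where "h = (\<lambda>z. E z / poly p z)"
  have conn: "connected ?R"
  proof -
    have "connected (UNIV - {z. poly p z = 0})"
      using poly_roots_finite[OF p] by (intro connected_open_diff_countable) (auto simp: countable_finite)
    moreover have "UNIV - {z. poly p z = 0} = ?R"
      by auto
    ultimately show ?thesis
      by simp
  qed
  have "(h has_field_derivative 0) (at z)" if z: "z \<in> ?R" for z
  proof -
    have "(E has_field_derivative deriv E z) (at z)"
      using holomorphic_derivI[OF E open_UNIV] by simp
    then have "(h has_field_derivative (deriv E z * poly p z - E z * poly (pderiv p) z) / (poly p z * poly p z)) (at z)"
      unfolding h_def using z by (intro DERIV_divide poly_DERIV) auto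
    then show ?thesis
      using w[of z] by (simp add: wronski_def)
  qed
  then obtain c where "\<And>z. z \<in> ?R \<Longrightarrow> h z = c"
    using DERIV_zero_connected_constant[OF conn open_poly_nonzero, of "{}" h]
    by (metis DERIV_isCont Diff_empty continuous_at_imp_continuous_on finite.emptyI)
  then show ?thesis
    using f unfolding h_def by auto
qed

lemma nonconstant_of_positive_order:
  assumes fM: "f \<in> M1" and ord: "nevanlinna_order f = ereal \<rho>" "0 < \<rho>" and p: "p \<noteq> 0"
    and const: "\<And>z. poly p z \<noteq> 0 \<Longrightarrow> f z = c"
  shows False
proof -
  obtain C r0 where C: "C \<ge> 0" and r0: "r0 \<ge> 3" and pb: "\<forall>z. r0 \<le> norm z \<longrightarrow> poly p z \<noteq> 0 \<and> \<bar>ln (norm (poly p z))\<bar> \<le> C * ln (norm z)"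
    using poly_ln_bound[OF p] by (elim exE conjE)
  have "real 0 < \<rho>"
    using ord by simp
  then show False
  proof (rule growth_contradiction[where ?r0.0 = r0 and K = 0, OF fM ord(1) _ abs_ge_zero[of "ln (norm c)"]])
    show "0 < r0"
      using r0 by simp
  qed (use const pb in auto)
qed

context related_pair
begin

text \<open>Each \<open>\<beta>\<^sub>i\<close> has a partner \<open>\<delta>\<^sub>i\<close> in the set, and the affine relation leaves two cases. In the case of
exchanged partners, \<open>x \<mapsto> \<beta>1 + \<beta>2 - x\<close> maps the fibre of \<open>w\<close> onto that of \<open>-w\<close>, so both are small, in
contradiction to the count of points over two values.\<close>

lemma eq_of_shared_pair:
  assumes neq: "poly W \<beta>1 \<noteq> poly W \<beta>2"
    and share2: "\<And>z. poly p z \<noteq> 0 \<Longrightarrow> f z \<in> {\<beta>1, \<beta>2} \<longleftrightarrow> g z \<in> {\<beta>1, \<beta>2}"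
    and w: "w \<noteq> 0" "2 * card {x. poly W x = w} < degree W"
    and pz: "poly p z \<noteq> 0"
  shows "f z = g z"
proof -
  have \<beta>: "\<beta>1 \<noteq> \<beta>2"
    using neq by auto
  have partner: "\<exists>\<delta>\<in>{\<beta>1, \<beta>2}. poly W \<delta> = a * poly W \<beta> \<and> (\<forall>z. poly p z \<noteq> 0 \<longrightarrow> f z = \<beta> \<longleftrightarrow> g z = \<delta>)"
    if b: "\<beta> \<in> {\<beta>1, \<beta>2}" for \<beta>
  proof -
    have inj: "x = y" if "poly W x = poly W y" "x \<in> {\<beta>1, \<beta>2}" "y \<in> {\<beta>1, \<beta>2}" for x y
      using that neq by auto
    obtain z1 where z1: "poly p z1 \<noteq> 0" "f z1 = \<beta>"
      using f_takes_value by blast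
    have \<delta>: "g z1 \<in> {\<beta>1, \<beta>2}" "poly W (g z1) = a * poly W \<beta>"
      using share2[OF z1(1)] z1(2) b rel[OF z1(1)] by auto
    have "f v = \<beta> \<longleftrightarrow> g v = g z1" if pv: "poly p v \<noteq> 0" for v
    proof
      assume fv: "f v = \<beta>"
      then have "g v \<in> {\<beta>1, \<beta>2}"
        using share2[OF pv] b by simp
      moreover have "poly W (g v) = poly W (g z1)"
        using rel[OF pv] fv \<delta>(2) by simp
      ultimately show "g v = g z1"
        using inj \<delta>(1) by blast
    next
      assume gv: "g v = g z1"
      then have "f v \<in> {\<beta>1, \<beta>2}"
        using share2[OF pv] \<delta>(1) by simp
      moreover have "poly W (f v) = poly W \<beta>"
        using rel[OF pv] gv \<delta>(2) a by simp
      ultimately show "f v = \<beta>"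
        using inj b by blast
    qed
    then show ?thesis
      using \<delta> by blast
  qed
  obtain \<delta>1 where \<delta>1: "\<delta>1 \<in> {\<beta>1, \<beta>2}" "poly W \<delta>1 = a * poly W \<beta>1" "\<And>z. poly p z \<noteq> 0 \<Longrightarrow> f z = \<beta>1 \<longleftrightarrow> g z = \<delta>1"
    using partner[of \<beta>1] by blast
  obtain \<delta>2 where \<delta>2: "\<delta>2 \<in> {\<beta>1, \<beta>2}" "poly W \<delta>2 = a * poly W \<beta>2" "\<And>z. poly p z \<noteq> 0 \<Longrightarrow> f z = \<beta>2 \<longleftrightarrow> g z = \<delta>2"
    using partner[of \<beta>2] by blast
  have "poly W \<delta>1 \<noteq> poly W \<delta>2"
    using \<delta>1(2) \<delta>2(2) neq a by simp
  then have \<delta>: "\<delta>1 \<noteq> \<delta>2"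
    by auto
  have lin: "f v * (\<delta>1 - \<delta>2) - g v * (\<beta>1 - \<beta>2) + (\<beta>1 * \<delta>2 - \<beta>2 * \<delta>1) = 0" if "poly p v \<noteq> 0" for v
    by (rule linear_relation[OF \<beta> \<delta> \<delta>1(2,3) \<delta>2(2,3) that])
  show ?thesis
  proof (cases "\<delta>1 = \<beta>1")
    case True
    then have "\<delta>2 = \<beta>2"
      using \<delta> \<delta>2(1) by auto
    then have "(f z - g z) * (\<beta>1 - \<beta>2) = 0"
      using lin[OF pz] True by (simp add: algebra_simps)
    then show ?thesis
      using \<beta> by simp
  next
    case False
    then have sw: "\<delta>1 = \<beta>2" "\<delta>2 = \<beta>1"
      using \<delta> \<delta>1(1) \<delta>2(1) by auto
    have sum: "f v + g v = \<beta>1 + \<beta>2" if "poly p v \<noteq> 0" for v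
    proof -
      have "(f v + g v - (\<beta>1 + \<beta>2)) * (\<beta>1 - \<beta>2) = 0"
        using lin[OF that] unfolding sw by (simp add: algebra_simps)
      then show ?thesis
        using \<beta> by simp
    qed
    have a1: "a = -1"
    proof -
      have e: "poly W \<beta>2 = a * poly W \<beta>1" "poly W \<beta>1 = a * poly W \<beta>2"
        using \<delta>1(2) \<delta>2(2) unfolding sw by auto
      have "(a + 1) * (poly W \<beta>1 - poly W \<beta>2) = 0"
        using e by (simp add: algebra_simps)
      then have "a + 1 = 0"
        using neq by simp
      then show ?thesis
        by (simp add: eq_neg_iff_add_eq_0)
    qed
    define s where "s = \<beta>1 + \<beta>2"
    have refl: "poly W (s - x) = - poly W x" for x
    proof -
      obtain v where v: "poly p v \<noteq> 0" "f v = x"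
        using f_takes_value by blast
      have "g v = s - x"
        using sum[OF v(1)] v(2) by (simp add: s_def algebra_simps)
      then show ?thesis
        using rel[OF v(1)] v(2) a1 by simp
    qed
    have "{x. poly W x = - w} = (\<lambda>x. s - x) ` {x. poly W x = w}"
    proof (intro equalityI subsetI)
      fix x assume "x \<in> {x. poly W x = - w}"
      then have "poly W (s - x) = w" "x = s - (s - x)"
        using refl[of x] by auto
      then show "x \<in> (\<lambda>x. s - x) ` {x. poly W x = w}"
        by blast
    qed (use refl in auto)
    then have "card {x. poly W x = - w} = card ((\<lambda>x. s - x) ` {x. poly W x = w})"
      by (rule arg_cong)
    also have "\<dots> = card {x. poly W x = w}"
      by (intro card_image) (auto simp: inj_on_def)
    finally have "card {x. poly W x = - w} = card {x. poly W x = w}" .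
    moreover have "degree W + 1 \<le> card {x. poly W x = w} + card {x. poly W x = - w}"
    proof (rule card_preimages_of_two_values[OF degW])
      show "w \<noteq> - w"
        unfolding eq_neg_iff_add_eq_0 mult_2[symmetric] using w(1) by simp
    qed
    ultimately show ?thesis
      using w(2) by linarith
  qed
qed

end

lemma eq_of_eq_off_roots:
  assumes fM: "f \<in> M1" and gM: "g \<in> M1" and p: "p \<noteq> 0" and eq: "\<And>z. poly p z \<noteq> 0 \<Longrightarrow> f z = g z"
  shows "f = g"
proof
  fix z
  have "eventually (\<lambda>w. poly p w \<noteq> 0) (at z)"
    using p poly_all_0_iff_0[of p] by (intro eventually_entire_nonzero) (auto intro!: holomorphic_intros)
  then have ev: "eventually (\<lambda>w. f w = g w) (at z)"
    by eventually_elim (rule eq)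
  then have iff: "is_pole f z \<longleftrightarrow> is_pole g z"
    by (intro is_pole_cong) auto
  show "f z = g z"
  proof (cases "is_pole f z")
    case True
    then show ?thesis
      using M1_D(4)[OF fM] M1_D(4)[OF gM] iff by simp
  next
    case False
    then have "isCont f z" "isCont g z"
      using M1_D(3)[OF fM] M1_D(3)[OF gM] iff by (auto intro!: analytic_at_imp_isCont)
    then have "isCont (\<lambda>z. f z - g z) z"
      by (intro continuous_intros)
    moreover have "eventually (\<lambda>w. f w - g w = 0) (at z)"
      using ev by eventually_elim simp
    ultimately have "f z - g z = 0"
      by (rule isCont_eventually_zero)
    then show ?thesis
      by simp
  qed
qed

lemma M1_clear_poles:
  assumes "f \<in> M1"
  shows "\<exists>E q. E holomorphic_on UNIV \<and> q \<noteq> 0 \<and> (\<forall>z. poly q z = 0 \<longleftrightarrow> is_pole f z) \<and>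
    (\<forall>z. \<not> is_pole f z \<longrightarrow> f z * poly q z = E z)"
proof -
  obtain E q where E: "E holomorphic_on UNIV" "\<And>z. poly q z = 0 \<longleftrightarrow> is_pole f z"
    "\<And>z. f analytic_on {z} \<Longrightarrow> f z * poly q z = E z"
    using clear_poles[OF M1_D(1,2)[OF assms]] by metis
  have "q \<noteq> 0"
  proof
    assume "q = 0"
    then have "{z. is_pole f z} = UNIV"
      using E(2) by auto
    then show False
      using M1_D(2)[OF assms] infinite_UNIV_char_0[where 'a = complex] by simp
  qed
  then show ?thesis
    using E M1_D(3)[OF assms] by (intro exI[of _ E] exI[of _ q]) auto
qed

lemma pderiv_distinct_roots_nonzero:
  fixes W :: "complex poly"
  assumes "finite A" "c \<noteq> 0" "W = smult c (\<Prod>a\<in>A. [:- a, 1:])" "x \<in> A"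
  shows "poly (pderiv W) x \<noteq> 0"
proof -
  define R where "R = smult c (\<Prod>a\<in>A - {x}. [:- a, 1:])"
  have W: "W = [:- x, 1:] * R"
    unfolding assms(3) R_def using assms(1,4) by (subst prod.remove[of A x]) auto
  have "poly (pderiv W) x = poly R x"
    unfolding W pderiv_mult by (simp add: pderiv_pCons)
  also have "\<dots> \<noteq> 0"
    using assms(1,2) by (auto simp: R_def poly_prod)
  finally show ?thesis .
qed

theorem theorem2p2:
  fixes n :: nat
    and f g :: "complex \<Rightarrow> complex"
    and \<alpha> :: "nat \<Rightarrow> complex"
    and \<beta>1 \<beta>2 :: complex
    and S1 S2 :: "complex set"
    and P :: "complex poly"
    and k :: nat
  assumes "n \<ge> 1"
    and "f \<in> M1" and "g \<in> M1"
    and "S1 = \<alpha> ` {1..n}" and "S2 = {\<beta>1, \<beta>2}"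
    and "inj_on \<alpha> {1..n}" and "\<beta>1 \<noteq> \<beta>2" and "\<beta>1 \<notin> S1" and "\<beta>2 \<notin> S1"
    and "0 \<notin> S1" and "0 \<notin> S2"
    and "P = assoc_poly n \<alpha>"
    and "k = num_critical_points P"
    and "n > max (2 * k + 5) (2 * Gamma1 P)"
    and "k \<ge> 2" and "Gamma1 P \<ge> 3"
    and "(\<Prod>i=1..n. \<beta>1 - \<alpha> i) \<noteq> (\<Prod>i=1..n. \<beta>2 - \<alpha> i)"
    and "noninteger_finite_order f"
    and "share_IM f g S1" and "share_IM f g S2"
  shows "f = g"
proof -
  note fM = \<open>f \<in> M1\<close> and gM = \<open>g \<in> M1\<close>
  have \<alpha>0: "\<And>i. i \<in> {1..n} \<Longrightarrow> \<alpha> i \<noteq> 0"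
    using \<open>0 \<notin> S1\<close> \<open>S1 = \<alpha> ` {1..n}\<close> by force
  define \<gamma> where "\<gamma> = (-1) ^ (n + 1) * (\<Prod>i=1..n. \<alpha> i)"
  have \<gamma>: "\<gamma> \<noteq> 0"
    using \<alpha>0 by (simp add: \<gamma>_def)
  define W where "W = P - 1"
  have prodW: "(\<Prod>i=1..n. [:- \<alpha> i, 1:]) = smult \<gamma> W"
    unfolding W_def \<open>P = assoc_poly n \<alpha>\<close> \<gamma>_def by (rule assoc_poly_factorization[OF \<alpha>0])
  have W: "W = smult (1 / \<gamma>) (\<Prod>a\<in>S1. [:- a, 1:])"
  proof -
    have "(\<Prod>a\<in>S1. [:- a, 1:]) = smult \<gamma> W"
      unfolding \<open>S1 = \<alpha> ` {1..n}\<close> prodW[symmetric] using \<open>inj_on \<alpha> {1..n}\<close> by (simp add: prod.reindex)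
    then show ?thesis
      using \<gamma> by simp
  qed
  have finS: "finite S1" and cardS: "card S1 = n"
    using \<open>S1 = \<alpha> ` {1..n}\<close> \<open>inj_on \<alpha> {1..n}\<close> by (auto simp: card_image)
  have deg_n: "degree W = n"
    using \<gamma> cardS finS unfolding W by (simp add: degree_prod_eq_sum_degree)
  have rootsW: "poly W x = 0 \<longleftrightarrow> x \<in> S1" for x
    unfolding W using \<gamma> finS by (simp add: poly_prod)
  have W'P: "pderiv W = pderiv P"
    by (simp add: W_def pderiv_diff)
  have W'0: "pderiv W \<noteq> 0"
    using deg_n \<open>n \<ge> 1\<close> by (simp add: pderiv_eq_0_iff)
  define G where "G = {z. poly (pderiv W) z = 0}"
  have finG: "finite G"
    unfolding G_def by (rule poly_roots_finite[OF W'0])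
  have cardG: "card G = k"
    unfolding G_def W'P \<open>k = num_critical_points P\<close> num_critical_points_def ..
  have W'fac: "pderiv W = smult (lead_coeff (pderiv W)) (\<Prod>a\<in>G. [:- a, 1:] ^ order a (pderiv W))"
    unfolding G_def by (rule complex_poly_decompose[symmetric])
  have disj: "S1 \<inter> G = {}"
    using pderiv_distinct_roots_nonzero[OF finS _ W] \<gamma> by (auto simp: G_def)
  obtain Ef qf where Ef: "Ef holomorphic_on UNIV" "qf \<noteq> 0" "\<forall>z. poly qf z = 0 \<longleftrightarrow> is_pole f z"
    "\<forall>z. \<not> is_pole f z \<longrightarrow> f z * poly qf z = Ef z"
    using M1_clear_poles[OF fM] by (elim exE conjE)
  obtain Eg qg where Eg: "Eg holomorphic_on UNIV" "qg \<noteq> 0" "\<forall>z. poly qg z = 0 \<longleftrightarrow> is_pole g z"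
    "\<forall>z. \<not> is_pole g z \<longrightarrow> g z * poly qg z = Eg z"
    using M1_clear_poles[OF gM] by (elim exE conjE)
  define p where "p = qf * qg"
  define f1 where "f1 = (\<lambda>z. Ef z * poly qg z)"
  define g1 where "g1 = (\<lambda>z. Eg z * poly qf z)"
  have p: "p \<noteq> 0"
    using Ef(2) Eg(2) by (simp add: p_def)
  have nopole: "\<not> is_pole f z" "\<not> is_pole g z" if "poly p z \<noteq> 0" for z
    using that Ef(3) Eg(3) by (auto simp: p_def)
  have f1: "f1 holomorphic_on UNIV" and g1: "g1 holomorphic_on UNIV"
    unfolding f1_def g1_def using Ef(1) Eg(1) by (auto intro!: holomorphic_intros)
  have f_clear: "f z * poly p z = f1 z" if "\<not> is_pole f z" for z
    using Ef(4)[rule_format, OF that] by (simp add: p_def f1_def)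
  have g_clear: "g z * poly p z = g1 z" if "\<not> is_pole g z" for z
    using Eg(4)[rule_format, OF that] by (simp add: p_def g1_def)
  have feq: "f z = f1 z / poly p z" if "poly p z \<noteq> 0" for z
    using f_clear[OF nopole(1)[OF that]] that by (simp add: eq_divide_eq)
  have geq: "g z = g1 z / poly p z" if "poly p z \<noteq> 0" for z
    using g_clear[OF nopole(2)[OF that]] that by (simp add: eq_divide_eq)
  have shared: "f z \<in> S \<longleftrightarrow> g z \<in> S" if "share_IM f g S" "poly p z \<noteq> 0" for S z
  proof -
    have "z \<in> Ebar f S \<longleftrightarrow> z \<in> Ebar g S"
      using that(1) by (simp add: share_IM_def)
    then show ?thesis
      using nopole[OF that(2)] by (simp add: Ebar_def)
  qed
  obtain \<rho> \<sigma> \<tau> and d :: nat where ord: "nevanlinna_order f = ereal \<rho>" and exps: "real d < \<rho>" "\<rho> < \<sigma>" "\<sigma> < \<tau>" "\<tau> < real d + 1"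
    using noninteger_order_data[OF fM \<open>noninteger_finite_order f\<close>] by (elim exE conjE)
  have \<rho>: "0 < \<rho>"
    using exps(1) by linarith
  have ncf: "\<exists>z. wronski f1 p z \<noteq> 0"
  proof (rule ccontr)
    assume "\<not> ?thesis"
    then obtain c where "\<forall>z. poly p z \<noteq> 0 \<longrightarrow> f z = c"
      using wronski_zero_imp_constant[OF f1 p feq] by auto
    then show False
      using nonconstant_of_positive_order[OF fM ord \<rho> p] by blast
  qed
  have lc: "lead_coeff (pderiv W) \<noteq> 0"
    using W'0 by simp
  \<comment> \<open>The pair \<open>f, f\<close> already yields that \<open>f\<close> takes every value, which is needed to see that \<open>g\<close> is not constant.\<close>
  interpret ff: finite_order_pair f f f1 f1 p W S1 G "1 / \<gamma>" "lead_coeff (pderiv W)" "\<lambda>a. order a (pderiv W)" \<rho> \<sigma> \<tau> d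
    using f1 p feq M1_D(1)[OF fM] finS finG \<gamma> lc W W'fac disj ncf fM f_clear ord exps
    by unfold_locales auto
  have ncg: "\<exists>z. wronski g1 p z \<noteq> 0"
  proof (rule ccontr)
    assume "\<not> ?thesis"
    then obtain c where c: "\<forall>z. poly p z \<noteq> 0 \<longrightarrow> g z = c"
      using wronski_zero_imp_constant[OF g1 p geq] by auto
    obtain z1 where z1: "poly p z1 \<noteq> 0" "f z1 = \<beta>1"
      using ff.f_takes_value by blast
    obtain z2 where z2: "poly p z2 \<noteq> 0" "f z2 = \<alpha> 1"
      using ff.f_takes_value by blast
    have "c \<notin> S1"
      using shared[OF \<open>share_IM f g S1\<close> z1(1)] z1 c \<open>\<beta>1 \<notin> S1\<close> by simp
    moreover have "c \<in> S1"
      using shared[OF \<open>share_IM f g S1\<close> z2(1)] z2 c \<open>S1 = \<alpha> ` {1..n}\<close> \<open>n \<ge> 1\<close> by auto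
    ultimately show False
      by simp
  qed
  interpret fg: finite_order_pair f g f1 g1 p W S1 G "1 / \<gamma>" "lead_coeff (pderiv W)" "\<lambda>a. order a (pderiv W)" \<rho> \<sigma> \<tau> d
  proof unfold_locales
    show "poly W (f z) = 0 \<longleftrightarrow> poly W (g z) = 0" if "poly p z \<noteq> 0" for z
      unfolding rootsW by (rule shared[OF \<open>share_IM f g S1\<close> that])
  qed (use f1 g1 p feq geq M1_D(1)[OF fM] M1_D(1)[OF gM] finS finG \<gamma> lc W W'fac disj ncf ncg fM gM f_clear ord exps in auto)
  have card: "2 * card G + 6 \<le> card S1"
    unfolding cardG cardS using \<open>n > max (2 * k + 5) (2 * Gamma1 P)\<close> by simp
  have "\<exists>a b. a \<noteq> 0 \<and> (\<forall>z. poly p z \<noteq> 0 \<longrightarrow>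
      poly W (g z) = a * poly W (f z) + b * poly W (f z) * poly W (g z))"
    by (rule fg.moebius_relation) (rule fg.dlog_quot_eq[OF fM \<open>noninteger_finite_order f\<close> card])
  then obtain a b where a: "a \<noteq> 0" and ab: "\<forall>z. poly p z \<noteq> 0 \<longrightarrow>
      poly W (g z) = a * poly W (f z) + b * poly W (f z) * poly W (g z)"
    by (elim exE conjE)
  \<comment> \<open>At a point with \<open>W(f) = 1/b\<close> the relation would read \<open>a/b = 0\<close>.\<close>
  have b0: "b = 0"
  proof (rule ccontr)
    assume b: "b \<noteq> 0"
    have "\<not> constant (poly (W - [:1 / b:]))"
    proof
      assume "constant (poly (W - [:1 / b:]))"
      then have "constant (poly W)"
        unfolding constant_def by simp
      then show False
        using deg_n \<open>n \<ge> 1\<close> by (simp add: constant_degree)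
    qed
    then obtain \<kappa> where "poly (W - [:1 / b:]) \<kappa> = 0"
      using fundamental_theorem_of_algebra by blast
    then have \<kappa>: "poly W \<kappa> = 1 / b"
      by simp
    obtain z where z: "poly p z \<noteq> 0" "f z = \<kappa>"
      using fg.f_takes_value by blast
    have "poly W (g z) = a * (1 / b) + b * (1 / b) * poly W (g z)"
      using ab z \<kappa> by metis
    then show False
      using a b by simp
  qed
  interpret related_pair f g f1 g1 p W S1 G "1 / \<gamma>" "lead_coeff (pderiv W)" "\<lambda>a. order a (pderiv W)" \<rho> \<sigma> \<tau> d a
    by unfold_locales (use a ab b0 deg_n \<open>n \<ge> 1\<close> in auto)
  have neq: "poly W \<beta>1 \<noteq> poly W \<beta>2"
  proof -
    have "(\<Prod>i=1..n. x - \<alpha> i) = \<gamma> * poly W x" for x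
      using arg_cong[OF prodW, of "\<lambda>q. poly q x"] by (simp add: poly_prod)
    then show ?thesis
      using \<open>(\<Prod>i=1..n. \<beta>1 - \<alpha> i) \<noteq> (\<Prod>i=1..n. \<beta>2 - \<alpha> i)\<close> by auto
  qed
  have P0: "P \<noteq> 0"
    using W'0 W'P by auto
  have "{x. poly W x = - 1} = {x. poly P x = 0}"
    by (simp add: W_def)
  then have "2 * card {x. poly W x = - 1} < degree W"
    using \<open>n > max (2 * k + 5) (2 * Gamma1 P)\<close> unfolding deg_n Gamma1_eq_card_zeros[OF P0] by simp
  then have "f z = g z" if "poly p z \<noteq> 0" for z
    using shared[OF \<open>share_IM f g S2\<close>] \<open>S2 = {\<beta>1, \<beta>2}\<close>
    by (intro eq_of_shared_pair[OF neq _ _ _ that, where w = "-1"]) auto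
  then show ?thesis
    by (rule eq_of_eq_off_roots[OF fM gM p])
qed

end
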